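(* Let $\xi=(\xi_t)_{t\ge 0}$ be a real-valued L\'evy process which drifts to $\infty$ and such that $\xi_1\notin L^1(\mathbb{P})$. Let $\tilde U$ and $\nu$ be as defined in the context. Let $\alpha\in(0,1)$, let $a:(0,\infty)\to(0,\infty)$ be regularly varying at $\infty$ with index $\alpha$, and let $b:(0,\infty)\to(0,\infty)$ be an asymptotic inverse of $a$, that is $a(b(t))\sim b(a(t))\sim t$ as $t\to\infty$, with $b$ regularly varying at $\infty$ with index $1/\alpha$. The following assertions (under the probability measure $\mathbb{P}$) are equivalent: (i) $b(t)^{-1}\xi_t$ has a non-degenerate limit in distribution as $t\to\infty$. (ii) For every $f\in L^1(\nu)$ with $\langle\nu,f\rangle\ne0$, $$\frac{1}{a(t)}\int_0^t f(\tilde U(s))\,\mathrm{d}s,\qquad t>0,$$ has a non-degenerate limit in distribution as $t\to\infty$. In that case, the limit in (i) is a positive $\alpha$-stable variable, say $\sigma$, with $$\mathbb{E}(\exp(-\lambda\sigma))=\exp(-c\lambda^\alpha)\qquad(\lambda\ge0)$$ for some $c>0$, and the limit in (ii) has the law of $\langle\nu,f\rangle\,\sigma^{-\alpha}$ (and is thus proportional to a Mittag-Leffler variable with parameter $\alpha$).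
   Context: $\xi=(\xi_t)_{t\ge0}$ is a real-valued L\'evy process (started from $0$, with c\`adl\`ag paths) on a probability space $(\Omega,\mathcal{A},\mathbb{P})$, with $\lim_{t\to\infty}\xi_t=\infty$ a.s. ("$\xi$ drifts to $\infty$"). Let $\hat\xi$ be an independent copy of $-\xi$, and $\hat I=\int_0^\infty \exp(\hat\xi_s)\,\mathrm{d}s$, which is a.s. finite, with law $\mu$ on $(0,\infty)$. Put $\tilde\xi_t=\xi_t$ for $t\ge0$ and $\tilde\xi_t=\hat\xi_{|t|-}$ (left limit) for $t<0$. For $t\in\mathbb{R}$ set $\tilde I(t)=\int_{-\infty}^t \exp(\tilde\xi_s)\,\mathrm{d}s$ and $\tilde V(t)=\exp(-\tilde\xi_t)\tilde I(t)$. The map $A(t)=\int_0^t \frac{\mathrm{d}s}{\tilde V(s)}=\ln\tilde I(t)-\ln\tilde I(0)$, $t\in\mathbb{R}$, is a bijection $\mathbb{R}\to\mathbb{R}$, and $T$ denotes its inverse. Set $\tilde U(t)=1/\tilde V(T(t))$, $t\in\mathbb{R}$. The measure $\nu$ on $(0,\infty)$ is given by $\langle\nu,f\rangle=\int_{(0,\infty)}\frac1x f(1/x)\,\mu(\mathrm{d}x)$. A family $(Y(t))_{t>0}$ of random variables has a non-degenerate limit in distribution as $t\to\infty$ if $Y(t)$ converges in law, under $\mathbb{P}$, towards some random variable which is not a.s. constant. *)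

theory Defs
  imports "HOL-Probability.Probability" "HOL-Library.Landau_Symbols"
begin

definition cadlag :: "(real \<Rightarrow> real) \<Rightarrow> bool" where
  "cadlag x \<longleftrightarrow>
     (\<forall>t\<ge>0. continuous (at_right t) x) \<and>
     (\<forall>t>0. \<exists>l. (x \<longlongrightarrow> l) (at_left t))"

text \<open>Processes are maps \<open>X\<close> from times to random variables; only times \<open>t \<ge> 0\<close> matter.\<close>

definition path_map :: "(real \<Rightarrow> 'a \<Rightarrow> real) \<Rightarrow> 'a \<Rightarrow> real \<Rightarrow> real" where
  "path_map X \<omega> = (\<lambda>t\<in>{0..}. X t \<omega>)"

abbreviation path_space :: "(real \<Rightarrow> real) measure" where
  "path_space \<equiv> PiM {0..} (\<lambda>_. borel)"

definition levy_process :: "'a measure \<Rightarrow> (real \<Rightarrow> 'a \<Rightarrow> real) \<Rightarrow> bool" where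
  "levy_process M X \<longleftrightarrow>
     prob_space M \<and>
     (\<forall>t\<ge>0. X t \<in> borel_measurable M) \<and>
     (\<forall>\<omega>\<in>space M. X 0 \<omega> = 0 \<and> cadlag (\<lambda>t. X t \<omega>)) \<and>
     (\<forall>s\<ge>0. \<forall>t\<ge>s. distr M borel (\<lambda>\<omega>. X t \<omega> - X s \<omega>) = distr M borel (X (t - s))) \<and>
     (\<forall>(n::nat) (\<tau>::nat \<Rightarrow> real). 0 \<le> \<tau> 0 \<and> (\<forall>i<n. \<tau> i \<le> \<tau> (Suc i)) \<longrightarrow>
        prob_space.indep_vars M (\<lambda>_. borel) (\<lambda>i \<omega>. X (\<tau> (Suc i)) \<omega> - X (\<tau> i) \<omega>) {..<n})"

definition drifts_to_infinity :: "'a measure \<Rightarrow> (real \<Rightarrow> 'a \<Rightarrow> real) \<Rightarrow> bool" where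
  "drifts_to_infinity M X \<longleftrightarrow> (AE \<omega> in M. filterlim (\<lambda>t. X t \<omega>) at_top at_top)"

text \<open>\<open>Y\<close> is a cadlag process, independent of \<open>X\<close> and with the same law as \<open>- X\<close>.\<close>

definition independent_copy_of_minus ::
    "'a measure \<Rightarrow> (real \<Rightarrow> 'a \<Rightarrow> real) \<Rightarrow> (real \<Rightarrow> 'a \<Rightarrow> real) \<Rightarrow> bool" where
  "independent_copy_of_minus M X Y \<longleftrightarrow>
     (\<forall>\<omega>\<in>space M. cadlag (\<lambda>t. Y t \<omega>)) \<and>
     prob_space.indep_var M path_space (path_map X) path_space (path_map Y) \<and>
     distr M path_space (path_map Y) = distr M path_space (path_map (\<lambda>t \<omega>. - X t \<omega>))"

text \<open>
  The pathwise functionals below take a path \<open>x\<close> of \<open>\<xi>\<close> and a path \<open>y\<close> of its dual.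
  On the null event where an integral diverges or \<open>A_fun\<close> is not bijective they take
  the default values of the library's integral and inverse.
\<close>

definition I_hat :: "(real \<Rightarrow> real) \<Rightarrow> real" where
  "I_hat y = (LBINT s:{0..}. exp (y s))"

definition xi_tilde :: "(real \<Rightarrow> real) \<Rightarrow> (real \<Rightarrow> real) \<Rightarrow> real \<Rightarrow> real" where
  "xi_tilde x y t = (if 0 \<le> t then x t else Lim (at_left \<bar>t\<bar>) y)"

definition I_tilde :: "(real \<Rightarrow> real) \<Rightarrow> (real \<Rightarrow> real) \<Rightarrow> real \<Rightarrow> real" where
  "I_tilde x y t = (LBINT s:{..t}. exp (xi_tilde x y s))"

definition V_tilde :: "(real \<Rightarrow> real) \<Rightarrow> (real \<Rightarrow> real) \<Rightarrow> real \<Rightarrow> real" where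
  "V_tilde x y t = exp (- xi_tilde x y t) * I_tilde x y t"

text \<open>The interval integral is signed, so this is also the intended value for \<open>t < 0\<close>.\<close>

definition A_fun :: "(real \<Rightarrow> real) \<Rightarrow> (real \<Rightarrow> real) \<Rightarrow> real \<Rightarrow> real" where
  "A_fun x y t = (LBINT s=ereal 0..ereal t. 1 / V_tilde x y s)"

definition T_fun :: "(real \<Rightarrow> real) \<Rightarrow> (real \<Rightarrow> real) \<Rightarrow> real \<Rightarrow> real" where
  "T_fun x y = inv (A_fun x y)"

definition U_tilde :: "(real \<Rightarrow> real) \<Rightarrow> (real \<Rightarrow> real) \<Rightarrow> real \<Rightarrow> real" where
  "U_tilde x y t = 1 / V_tilde x y (T_fun x y t)"

definition mu_law :: "'a measure \<Rightarrow> (real \<Rightarrow> 'a \<Rightarrow> real) \<Rightarrow> real measure" where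
  "mu_law M Y = distr M borel (\<lambda>\<omega>. I_hat (\<lambda>t. Y t \<omega>))"

text \<open>A measure on the space \<open>(0,\<infty>)\<close>; the two lemmas below recover the defining functional.\<close>

definition nu_measure :: "'a measure \<Rightarrow> (real \<Rightarrow> 'a \<Rightarrow> real) \<Rightarrow> real measure" where
  "nu_measure M Y =
     distr (density (restrict_space (mu_law M Y) {0<..}) (\<lambda>x. ennreal (1 / x)))
           (restrict_space borel {0<..}) (\<lambda>x. 1 / x)"

lemma recip_measurable_pos:
  "(\<lambda>x::real. 1 / x) \<in> restrict_space (mu_law M Y) {0<..} \<rightarrow>\<^sub>M restrict_space borel {0<..}"
proof (rule measurable_restrict_space3)
  show "(\<lambda>x::real. 1 / x) \<in> mu_law M Y \<rightarrow>\<^sub>M borel"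
    by (simp add: mu_law_def)
qed auto

lemma integrable_nu_measure_iff:
  fixes f :: "real \<Rightarrow> real"
  assumes [measurable]: "f \<in> borel_measurable (restrict_space borel {0<..})"
  shows "integrable (nu_measure M Y) f \<longleftrightarrow>
         set_integrable (mu_law M Y) {0<..} (\<lambda>x. 1 / x * f (1 / x))"
proof -
  note [measurable] = recip_measurable_pos[of M Y]
  have R: "(\<lambda>x::real. 1 / x) \<in> borel_measurable (restrict_space (mu_law M Y) {0<..})"
    by (rule measurable_restrict_space1) (simp add: mu_law_def)
  have C: "(\<lambda>x. f (1 / x)) \<in> borel_measurable (restrict_space (mu_law M Y) {0<..})"
    by (rule measurable_compose[OF recip_measurable_pos assms])
  have "integrable (nu_measure M Y) f \<longleftrightarrow>
        integrable (density (restrict_space (mu_law M Y) {0<..}) (\<lambda>x. ennreal (1 / x))) (\<lambda>x. f (1 / x))"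
    unfolding nu_measure_def by (rule integrable_distr_eq) (use assms in auto)
  also have "\<dots> \<longleftrightarrow> integrable (restrict_space (mu_law M Y) {0<..}) (\<lambda>x. 1 / x * f (1 / x))"
    by (subst integrable_density)
       (auto intro!: R C AE_I2 simp: space_restrict_space)
  also have "\<dots> \<longleftrightarrow> set_integrable (mu_law M Y) {0<..} (\<lambda>x. 1 / x * f (1 / x))"
    unfolding set_integrable_def
    by (subst integrable_restrict_space) (auto simp: mu_law_def)
  finally show ?thesis .
qed

lemma integral_nu_measure:
  fixes f :: "real \<Rightarrow> real"
  assumes [measurable]: "f \<in> borel_measurable (restrict_space borel {0<..})"
  shows "integral\<^sup>L (nu_measure M Y) f = (LINT x:{0<..}|mu_law M Y. 1 / x * f (1 / x))"
proof -
  have R: "(\<lambda>x::real. 1 / x) \<in> borel_measurable (restrict_space (mu_law M Y) {0<..})"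
    by (rule measurable_restrict_space1) (simp add: mu_law_def)
  have C: "(\<lambda>x. f (1 / x)) \<in> borel_measurable (restrict_space (mu_law M Y) {0<..})"
    by (rule measurable_compose[OF recip_measurable_pos assms])
  have "integral\<^sup>L (nu_measure M Y) f =
        integral\<^sup>L (density (restrict_space (mu_law M Y) {0<..}) (\<lambda>x. ennreal (1 / x))) (\<lambda>x. f (1 / x))"
    unfolding nu_measure_def
    by (rule integral_distr) (use assms recip_measurable_pos in auto)
  also have "\<dots> = integral\<^sup>L (restrict_space (mu_law M Y) {0<..}) (\<lambda>x. 1 / x * f (1 / x))"
    by (subst integral_density)
       (auto intro!: R C AE_I2 simp: space_restrict_space)
  also have "\<dots> = (LINT x:{0<..}|mu_law M Y. 1 / x * f (1 / x))"
    unfolding set_lebesgue_integral_def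
    by (subst integral_restrict_space) (auto simp: mu_law_def)
  finally show ?thesis .
qed

text \<open>Regular variation at infinity of a function on \<open>(0,\<infty>)\<close>, with measurability included as usual.\<close>

definition regularly_varying :: "(real \<Rightarrow> real) \<Rightarrow> real \<Rightarrow> bool" where
  "regularly_varying g \<rho> \<longleftrightarrow>
     g \<in> borel_measurable (restrict_space borel {0<..}) \<and>
     (\<forall>c>0. ((\<lambda>t. g (c * t) / g t) \<longlongrightarrow> c powr \<rho>) at_top)"

text \<open>
  Version of \<^const>\<open>weak_conv_m\<close> for laws of a family of random variables with a real
  parameter tending to infinity; \<open>L\<close> is the law of the limit.
\<close>

definition converges_in_law :: "'a measure \<Rightarrow> (real \<Rightarrow> 'a \<Rightarrow> real) \<Rightarrow> real measure \<Rightarrow> bool" where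
  "converges_in_law M Y L \<longleftrightarrow>
     real_distribution L \<and>
     (\<forall>x. isCont (cdf L) x \<longrightarrow>
        ((\<lambda>t. cdf (distr M borel (Y t)) x) \<longlongrightarrow> cdf L x) at_top)"

definition nondegenerate :: "real measure \<Rightarrow> bool" where
  "nondegenerate L \<longleftrightarrow> \<not> (\<exists>c. AE x in L. x = c)"

definition has_nondegenerate_limit_in_law :: "'a measure \<Rightarrow> (real \<Rightarrow> 'a \<Rightarrow> real) \<Rightarrow> bool" where
  "has_nondegenerate_limit_in_law M Y \<longleftrightarrow> (\<exists>L. converges_in_law M Y L \<and> nondegenerate L)"

text \<open>Stability is meant in the strict sense, without centering.\<close>

definition stable_law :: "real \<Rightarrow> real measure \<Rightarrow> bool" where
  "stable_law \<alpha> L \<longleftrightarrow>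
     real_distribution L \<and> nondegenerate L \<and>
     (\<forall>p>0. \<forall>q>0.
        distr L borel (\<lambda>x. p * x) \<star> distr L borel (\<lambda>x. q * x) =
        distr L borel (\<lambda>x. (p powr \<alpha> + q powr \<alpha>) powr (1 / \<alpha>) * x))"

text \<open>The moment generating function is the Mittag-Leffler function with parameter \<open>\<alpha>\<close>.\<close>

definition mittag_leffler_law :: "real \<Rightarrow> real measure \<Rightarrow> bool" where
  "mittag_leffler_law \<alpha> L \<longleftrightarrow>
     real_distribution L \<and>
     (\<forall>q::real. integrable L (\<lambda>x. exp (q * x)) \<and>
        (\<lambda>n. q ^ n / Gamma (1 + real n * \<alpha>)) sums (\<integral>x. exp (q * x) \<partial>L))"

end

theory Submission
  imports Defs "HOL-Real_Asymp.Real_Asymp"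
begin

text \<open>The additive functional \<open>A\<close> is the process itself up to a stationary correction: as \<open>V t =
  exp (- \<xi> t) * I t\<close>, where \<open>I t\<close> is the integral of the exponential of the two-sided path up to
  time \<open>t\<close>, \<open>A t = ln (I t) - ln (I 0) = \<xi> t + ln (V t) - ln (V 0)\<close>
  (\<open>A_eq_\<xi>_plus\<close>), and \<open>V\<close> is a stationary process with marginal law \<open>\<mu>\<close>
  (\<open>V_law\<close>). The correction is tight and \<open>b t\<close> tends to infinity, so that \<open>\<xi> t / b
  t\<close> and \<open>A t / b t\<close> have the same limit laws (\<open>X\<xi>_iff_XA\<close>).

  The time change \<open>T\<close> is the inverse of \<open>A\<close>, so \<open>T t \<le> s\<close> means \<open>t \<le>
  A s\<close>. Since \<open>a\<close> and \<open>b\<close> are asymptotically inverse and regularly varying, \<open>A t /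
  b t\<close> converges in law to \<open>\<sigma> > 0\<close> if and only if \<open>T t / a t\<close> converges in law to
  \<open>\<sigma> powr (- \<alpha>)\<close> (\<open>XT_limit_if_XA_limit\<close>, \<open>XA_limit_if_XT_limit\<close>).
  Finally the substitution \<open>u = A r\<close> turns the integral of \<open>f (U u)\<close> over \<open>{0..t}\<close>
  into the integral of \<open>g (V r)\<close>, \<open>g v = f (1 / v) / v\<close>, over \<open>{0..T t}\<close>. The
  \<open>\<mu>\<close>-integral of \<open>g\<close> is the \<open>\<nu>\<close>-integral \<open>m\<close> of
  \<open>f\<close>, so a law of large numbers for \<open>V\<close> makes the second integral behave like \<open>m * T
  t\<close> (\<open>YU_asymptotic\<close>). For \<open>f x = 1 / x\<close> it is \<open>T t\<close> exactly, so that (ii)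
  contains the convergence of \<open>T t / a t\<close>.

  The law of large numbers rests on mixing: \<open>V (r + u)\<close> is \<open>exp (- (\<xi> (r + u) - \<xi> r)) * V
  r\<close>, which vanishes as \<open>u\<close> grows, plus a term that depends only on the increments of
  \<open>\<xi>\<close> after time \<open>r\<close>. So covariances of Lipschitz functionals vanish at large distances,
  which gives the mean ergodic theorem for these; it extends to all \<open>\<mu>\<close>-integrable functions by
  approximation (\<open>law_of_large_numbers\<close>).

  One point is delicate in the implication from (ii) to (i). A limit law of \<open>T t / a t\<close> might have an atom at
  \<open>0\<close>, which would mean that \<open>A t / b t\<close> escapes to infinity with positive probability.
  Splitting \<open>[0,2 s]\<close> into two intervals of length \<open>s\<close> shows that the probability
  \<open>p\<close> of not escaping satisfies \<open>p \<le> p\<^sup>2\<close>. Hence \<open>p\<close> is \<open>0\<close>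
  or \<open>1\<close>, and a nondegenerate limit law has \<open>p = 1\<close> (\<open>XT_limit_pos\<close>).

  The law of \<open>\<sigma>\<close> is identified through the independence of the increments of \<open>\<xi>\<close>,
  which makes it strictly stable. It is carried by \<open>[0,\<infinity>)\<close> as \<open>\<xi>\<close> drifts to
  infinity, and Cauchy's functional equation gives its Laplace transform (\<open>stable_nonneg_laplace\<close>).
  Integrating this transform against powers yields the moments of \<open>\<sigma> powr (- \<alpha>)\<close>, which are
  those of a Mittag-Leffler law (\<open>mittag_leffler_reciprocal_stable\<close>).\<close>

section \<open>Cadlag functions\<close>

text \<open>The least point strictly above \<open>s\<close> of the grid of mesh \<open>1 / (n + 1)\<close>. A cadlag
  function is the pointwise limit of its values at these points, from which joint measurability follows.\<close>
definition grid_above :: "nat \<Rightarrow> real \<Rightarrow> real" where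
  "grid_above n s = (of_int \<lfloor>real (Suc n) * s\<rfloor> + 1) / real (Suc n)"

lemma grid_above_gt: "s < grid_above n s"
proof -
  have "real (Suc n) * s < of_int \<lfloor>real (Suc n) * s\<rfloor> + 1" by linarith
  then show ?thesis unfolding grid_above_def by (simp add: field_simps)
qed

lemma grid_above_le: "grid_above n s \<le> s + 1 / real (Suc n)"
proof -
  have "of_int \<lfloor>real (Suc n) * s\<rfloor> + 1 \<le> real (Suc n) * s + 1" by linarith
  then have "grid_above n s \<le> (real (Suc n) * s + 1) / real (Suc n)"
    unfolding grid_above_def by (intro divide_right_mono) auto
  also have "\<dots> = s + 1 / real (Suc n)" by (simp add: add_divide_distrib del: of_nat_Suc)
  finally show ?thesis .
qed

lemma filterlim_grid_above: "filterlim (\<lambda>n. grid_above n s) (at_right s) sequentially"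
proof -
  have *: "(\<lambda>n. s + 1 / real (Suc n)) \<longlonglongrightarrow> s + 0"
    by (intro tendsto_intros LIMSEQ_inverse_real_of_nat[unfolded inverse_eq_divide])
  have "(\<lambda>n. grid_above n s) \<longlonglongrightarrow> s"
    by (rule tendsto_sandwich[OF _ _ tendsto_const *[unfolded add_0_right]])
       (intro always_eventually allI grid_above_le less_imp_le[OF grid_above_gt])+
  then show ?thesis
    unfolding filterlim_at by (auto intro!: always_eventually simp: grid_above_gt less_imp_neq[OF grid_above_gt, symmetric])
qed

lemma cadlag_right_limit: "cadlag x \<Longrightarrow> 0 \<le> t \<Longrightarrow> (x \<longlongrightarrow> x t) (at_right t)"
  by (simp add: cadlag_def continuous_within)

lemma cadlag_left_limit: "cadlag x \<Longrightarrow> 0 < t \<Longrightarrow> (x \<longlongrightarrow> Lim (at_left t) x) (at_left t)"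
  unfolding cadlag_def using tendsto_Lim trivial_limit_at_left_real by blast

lemma cadlag_grid_above: "cadlag x \<Longrightarrow> 0 \<le> s \<Longrightarrow> (\<lambda>n. x (grid_above n s)) \<longlonglongrightarrow> x s"
  using filterlim_compose[OF cadlag_right_limit filterlim_grid_above] by blast

lemma cadlag_uminus: "cadlag x \<Longrightarrow> cadlag (\<lambda>t. - x t)"
  unfolding cadlag_def by (auto intro: continuous_minus) (metis tendsto_minus)

lemma cadlag_shift:
  assumes "cadlag x" "0 \<le> r"
  shows "cadlag (\<lambda>t. x (r + t) - c)"
  unfolding cadlag_def
proof (intro conjI allI impI)
  fix t :: real assume "0 \<le> t"
  have "filterlim (\<lambda>t. r + t) (at_right (r + t)) (at_right t)"
    unfolding filterlim_at by (auto intro!: tendsto_eq_intros simp: eventually_at_filter)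
  from filterlim_compose[OF cadlag_right_limit[OF assms(1)] this] \<open>0 \<le> t\<close> assms(2)
  show "continuous (at_right t) (\<lambda>t. x (r + t) - c)"
    unfolding continuous_within by (intro tendsto_intros) auto
next
  fix t :: real assume "0 < t"
  have "filterlim (\<lambda>t. r + t) (at_left (r + t)) (at_left t)"
    unfolding filterlim_at by (auto intro!: tendsto_eq_intros simp: eventually_at_filter)
  from filterlim_compose[OF cadlag_left_limit[OF assms(1)] this] \<open>0 < t\<close> assms(2)
  have "((\<lambda>t. x (r + t) - c) \<longlongrightarrow> Lim (at_left (r + t)) x - c) (at_left t)"
    by (intro tendsto_intros) auto
  then show "\<exists>l. ((\<lambda>t. x (r + t) - c) \<longlongrightarrow> l) (at_left t)" by blast
qed

lemma cadlag_bounded: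
  assumes "cadlag x"
  obtains K where "\<And>s. 0 \<le> s \<Longrightarrow> s \<le> t \<Longrightarrow> \<bar>x s\<bar> \<le> K"
proof -
  have loc: "\<exists>T K. open T \<and> s \<in> T \<and> (\<forall>r\<in>T. 0 \<le> r \<longrightarrow> \<bar>x r\<bar> \<le> K)" if "s \<in> {0..t}" for s
  proof -
    have s: "0 \<le> s" using that by simp
    have "eventually (\<lambda>r. dist (x r) (x s) < 1) (at_right s)"
      using cadlag_right_limit[OF assms s] by (rule tendstoD) simp
    then obtain b where b: "s < b" "\<And>r. s < r \<Longrightarrow> r < b \<Longrightarrow> dist (x r) (x s) < 1"
      unfolding eventually_at_right_field by blast
    obtain a L where a: "a < s" "\<And>r. a < r \<Longrightarrow> r < s \<Longrightarrow> 0 \<le> r \<Longrightarrow> dist (x r) L < 1"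
    proof (cases "s = 0")
      case True
      then show ?thesis by (intro that[of "-1"]) auto
    next
      case False
      then have "eventually (\<lambda>r. dist (x r) (Lim (at_left s) x) < 1) (at_left s)"
        using s by (intro tendstoD[OF cadlag_left_limit[OF assms]]) auto
      then show ?thesis unfolding eventually_at_left_field using that by blast
    qed
    have "\<bar>x r\<bar> \<le> \<bar>x s\<bar> + \<bar>L\<bar> + 1" if "r \<in> {a<..<b}" "0 \<le> r" for r
    proof (cases r s rule: linorder_cases)
      case less
      with a(2)[of r] that show ?thesis by (auto simp: dist_real_def)
    next
      case greater
      with b(2)[of r] that show ?thesis by (auto simp: dist_real_def)
    qed auto
    with a b show ?thesis by (intro exI[of _ "{a<..<b}"] exI[of _ "\<bar>x s\<bar> + \<bar>L\<bar> + 1"]) auto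
  qed
  then obtain T K where TK: "\<And>s. s \<in> {0..t} \<Longrightarrow> open (T s) \<and> s \<in> T s \<and> (\<forall>r\<in>T s. 0 \<le> r \<longrightarrow> \<bar>x r\<bar> \<le> K s)"
    by metis
  obtain C where C: "C \<subseteq> {0..t}" "finite C" "{0..t} \<subseteq> (\<Union>s\<in>C. T s)"
    by (rule compactE_image[OF compact_Icc[of 0 t], of "{0..t}" T]) (use TK in auto)
  show ?thesis
  proof (rule that[of "\<Sum>s\<in>C. \<bar>K s\<bar>"])
    fix r assume "0 \<le> r" "r \<le> t"
    then obtain s where s: "s \<in> C" "r \<in> T s" using C(3) by auto
    have "\<bar>x r\<bar> \<le> \<bar>K s\<bar>" using TK[of s] s C(1) \<open>0 \<le> r\<close> by fastforce
    also have "\<dots> \<le> (\<Sum>s\<in>C. \<bar>K s\<bar>)" by (rule member_le_sum) (use s C in auto)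
    finally show "\<bar>x r\<bar> \<le> (\<Sum>s\<in>C. \<bar>K s\<bar>)" .
  qed
qed

lemma countable_left_jumps_up:
  assumes "cadlag x"
  shows "countable {t. 0 < t \<and> Lim (at_left t) x < x t}"
proof -
  let ?D = "{t. 0 < t \<and> Lim (at_left t) x < x t}"
  define Q where "Q t p q r \<longleftrightarrow> p \<in> \<rat> \<and> q \<in> \<rat> \<and> r \<in> \<rat> \<and> q < t \<and> t < r \<and>
      (\<forall>s. q < s \<and> s < t \<longrightarrow> x s < p) \<and> (\<forall>s. t \<le> s \<and> s < r \<longrightarrow> p < x s)" for t p q r
  have "\<exists>p q r. Q t p q r" if "t \<in> ?D" for t
  proof -
    have t: "0 < t" and lt: "Lim (at_left t) x < x t" using that by auto
    obtain p where p: "p \<in> \<rat>" "Lim (at_left t) x < p" "p < x t" using Rats_dense_in_real[OF lt] by auto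
    have "eventually (\<lambda>s. x s < p) (at_left t)"
      using order_tendstoD(2)[OF cadlag_left_limit[OF assms t] p(2)] .
    then obtain a where a: "a < t" "\<And>s. a < s \<Longrightarrow> s < t \<Longrightarrow> x s < p"
      unfolding eventually_at_left_field by blast
    have "eventually (\<lambda>s. p < x s) (at_right t)"
      using order_tendstoD(1)[OF cadlag_right_limit[OF assms less_imp_le[OF t]] p(3)] .
    then obtain b where b: "t < b" "\<And>s. t < s \<Longrightarrow> s < b \<Longrightarrow> p < x s"
      unfolding eventually_at_right_field by blast
    obtain q where q: "q \<in> \<rat>" "a < q" "q < t" using Rats_dense_in_real[OF a(1)] by auto
    obtain r where r: "r \<in> \<rat>" "t < r" "r < b" using Rats_dense_in_real[OF b(1)] by auto
    have "\<forall>s. t \<le> s \<and> s < r \<longrightarrow> p < x s"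
      using b(2) r p(3) by (auto simp: le_less)
    moreover have "\<forall>s. q < s \<and> s < t \<longrightarrow> x s < p" using a(2) q(2) by auto
    ultimately show ?thesis unfolding Q_def using p(1) q r by blast
  qed
  then obtain p q r where pqr: "\<And>t. t \<in> ?D \<Longrightarrow> Q t (p t) (q t) (r t)" by metis
  \<comment> \<open>Two jump times \<open>t < u\<close> with the same rationals would put \<open>x t\<close> on both
    sides of \<open>p t\<close>.\<close>
  have lt: False if "t \<in> ?D" "u \<in> ?D" "p t = p u" "q t = q u" "r t = r u" "t < u" for t u
  proof -
    have "p t < x t" using pqr[OF that(1)] by (auto simp: Q_def)
    moreover have "x t < p t" using pqr[OF that(1)] pqr[OF that(2)] that(3-) by (auto simp: Q_def)
    ultimately show False by simp
  qed
  have "inj_on (\<lambda>t. (p t, q t, r t)) ?D"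
  proof (rule inj_onI)
    fix t u assume "t \<in> ?D" "u \<in> ?D" "(p t, q t, r t) = (p u, q u, r u)"
    then show "t = u" using lt[of t u] lt[of u t] by (cases t u rule: linorder_cases) auto
  qed
  moreover have "(\<lambda>t. (p t, q t, r t)) ` ?D \<subseteq> \<rat> \<times> \<rat> \<times> \<rat>" using pqr by (auto simp: Q_def)
  then have "countable ((\<lambda>t. (p t, q t, r t)) ` ?D)"
    by (rule countable_subset) (intro countable_SIGMA countable_rat)
  ultimately show ?thesis by (rule countable_image_inj_on[rotated])
qed

lemma cadlag_countable_jumps:
  assumes "cadlag x"
  shows "countable {t. 0 < t \<and> Lim (at_left t) x \<noteq> x t}"
proof -
  have L: "Lim (at_left t) (\<lambda>t. - x t) = - Lim (at_left t) x" if "0 < t" for t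
    using tendsto_minus[OF cadlag_left_limit[OF assms that]] by (intro tendsto_Lim) auto
  have "{t. 0 < t \<and> Lim (at_left t) x \<noteq> x t} \<subseteq>
    {t. 0 < t \<and> Lim (at_left t) x < x t} \<union> {t. 0 < t \<and> Lim (at_left t) (\<lambda>t. - x t) < - x t}"
    using L by auto
  then show ?thesis
    using countable_left_jumps_up[OF assms] countable_left_jumps_up[OF cadlag_uminus[OF assms]]
    by (meson countable_Un countable_subset)
qed

lemma cadlag_AE_continuous:
  assumes "cadlag x"
  shows "AE t in lborel. 0 < t \<longrightarrow> Lim (at_left t) x = x t"
  using cadlag_countable_jumps[OF assms]
  by (intro AE_I'[OF countable_imp_null_set_lborel[OF cadlag_countable_jumps[OF assms]]]) auto

lemma grid_above_nonneg: "0 \<le> s \<Longrightarrow> 0 \<le> grid_above n s"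
  using grid_above_gt[of s n] by simp

lemma borel_measurable_grid_above:
  assumes X: "\<And>t. t \<ge> 0 \<Longrightarrow> X t \<in> borel_measurable M"
  shows "(\<lambda>(s, \<omega>). X (grid_above n (max 0 s)) \<omega>) \<in> borel_measurable (borel \<Otimes>\<^sub>M M)"
proof -
  let ?g = "\<lambda>(s::real, \<omega>::'a). nat \<lfloor>real (Suc n) * max 0 s\<rfloor>"
  have m: "(\<lambda>p. X ((real (?g p) + 1) / real (Suc n)) (snd p)) \<in> borel_measurable (borel \<Otimes>\<^sub>M M)"
  proof (rule measurable_compose_countable[where f="\<lambda>i p. X ((real i + 1) / real (Suc n)) (snd p)"])
    show "(\<lambda>p. X ((real i + 1) / real (Suc n)) (snd p)) \<in> borel_measurable (borel \<Otimes>\<^sub>M M)" for i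
      by (rule measurable_compose[OF measurable_snd X]) simp
    show "?g \<in> measurable (borel \<Otimes>\<^sub>M M) (count_space UNIV)" by measurable
  qed
  have e: "(\<lambda>(s, \<omega>). X (grid_above n (max 0 s)) \<omega>) = (\<lambda>p. X ((real (?g p) + 1) / real (Suc n)) (snd p))"
    by (auto simp: fun_eq_iff grid_above_def)
  show ?thesis unfolding e by (rule m)
qed

lemma cadlag_process_measurable:
  assumes X: "\<And>t. t \<ge> 0 \<Longrightarrow> X t \<in> borel_measurable M"
    and c: "\<And>\<omega>. \<omega> \<in> space M \<Longrightarrow> cadlag (\<lambda>t. X t \<omega>)"
  shows "(\<lambda>(s, \<omega>). X (max 0 s) \<omega>) \<in> borel_measurable (borel \<Otimes>\<^sub>M M)"
  by (rule borel_measurable_LIMSEQ_real[OF _ borel_measurable_grid_above[OF X]])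
     (auto simp: space_pair_measure intro!: cadlag_grid_above[OF c])

lemma cadlag_left_process_measurable:
  assumes X: "\<And>t. t \<ge> 0 \<Longrightarrow> X t \<in> borel_measurable M"
    and c: "\<And>\<omega>. \<omega> \<in> space M \<Longrightarrow> cadlag (\<lambda>t. X t \<omega>)"
  shows "(\<lambda>(s, \<omega>). if 0 < s then Lim (at_left s) (\<lambda>t. X t \<omega>) else 0) \<in> borel_measurable (borel \<Otimes>\<^sub>M M)"
proof (rule borel_measurable_LIMSEQ_real[where u="\<lambda>n (s, \<omega>). if 0 < s then X (max 0 (s - 1 / real (Suc n))) \<omega> else 0"])
  have "(\<lambda>p. X (max 0 (fst p - 1 / real (Suc n))) (snd p)) \<in> borel_measurable (borel \<Otimes>\<^sub>M M)" for n
    using measurable_compose[of "\<lambda>p. (fst p - 1 / real (Suc n), snd p)" _ "borel \<Otimes>\<^sub>M M", OF _ cadlag_process_measurable[OF X c]]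
    by (simp add: split_beta)
  then show "(\<lambda>(s, \<omega>). if 0 < s then X (max 0 (s - 1 / real (Suc n))) \<omega> else 0) \<in> borel_measurable (borel \<Otimes>\<^sub>M M)" for n
    unfolding split_beta by measurable
next
  fix p :: "real \<times> 'a" assume p: "p \<in> space (borel \<Otimes>\<^sub>M M)"
  obtain s \<omega> where [simp]: "p = (s, \<omega>)" by (cases p)
  have w: "\<omega> \<in> space M" using p by (auto simp: space_pair_measure)
  show "(\<lambda>n. case p of (s, \<omega>) \<Rightarrow> if 0 < s then X (max 0 (s - 1 / real (Suc n))) \<omega> else 0)
      \<longlonglongrightarrow> (case p of (s, \<omega>) \<Rightarrow> if 0 < s then Lim (at_left s) (\<lambda>t. X t \<omega>) else 0)"
  proof (cases "0 < s")
    case True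
    have "(\<lambda>n. max 0 (s - 1 / real (Suc n))) \<longlonglongrightarrow> max 0 (s - 0)"
      by (intro tendsto_intros LIMSEQ_inverse_real_of_nat[unfolded inverse_eq_divide])
    moreover have lt: "max 0 (s - 1 / real (Suc n)) < s" for n using True by auto
    ultimately have "filterlim (\<lambda>n. max 0 (s - 1 / real (Suc n))) (at_left s) sequentially"
      unfolding filterlim_at by (intro conjI always_eventually allI) (auto simp: less_imp_neq[OF lt] lt[unfolded max_less_iff_conj, THEN conjunct2] True simp del: of_nat_Suc)
    from filterlim_compose[OF cadlag_left_limit[OF c[OF w] True] this] True show ?thesis by simp
  qed simp
qed

lemma cadlag_measurable:
  assumes "cadlag x"
  shows "(\<lambda>s. x (max 0 s)) \<in> borel_measurable borel"
proof -
  have "(\<lambda>(s, \<omega>::unit). x (max 0 s)) \<in> borel_measurable (borel \<Otimes>\<^sub>M count_space UNIV)"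
    using assms by (intro cadlag_process_measurable[where X="\<lambda>t _. x t"]) auto
  from measurable_compose[OF measurable_Pair2'[of "()" "count_space UNIV" borel] this]
  show ?thesis by simp
qed

lemma cadlag_measurable_if:
  assumes "cadlag x"
  shows "(\<lambda>s. if 0 \<le> s then x s else c) \<in> borel_measurable borel"
proof -
  note [measurable] = cadlag_measurable[OF assms]
  have "(\<lambda>s. if 0 \<le> s then x s else c) = (\<lambda>s. if 0 \<le> s then x (max 0 s) else c)" by (auto simp: fun_eq_iff)
  then show ?thesis by simp
qed

lemma cadlag_exp_integrable:
  assumes "cadlag x"
  shows "set_integrable lborel {0..t} (\<lambda>s. exp (x s))"
proof -
  obtain K where K: "\<And>s. 0 \<le> s \<Longrightarrow> s \<le> t \<Longrightarrow> \<bar>x s\<bar> \<le> K" using cadlag_bounded[OF assms] by metis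
  note [measurable] = cadlag_measurable_if[OF assms, of 0]
  have "set_integrable lborel {0..t} (\<lambda>s. exp (if 0 \<le> s then x s else 0))"
    unfolding set_integrable_def
  proof (rule integrableI_bounded_set_indicator[where B="exp K"])
    show "AE s in lborel. s \<in> {0..t} \<longrightarrow> norm (exp (if 0 \<le> s then x s else 0)) \<le> exp K"
      using K by (auto simp: abs_le_iff)
  qed (auto simp: emeasure_lborel_Icc_eq)
  then show ?thesis by (rule set_integrable_cong[THEN iffD1, rotated -1]) auto
qed

section \<open>Laws of processes with stationary independent increments\<close>

text \<open>The time domain \<open>D\<close> is a parameter so that the notion applies both to the process on
  \<open>{0..}\<close> and to its time reversal, which lives on \<open>{0..r}\<close>; \<open>\<kappa>\<close> gives the
  laws of the increments.\<close>
definition stationary_independent_increments ::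
    "'a measure \<Rightarrow> (real \<Rightarrow> 'a \<Rightarrow> real) \<Rightarrow> real set \<Rightarrow> (real \<Rightarrow> real measure) \<Rightarrow> bool" where
  "stationary_independent_increments M X D \<kappa> \<longleftrightarrow>
     (\<forall>t\<in>D. X t \<in> borel_measurable M) \<and>
     (\<forall>\<omega>\<in>space M. X 0 \<omega> = 0) \<and>
     (\<forall>s\<in>D. \<forall>t\<in>D. s \<le> t \<longrightarrow> distr M borel (\<lambda>\<omega>. X t \<omega> - X s \<omega>) = \<kappa> (t - s)) \<and>
     (\<forall>(n::nat) \<tau>. (\<forall>i\<le>n. \<tau> i \<in> D) \<and> (\<forall>i<n. \<tau> i \<le> \<tau> (Suc i)) \<longrightarrow>
        prob_space.indep_vars M (\<lambda>_. borel) (\<lambda>i \<omega>. X (\<tau> (Suc i)) \<omega> - X (\<tau> i) \<omega>) {..<n})"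

lemma stationary_independent_incrementsD:
  assumes "stationary_independent_increments M X D \<kappa>"
  shows "\<And>t. t \<in> D \<Longrightarrow> X t \<in> borel_measurable M"
    "\<And>\<omega>. \<omega> \<in> space M \<Longrightarrow> X 0 \<omega> = 0"
    "\<And>s t. s \<in> D \<Longrightarrow> t \<in> D \<Longrightarrow> s \<le> t \<Longrightarrow> distr M borel (\<lambda>\<omega>. X t \<omega> - X s \<omega>) = \<kappa> (t - s)"
    "\<And>(n::nat) \<tau>. (\<And>i. i \<le> n \<Longrightarrow> \<tau> i \<in> D) \<Longrightarrow> (\<And>i. i < n \<Longrightarrow> \<tau> i \<le> \<tau> (Suc i)) \<Longrightarrow>
        prob_space.indep_vars M (\<lambda>_. borel) (\<lambda>i \<omega>. X (\<tau> (Suc i)) \<omega> - X (\<tau> i) \<omega>) {..<n}"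
  using assms unfolding stationary_independent_increments_def by blast+

lemma (in prob_space) indep_vars_reindex:
  assumes f: "inj_on f I" and X: "indep_vars M' X (f ` I)"
  shows "indep_vars (M' \<circ> f) (\<lambda>i. X (f i)) I"
  unfolding indep_vars_def2 indep_sets_def
proof (intro conjI ballI allI impI)
  fix i assume "i \<in> I"
  then show rv: "random_variable ((M' \<circ> f) i) (X (f i))"
    using X by (simp add: indep_vars_def2)
  show "{X (f i) -` A \<inter> space M |A. A \<in> sets ((M' \<circ> f) i)} \<subseteq> events"
    using measurable_sets[OF rv] by blast
next
  fix J A assume J: "J \<subseteq> I" "J \<noteq> {}" "finite J"
    and A: "A \<in> (\<Pi> i\<in>J. {X (f i) -` A \<inter> space M |A. A \<in> sets ((M' \<circ> f) i)})"
  let ?g = "\<lambda>k. A (the_inv_into I f k)"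
  have g: "?g (f i) = A i" if "i \<in> J" for i
    using that J f by (subst the_inv_into_f_f) auto
  have fJ: "inj_on f J" using f J(1) by (rule inj_on_subset)
  have "prob (\<Inter>k\<in>f ` J. ?g k) = (\<Prod>k\<in>f ` J. prob (?g k))"
  proof (rule indep_setsD[where F="\<lambda>i. {X i -` A \<inter> space M |A. A \<in> sets (M' i)}"])
    show "indep_sets (\<lambda>i. {X i -` A \<inter> space M |A. A \<in> sets (M' i)}) (f ` I)"
      using X by (auto simp: indep_vars_def2)
    show "\<forall>k\<in>f ` J. ?g k \<in> {X k -` A \<inter> space M |A. A \<in> sets (M' k)}"
    proof safe
      fix i assume i: "i \<in> J"
      with A have "A i \<in> {X (f i) -` A \<inter> space M |A. A \<in> sets ((M' \<circ> f) i)}" by auto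
      then show "\<exists>B. ?g (f i) = X (f i) -` B \<inter> space M \<and> B \<in> sets (M' (f i))"
        unfolding g[OF i] by auto
    qed
  qed (use J in auto)
  moreover have "(\<Inter>k\<in>f ` J. ?g k) = (\<Inter>j\<in>J. A j)" unfolding image_image by (intro INF_cong refl g)
  moreover have "(\<Prod>k\<in>f ` J. prob (?g k)) = (\<Prod>j\<in>J. prob (A j))"
    unfolding prod.reindex[OF fJ] comp_def by (intro prod.cong refl arg_cong[where f=prob] g)
  ultimately show "prob (\<Inter>j\<in>J. A j) = (\<Prod>j\<in>J. prob (A j))" by (simp only:)
qed

lemma increments_distr_eq_PiM:
  assumes "prob_space M" and X: "stationary_independent_increments M X D \<kappa>"
    and \<tau>: "\<And>i. i \<le> n \<Longrightarrow> \<tau> i \<in> D" "\<And>i. i < n \<Longrightarrow> \<tau> i \<le> \<tau> (Suc i)" and n: "0 < n"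
  shows "distr M (PiM {..<n} (\<lambda>_. borel)) (\<lambda>\<omega>. \<lambda>i\<in>{..<n}. X (\<tau> (Suc i)) \<omega> - X (\<tau> i) \<omega>) =
    PiM {..<n} (\<lambda>i. \<kappa> (\<tau> (Suc i) - \<tau> i))"
proof -
  interpret prob_space M by fact
  have [measurable]: "X (\<tau> i) \<in> borel_measurable M" if "i \<le> n" for i
    by (rule stationary_independent_incrementsD(1)[OF X \<tau>(1)[OF that]])
  have "indep_vars (\<lambda>_. borel) (\<lambda>i \<omega>. X (\<tau> (Suc i)) \<omega> - X (\<tau> i) \<omega>) {..<n}"
    using \<tau> by (intro stationary_independent_incrementsD(4)[OF X]) auto
  then have "distr M (PiM {..<n} (\<lambda>_. borel)) (\<lambda>\<omega>. \<lambda>i\<in>{..<n}. X (\<tau> (Suc i)) \<omega> - X (\<tau> i) \<omega>) =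
    PiM {..<n} (\<lambda>i. distr M borel (\<lambda>\<omega>. X (\<tau> (Suc i)) \<omega> - X (\<tau> i) \<omega>))"
    by (subst (asm) indep_vars_iff_distr_eq_PiM') (use n in auto)
  also have "\<dots> = PiM {..<n} (\<lambda>i. \<kappa> (\<tau> (Suc i) - \<tau> i))"
    using \<tau> by (intro PiM_cong refl stationary_independent_incrementsD(3)[OF X]) auto
  finally show ?thesis .
qed

text \<open>The values at the points of \<open>J\<close> are partial sums of the increments between consecutive points of
  \<open>0 # sorted_list_of_set J\<close>, whose joint law is a product measure. The right-hand side therefore depends
  only on \<open>\<kappa>\<close>, not on the process.\<close>
lemma emeasure_finite_dim_eq_increments:
  assumes "prob_space M" and X: "stationary_independent_increments M X D \<kappa>"
    and D: "D \<subseteq> {0..}" "0 \<in> D" and J: "finite J" "J \<subseteq> D" "J \<noteq> {}"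
    and A: "\<And>i. i \<in> J \<Longrightarrow> A i \<in> sets borel"
  shows "emeasure M {\<omega>\<in>space M. \<forall>i\<in>J. X i \<omega> \<in> A i} =
    (let l = sorted_list_of_set J; n = length l; \<tau> = (\<lambda>i. (0 # l) ! i)
     in emeasure (PiM {..<n} (\<lambda>i. \<kappa> (\<tau> (Suc i) - \<tau> i)))
          {w\<in>space (PiM {..<n} (\<lambda>_. borel)). \<forall>k<n. (\<Sum>i<Suc k. w i) \<in> A (l ! k)})"
proof -
  interpret prob_space M by fact
  define l where "l = sorted_list_of_set J"
  define n where "n = length l"
  define \<tau> where "\<tau> = (\<lambda>i. (0 # l) ! i)"
  have l: "sorted l" "set l = J" using J by (auto simp: l_def)
  have n: "0 < n" using J l by (auto simp: n_def)
  have s0: "sorted (0 # l)" using l J D by auto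
  have tD: "\<tau> i \<in> D" if "i \<le> n" for i
    using that l J D by (cases i) (auto simp: \<tau>_def n_def)
  have mono: "\<tau> i \<le> \<tau> (Suc i)" if "i < n" for i
    unfolding \<tau>_def using s0 that by (intro sorted_nth_mono) (auto simp: n_def)
  let ?Y = "\<lambda>i \<omega>. X (\<tau> (Suc i)) \<omega> - X (\<tau> i) \<omega>"
  let ?B = "{w\<in>space (PiM {..<n} (\<lambda>_. borel)). \<forall>k<n. (\<Sum>i<Suc k. w i) \<in> A (l ! k)}"
  have Al: "A (l ! k) \<in> sets borel" if "k < n" for k
    using that A l by (auto simp: n_def)
  have B: "?B \<in> sets (PiM {..<n} (\<lambda>_. borel :: real measure))"
  proof (rule sets.sets_Collect_countable_All)
    fix k
    show "{w\<in>space (PiM {..<n} (\<lambda>_. borel)). k < n \<longrightarrow> (\<Sum>i<Suc k. w i) \<in> A (l ! k)}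
      \<in> sets (PiM {..<n} (\<lambda>_. borel))"
    proof (cases "k < n")
      case True
      have "(\<lambda>w. \<Sum>i<Suc k. w i) \<in> borel_measurable (PiM {..<n} (\<lambda>_. borel :: real measure))"
        using True by (intro borel_measurable_sum measurable_component_singleton) auto
      from measurable_sets[OF this Al[OF True]] True show ?thesis
        by (auto simp: vimage_def Int_def conj_commute)
    qed simp
  qed
  have Ym [measurable]: "?Y i \<in> borel_measurable M" if "i < n" for i
    using that by (intro borel_measurable_diff stationary_independent_incrementsD(1)[OF X] tD) auto
  have mY: "(\<lambda>\<omega>. \<lambda>i\<in>{..<n}. ?Y i \<omega>) \<in> measurable M (PiM {..<n} (\<lambda>_. borel))"
    by (intro measurable_restrict Ym) simp
  have tel: "(\<Sum>i<Suc k. ?Y i \<omega>) = X (l ! k) \<omega>" if "\<omega> \<in> space M" for k \<omega>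
  proof -
    have "(\<Sum>i<Suc k. ?Y i \<omega>) = X (\<tau> (Suc k)) \<omega> - X (\<tau> 0) \<omega>" by (rule sum_lessThan_telescope)
    then show ?thesis using stationary_independent_incrementsD(2)[OF X that] by (simp add: \<tau>_def)
  qed
  have Jl: "(\<forall>i\<in>J. P i) \<longleftrightarrow> (\<forall>k<n. P (l ! k))" for P
    unfolding l(2)[symmetric] n_def by (simp add: all_set_conv_all_nth)
  have "{\<omega>\<in>space M. \<forall>i\<in>J. X i \<omega> \<in> A i} = (\<lambda>\<omega>. \<lambda>i\<in>{..<n}. ?Y i \<omega>) -` ?B \<inter> space M"
  proof (intro set_eqI)
    fix \<omega>
    have "(\<Sum>i<Suc k. (\<lambda>i\<in>{..<n}. ?Y i \<omega>) i) = X (l ! k) \<omega>" if "\<omega> \<in> space M" "k < n" for k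
      by (subst tel[OF that(1), symmetric]) (use that in \<open>auto intro!: sum.cong\<close>)
    then show "\<omega> \<in> {\<omega>\<in>space M. \<forall>i\<in>J. X i \<omega> \<in> A i} \<longleftrightarrow> \<omega> \<in> (\<lambda>\<omega>. \<lambda>i\<in>{..<n}. ?Y i \<omega>) -` ?B \<inter> space M"
      unfolding Jl by (auto simp: space_PiM)
  qed
  also have "emeasure M \<dots> = emeasure (distr M (PiM {..<n} (\<lambda>_. borel)) (\<lambda>\<omega>. \<lambda>i\<in>{..<n}. ?Y i \<omega>)) ?B"
    by (rule emeasure_distr[OF mY B, symmetric])
  also have "\<dots> = emeasure (PiM {..<n} (\<lambda>i. \<kappa> (\<tau> (Suc i) - \<tau> i))) ?B"
    by (simp only: increments_distr_eq_PiM[where \<tau>=\<tau> and n=n, OF assms(1) X tD mono n])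
  finally show ?thesis by (simp add: Let_def l_def n_def \<tau>_def)
qed

lemma restrict_vimage_prod_emb:
  fixes Z :: "real \<Rightarrow> 'a \<Rightarrow> real"
  assumes "J \<subseteq> D"
  shows "(\<lambda>\<omega>. \<lambda>t\<in>D. Z t \<omega>) -` prod_emb D (\<lambda>_. borel :: real measure) J (Pi\<^sub>E J A) \<inter> space K =
    {\<omega>\<in>space K. \<forall>i\<in>J. Z i \<omega> \<in> A i}"
proof (rule set_eqI)
  fix \<omega>
  have r: "restrict (\<lambda>t\<in>D. Z t \<omega>) J = (\<lambda>t\<in>J. Z t \<omega>)" using assms by (simp add: Int_absorb1)
  show "\<omega> \<in> (\<lambda>\<omega>. \<lambda>t\<in>D. Z t \<omega>) -` prod_emb D (\<lambda>_. borel :: real measure) J (Pi\<^sub>E J A) \<inter> space K \<longleftrightarrow>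
    \<omega> \<in> {\<omega>\<in>space K. \<forall>i\<in>J. Z i \<omega> \<in> A i}"
    unfolding prod_emb_def vimage_Int Int_iff vimage_eq r mem_Collect_eq restrict_PiE_iff space_borel by blast
qed

text \<open>The finite-dimensional cylinders are an intersection-stable generator of the product sigma-algebra, and on
  these both laws are given by the same expression in \<open>\<kappa>\<close>.\<close>
lemma stationary_independent_increments_law_unique:
  assumes M: "prob_space M" and N: "prob_space N"
    and X: "stationary_independent_increments M X D \<kappa>"
    and Y: "stationary_independent_increments N Y D \<kappa>"
    and D: "D \<subseteq> {0..}" "0 \<in> D"
  shows "distr M (PiM D (\<lambda>_. borel)) (\<lambda>\<omega>. \<lambda>t\<in>D. X t \<omega>) = distr N (PiM D (\<lambda>_. borel)) (\<lambda>\<omega>. \<lambda>t\<in>D. Y t \<omega>)"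
proof -
  interpret M: prob_space M by fact
  interpret N: prob_space N by fact
  have mX: "(\<lambda>\<omega>. \<lambda>t\<in>D. X t \<omega>) \<in> measurable M (PiM D (\<lambda>_. borel))"
    by (intro measurable_restrict stationary_independent_incrementsD(1)[OF X])
  have mY: "(\<lambda>\<omega>. \<lambda>t\<in>D. Y t \<omega>) \<in> measurable N (PiM D (\<lambda>_. borel))"
    by (intro measurable_restrict stationary_independent_incrementsD(1)[OF Y])
  note pre = restrict_vimage_prod_emb
  show ?thesis
  proof (rule measure_eqI_PiM_infinite)
    show "finite_measure (distr M (PiM D (\<lambda>_. borel)) (\<lambda>\<omega>. \<lambda>t\<in>D. X t \<omega>))"
      by (rule M.finite_measure_distr[OF mX])
    fix A :: "real \<Rightarrow> real set" and J assume J: "finite J" "J \<subseteq> D" and A: "\<And>i. i \<in> J \<Longrightarrow> A i \<in> sets borel"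
    have s: "prod_emb D (\<lambda>_. borel) J (Pi\<^sub>E J A) \<in> sets (PiM D (\<lambda>_. borel :: real measure))"
      using J A by (intro sets_PiM_I) auto
    show "emeasure (distr M (PiM D (\<lambda>_. borel)) (\<lambda>\<omega>. \<lambda>t\<in>D. X t \<omega>)) (prod_emb D (\<lambda>_. borel) J (Pi\<^sub>E J A)) =
      emeasure (distr N (PiM D (\<lambda>_. borel)) (\<lambda>\<omega>. \<lambda>t\<in>D. Y t \<omega>)) (prod_emb D (\<lambda>_. borel) J (Pi\<^sub>E J A))"
    proof (cases "J = {}")
      case True
      then show ?thesis
        unfolding emeasure_distr[OF mX s] emeasure_distr[OF mY s] pre[OF J(2)]
        by (simp add: M.emeasure_space_1 N.emeasure_space_1)
    next
      case False
      show ?thesis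
        unfolding emeasure_distr[OF mX s] emeasure_distr[OF mY s] pre[OF J(2)]
        by (rule trans[OF emeasure_finite_dim_eq_increments[OF M X D J False A]
          emeasure_finite_dim_eq_increments[OF N Y D J False A, symmetric]])
    qed
  qed auto
qed

section \<open>Levy processes\<close>

lemma levy_processD:
  assumes "levy_process M X"
  shows "prob_space M" "\<And>t. 0 \<le> t \<Longrightarrow> X t \<in> borel_measurable M"
    "\<And>\<omega>. \<omega> \<in> space M \<Longrightarrow> X 0 \<omega> = 0" "\<And>\<omega>. \<omega> \<in> space M \<Longrightarrow> cadlag (\<lambda>t. X t \<omega>)"
    "\<And>s t. 0 \<le> s \<Longrightarrow> s \<le> t \<Longrightarrow> distr M borel (\<lambda>\<omega>. X t \<omega> - X s \<omega>) = distr M borel (X (t - s))"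
    "\<And>(n::nat) \<tau>. 0 \<le> \<tau> 0 \<Longrightarrow> (\<And>i. i < n \<Longrightarrow> \<tau> i \<le> \<tau> (Suc i)) \<Longrightarrow>
        prob_space.indep_vars M (\<lambda>_. borel) (\<lambda>i \<omega>. X (\<tau> (Suc i)) \<omega> - X (\<tau> i) \<omega>) {..<n}"
  using assms unfolding levy_process_def by auto

lemma levy_stationary_independent_increments:
  assumes "levy_process M X" "0 \<le> r"
  shows "stationary_independent_increments M (\<lambda>t \<omega>. X (r + t) \<omega> - X r \<omega>) {0..} (\<lambda>t. distr M borel (X t))"
proof -
  note L = levy_processD[OF assms(1)]
  show ?thesis
    unfolding stationary_independent_increments_def
  proof (intro conjI ballI allI impI)
    fix t :: real assume "t \<in> {0..}"
    then show "(\<lambda>\<omega>. X (r + t) \<omega> - X r \<omega>) \<in> borel_measurable M"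
      using assms(2) by (intro borel_measurable_diff L(2)) auto
  next
    fix s t :: real assume "s \<in> {0..}" "t \<in> {0..}" "s \<le> t"
    then show "distr M borel (\<lambda>\<omega>. X (r + t) \<omega> - X r \<omega> - (X (r + s) \<omega> - X r \<omega>)) = distr M borel (X (t - s))"
      using L(5)[of "r + s" "r + t"] assms(2) by simp
  next
    fix n and \<tau> :: "nat \<Rightarrow> real" assume "(\<forall>i\<le>n. \<tau> i \<in> {0..}) \<and> (\<forall>i<n. \<tau> i \<le> \<tau> (Suc i))"
    then show "prob_space.indep_vars M (\<lambda>_. borel)
      (\<lambda>i \<omega>. X (r + \<tau> (Suc i)) \<omega> - X r \<omega> - (X (r + \<tau> i) \<omega> - X r \<omega>)) {..<n}"
      using L(6)[of "\<lambda>i. r + \<tau> i" n] assms(2) by auto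
  qed auto
qed

text \<open>The increments of the reversed process over a grid are those of the process over the reflected grid, taken in
  the opposite order.\<close>
lemma levy_reversed_stationary_independent_increments:
  assumes "levy_process M X" "0 \<le> r"
  shows "stationary_independent_increments M (\<lambda>t \<omega>. X r \<omega> - X (r - t) \<omega>) {0..r} (\<lambda>t. distr M borel (X t))"
proof -
  note L = levy_processD[OF assms(1)]
  interpret prob_space M by (rule L(1))
  show ?thesis
    unfolding stationary_independent_increments_def
  proof (intro conjI ballI allI impI)
    fix t :: real assume "t \<in> {0..r}"
    then show "(\<lambda>\<omega>. X r \<omega> - X (r - t) \<omega>) \<in> borel_measurable M"
      by (intro borel_measurable_diff L(2)) auto
  next
    fix s t :: real assume "s \<in> {0..r}" "t \<in> {0..r}" "s \<le> t"
    then show "distr M borel (\<lambda>\<omega>. X r \<omega> - X (r - t) \<omega> - (X r \<omega> - X (r - s) \<omega>)) = distr M borel (X (t - s))"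
      using L(5)[of "r - t" "r - s"] by simp
  next
    fix n :: nat and \<tau> :: "nat \<Rightarrow> real" assume \<tau>: "(\<forall>i\<le>n. \<tau> i \<in> {0..r}) \<and> (\<forall>i<n. \<tau> i \<le> \<tau> (Suc i))"
    define \<sigma> where "\<sigma> i = r - \<tau> (n - i)" for i
    have "indep_vars (\<lambda>_. borel) (\<lambda>i \<omega>. X (\<sigma> (Suc i)) \<omega> - X (\<sigma> i) \<omega>) {..<n}"
    proof (rule L(6))
      show "0 \<le> \<sigma> 0" using \<tau> by (auto simp: \<sigma>_def)
      show "\<sigma> i \<le> \<sigma> (Suc i)" if "i < n" for i
      proof -
        have "\<tau> (n - Suc i) \<le> \<tau> (Suc (n - Suc i))" using \<tau> that by auto
        then show ?thesis using that by (auto simp: \<sigma>_def Suc_diff_Suc)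
      qed
    qed
    moreover have "(\<lambda>i. n - Suc i) ` {..<n} \<subseteq> {..<n}" by auto
    ultimately have "indep_vars (\<lambda>_. borel) (\<lambda>i \<omega>. X (\<sigma> (Suc i)) \<omega> - X (\<sigma> i) \<omega>) ((\<lambda>i. n - Suc i) ` {..<n})"
      by (rule indep_vars_subset)
    then have "indep_vars ((\<lambda>_. borel) \<circ> (\<lambda>i. n - Suc i))
        (\<lambda>i. (\<lambda>i \<omega>. X (\<sigma> (Suc i)) \<omega> - X (\<sigma> i) \<omega>) (n - Suc i)) {..<n}"
      by (intro indep_vars_reindex) (auto simp: inj_on_def)
    then have "indep_vars (\<lambda>_. borel) (\<lambda>i \<omega>. X (\<sigma> (Suc (n - Suc i))) \<omega> - X (\<sigma> (n - Suc i)) \<omega>) {..<n}"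
      by (simp add: comp_def)
    also have "indep_vars (\<lambda>_. borel) (\<lambda>i \<omega>. X (\<sigma> (Suc (n - Suc i))) \<omega> - X (\<sigma> (n - Suc i)) \<omega>) {..<n} \<longleftrightarrow>
      indep_vars (\<lambda>_. borel) (\<lambda>i \<omega>. X r \<omega> - X (r - \<tau> (Suc i)) \<omega> - (X r \<omega> - X (r - \<tau> i) \<omega>)) {..<n}"
      by (intro indep_vars_cong) (auto simp: \<sigma>_def Suc_diff_Suc fun_eq_iff)
    finally show "indep_vars (\<lambda>_. borel) (\<lambda>i \<omega>. X r \<omega> - X (r - \<tau> (Suc i)) \<omega> - (X r \<omega> - X (r - \<tau> i) \<omega>)) {..<n}" .
  qed auto
qed

text \<open>Independence is checked on cylinders, where both events are functions of disjoint groups of increments over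
  one common grid.\<close>
lemma levy_past_future_indep:
  assumes levy: "levy_process M X" and r: "0 \<le> r"
  shows "prob_space.indep_var M (PiM {0..r} (\<lambda>_. borel)) (\<lambda>\<omega>. \<lambda>s\<in>{0..r}. X s \<omega>)
    path_space (path_map (\<lambda>s \<omega>. X (r + s) \<omega> - X r \<omega>))"
proof -
  note L = levy_processD[OF levy]
  interpret prob_space M by (rule L(1))
  let ?P = "\<lambda>\<omega>. \<lambda>s\<in>{0..r}. X s \<omega>" and ?F = "path_map (\<lambda>s \<omega>. X (r + s) \<omega> - X r \<omega>)"
  let ?MP = "PiM {0..r} (\<lambda>_. borel :: real measure)"
  let ?A1 = "prod_algebra {0..r} (\<lambda>_. borel :: real measure)" and ?A2 = "prod_algebra {0..} (\<lambda>_. borel :: real measure)"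
  have mP: "?P \<in> measurable M ?MP" by (intro measurable_restrict L) auto
  have mF: "?F \<in> measurable M path_space" unfolding path_map_def
    using r by (intro measurable_restrict borel_measurable_diff L) auto
  have key: "prob ((?P -` E1 \<inter> space M) \<inter> (?F -` E2 \<inter> space M)) = prob (?P -` E1 \<inter> space M) * prob (?F -` E2 \<inter> space M)"
    if "E1 \<in> ?A1" "E2 \<in> ?A2" for E1 E2
  proof -
    obtain J1 A1 where E1: "E1 = prod_emb {0..r} (\<lambda>_. borel) J1 (\<Pi>\<^sub>E j\<in>J1. A1 j)" "finite J1" "J1 \<subseteq> {0..r}"
      and A1: "\<And>i. i \<in> J1 \<Longrightarrow> A1 i \<in> sets borel" using \<open>E1 \<in> ?A1\<close> by (rule prod_algebraE) auto
    obtain J2 A2 where E2: "E2 = prod_emb {0..} (\<lambda>_. borel) J2 (\<Pi>\<^sub>E j\<in>J2. A2 j)" "finite J2" "J2 \<subseteq> {0..}"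
      and A2: "\<And>i. i \<in> J2 \<Longrightarrow> A2 i \<in> sets borel" using \<open>E2 \<in> ?A2\<close> by (rule prod_algebraE) auto
    have pre1: "?P -` E1 \<inter> space M = {\<omega>\<in>space M. \<forall>i\<in>J1. X i \<omega> \<in> A1 i}"
      unfolding E1(1) by (rule restrict_vimage_prod_emb[OF E1(3)])
    have pre2: "?F -` E2 \<inter> space M = {\<omega>\<in>space M. \<forall>i\<in>J2. X (r + i) \<omega> - X r \<omega> \<in> A2 i}"
      unfolding E2(1) path_map_def by (rule restrict_vimage_prod_emb[OF E2(3)])
    \<comment> \<open>The increments over one grid through \<open>0\<close>, \<open>J1\<close>, \<open>r\<close> and
      \<open>r + J2\<close> are independent; the first \<open>n1\<close>
      of them determine the past, the others the future.\<close>
    define l1 where "l1 = sorted_list_of_set J1"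
    define l2 where "l2 = sorted_list_of_set J2"
    \<comment> \<open>The point \<open>r\<close> is kept twice if it lies in \<open>J1\<close>, or if \<open>0\<close>
      lies in \<open>J2\<close>; the increment in between is then \<open>0\<close>.\<close>
    define l where "l = 0 # l1 @ r # map ((+) r) l2"
    define n1 where "n1 = Suc (length l1)"
    define n where "n = n1 + length l2"
    define \<tau> where "\<tau> i = l ! i" for i
    have l1: "sorted l1" "set l1 = J1" and l2: "sorted l2" "set l2 = J2" using E1 E2 by (auto simp: l1_def l2_def)
    have "sorted (map ((+) r) l2)" using l2 by (simp add: sorted_map)
    moreover have "sorted (r # map ((+) r) l2)"
      using calculation l2(2) E2(3) by (auto simp: subset_eq)
    moreover have "\<forall>x\<in>set l1. \<forall>y\<in>set (r # map ((+) r) l2). x \<le> y"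
      using l1(2) l2(2) E1(3) E2(3) by (fastforce simp: subset_eq)
    ultimately have "sorted (l1 @ r # map ((+) r) l2)" using l1(1) unfolding sorted_append by blast
    moreover have "\<forall>y\<in>set (l1 @ r # map ((+) r) l2). 0 \<le> y"
      using l1(2) l2(2) E1(3) E2(3) r by (auto simp: subset_eq)
    ultimately have sl: "sorted l" unfolding l_def by simp
    have len: "length l = Suc n" by (simp add: l_def n_def n1_def)
    have \<tau>0: "\<tau> 0 = 0" by (simp add: \<tau>_def l_def)
    have \<tau>1: "\<tau> (Suc k) = l1 ! k" if "k < length l1" for k using that by (simp add: \<tau>_def l_def nth_append)
    have \<tau>r: "\<tau> n1 = r" by (simp add: \<tau>_def l_def n1_def nth_append)
    have \<tau>2: "\<tau> (Suc (n1 + k)) = r + l2 ! k" if "k < length l2" for k using that by (simp add: \<tau>_def l_def n1_def nth_append)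
    let ?Y = "\<lambda>i \<omega>. X (\<tau> (Suc i)) \<omega> - X (\<tau> i) \<omega>"
    have ind: "indep_vars (\<lambda>_. borel) ?Y {..<n}"
    proof (rule L(6))
      show "0 \<le> \<tau> 0" by (simp add: \<tau>0)
      show "\<tau> i \<le> \<tau> (Suc i)" if "i < n" for i
        unfolding \<tau>_def using sl len that by (intro sorted_nth_mono) auto
    qed
    define R1 where "R1 = (\<lambda>\<omega>. restrict (\<lambda>i. ?Y i \<omega>) {..<n1})"
    define R2 where "R2 = (\<lambda>\<omega>. restrict (\<lambda>i. ?Y i \<omega>) {n1..<n})"
    have R1_space: "R1 \<omega> \<in> space (PiM {..<n1} (\<lambda>_. borel))" and R2_space: "R2 \<omega> \<in> space (PiM {n1..<n} (\<lambda>_. borel))" for \<omega>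
      by (auto simp: R1_def R2_def space_PiM)
    have ind2: "indep_var (PiM {..<n1} (\<lambda>_. borel)) R1 (PiM {n1..<n} (\<lambda>_. borel)) R2"
      unfolding R1_def R2_def
      by (rule indep_var_restrict[OF ind]) (auto simp: n_def)
    let ?B1 = "{w\<in>space (PiM {..<n1} (\<lambda>_. borel)). \<forall>k<length l1. (\<Sum>i<Suc k. w i) \<in> A1 (l1 ! k)}"
    let ?B2 = "{w\<in>space (PiM {n1..<n} (\<lambda>_. borel)). \<forall>k<length l2. (\<Sum>i=n1..<Suc (n1 + k). w i) \<in> A2 (l2 ! k)}"
    have S: "{w\<in>space (PiM I (\<lambda>_. borel)). k < m \<longrightarrow> (\<Sum>i\<in>K k. w i) \<in> A k} \<in> sets (PiM I (\<lambda>_. borel :: real measure))"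
      if "k < m \<Longrightarrow> K k \<subseteq> I" "k < m \<Longrightarrow> A k \<in> sets borel"
      for I :: "nat set" and k m :: nat and K :: "nat \<Rightarrow> nat set" and A :: "nat \<Rightarrow> real set"
    proof (cases "k < m")
      case True
      have "(\<lambda>w. \<Sum>i\<in>K k. w i) \<in> borel_measurable (PiM I (\<lambda>_. borel :: real measure))"
        using that(1)[OF True] by (intro borel_measurable_sum measurable_component_singleton) auto
      from measurable_sets[OF this that(2)[OF True]] True show ?thesis
        by (auto simp: vimage_def Int_def conj_commute)
    qed simp
    have B1: "?B1 \<in> sets (PiM {..<n1} (\<lambda>_. borel :: real measure))"
      using A1 l1 by (intro sets.sets_Collect_countable_All S[of _ _ "\<lambda>k. {..<Suc k}" _ "\<lambda>k. A1 (l1 ! k)"]) (auto simp: n1_def)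
    have B2: "?B2 \<in> sets (PiM {n1..<n} (\<lambda>_. borel :: real measure))"
      using A2 l2 by (intro sets.sets_Collect_countable_All S[of _ _ "\<lambda>k. {n1..<Suc (n1 + k)}" _ "\<lambda>k. A2 (l2 ! k)"]) (auto simp: n_def)
    have s1: "(\<Sum>i<Suc k. R1 \<omega> i) = X (l1 ! k) \<omega>" if "\<omega> \<in> space M" "k < length l1" for \<omega> k
    proof -
      have "(\<Sum>i<Suc k. R1 \<omega> i) = (\<Sum>i<Suc k. ?Y i \<omega>)" using that by (intro sum.cong) (auto simp: n1_def R1_def)
      also have "\<dots> = X (\<tau> (Suc k)) \<omega> - X (\<tau> 0) \<omega>" by (rule sum_lessThan_telescope)
      finally show ?thesis using that by (simp add: \<tau>0 \<tau>1 L(3))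
    qed
    have s2: "(\<Sum>i=n1..<Suc (n1 + k). R2 \<omega> i) = X (r + l2 ! k) \<omega> - X r \<omega>" if "\<omega> \<in> space M" "k < length l2" for \<omega> k
    proof -
      have "(\<Sum>i=n1..<Suc (n1 + k). R2 \<omega> i) = (\<Sum>i=n1..<Suc (n1 + k). ?Y i \<omega>)" using that by (intro sum.cong) (auto simp: n_def R2_def)
      also have "\<dots> = X (\<tau> (Suc (n1 + k))) \<omega> - X (\<tau> n1) \<omega>" by (rule sum_Suc_diff') simp
      finally show ?thesis using that by (simp add: \<tau>r \<tau>2)
    qed
    have e1: "?P -` E1 \<inter> space M = R1 -` ?B1 \<inter> space M"
    proof (rule set_eqI)
      fix \<omega>
      have "\<omega> \<in> ?P -` E1 \<inter> space M \<longleftrightarrow> \<omega> \<in> space M \<and> (\<forall>k<length l1. X (l1 ! k) \<omega> \<in> A1 (l1 ! k))"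
        unfolding pre1 l1(2)[symmetric] all_set_conv_all_nth by blast
      also have "\<dots> \<longleftrightarrow> \<omega> \<in> R1 -` ?B1 \<inter> space M"
        using s1[of \<omega>] R1_space[of \<omega>] by (auto simp only: vimage_eq IntI Int_iff mem_Collect_eq)
      finally show "\<omega> \<in> ?P -` E1 \<inter> space M \<longleftrightarrow> \<omega> \<in> R1 -` ?B1 \<inter> space M" .
    qed
    have e2: "?F -` E2 \<inter> space M = R2 -` ?B2 \<inter> space M"
    proof (rule set_eqI)
      fix \<omega>
      have "\<omega> \<in> ?F -` E2 \<inter> space M \<longleftrightarrow> \<omega> \<in> space M \<and> (\<forall>k<length l2. X (r + l2 ! k) \<omega> - X r \<omega> \<in> A2 (l2 ! k))"
        unfolding pre2 l2(2)[symmetric] all_set_conv_all_nth by blast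
      also have "\<dots> \<longleftrightarrow> \<omega> \<in> R2 -` ?B2 \<inter> space M"
        using s2[of \<omega>] R2_space[of \<omega>] by (auto simp only: vimage_eq IntI Int_iff mem_Collect_eq)
      finally show "\<omega> \<in> ?F -` E2 \<inter> space M \<longleftrightarrow> \<omega> \<in> R2 -` ?B2 \<inter> space M" .
    qed
    have "R1 -` ?B1 \<inter> space M \<inter> (R2 -` ?B2 \<inter> space M) = (\<lambda>x. (R1 x, R2 x)) -` (?B1 \<times> ?B2) \<inter> space M" by blast
    then show ?thesis unfolding e1 e2 by (simp only: indep_varD[OF ind2 B1 B2])
  qed
  show ?thesis
    unfolding indep_var_def
  proof (subst indep_vars_finite[where E="case_bool ?A1 ?A2"])
    have p2: "(\<Prod>j\<in>UNIV. g j) = g True * g False" for g :: "bool \<Rightarrow> real" by (simp add: UNIV_bool mult.commute)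
    have i2: "(\<Inter>j\<in>UNIV. G j) = G True \<inter> G False" for G :: "bool \<Rightarrow> 'a set" by (simp add: UNIV_bool Int_commute)
    show "\<forall>A\<in>Pi UNIV (case_bool ?A1 ?A2). prob (\<Inter>j\<in>UNIV. case_bool ?P ?F j -` A j \<inter> space M) =
        (\<Prod>j\<in>UNIV. prob (case_bool ?P ?F j -` A j \<inter> space M))"
    proof
      fix A assume A: "A \<in> Pi UNIV (case_bool ?A1 ?A2)"
      have "A True \<in> ?A1" "A False \<in> ?A2" using Pi_mem[OF A UNIV_I, of True] Pi_mem[OF A UNIV_I, of False] by (simp_all only: bool.case)
      from key[OF this] show "prob (\<Inter>j\<in>UNIV. case_bool ?P ?F j -` A j \<inter> space M) =
        (\<Prod>j\<in>UNIV. prob (case_bool ?P ?F j -` A j \<inter> space M))"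
        unfolding i2 p2 bool.case .
    qed
  next
    fix i :: bool
    show "sets (case_bool ?MP path_space i) = sigma_sets (space (case_bool ?MP path_space i)) (case_bool ?A1 ?A2 i)"
      by (cases i) (simp_all add: sets_PiM space_PiM)
    show "random_variable (case_bool ?MP path_space i) (case_bool ?P ?F i)"
      using mP mF by (cases i) simp_all
    show "Int_stable (case_bool ?A1 ?A2 i)"
      by (cases i) (simp_all add: Int_stable_prod_algebra)
    show "space (case_bool ?MP path_space i) \<in> case_bool ?A1 ?A2 i"
      by (cases i) (simp_all only: bool.case space_PiM space_in_prod_algebra)
    show "case_bool ?A1 ?A2 i \<subseteq> Pow (space (case_bool ?MP path_space i))"
      by (cases i) (simp_all only: bool.case space_PiM prod_algebra_sets_into_space)
  qed auto
qed

section \<open>Integral functionals on path space\<close>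

text \<open>A measurable substitute, on arbitrary functions, for evaluating a right-continuous path: a product
  sigma-algebra does not see the regularity of the paths, and evaluation itself is not jointly measurable.\<close>
definition right_lim :: "(real \<Rightarrow> real) \<Rightarrow> real \<Rightarrow> real" where
  "right_lim w s = lim (\<lambda>n. w (grid_above n (max 0 s)))"

lemma right_lim_eq: "(w \<longlongrightarrow> l) (at_right s) \<Longrightarrow> 0 \<le> s \<Longrightarrow> right_lim w s = l"
  unfolding right_lim_def using limI[OF filterlim_compose[OF _ filterlim_grid_above]] by (simp add: max_absorb2)

lemma right_lim_cong: "(\<And>t. 0 \<le> t \<Longrightarrow> w t = w' t) \<Longrightarrow> right_lim w s = right_lim w' s"
  unfolding right_lim_def by (intro arg_cong[where f=lim] ext) (simp add: grid_above_nonneg)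

lemma right_lim_path: "cadlag (\<lambda>t. X t \<omega>) \<Longrightarrow> 0 \<le> s \<Longrightarrow> right_lim (path_map X \<omega>) s = X s \<omega>"
  by (rule trans[OF right_lim_cong[of "path_map X \<omega>" "\<lambda>t. X t \<omega>"] right_lim_eq[OF cadlag_right_limit]])
    (simp_all add: path_map_def)

lemma measurable_right_lim: "(\<lambda>(s, w). right_lim w s) \<in> borel_measurable (borel \<Otimes>\<^sub>M path_space)"
proof -
  have "(\<lambda>w. w t) \<in> borel_measurable path_space" if "0 \<le> t" for t :: real
    using that by (intro measurable_component_singleton) auto
  then have "(\<lambda>(s, w). w (grid_above n (max 0 s))) \<in> borel_measurable (borel \<Otimes>\<^sub>M path_space)" for n
    by (rule borel_measurable_grid_above[where X="\<lambda>t w. w t" and M=path_space])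
  then have "(\<lambda>p. lim (\<lambda>n. (case p of (s, w) \<Rightarrow> w (grid_above n (max 0 s))))) \<in> borel_measurable (borel \<Otimes>\<^sub>M path_space)"
    by (rule borel_measurable_lim_metric)
  then show ?thesis unfolding right_lim_def by (simp only: case_prod_beta')
qed

lemma path_map_measurable:
  "(\<And>t. 0 \<le> t \<Longrightarrow> X t \<in> borel_measurable M) \<Longrightarrow> path_map X \<in> measurable M path_space"
  unfolding path_map_def by (intro measurable_restrict) auto

definition exp_integral :: "real set \<Rightarrow> (real \<Rightarrow> real) \<Rightarrow> real" where
  "exp_integral D w = (LBINT s:D. exp (right_lim w s))"

definition total_exp_integral :: "(real \<Rightarrow> real) \<Rightarrow> ennreal" where
  "total_exp_integral w = (\<integral>\<^sup>+s\<in>{0..}. ennreal (exp (right_lim w s)) \<partial>lborel)"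

lemma measurable_exp_right_lim:
  "(\<lambda>p. exp (right_lim (fst p) (snd p))) \<in> borel_measurable (path_space \<Otimes>\<^sub>M lborel)"
proof -
  have "(\<lambda>p. right_lim (fst p) (snd p)) \<in> borel_measurable (path_space \<Otimes>\<^sub>M borel)"
    using measurable_compose[OF measurable_pair_swap' measurable_right_lim] by (simp add: split_beta)
  then have "(\<lambda>p. right_lim (fst p) (snd p)) \<in> borel_measurable (path_space \<Otimes>\<^sub>M lborel)"
    by (simp cong: measurable_cong_sets sets_pair_measure_cong)
  then show ?thesis by (rule measurable_compose[OF _ borel_measurable_exp])
qed

lemma measurable_exp_integral:
  assumes [measurable]: "D \<in> sets borel"
  shows "exp_integral D \<in> borel_measurable path_space"
proof -
  have "(\<lambda>p. indicator D (snd p) *\<^sub>R exp (right_lim (fst p) (snd p))) \<in> borel_measurable (path_space \<Otimes>\<^sub>M lborel)"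
    using assms by (intro borel_measurable_scaleR measurable_exp_right_lim borel_measurable_indicator'
        measurable_compose[OF measurable_snd borel_measurable_indicator]) simp
  then have "(\<lambda>w. \<integral>s. indicator D s *\<^sub>R exp (right_lim w s) \<partial>lborel) \<in> borel_measurable path_space"
    by (intro lborel.borel_measurable_lebesgue_integral) (simp only: case_prod_beta')
  then show ?thesis unfolding exp_integral_def[abs_def] set_lebesgue_integral_def by simp
qed

lemma measurable_total_exp_integral: "total_exp_integral \<in> borel_measurable path_space"
proof -
  have "(\<lambda>p. ennreal (exp (right_lim (fst p) (snd p))) * indicator {0..} (snd p)) \<in> borel_measurable (path_space \<Otimes>\<^sub>M lborel)"
    by (intro borel_measurable_times_ennreal measurable_compose[OF measurable_exp_right_lim measurable_ennreal]
        measurable_compose[OF measurable_snd borel_measurable_indicator]) simp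
  then have "(\<lambda>w. \<integral>\<^sup>+s. ennreal (exp (right_lim w s)) * indicator {0..} s \<partial>lborel) \<in> borel_measurable path_space"
    by (intro lborel.borel_measurable_nn_integral) (simp only: case_prod_beta')
  then show ?thesis unfolding total_exp_integral_def[abs_def] by simp
qed

lemma exp_integral_path:
  assumes "cadlag (\<lambda>t. X t \<omega>)" "D \<subseteq> {0..}"
  shows "exp_integral D (path_map X \<omega>) = (LBINT s:D. exp (X s \<omega>))"
  unfolding exp_integral_def set_lebesgue_integral_def
  using assms by (intro Bochner_Integration.integral_cong refl) (auto simp: indicator_def right_lim_path)

lemma total_exp_integral_path:
  assumes "cadlag (\<lambda>t. X t \<omega>)"
  shows "total_exp_integral (path_map X \<omega>) = (\<integral>\<^sup>+s\<in>{0..}. ennreal (exp (X s \<omega>)) \<partial>lborel)"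
  unfolding total_exp_integral_def
  using assms by (intro nn_integral_cong) (auto simp: indicator_def right_lim_path)

lemma cadlag_nn_integral_exp:
  assumes "cadlag x"
  shows "set_integrable lborel {0..} (\<lambda>s. exp (x s)) \<longleftrightarrow> (\<integral>\<^sup>+s\<in>{0..}. ennreal (exp (x s)) \<partial>lborel) < \<infinity>" (is ?fin)
    and "(\<integral>\<^sup>+s\<in>{0..}. ennreal (exp (x s)) \<partial>lborel) < \<infinity> \<Longrightarrow> ennreal (I_hat x) = (\<integral>\<^sup>+s\<in>{0..}. ennreal (exp (x s)) \<partial>lborel)" (is "_ \<Longrightarrow> _ = ?N")
proof -
  let ?N = "(\<integral>\<^sup>+s\<in>{0..}. ennreal (exp (x s)) \<partial>lborel)"
  have m: "(\<lambda>s. indicator {0..} s *\<^sub>R exp (x s)) \<in> borel_measurable lborel"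
  proof -
    have [measurable]: "(\<lambda>s. if 0 \<le> s then x s else 0) \<in> borel_measurable borel"
      by (rule cadlag_measurable_if[OF assms])
    have "(\<lambda>s. indicator {0..} s *\<^sub>R exp (x s)) = (\<lambda>s. indicator {0..} s *\<^sub>R exp (if 0 \<le> s then x s else 0))"
      by (auto simp: fun_eq_iff indicator_def)
    then show ?thesis by simp
  qed
  have e: "(\<integral>\<^sup>+s. ennreal (indicator {0..} s *\<^sub>R exp (x s)) \<partial>lborel) = ?N"
    by (intro nn_integral_cong) (auto simp: indicator_def)
  show i: "set_integrable lborel {0..} (\<lambda>s. exp (x s)) \<longleftrightarrow> ?N < \<infinity>"
    unfolding set_integrable_def using m by (subst integrable_iff_bounded) (auto simp: e[symmetric])
  show "ennreal (I_hat x) = ?N" if "?N < \<infinity>"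
    using that i[unfolded set_integrable_def] unfolding I_hat_def set_lebesgue_integral_def
    using e[unfolded real_scaleR_def] by (subst nn_integral_eq_integral[symmetric]) auto
qed

section \<open>Path laws of a Levy process\<close>

lemma stationary_independent_increments_subset:
  assumes "stationary_independent_increments M X D \<kappa>" "C \<subseteq> D"
  shows "stationary_independent_increments M X C \<kappa>"
proof -
  note S = stationary_independent_incrementsD[OF assms(1)]
  show ?thesis
    unfolding stationary_independent_increments_def
  proof (intro conjI ballI allI impI)
    fix n :: nat and \<tau> :: "nat \<Rightarrow> real" assume \<tau>: "(\<forall>i\<le>n. \<tau> i \<in> C) \<and> (\<forall>i<n. \<tau> i \<le> \<tau> (Suc i))"
    show "prob_space.indep_vars M (\<lambda>_. borel) (\<lambda>i \<omega>. X (\<tau> (Suc i)) \<omega> - X (\<tau> i) \<omega>) {..<n}"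
      by (rule S(4)) (use \<tau> assms(2) in auto)
  qed (use assms(2) in \<open>auto intro!: S(1-3)\<close>)
qed

lemma levy_process_stationary_independent_increments:
  assumes "levy_process M X"
  shows "stationary_independent_increments M X {0..} (\<lambda>t. distr M borel (X t))"
proof -
  note L = levy_processD[OF assms]
  show ?thesis
    unfolding stationary_independent_increments_def
  proof (intro conjI ballI allI impI)
    fix n :: nat and \<tau> :: "nat \<Rightarrow> real" assume \<tau>: "(\<forall>i\<le>n. \<tau> i \<in> {0..}) \<and> (\<forall>i<n. \<tau> i \<le> \<tau> (Suc i))"
    show "prob_space.indep_vars M (\<lambda>_. borel) (\<lambda>i \<omega>. X (\<tau> (Suc i)) \<omega> - X (\<tau> i) \<omega>) {..<n}"
      by (rule L(6)) (use \<tau> in auto)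
  qed (auto intro!: L(2,3,5))
qed

lemma levy_shift_law:
  assumes "levy_process M X" "0 \<le> r"
  shows "distr M path_space (path_map (\<lambda>t \<omega>. X (r + t) \<omega> - X r \<omega>)) = distr M path_space (path_map X)"
  unfolding path_map_def
  by (rule stationary_independent_increments_law_unique[OF levy_processD(1)[OF assms(1)] levy_processD(1)[OF assms(1)]
        levy_stationary_independent_increments[OF assms] levy_process_stationary_independent_increments[OF assms(1)]]) auto

text \<open>Both processes have stationary independent increments on \<open>{0..r}\<close> with the same increment laws;
  stopping at \<open>r\<close> turns their laws into laws on the path space.\<close>
lemma levy_reversal_law:
  assumes "levy_process M X" "0 \<le> r"
  shows "distr M path_space (path_map (\<lambda>t \<omega>. X r \<omega> - X (r - min t r) \<omega>)) =
    distr M path_space (path_map (\<lambda>t. X (min t r)))"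
proof -
  note L = levy_processD[OF assms(1)]
  let ?g = "\<lambda>w. \<lambda>t\<in>{0..}. w (min t r) :: real"
  have g: "?g \<in> measurable (PiM {0..r} (\<lambda>_. borel)) path_space"
    using assms(2) by (intro measurable_restrict measurable_component_singleton) auto
  have e: "distr M path_space (path_map (\<lambda>t. Z (min t r))) =
      distr (distr M (PiM {0..r} (\<lambda>_. borel)) (\<lambda>\<omega>. \<lambda>t\<in>{0..r}. Z t \<omega>)) path_space ?g"
    if "\<And>t. t \<in> {0..r} \<Longrightarrow> Z t \<in> borel_measurable M" for Z
    using assms(2) by (subst distr_distr[OF g measurable_restrict[OF that]])
      (auto simp: path_map_def fun_eq_iff restrict_def intro!: distr_cong)
  have "distr M (PiM {0..r} (\<lambda>_. borel)) (\<lambda>\<omega>. \<lambda>t\<in>{0..r}. X r \<omega> - X (r - t) \<omega>) =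
      distr M (PiM {0..r} (\<lambda>_. borel)) (\<lambda>\<omega>. \<lambda>t\<in>{0..r}. X t \<omega>)"
    by (rule stationary_independent_increments_law_unique[OF L(1) L(1)
          levy_reversed_stationary_independent_increments[OF assms]
          stationary_independent_increments_subset[OF levy_process_stationary_independent_increments[OF assms(1)]]]) (use assms(2) in auto)
  then have "distr M path_space (path_map (\<lambda>t. (\<lambda>t \<omega>. X r \<omega> - X (r - t) \<omega>) (min t r))) =
    distr M path_space (path_map (\<lambda>t. X (min t r)))"
    using assms(2) by (subst (1 2) e) (auto intro!: L(2) borel_measurable_diff)
  then show ?thesis by simp
qed

text \<open>Reversing time on \<open>{0..r}\<close> maps \<open>X s\<close> to \<open>X r - X (r - s)\<close> and leaves
  \<open>X r\<close> unchanged; a substitution in the integral then gives the right-hand side. The reversed path is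
  left-continuous where the original one is right-continuous, but this concerns only countably many times.\<close>
lemma levy_reversed_exp_integral:
  assumes levy: "levy_process M X" and r: "0 \<le> r"
  shows "distr M (borel \<Otimes>\<^sub>M borel) (\<lambda>\<omega>. (X r \<omega>, LBINT s:{0..r}. exp (- X s \<omega>))) =
    distr M (borel \<Otimes>\<^sub>M borel) (\<lambda>\<omega>. (X r \<omega>, LBINT s:{0..r}. exp (X s \<omega> - X r \<omega>)))"
proof -
  note L = levy_processD[OF levy]
  let ?G = "\<lambda>w. (w r, exp_integral {0..<r} (\<lambda>t\<in>{0..}. - w t))"
  have [measurable]: "exp_integral {0..<r} \<in> borel_measurable path_space" by (rule measurable_exp_integral) simp
  have G: "?G \<in> measurable path_space (borel \<Otimes>\<^sub>M borel)"
  proof (rule measurable_Pair)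
    show "(\<lambda>w. w r) \<in> borel_measurable path_space" using r by (intro measurable_component_singleton) auto
    have "(\<lambda>w. \<lambda>t\<in>{0..}. - w t) \<in> measurable path_space path_space"
      by (intro measurable_restrict borel_measurable_uminus measurable_component_singleton)
    then show "(\<lambda>w. exp_integral {0..<r} (\<lambda>t\<in>{0..}. - w t)) \<in> borel_measurable path_space" by measurable
  qed
  let ?F = "path_map (\<lambda>t. X (min t r))" and ?R = "path_map (\<lambda>t \<omega>. X r \<omega> - X (r - min t r) \<omega>)"
  have F: "?F \<in> measurable M path_space" and R: "?R \<in> measurable M path_space"
    using r by (auto intro!: path_map_measurable borel_measurable_diff L(2))
  have Icc: "(LBINT s:{0..r}. f s) = (LBINT s:{0..<r}. f s)" for f :: "real \<Rightarrow> real"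
    unfolding set_lebesgue_integral_def
    by (rule integral_discrete_difference[of "{r}"]) (auto simp: indicator_def)
  have eF: "?G (?F \<omega>) = (X r \<omega>, LBINT s:{0..r}. exp (- X s \<omega>))" if w: "\<omega> \<in> space M" for \<omega>
  proof -
    have "right_lim (\<lambda>t\<in>{0..}. - ?F \<omega> t) s = - X s \<omega>" if s: "0 \<le> s" "s < r" for s
    proof (rule right_lim_eq)
      have "eventually (\<lambda>t. (\<lambda>t\<in>{0..}. - ?F \<omega> t) t = - X t \<omega>) (at_right s)"
        using s unfolding eventually_at_right_field by (intro exI[of _ r]) (auto simp: path_map_def)
      then show "((\<lambda>t\<in>{0..}. - ?F \<omega> t) \<longlongrightarrow> - X s \<omega>) (at_right s)"
        using tendsto_minus[OF cadlag_right_limit[OF L(4)[OF w] s(1)]] by (simp add: tendsto_cong)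
    qed (use s in auto)
    then have "exp_integral {0..<r} (\<lambda>t\<in>{0..}. - ?F \<omega> t) = (LBINT s:{0..<r}. exp (- X s \<omega>))"
      unfolding exp_integral_def set_lebesgue_integral_def
      by (intro Bochner_Integration.integral_cong) (auto simp: indicator_def)
    then show ?thesis using r by (simp add: Icc path_map_def)
  qed
  have eR: "?G (?R \<omega>) = (X r \<omega>, LBINT s:{0..r}. exp (X s \<omega> - X r \<omega>))" if w: "\<omega> \<in> space M" for \<omega>
  proof -
    note c = L(4)[OF w]
    have [measurable]: "(\<lambda>s. X (max 0 s) \<omega>) \<in> borel_measurable borel" by (rule cadlag_measurable[OF c])
    have [measurable]: "(\<lambda>s. if 0 < s then Lim (at_left s) (\<lambda>t. X t \<omega>) else 0) \<in> borel_measurable borel"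
    proof -
      have "(\<lambda>(s, \<omega>'::unit). if 0 < s then Lim (at_left s) (\<lambda>t. X t \<omega>) else 0) \<in> borel_measurable (borel \<Otimes>\<^sub>M count_space UNIV)"
        using c by (intro cadlag_left_process_measurable[where X="\<lambda>t _. X t \<omega>"]) auto
      from measurable_compose[OF measurable_Pair2'[of "()" "count_space UNIV" borel] this]
      show ?thesis by simp
    qed
    let ?l = "\<lambda>s. if 0 < s then Lim (at_left s) (\<lambda>t. X t \<omega>) else 0"
    have lim: "right_lim (\<lambda>t\<in>{0..}. - ?R \<omega> t) s = ?l (r - s) - X r \<omega>" if s: "0 \<le> s" "s < r" for s
    proof (rule right_lim_eq)
      have "filterlim (\<lambda>t. r - t) (at_left (r - s)) (at_right s)"
        unfolding filterlim_at using s by (auto intro!: tendsto_eq_intros simp: eventually_at_filter)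
      from filterlim_compose[OF cadlag_left_limit[OF c] this] s
      have "((\<lambda>t. X (r - t) \<omega> - X r \<omega>) \<longlongrightarrow> ?l (r - s) - X r \<omega>) (at_right s)"
        by (intro tendsto_intros) auto
      moreover have "eventually (\<lambda>t. (\<lambda>t\<in>{0..}. - ?R \<omega> t) t = X (r - t) \<omega> - X r \<omega>) (at_right s)"
        using s unfolding eventually_at_right_field by (intro exI[of _ r]) (auto simp: path_map_def)
      ultimately show "((\<lambda>t\<in>{0..}. - ?R \<omega> t) \<longlongrightarrow> ?l (r - s) - X r \<omega>) (at_right s)"
        by (simp add: tendsto_cong)
    qed (use s in auto)
    have "exp_integral {0..<r} (\<lambda>t\<in>{0..}. - ?R \<omega> t) = (\<integral>s. indicator {0<..r} (r + (-1) * s) *\<^sub>R exp (?l (r + (-1) * s) - X r \<omega>) \<partial>lborel)"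
      unfolding exp_integral_def set_lebesgue_integral_def
      by (intro Bochner_Integration.integral_cong refl) (auto simp: indicator_def lim)
    also have "\<dots> = (LBINT s:{0<..r}. exp (?l s - X r \<omega>))"
      unfolding set_lebesgue_integral_def
      by (subst lborel_integral_real_affine[where c="-1" and t=r and f="\<lambda>s. indicator {0<..r} s *\<^sub>R exp (?l s - X r \<omega>)"]) auto
    also have "\<dots> = (LBINT s:{0<..r}. exp (X (max 0 s) \<omega> - X r \<omega>))"
      unfolding set_lebesgue_integral_def
    proof (rule integral_cong_AE)
      show "AE s in lborel. indicator {0<..r} s *\<^sub>R exp (?l s - X r \<omega>) = indicator {0<..r} s *\<^sub>R exp (X (max 0 s) \<omega> - X r \<omega>)"
        using cadlag_AE_continuous[OF c] by eventually_elim (auto simp: indicator_def)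
    qed measurable
    also have "\<dots> = (LBINT s:{0..r}. exp (X s \<omega> - X r \<omega>))"
      unfolding set_lebesgue_integral_def
      by (rule integral_discrete_difference[of "{0}"]) (auto simp: indicator_def)
    finally show ?thesis using r L(3)[OF w] by (simp add: path_map_def)
  qed
  have "distr M (borel \<Otimes>\<^sub>M borel) (\<lambda>\<omega>. (X r \<omega>, LBINT s:{0..r}. exp (- X s \<omega>))) =
      distr (distr M path_space ?F) (borel \<Otimes>\<^sub>M borel) ?G"
    unfolding distr_distr[OF G F] by (intro distr_cong refl) (simp only: eF comp_def)
  also have "\<dots> = distr (distr M path_space ?R) (borel \<Otimes>\<^sub>M borel) ?G"
    by (simp only: levy_reversal_law[OF levy r])
  also have "\<dots> = distr M (borel \<Otimes>\<^sub>M borel) (\<lambda>\<omega>. (X r \<omega>, LBINT s:{0..r}. exp (X s \<omega> - X r \<omega>)))"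
    unfolding distr_distr[OF G R] by (intro distr_cong refl) (simp only: eR comp_def)
  finally show ?thesis .
qed

section \<open>Independence of random elements of different spaces\<close>

text \<open>A number and a path have different types, so their independence is expressed by a product law rather than by
  \<open>indep_var\<close>.\<close>
definition independent_pair ::
    "'a measure \<Rightarrow> 'b measure \<Rightarrow> ('a \<Rightarrow> 'b) \<Rightarrow> 'c measure \<Rightarrow> ('a \<Rightarrow> 'c) \<Rightarrow> bool" where
  "independent_pair M A X B Y \<longleftrightarrow> X \<in> measurable M A \<and> Y \<in> measurable M B \<and>
     distr M (A \<Otimes>\<^sub>M B) (\<lambda>\<omega>. (X \<omega>, Y \<omega>)) = distr M A X \<Otimes>\<^sub>M distr M B Y"

lemma (in prob_space) independent_pair_if_indep_var: "indep_var A X B Y \<Longrightarrow> independent_pair M A X B Y"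
  by (simp add: indep_var_distribution_eq independent_pair_def)

lemma (in prob_space) independent_pair_compose:
  assumes XY: "independent_pair M A X B Y" and f: "f \<in> measurable A C" and g: "g \<in> measurable B D"
  shows "independent_pair M C (\<lambda>\<omega>. f (X \<omega>)) D (\<lambda>\<omega>. g (Y \<omega>))"
proof -
  note [measurable] = f g
  have [measurable]: "X \<in> measurable M A" "Y \<in> measurable M B" using XY by (auto simp: independent_pair_def)
  interpret Y: prob_space "distr M B Y" by (rule prob_space_distr) simp
  interpret gY: prob_space "distr (distr M B Y) D g" by (rule Y.prob_space_distr) simp
  have "distr M C (\<lambda>\<omega>. f (X \<omega>)) \<Otimes>\<^sub>M distr M D (\<lambda>\<omega>. g (Y \<omega>)) =
      distr (distr M A X) C f \<Otimes>\<^sub>M distr (distr M B Y) D g"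
    by (simp add: distr_distr comp_def)
  also have "\<dots> = distr (distr M A X \<Otimes>\<^sub>M distr M B Y) (C \<Otimes>\<^sub>M D) (\<lambda>(x, y). (f x, g y))"
    by (rule pair_measure_distr) (auto intro: gY.sigma_finite_measure_axioms)
  also have "\<dots> = distr (distr M (A \<Otimes>\<^sub>M B) (\<lambda>\<omega>. (X \<omega>, Y \<omega>))) (C \<Otimes>\<^sub>M D) (\<lambda>(x, y). (f x, g y))"
    using XY by (simp add: independent_pair_def)
  also have "\<dots> = distr M (C \<Otimes>\<^sub>M D) (\<lambda>\<omega>. (f (X \<omega>), g (Y \<omega>)))"
    by (subst distr_distr) (auto simp: comp_def)
  finally show ?thesis by (simp add: independent_pair_def)
qed

lemma (in prob_space) independent_pair_assoc:
  assumes XYZ: "independent_pair M A X (B \<Otimes>\<^sub>M C) (\<lambda>\<omega>. (Y \<omega>, Z \<omega>))" and YZ: "independent_pair M B Y C Z"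
  shows "independent_pair M (A \<Otimes>\<^sub>M B) (\<lambda>\<omega>. (X \<omega>, Y \<omega>)) C Z"
proof -
  have [measurable]: "X \<in> measurable M A" "Y \<in> measurable M B" "Z \<in> measurable M C"
    using XYZ YZ by (auto simp: independent_pair_def)
  let ?X = "distr M A X" and ?Y = "distr M B Y" and ?Z = "distr M C Z"
  interpret X: prob_space ?X by (rule prob_space_distr) simp
  interpret Y: prob_space ?Y by (rule prob_space_distr) simp
  interpret Z: prob_space ?Z by (rule prob_space_distr) simp
  interpret YZ: pair_prob_space ?Y ?Z ..
  interpret XY: prob_space "distr M (A \<Otimes>\<^sub>M B) (\<lambda>\<omega>. (X \<omega>, Y \<omega>))" by (rule prob_space_distr) measurable
  have d3: "distr M (A \<Otimes>\<^sub>M (B \<Otimes>\<^sub>M C)) (\<lambda>\<omega>. (X \<omega>, Y \<omega>, Z \<omega>)) = ?X \<Otimes>\<^sub>M (?Y \<Otimes>\<^sub>M ?Z)"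
    using XYZ YZ by (simp add: independent_pair_def)
  have d2: "distr M (A \<Otimes>\<^sub>M B) (\<lambda>\<omega>. (X \<omega>, Y \<omega>)) = ?X \<Otimes>\<^sub>M ?Y"
    using independent_pair_compose[OF XYZ measurable_ident_sets[OF refl] measurable_fst]
    by (simp add: independent_pair_def)
  have "distr M (A \<Otimes>\<^sub>M B) (\<lambda>\<omega>. (X \<omega>, Y \<omega>)) \<Otimes>\<^sub>M ?Z = distr M ((A \<Otimes>\<^sub>M B) \<Otimes>\<^sub>M C) (\<lambda>\<omega>. ((X \<omega>, Y \<omega>), Z \<omega>))"
  proof (rule pair_measure_eqI)
    fix E F assume "E \<in> sets (distr M (A \<Otimes>\<^sub>M B) (\<lambda>\<omega>. (X \<omega>, Y \<omega>)))" "F \<in> sets ?Z"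
    then have [measurable]: "E \<in> sets (A \<Otimes>\<^sub>M B)" "F \<in> sets C" by auto
    let ?S = "(\<lambda>(x, y, z). ((x, y), z)) -` (E \<times> F) \<inter> space (A \<Otimes>\<^sub>M (B \<Otimes>\<^sub>M C))"
    have S: "?S \<in> sets (A \<Otimes>\<^sub>M (B \<Otimes>\<^sub>M C))" by measurable
    have "emeasure (distr M ((A \<Otimes>\<^sub>M B) \<Otimes>\<^sub>M C) (\<lambda>\<omega>. ((X \<omega>, Y \<omega>), Z \<omega>))) (E \<times> F) =
        emeasure (distr M (A \<Otimes>\<^sub>M (B \<Otimes>\<^sub>M C)) (\<lambda>\<omega>. (X \<omega>, Y \<omega>, Z \<omega>))) ?S"
      by (subst (1 2) emeasure_distr) (auto intro!: arg_cong[where f="emeasure M"] simp: space_pair_measure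
          measurable_space[OF \<open>X \<in> measurable M A\<close>] measurable_space[OF \<open>Y \<in> measurable M B\<close>]
          measurable_space[OF \<open>Z \<in> measurable M C\<close>])
    also have "\<dots> = (\<integral>\<^sup>+x. emeasure (?Y \<Otimes>\<^sub>M ?Z) (Pair x -` ?S) \<partial>?X)"
      unfolding d3 using S by (intro YZ.emeasure_pair_measure_alt) simp
    also have "\<dots> = (\<integral>\<^sup>+x. emeasure ?Y (Pair x -` E) * emeasure ?Z F \<partial>?X)"
    proof (rule nn_integral_cong)
      fix x assume x: "x \<in> space ?X"
      have "Pair x -` ?S = (Pair x -` E) \<times> F"
        using x sets.sets_into_space[OF \<open>E \<in> sets (A \<Otimes>\<^sub>M B)\<close>] sets.sets_into_space[OF \<open>F \<in> sets C\<close>]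
        by (auto simp: space_pair_measure)
      then show "emeasure (?Y \<Otimes>\<^sub>M ?Z) (Pair x -` ?S) = emeasure ?Y (Pair x -` E) * emeasure ?Z F"
        using sets_Pair1[of E A B x] by (simp add: Z.emeasure_pair_measure_Times)
    qed
    also have "\<dots> = (\<integral>\<^sup>+x. emeasure ?Y (Pair x -` E) \<partial>?X) * emeasure ?Z F"
      by (intro nn_integral_multc Y.measurable_emeasure_Pair) simp
    also have "(\<integral>\<^sup>+x. emeasure ?Y (Pair x -` E) \<partial>?X) = emeasure (distr M (A \<Otimes>\<^sub>M B) (\<lambda>\<omega>. (X \<omega>, Y \<omega>))) E"
      unfolding d2 by (intro Y.emeasure_pair_measure_alt[symmetric]) simp
    finally show "emeasure (distr M (A \<Otimes>\<^sub>M B) (\<lambda>\<omega>. (X \<omega>, Y \<omega>))) E * emeasure ?Z F =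
      emeasure (distr M ((A \<Otimes>\<^sub>M B) \<Otimes>\<^sub>M C) (\<lambda>\<omega>. ((X \<omega>, Y \<omega>), Z \<omega>))) (E \<times> F)" by simp
  qed (auto intro: XY.sigma_finite_measure_axioms Z.sigma_finite_measure_axioms cong: sets_pair_measure_cong)
  then show ?thesis by (simp add: independent_pair_def)
qed

section \<open>The exponential functional of a process drifting to infinity\<close>

lemma diameter_bounded_emeasure:
  fixes S :: "real set"
  assumes "S \<subseteq> {0..}" "\<And>s t. s \<in> S \<Longrightarrow> t \<in> S \<Longrightarrow> t \<le> s + k"
  shows "emeasure lborel S \<le> ennreal k"
proof (cases "S = {}")
  case False
  have bdd: "bdd_below S" using assms(1) by (intro bdd_belowI[of _ 0]) auto
  have "S \<subseteq> {Inf S..Inf S + k}"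
  proof
    fix t assume t: "t \<in> S"
    have "t - k \<le> Inf S" using assms(2)[OF _ t] False by (intro cInf_greatest) (auto simp: algebra_simps)
    with cInf_lower[OF t bdd] show "t \<in> {Inf S..Inf S + k}" by auto
  qed
  then have "emeasure lborel S \<le> emeasure lborel {Inf S..Inf S + k}" by (rule emeasure_mono) simp
  also have "\<dots> \<le> ennreal k" by (cases "0 \<le> k") (auto simp: emeasure_lborel_Icc_eq)
  finally show ?thesis .
qed simp

text \<open>Once the process is more than \<open>1\<close> above its current value for good after \<open>k\<close> further
  units of time, no interval of length \<open>1\<close> can be visited at two such times more than \<open>k\<close> apart.
  As the future is independent of the present and this happens with probability at least \<open>1/2\<close> for some
  \<open>k\<close>, the occupation measure of an interval of length \<open>1\<close> is at most \<open>2 * k\<close>,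
  wherever the interval lies.\<close>
lemma levy_occupation_bound:
  assumes levy: "levy_process M X" and drift: "drifts_to_infinity M X"
  obtains k :: nat where
    "\<And>x. (\<integral>\<^sup>+t\<in>{0..}. emeasure M {\<omega>\<in>space M. x \<le> X t \<omega> \<and> X t \<omega> < x + 1} \<partial>lborel) \<le> ennreal (2 * real k)"
proof -
  note L = levy_processD[OF levy]
  interpret prob_space M by (rule L(1))
  interpret P: pair_sigma_finite lborel M ..
  have jm: "(\<lambda>(s, \<omega>). X (max 0 s) \<omega>) \<in> borel_measurable (borel \<Otimes>\<^sub>M M)"
    by (rule cadlag_process_measurable[OF L(2) L(4)])
  have jmc: "(\<lambda>p. X (max 0 (fst p + c)) (snd p)) \<in> borel_measurable (lborel \<Otimes>\<^sub>M M)" for c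
  proof -
    have "(\<lambda>p. (fst p + c, snd p)) \<in> measurable (lborel \<Otimes>\<^sub>M M) (borel \<Otimes>\<^sub>M M)" by measurable
    from measurable_compose[OF this jm] show ?thesis by (simp only: case_prod_conv)
  qed
  \<comment> \<open>Rational times suffice by right-continuity, and keep the event measurable on the path
    space.\<close>
  define B where "B k = {w\<in>space path_space. \<forall>q\<in>\<rat> \<inter> {real k..}. 1 < w q}" for k
  have B: "B k \<in> sets path_space" for k
  proof -
    have "{w\<in>space path_space. 1 < w q} \<in> sets path_space" if "q \<in> \<rat> \<inter> {real k..}" for q
    proof -
      have "(\<lambda>w. w q) \<in> borel_measurable path_space" using that by (intro measurable_component_singleton) auto
      from measurable_sets[OF this, of "{1<..}"] show ?thesis by (simp add: vimage_def Int_def conj_commute)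
    qed
    then show ?thesis unfolding B_def by (intro sets.sets_Collect_countable_All') (auto simp: countable_rat)
  qed
  define Q where "Q k = path_map X -` B k \<inter> space M" for k
  have pm: "path_map X \<in> measurable M path_space" by (rule path_map_measurable[OF L(2)])
  have Q: "Q k \<in> events" for k unfolding Q_def by (rule measurable_sets[OF pm B])
  have Q_iff: "\<omega> \<in> Q k \<longleftrightarrow> \<omega> \<in> space M \<and> (\<forall>q\<in>\<rat> \<inter> {real k..}. 1 < X q \<omega>)" for \<omega> k
  proof (cases "\<omega> \<in> space M")
    case True
    have "path_map X \<omega> q = X q \<omega>" if "q \<in> {real k..}" for q using that by (simp add: path_map_def)
    with True measurable_space[OF pm True] show ?thesis by (auto simp: Q_def B_def)
  qed (simp add: Q_def)
  have "prob (\<Union>k. Q k) = 1"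
  proof (subst prob_eq_1)
    show "AE \<omega> in M. \<omega> \<in> (\<Union>k. Q k)"
      using drift AE_space unfolding drifts_to_infinity_def
    proof eventually_elim
      case (elim \<omega>)
      from elim(1) obtain N where N: "\<And>t. N \<le> t \<Longrightarrow> 1 < X t \<omega>"
        unfolding filterlim_at_top_dense eventually_at_top_linorder by blast
      obtain k :: nat where "N \<le> real k" using real_arch_simple by blast
      then have "\<omega> \<in> Q k" using N elim(2) by (auto simp: Q_iff)
      then show ?case by blast
    qed
  qed (use Q in auto)
  moreover have "(\<lambda>k. prob (Q k)) \<longlonglongrightarrow> prob (\<Union>k. Q k)"
    using Q by (intro finite_Lim_measure_incseq) (auto simp: incseq_def Q_iff)
  ultimately have "(\<lambda>k. prob (Q k)) \<longlonglongrightarrow> 1" by simp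
  from order_tendstoD(1)[OF this, of "1/2"] obtain k where k: "1/2 < prob (Q k)"
    unfolding eventually_sequentially by auto
  let ?F = "\<lambda>t. path_map (\<lambda>s \<omega>. X (t + s) \<omega> - X t \<omega>)"
  have half: "ennreal (1/2) * emeasure M {\<omega>\<in>space M. x \<le> X t \<omega> \<and> X t \<omega> < x + 1} \<le>
      emeasure M {\<omega>\<in>space M. (x \<le> X t \<omega> \<and> X t \<omega> < x + 1) \<and> ?F t \<omega> \<in> B k}" if t: "0 \<le> t" for t x
  proof -
    have Fm: "?F t \<in> measurable M path_space"
      using t by (intro path_map_measurable borel_measurable_diff L(2)) auto
    have [measurable]: "X t \<in> borel_measurable M" by (rule L(2)[OF t])
    let ?E = "{w\<in>space (PiM {0..t} (\<lambda>_. borel)). w t \<in> {x..<x+1}}"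
    have E: "?E \<in> sets (PiM {0..t} (\<lambda>_. borel :: real measure))"
    proof -
      have "(\<lambda>w. w t) \<in> borel_measurable (PiM {0..t} (\<lambda>_. borel :: real measure))"
        using t by (intro measurable_component_singleton) auto
      from measurable_sets[OF this, of "{x..<x+1}"] show ?thesis by (simp add: vimage_def Int_def conj_commute)
    qed
    have "prob (?F t -` B k \<inter> space M) = measure (distr M path_space (?F t)) (B k)"
      by (rule measure_distr[OF Fm B, symmetric])
    also have "\<dots> = prob (Q k)"
      unfolding levy_shift_law[OF levy t] Q_def by (rule measure_distr[OF pm B])
    finally have pF: "1/2 \<le> prob (?F t -` B k \<inter> space M)" using k by simp
    have e1: "(\<lambda>\<omega>. \<lambda>s\<in>{0..t}. X s \<omega>) -` ?E \<inter> space M = {\<omega>\<in>space M. x \<le> X t \<omega> \<and> X t \<omega> < x + 1}"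
      using t by (auto simp: space_PiM)
    have "prob {\<omega>\<in>space M. (x \<le> X t \<omega> \<and> X t \<omega> < x + 1) \<and> ?F t \<omega> \<in> B k} =
      prob ((\<lambda>\<omega>. ((\<lambda>s\<in>{0..t}. X s \<omega>), ?F t \<omega>)) -` (?E \<times> B k) \<inter> space M)"
      using t by (intro arg_cong[where f=prob]) (auto simp: space_PiM)
    also have "\<dots> = prob {\<omega>\<in>space M. x \<le> X t \<omega> \<and> X t \<omega> < x + 1} * prob (?F t -` B k \<inter> space M)"
      using indep_varD[OF levy_past_future_indep[OF levy t] E B] unfolding e1 .
    finally have "prob {\<omega>\<in>space M. (x \<le> X t \<omega> \<and> X t \<omega> < x + 1) \<and> ?F t \<omega> \<in> B k} =
      prob {\<omega>\<in>space M. x \<le> X t \<omega> \<and> X t \<omega> < x + 1} * prob (?F t -` B k \<inter> space M)" .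
    moreover have "prob {\<omega>\<in>space M. x \<le> X t \<omega> \<and> X t \<omega> < x + 1} * (1/2) \<le>
        prob {\<omega>\<in>space M. x \<le> X t \<omega> \<and> X t \<omega> < x + 1} * prob (?F t -` B k \<inter> space M)"
      using pF by (intro mult_left_mono) auto
    ultimately show ?thesis unfolding emeasure_eq_measure
      by (subst ennreal_mult[symmetric]) (auto simp: mult.commute intro!: ennreal_leI)
  qed
  show ?thesis
  proof (rule that[of k])
    fix x :: real
    let ?A = "\<lambda>t \<omega>. 0 \<le> t \<and> (x \<le> X (max 0 t) \<omega> \<and> X (max 0 t) \<omega> < x + 1) \<and>
      (\<forall>q\<in>\<rat> \<inter> {real k..}. 1 < X (max 0 (t + q)) \<omega> - X (max 0 t) \<omega>)"
    have Am: "{p\<in>space (lborel \<Otimes>\<^sub>M M). ?A (fst p) (snd p)} \<in> sets (lborel \<Otimes>\<^sub>M M)"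
    proof -
      note [measurable] = jmc jmc[of 0, simplified]
      have c: "countable (\<rat> \<inter> {real k..})" by (auto simp: countable_rat)
      have "{p\<in>space (lborel \<Otimes>\<^sub>M M). \<forall>q\<in>\<rat> \<inter> {real k..}. 1 < X (max 0 (fst p + q)) (snd p) - X (max 0 (fst p)) (snd p)} \<in> sets (lborel \<Otimes>\<^sub>M M)"
        by (intro sets.sets_Collect_countable_All' c) measurable
      moreover have "{p\<in>space (lborel \<Otimes>\<^sub>M M). 0 \<le> fst p \<and> x \<le> X (max 0 (fst p)) (snd p) \<and> X (max 0 (fst p)) (snd p) < x + 1} \<in> sets (lborel \<Otimes>\<^sub>M M)"
        by measurable
      ultimately have "{p\<in>space (lborel \<Otimes>\<^sub>M M). \<forall>q\<in>\<rat> \<inter> {real k..}. 1 < X (max 0 (fst p + q)) (snd p) - X (max 0 (fst p)) (snd p)} \<inter>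
          {p\<in>space (lborel \<Otimes>\<^sub>M M). 0 \<le> fst p \<and> x \<le> X (max 0 (fst p)) (snd p) \<and> X (max 0 (fst p)) (snd p) < x + 1} \<in> sets (lborel \<Otimes>\<^sub>M M)"
        by (rule sets.Int)
      also have "{p\<in>space (lborel \<Otimes>\<^sub>M M). \<forall>q\<in>\<rat> \<inter> {real k..}. 1 < X (max 0 (fst p + q)) (snd p) - X (max 0 (fst p)) (snd p)} \<inter>
          {p\<in>space (lborel \<Otimes>\<^sub>M M). 0 \<le> fst p \<and> x \<le> X (max 0 (fst p)) (snd p) \<and> X (max 0 (fst p)) (snd p) < x + 1} =
          {p\<in>space (lborel \<Otimes>\<^sub>M M). ?A (fst p) (snd p)}" by blast
      finally show ?thesis .
    qed
    let ?I = "indicator {p\<in>space (lborel \<Otimes>\<^sub>M M). ?A (fst p) (snd p)} :: _ \<Rightarrow> ennreal"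
    have Im: "?I \<in> borel_measurable (lborel \<Otimes>\<^sub>M M)" using Am by (rule borel_measurable_indicator)
    have path: "(\<integral>\<^sup>+t. ?I (t, \<omega>) \<partial>lborel) \<le> ennreal (real k)" if w: "\<omega> \<in> space M" for \<omega>
    proof -
      have "(\<integral>\<^sup>+t. ?I (t, \<omega>) \<partial>lborel) = (\<integral>\<^sup>+t. indicator {t. ?A t \<omega>} t \<partial>lborel)"
        using w by (intro nn_integral_cong) (auto simp: indicator_def space_pair_measure)
      also have "\<dots> = emeasure lborel {t. ?A t \<omega>}"
      proof (rule nn_integral_indicator)
        have "{t. ?A t \<omega>} = (\<lambda>t. (t, \<omega>)) -` {p\<in>space (lborel \<Otimes>\<^sub>M M). ?A (fst p) (snd p)}"
          using w by (auto simp: space_pair_measure)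
        then show "{t. ?A t \<omega>} \<in> sets lborel" using sets_Pair2[OF Am] by simp
      qed
      also have "\<dots> \<le> ennreal (real k)"
      proof (rule diameter_bounded_emeasure)
        fix s t assume s: "s \<in> {t. ?A t \<omega>}" and t: "t \<in> {t. ?A t \<omega>}"
        show "t \<le> s + real k"
        proof (rule ccontr)
          assume "\<not> t \<le> s + real k"
          then have st: "s + real k < t" by simp
          have "X s \<omega> + 1 \<le> X t \<omega>"
          proof (rule ccontr)
            assume n: "\<not> X s \<omega> + 1 \<le> X t \<omega>"
            have "eventually (\<lambda>r. X r \<omega> < X s \<omega> + 1) (at_right t)"
              using order_tendstoD(2)[OF cadlag_right_limit[OF L(4)[OF w]], of t] t n by simp
            then obtain b where b: "t < b" "\<And>r. t < r \<Longrightarrow> r < b \<Longrightarrow> X r \<omega> < X s \<omega> + 1"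
              unfolding eventually_at_right_field by blast
            have "t - s < b - s" using b by simp
            then obtain q where q: "q \<in> \<rat>" "t - s < q" "q < b - s" using Rats_dense_in_real by blast
            have "real k \<le> q" using q st by simp
            moreover have "max 0 (s + q) = s + q" "max 0 s = s" using s t q by auto
            ultimately have "1 < X (s + q) \<omega> - X s \<omega>" using s q by (metis (mono_tags, lifting) Int_iff atLeast_iff mem_Collect_eq)
            moreover have "X (s + q) \<omega> < X s \<omega> + 1" using q by (intro b) auto
            ultimately show False by simp
          qed
          moreover have "x \<le> X s \<omega>" "X t \<omega> < x + 1" using s t by auto
          ultimately show False by simp
        qed
      qed auto
      finally show ?thesis .
    qed
    have "ennreal (1/2) * (\<integral>\<^sup>+t\<in>{0..}. emeasure M {\<omega>\<in>space M. x \<le> X t \<omega> \<and> X t \<omega> < x + 1} \<partial>lborel) \<le>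
      (\<integral>\<^sup>+t. (\<integral>\<^sup>+\<omega>. ?I (t, \<omega>) \<partial>M) \<partial>lborel)"
    proof (subst nn_integral_cmult[symmetric])
      have "(\<lambda>t. emeasure M {\<omega>\<in>space M. x \<le> X (max 0 t) \<omega> \<and> X (max 0 t) \<omega> < x + 1}) \<in> borel_measurable lborel"
      proof -
        note [measurable] = jmc[of 0, simplified]
        have C: "{p\<in>space (lborel \<Otimes>\<^sub>M M). x \<le> X (max 0 (fst p)) (snd p) \<and> X (max 0 (fst p)) (snd p) < x + 1} \<in> sets (lborel \<Otimes>\<^sub>M M)"
          by measurable
        have "(\<lambda>t. emeasure M (Pair t -` {p\<in>space (lborel \<Otimes>\<^sub>M M). x \<le> X (max 0 (fst p)) (snd p) \<and> X (max 0 (fst p)) (snd p) < x + 1})) \<in> borel_measurable lborel"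
          by (rule measurable_emeasure_Pair[OF C])
        then show ?thesis by (simp add: vimage_def space_pair_measure)
      qed
      moreover have "(\<lambda>t. emeasure M {\<omega>\<in>space M. x \<le> X t \<omega> \<and> X t \<omega> < x + 1} * indicator {0..} t) =
          (\<lambda>t. emeasure M {\<omega>\<in>space M. x \<le> X (max 0 t) \<omega> \<and> X (max 0 t) \<omega> < x + 1} * indicator {0..} t)"
        by (auto simp: fun_eq_iff indicator_def max_absorb2)
      ultimately show "(\<lambda>t. emeasure M {\<omega>\<in>space M. x \<le> X t \<omega> \<and> X t \<omega> < x + 1} * indicator {0..} t) \<in> borel_measurable lborel"
        by simp
      show "(\<integral>\<^sup>+t. ennreal (1/2) * (emeasure M {\<omega>\<in>space M. x \<le> X t \<omega> \<and> X t \<omega> < x + 1} * indicator {0..} t) \<partial>lborel) \<le>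
        (\<integral>\<^sup>+t. (\<integral>\<^sup>+\<omega>. ?I (t, \<omega>) \<partial>M) \<partial>lborel)"
      proof (rule nn_integral_mono)
        fix t :: real
        show "ennreal (1/2) * (emeasure M {\<omega>\<in>space M. x \<le> X t \<omega> \<and> X t \<omega> < x + 1} * indicator {0..} t) \<le> (\<integral>\<^sup>+\<omega>. ?I (t, \<omega>) \<partial>M)"
        proof (cases "0 \<le> t")
          case True
          have Fs: "?F t \<omega> \<in> space path_space" for \<omega> by (auto simp: path_map_def space_PiM)
          have Fq: "?F t \<omega> q = X (max 0 (t + q)) \<omega> - X (max 0 t) \<omega>" if "q \<in> {real k..}" for \<omega> q
            using that True by (simp add: path_map_def max_absorb2)
          have "(\<integral>\<^sup>+\<omega>. ?I (t, \<omega>) \<partial>M) = (\<integral>\<^sup>+\<omega>. indicator (Pair t -` {p\<in>space (lborel \<Otimes>\<^sub>M M). ?A (fst p) (snd p)}) \<omega> \<partial>M)"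
            by (intro nn_integral_cong) (auto simp: indicator_def)
          also have "\<dots> = emeasure M (Pair t -` {p\<in>space (lborel \<Otimes>\<^sub>M M). ?A (fst p) (snd p)})"
            by (rule nn_integral_indicator[OF sets_Pair1[OF Am]])
          also have "Pair t -` {p\<in>space (lborel \<Otimes>\<^sub>M M). ?A (fst p) (snd p)} =
            {\<omega>\<in>space M. (x \<le> X t \<omega> \<and> X t \<omega> < x + 1) \<and> ?F t \<omega> \<in> B k}"
            using True Fs Fq by (auto simp: B_def space_pair_measure max_absorb2)
          finally show ?thesis using half[OF True, of x] True by simp
        qed simp
      qed
    qed
    also have "\<dots> = (\<integral>\<^sup>+\<omega>. (\<integral>\<^sup>+t. ?I (t, \<omega>) \<partial>lborel) \<partial>M)"
      by (rule P.Fubini'[symmetric]) (use Im in \<open>simp add: case_prod_eta\<close>)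
    also have "\<dots> \<le> (\<integral>\<^sup>+\<omega>. ennreal (real k) \<partial>M)" by (intro nn_integral_mono path)
    also have "\<dots> = ennreal (real k)" by (simp add: emeasure_space_1)
    finally have h: "ennreal (1/2) * (\<integral>\<^sup>+t\<in>{0..}. emeasure M {\<omega>\<in>space M. x \<le> X t \<omega> \<and> X t \<omega> < x + 1} \<partial>lborel) \<le> ennreal (real k)" (is "_ * ?J \<le> _") .
    have "ennreal 2 * ennreal (1/2) = 1" by (subst ennreal_mult[symmetric]) auto
    then have "?J = ennreal 2 * (ennreal (1/2) * ?J)" by (simp only: mult.assoc[symmetric] mult_1)
    also have "\<dots> \<le> ennreal 2 * ennreal (real k)" by (intro mult_left_mono h) simp
    finally show "?J \<le> ennreal (2 * real k)" by (simp add: ennreal_mult del: ennreal_numeral)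
  qed
qed

text \<open>Splitting according to the integer part of the value, the expected integral over the times with nonnegative
  value is at most a multiple of the sum of \<open>exp (- j)\<close> by the occupation bound. The times with negative
  value are bounded, as the process drifts to infinity.\<close>
lemma levy_exp_functional_finite:
  assumes levy: "levy_process M X" and drift: "drifts_to_infinity M X"
  shows "AE \<omega> in M. (\<integral>\<^sup>+s\<in>{0..}. ennreal (exp (- X s \<omega>)) \<partial>lborel) < \<infinity>"
proof -
  note L = levy_processD[OF levy]
  interpret prob_space M by (rule L(1))
  interpret P: pair_sigma_finite lborel M ..
  obtain k :: nat where k: "\<And>x. (\<integral>\<^sup>+t\<in>{0..}. emeasure M {\<omega>\<in>space M. x \<le> X t \<omega> \<and> X t \<omega> < x + 1} \<partial>lborel) \<le> ennreal (2 * real k)"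
    using levy_occupation_bound[OF levy drift] by blast
  have jm: "(\<lambda>(s, \<omega>). X (max 0 s) \<omega>) \<in> borel_measurable (borel \<Otimes>\<^sub>M M)"
    by (rule cadlag_process_measurable[OF L(2) L(4)])
  then have [measurable]: "(\<lambda>p. X (max 0 (fst p)) (snd p)) \<in> borel_measurable (lborel \<Otimes>\<^sub>M M)"
    by (simp add: case_prod_beta' cong: measurable_cong_sets sets_pair_measure_cong)
  let ?D = "\<lambda>j p. 0 \<le> fst p \<and> real j \<le> X (max 0 (fst p)) (snd p) \<and> X (max 0 (fst p)) (snd p) < real j + 1"
  let ?E = "\<lambda>j. {p\<in>space (lborel \<Otimes>\<^sub>M M). ?D j p}"
  have E: "?E j \<in> sets (lborel \<Otimes>\<^sub>M M)" for j by measurable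
  define G where "G p = (\<Sum>j. ennreal (exp (- real j)) * indicator (?E j) p)" for p
  have Gm [measurable]: "G \<in> borel_measurable (lborel \<Otimes>\<^sub>M M)" unfolding G_def using E by measurable
  have "(\<integral>\<^sup>+p. G p \<partial>(lborel \<Otimes>\<^sub>M M)) = (\<Sum>j. ennreal (exp (- real j)) * emeasure (lborel \<Otimes>\<^sub>M M) (?E j))"
    unfolding G_def using E by (subst nn_integral_suminf) (auto simp: nn_integral_cmult_indicator)
  also have "\<dots> \<le> (\<Sum>j. ennreal (exp (- real j)) * ennreal (2 * real k))"
  proof (intro suminf_le mult_left_mono)
    fix j
    have "emeasure (lborel \<Otimes>\<^sub>M M) (?E j) = (\<integral>\<^sup>+t. emeasure M (Pair t -` ?E j) \<partial>lborel)"
      by (rule emeasure_pair_measure_alt[OF E])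
    also have "\<dots> = (\<integral>\<^sup>+t\<in>{0..}. emeasure M {\<omega>\<in>space M. real j \<le> X t \<omega> \<and> X t \<omega> < real j + 1} \<partial>lborel)"
    proof (rule nn_integral_cong)
      fix t :: real
      show "emeasure M (Pair t -` ?E j) = emeasure M {\<omega>\<in>space M. real j \<le> X t \<omega> \<and> X t \<omega> < real j + 1} * indicator {0..} t"
      proof (cases "0 \<le> t")
        case True
        then have "Pair t -` ?E j = {\<omega>\<in>space M. real j \<le> X t \<omega> \<and> X t \<omega> < real j + 1}"
          by (auto simp: space_pair_measure max_absorb2)
        then show ?thesis using True by simp
      next
        case False
        then have "Pair t -` ?E j = {}" by auto
        then show ?thesis using False by simp
      qed
    qed
    also have "\<dots> \<le> ennreal (2 * real k)" by (rule k)
    finally show "emeasure (lborel \<Otimes>\<^sub>M M) (?E j) \<le> ennreal (2 * real k)" .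
  qed auto
  also have "\<dots> = ennreal (\<Sum>j. exp (- real j) * (2 * real k))"
  proof -
    have "summable (\<lambda>j. exp (-1 :: real) ^ j)" by (rule summable_geometric) simp
    then have "summable (\<lambda>j. exp (- real j) * (2 * real k))"
      by (intro summable_mult2) (simp add: exp_of_nat_mult[symmetric])
    then show ?thesis by (subst suminf_ennreal2[symmetric]) (auto simp: ennreal_mult)
  qed
  finally have "(\<integral>\<^sup>+p. G p \<partial>(lborel \<Otimes>\<^sub>M M)) < \<infinity>" by (rule order.strict_trans1) simp
  also have "(\<integral>\<^sup>+p. G p \<partial>(lborel \<Otimes>\<^sub>M M)) = (\<integral>\<^sup>+\<omega>. (\<integral>\<^sup>+t. G (t, \<omega>) \<partial>lborel) \<partial>M)"
    by (rule P.nn_integral_snd[OF Gm, symmetric])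
  finally have fin: "AE \<omega> in M. (\<integral>\<^sup>+t. G (t, \<omega>) \<partial>lborel) \<noteq> \<infinity>"
    by (intro nn_integral_PInf_AE) auto
  show ?thesis using fin drift[unfolded drifts_to_infinity_def] AE_space
  proof eventually_elim
    case (elim \<omega>)
    note c = L(4)[OF elim(3)]
    from elim(2) obtain T where T: "\<And>t. T \<le> t \<Longrightarrow> 0 \<le> X t \<omega>"
      unfolding filterlim_at_top eventually_at_top_linorder by blast
    have int: "set_integrable lborel {0..T} (\<lambda>s. exp (- X s \<omega>))"
      by (rule cadlag_exp_integrable[OF cadlag_uminus[OF c]])
    have Gsec: "(\<lambda>t. G (t, \<omega>)) \<in> borel_measurable lborel"
      by (rule measurable_compose[OF measurable_Pair2'[OF elim(3)] Gm])
    have "(\<integral>\<^sup>+s\<in>{0..}. ennreal (exp (- X s \<omega>)) \<partial>lborel) \<le>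
      (\<integral>\<^sup>+t. G (t, \<omega>) + ennreal (indicator {0..T} t *\<^sub>R exp (- X t \<omega>)) \<partial>lborel)"
    proof (rule nn_integral_mono)
      fix s :: real
      show "ennreal (exp (- X s \<omega>)) * indicator {0..} s \<le> G (s, \<omega>) + ennreal (indicator {0..T} s *\<^sub>R exp (- X s \<omega>))"
      proof (cases "0 \<le> s \<and> 0 \<le> X s \<omega>")
        case True
        define j where "j = nat \<lfloor>X s \<omega>\<rfloor>"
        have j: "real j \<le> X s \<omega>" "X s \<omega> < real j + 1" using True unfolding j_def by linarith+
        have "ennreal (exp (- X s \<omega>)) \<le> ennreal (exp (- real j))" using j by (intro ennreal_leI) simp
        also have "\<dots> = (\<Sum>i\<in>{j}. ennreal (exp (- real i)) * indicator (?E i) (s, \<omega>))"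
          using j True elim(3) by (simp add: space_pair_measure max_absorb2)
        also have "\<dots> \<le> G (s, \<omega>)" unfolding G_def by (intro sum_le_suminf) auto
        finally show ?thesis using True by (simp add: add_increasing2)
      next
        case False
        show ?thesis
        proof (cases "0 \<le> s")
          case True
          with False T[of s] have "s \<in> {0..T}" by auto
          then show ?thesis by (simp add: add_increasing)
        qed simp
      qed
    qed
    also have "\<dots> = (\<integral>\<^sup>+t. G (t, \<omega>) \<partial>lborel) + (\<integral>\<^sup>+t. ennreal (indicator {0..T} t *\<^sub>R exp (- X t \<omega>)) \<partial>lborel)"
      using int by (intro nn_integral_add Gsec) (auto simp: set_integrable_def)
    also have "\<dots> < \<infinity>"
      using elim(1) int by (auto simp: set_integrable_def integrable_iff_bounded less_top[symmetric])
    finally show ?case .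
  qed
qed

section \<open>The stationary process driven by a Levy process and its dual\<close>

lemma (in prob_space) independent_pair_sym:
  assumes XY: "independent_pair M A X B Y"
  shows "independent_pair M B Y A X"
proof -
  have [measurable]: "X \<in> measurable M A" "Y \<in> measurable M B" using XY by (auto simp: independent_pair_def)
  interpret X: prob_space "distr M A X" by (rule prob_space_distr) simp
  interpret Y: prob_space "distr M B Y" by (rule prob_space_distr) simp
  interpret YX: pair_sigma_finite "distr M B Y" "distr M A X" ..
  have "distr M B Y \<Otimes>\<^sub>M distr M A X =
      distr (distr M A X \<Otimes>\<^sub>M distr M B Y) (distr M B Y \<Otimes>\<^sub>M distr M A X) (\<lambda>(x, y). (y, x))"
    by (rule YX.distr_pair_swap)
  also have "\<dots> = distr (distr M (A \<Otimes>\<^sub>M B) (\<lambda>\<omega>. (X \<omega>, Y \<omega>))) (B \<Otimes>\<^sub>M A) (\<lambda>(x, y). (y, x))"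
    using XY by (intro distr_cong) (auto simp: independent_pair_def cong: sets_pair_measure_cong)
  also have "\<dots> = distr M (B \<Otimes>\<^sub>M A) (\<lambda>\<omega>. (Y \<omega>, X \<omega>))"
    by (subst distr_distr) (auto simp: comp_def)
  finally show ?thesis by (simp add: independent_pair_def)
qed

lemma exp_integral_eq:
  assumes "\<And>s. s \<in> D \<Longrightarrow> 0 \<le> s \<and> (w \<longlongrightarrow> x s) (at_right s)"
  shows "exp_integral D w = (LBINT s:D. exp (x s))"
  unfolding exp_integral_def set_lebesgue_integral_def
  using assms by (intro Bochner_Integration.integral_cong refl) (auto simp: indicator_def right_lim_eq)

lemma set_integral_Icc_eq_Ico: "(LBINT s:{a..b::real}. f s) = (LBINT s:{a..<b}. f s :: real)"
  unfolding set_lebesgue_integral_def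
  by (rule integral_discrete_difference[of "{b}"]) (auto simp: indicator_def)

lemma set_integral_Icc_eq_Ioc: "(LBINT s:{a..b::real}. f s) = (LBINT s:{a<..b}. f s :: real)"
  unfolding set_lebesgue_integral_def
  by (rule integral_discrete_difference[of "{a}"]) (auto simp: indicator_def)

lemma set_integral_shift: "(LBINT s:{a..b}. f (r + s)) = (LBINT s:{r + a..r + b::real}. f s :: real)"
  unfolding set_lebesgue_integral_def
  by (subst lborel_integral_real_affine[where c=1 and t=r and f="\<lambda>s. indicator {r + a..r + b} s *\<^sub>R f s"])
    (auto intro!: Bochner_Integration.integral_cong simp: indicator_def)

lemma set_integral_shift_atLeast: "(LBINT s:{a..}. f (r + s)) = (LBINT s:{r + a::real..}. f s :: real)"
  unfolding set_lebesgue_integral_def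
  by (subst lborel_integral_real_affine[where c=1 and t=r and f="\<lambda>s. indicator {r + a..} s *\<^sub>R f s"])
    (auto intro!: Bochner_Integration.integral_cong simp: indicator_def)

lemma cadlag_exp_integral_add:
  assumes "cadlag x" "0 \<le> r" "0 \<le> u"
  shows "(LBINT s:{0..r + u}. exp (x s)) = (LBINT s:{0..r}. exp (x s)) + (LBINT s:{r..r + u}. exp (x s))"
proof -
  have i: "set_integrable lborel {0..r + u} (\<lambda>s. exp (x s))" by (rule cadlag_exp_integrable[OF assms(1)])
  have "{0..r + u} = {0..r} \<union> {r<..r + u}" using assms by auto
  then have "(LBINT s:{0..r + u}. exp (x s)) = (LBINT s:{0..r}. exp (x s)) + (LBINT s:{r<..r + u}. exp (x s))"
    using assms by (simp only:) (intro set_integral_Un set_integrable_subset[OF i], auto)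
  then show ?thesis by (simp add: set_integral_Icc_eq_Ioc)
qed

locale levy_dual_pair =
  fixes M :: "'a measure" and \<xi> \<xi>h :: "real \<Rightarrow> 'a \<Rightarrow> real"
  assumes levy: "levy_process M \<xi>"
    and drift: "drifts_to_infinity M \<xi>"
    and dual: "independent_copy_of_minus M \<xi> \<xi>h"

sublocale levy_dual_pair \<subseteq> prob_space M
  by (rule levy_processD(1)[OF levy])

context levy_dual_pair
begin

lemmas L = levy_processD[OF levy]

definition Ih :: "'a \<Rightarrow> real" where
  "Ih \<omega> = I_hat (\<lambda>t. \<xi>h t \<omega>)"

definition E :: "real \<Rightarrow> 'a \<Rightarrow> real" where
  "E t \<omega> = (LBINT s:{0..t}. exp (\<xi> s \<omega>))"

definition V :: "real \<Rightarrow> 'a \<Rightarrow> real" where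
  "V t \<omega> = exp (- \<xi> t \<omega>) * (Ih \<omega> + E t \<omega>)"

definition \<mu> :: "real measure" where
  "\<mu> = distr M borel Ih"

definition future :: "real \<Rightarrow> 'a \<Rightarrow> real \<Rightarrow> real" where
  "future r = path_map (\<lambda>s \<omega>. \<xi> (r + s) \<omega> - \<xi> r \<omega>)"

lemma \<xi>h_cadlag: "\<omega> \<in> space M \<Longrightarrow> cadlag (\<lambda>t. \<xi>h t \<omega>)"
  using dual by (auto simp: independent_copy_of_minus_def)

lemma dual_indep: "indep_var path_space (path_map \<xi>) path_space (path_map \<xi>h)"
  using dual by (auto simp: independent_copy_of_minus_def)

lemma path_\<xi> [measurable]: "path_map \<xi> \<in> measurable M path_space"
  and path_\<xi>h [measurable]: "path_map \<xi>h \<in> measurable M path_space"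
  using dual_indep by (auto dest: indep_var_rv1 indep_var_rv2)

lemma \<xi>h_measurable: "0 \<le> t \<Longrightarrow> \<xi>h t \<in> borel_measurable M"
proof -
  assume t: "0 \<le> t"
  then have "(\<lambda>w. w t) \<in> borel_measurable path_space" by (intro measurable_component_singleton) auto
  from measurable_compose[OF path_\<xi>h this] t show ?thesis by (simp add: path_map_def)
qed

lemma future_measurable: "0 \<le> r \<Longrightarrow> future r \<in> measurable M path_space"
  unfolding future_def by (intro path_map_measurable borel_measurable_diff L(2)) auto

lemma future_law: "0 \<le> r \<Longrightarrow> distr M path_space (future r) = distr M path_space (path_map \<xi>)"
  unfolding future_def by (rule levy_shift_law[OF levy])

lemma Ih_path: "\<omega> \<in> space M \<Longrightarrow> Ih \<omega> = exp_integral {0..} (path_map \<xi>h \<omega>)"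
  unfolding Ih_def I_hat_def by (subst exp_integral_path) (auto intro: \<xi>h_cadlag)

lemma Ih_measurable [measurable]: "Ih \<in> borel_measurable M"
proof -
  have "exp_integral {0..} \<in> borel_measurable path_space" by (rule measurable_exp_integral) simp
  from measurable_compose[OF path_\<xi>h this]
  show ?thesis by (rule measurable_cong[THEN iffD1, rotated]) (simp add: Ih_path)
qed

definition neg_path :: "(real \<Rightarrow> real) \<Rightarrow> real \<Rightarrow> real" where
  "neg_path w = (\<lambda>t\<in>{0..}. - w t)"

lemma neg_path_measurable: "neg_path \<in> measurable path_space path_space"
  unfolding neg_path_def by (intro measurable_restrict borel_measurable_uminus measurable_component_singleton)

lemma neg_path_map: "neg_path (path_map Z \<omega>) = path_map (\<lambda>t \<omega>. - Z t \<omega>) \<omega>"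
  by (auto simp: neg_path_def path_map_def fun_eq_iff)

lemma dual_law: "distr M path_space (path_map \<xi>h) = distr (distr M path_space (path_map \<xi>)) path_space neg_path"
  using dual by (subst distr_distr[OF neg_path_measurable path_\<xi>])
    (auto simp: independent_copy_of_minus_def neg_path_map comp_def intro!: distr_cong)

lemma neg_exp_integral_measurable: "(\<lambda>w. exp_integral {0..} (neg_path w)) \<in> borel_measurable path_space"
  by (rule measurable_compose[OF neg_path_measurable measurable_exp_integral]) simp

lemma \<mu>_eq: "\<mu> = distr (distr M path_space (path_map \<xi>)) borel (\<lambda>w. exp_integral {0..} (neg_path w))"
proof -
  have m: "exp_integral {0..} \<in> borel_measurable path_space" by (rule measurable_exp_integral) simp
  have "\<mu> = distr (distr M path_space (path_map \<xi>h)) borel (exp_integral {0..})"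
    unfolding \<mu>_def by (subst distr_distr[OF m path_\<xi>h]) (auto simp: Ih_path intro!: distr_cong)
  also have "\<dots> = distr (distr M path_space (path_map \<xi>)) borel (\<lambda>w. exp_integral {0..} (neg_path w))"
    unfolding dual_law by (subst distr_distr) (auto simp: comp_def intro!: m neg_path_measurable)
  finally show ?thesis .
qed

lemma AE_exp_neg_finite: "AE \<omega> in M. (\<integral>\<^sup>+s\<in>{0..}. ennreal (exp (- \<xi> s \<omega>)) \<partial>lborel) < \<infinity>"
  by (rule levy_exp_functional_finite[OF levy drift])

lemma AE_dual_exp_finite: "AE \<omega> in M. (\<integral>\<^sup>+s\<in>{0..}. ennreal (exp (\<xi>h s \<omega>)) \<partial>lborel) < \<infinity>"
proof -
  have s: "{w\<in>space path_space. total_exp_integral w < \<infinity>} \<in> sets path_space"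
    using measurable_total_exp_integral by measurable
  have s': "{w\<in>space path_space. total_exp_integral (neg_path w) < \<infinity>} \<in> sets path_space"
    using measurable_compose[OF neg_path_measurable measurable_total_exp_integral] by measurable
  have "AE \<omega> in M. total_exp_integral (neg_path (path_map \<xi> \<omega>)) < \<infinity>"
    using AE_exp_neg_finite AE_space
  proof eventually_elim
    case (elim \<omega>)
    then show ?case unfolding neg_path_map by (subst total_exp_integral_path) (auto intro: cadlag_uminus L(4))
  qed
  then have "AE w in distr M path_space (path_map \<xi>). total_exp_integral (neg_path w) < \<infinity>"
    by (subst AE_distr_iff[OF path_\<xi> s'])
  then have "AE w in distr (distr M path_space (path_map \<xi>)) path_space neg_path. total_exp_integral w < \<infinity>"
    by (subst AE_distr_iff) (use neg_path_measurable s in auto)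
  then have "AE \<omega> in M. total_exp_integral (path_map \<xi>h \<omega>) < \<infinity>"
    unfolding dual_law[symmetric] by (subst (asm) AE_distr_iff[OF path_\<xi>h s])
  then show ?thesis using AE_space
  proof eventually_elim
    case (elim \<omega>)
    then show ?case by (subst (asm) total_exp_integral_path) (auto intro: \<xi>h_cadlag)
  qed
qed

lemma joint_measurable_\<xi>: "(\<lambda>p. \<xi> (max 0 (fst p)) (snd p)) \<in> borel_measurable (borel \<Otimes>\<^sub>M M)"
  using cadlag_process_measurable[of \<xi> M, OF L(2) L(4)] by (simp only: case_prod_beta')

lemma joint_measurable_E: "(\<lambda>p. E (max 0 (fst p)) (snd p)) \<in> borel_measurable (borel \<Otimes>\<^sub>M M)"
proof -
  have "(\<lambda>q. (snd q, snd (fst q))) \<in> measurable ((borel \<Otimes>\<^sub>M M) \<Otimes>\<^sub>M lborel) (borel \<Otimes>\<^sub>M M)" by measurable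
  from measurable_compose[OF this joint_measurable_\<xi>]
  have [measurable]: "(\<lambda>q. \<xi> (max 0 (snd q)) (snd (fst q))) \<in> borel_measurable ((borel \<Otimes>\<^sub>M M) \<Otimes>\<^sub>M lborel)" by simp
  have "(\<lambda>q. (if 0 \<le> snd q \<and> snd q \<le> max 0 (fst (fst q)) then 1 else 0) *\<^sub>R exp (\<xi> (max 0 (snd q)) (snd (fst q)))) \<in> borel_measurable ((borel \<Otimes>\<^sub>M M) \<Otimes>\<^sub>M lborel)"
    by measurable
  then have "(\<lambda>p. \<integral>s. (if 0 \<le> s \<and> s \<le> max 0 (fst p) then 1 else 0) *\<^sub>R exp (\<xi> (max 0 s) (snd p)) \<partial>lborel) \<in> borel_measurable (borel \<Otimes>\<^sub>M M)"
    by (intro lborel.borel_measurable_lebesgue_integral) (simp only: case_prod_beta')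
  also have "(\<lambda>p. \<integral>s. (if 0 \<le> s \<and> s \<le> max 0 (fst p) then 1 else 0) *\<^sub>R exp (\<xi> (max 0 s) (snd p)) \<partial>lborel) = (\<lambda>p. E (max 0 (fst p)) (snd p))"
    unfolding E_def set_lebesgue_integral_def
    by (intro ext Bochner_Integration.integral_cong) (auto simp: indicator_def max_absorb2)
  finally show ?thesis .
qed

lemma joint_measurable_V: "(\<lambda>p. V (max 0 (fst p)) (snd p)) \<in> borel_measurable (borel \<Otimes>\<^sub>M M)"
proof -
  note [measurable] = joint_measurable_E joint_measurable_\<xi>
  show ?thesis unfolding V_def by measurable
qed

lemma V_measurable: "0 \<le> t \<Longrightarrow> V t \<in> borel_measurable M"
  using measurable_compose[OF measurable_Pair1'[of t borel M] joint_measurable_V] by (simp add: max_absorb2)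

lemma V_0: "\<omega> \<in> space M \<Longrightarrow> V 0 \<omega> = Ih \<omega>"
proof -
  assume "\<omega> \<in> space M"
  moreover have "E 0 \<omega> = 0" unfolding E_def set_integral_Icc_eq_Ioc by (simp add: set_lebesgue_integral_def)
  ultimately show ?thesis by (simp add: V_def L(3))
qed

text \<open>The past is summarised by two quantities only, with a sign \<open>c\<close>: for \<open>c = 1\<close> they
  determine \<open>V r\<close> together with \<open>Ih\<close>, and \<open>c = -1\<close> serves the time-reversed picture
  in the computation of its law.\<close>
lemma past_independent_future:
  assumes r: "0 \<le> r"
  shows "independent_pair M (borel \<Otimes>\<^sub>M borel) (\<lambda>\<omega>. (\<xi> r \<omega>, LBINT s:{0..r}. exp (c * \<xi> s \<omega>))) path_space (future r)"
proof -
  let ?g = "\<lambda>w. \<lambda>t\<in>{0..}. c * w (min t r) :: real"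
  let ?P = "\<lambda>\<omega>. \<lambda>s\<in>{0..r}. \<xi> s \<omega>"
  have g: "?g \<in> measurable (PiM {0..r} (\<lambda>_. borel)) path_space"
    using r by (intro measurable_restrict borel_measurable_times borel_measurable_const measurable_component_singleton) auto
  have m: "exp_integral {0..<r} \<in> borel_measurable path_space" by (rule measurable_exp_integral) simp
  have f: "(\<lambda>w. (w r, exp_integral {0..<r} (?g w))) \<in> measurable (PiM {0..r} (\<lambda>_. borel)) (borel \<Otimes>\<^sub>M borel)"
    using r by (intro measurable_Pair measurable_component_singleton measurable_compose[OF g m]) auto
  have "independent_pair M (PiM {0..r} (\<lambda>_. borel)) ?P path_space (future r)"
    unfolding future_def by (rule independent_pair_if_indep_var[OF levy_past_future_indep[OF levy r]])
  from independent_pair_compose[OF this f measurable_ident_sets[OF refl]]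
  have i: "independent_pair M (borel \<Otimes>\<^sub>M borel) (\<lambda>\<omega>. (?P \<omega> r, exp_integral {0..<r} (?g (?P \<omega>)))) path_space (future r)" .
  have e: "(?P \<omega> r, exp_integral {0..<r} (?g (?P \<omega>))) = (\<xi> r \<omega>, LBINT s:{0..r}. exp (c * \<xi> s \<omega>))" if w: "\<omega> \<in> space M" for \<omega>
  proof -
    have "exp_integral {0..<r} (?g (?P \<omega>)) = (LBINT s:{0..<r}. exp (c * \<xi> s \<omega>))"
    proof (rule exp_integral_eq)
      fix s assume s: "s \<in> {0..<r}"
      have "eventually (\<lambda>t. ?g (?P \<omega>) t = c * \<xi> t \<omega>) (at_right s)"
        using s unfolding eventually_at_right_field by (intro exI[of _ r]) auto
      moreover have "((\<lambda>t. c * \<xi> t \<omega>) \<longlongrightarrow> c * \<xi> s \<omega>) (at_right s)"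
        using s by (intro tendsto_intros cadlag_right_limit[OF L(4)[OF w]]) auto
      ultimately have "(?g (?P \<omega>) \<longlongrightarrow> c * \<xi> s \<omega>) (at_right s)" by (rule tendsto_cong[THEN iffD2])
      then show "0 \<le> s \<and> (?g (?P \<omega>) \<longlongrightarrow> c * \<xi> s \<omega>) (at_right s)" using s by simp
    qed
    then show ?thesis using r by (simp add: set_integral_Icc_eq_Ico)
  qed
  have e2: "(\<lambda>\<omega>. ((\<xi> r \<omega>, LBINT s:{0..r}. exp (c * \<xi> s \<omega>)), future r \<omega>)) \<omega> =
      (\<lambda>\<omega>. ((?P \<omega> r, exp_integral {0..<r} (?g (?P \<omega>))), future r \<omega>)) \<omega>" if w: "\<omega> \<in> space M" for \<omega>
    using e[OF w] by simp
  show ?thesis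
    using i unfolding independent_pair_def
    by (simp only: distr_cong[OF refl refl e2] distr_cong[OF refl refl e[symmetric]] measurable_cong[OF e[symmetric]] conj_assoc)
qed

text \<open>The part of \<open>V (r + u)\<close> that is produced after time \<open>r\<close>; it depends only on the
  increments of \<open>\<xi>\<close> after \<open>r\<close>.\<close>
definition W :: "real \<Rightarrow> real \<Rightarrow> 'a \<Rightarrow> real" where
  "W r u \<omega> = exp (- \<xi> (r + u) \<omega>) * (LBINT s:{r..r + u}. exp (\<xi> s \<omega>))"

lemma V_add:
  assumes "0 \<le> r" "0 \<le> u" "\<omega> \<in> space M"
  shows "V (r + u) \<omega> = exp (- (\<xi> (r + u) \<omega> - \<xi> r \<omega>)) * V r \<omega> + W r u \<omega>"
  unfolding V_def E_def W_def cadlag_exp_integral_add[OF L(4)[OF assms(3)] assms(1,2)]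
  by (simp add: exp_diff exp_minus field_simps)

definition path_pair :: "real \<Rightarrow> real \<Rightarrow> (real \<Rightarrow> real) \<Rightarrow> real \<times> real" where
  "path_pair r u w = (w (r + u) - w r, exp (- w (r + u)) * exp_integral {r..r + u} w)"

lemma path_pair_measurable: "0 \<le> r \<Longrightarrow> 0 \<le> u \<Longrightarrow> path_pair r u \<in> measurable path_space (borel \<Otimes>\<^sub>M borel)"
  unfolding path_pair_def
  by (intro measurable_Pair borel_measurable_diff borel_measurable_times measurable_exp_integral
      measurable_compose[OF _ borel_measurable_exp] borel_measurable_uminus measurable_component_singleton) auto

lemma path_pair_\<xi>: "0 \<le> r \<Longrightarrow> 0 \<le> u \<Longrightarrow> \<omega> \<in> space M \<Longrightarrow>
    path_pair r u (path_map \<xi> \<omega>) = (\<xi> (r + u) \<omega> - \<xi> r \<omega>, W r u \<omega>)"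
  unfolding path_pair_def W_def by (subst exp_integral_path) (auto simp: path_map_def intro: L(4))

lemma path_pair_future:
  assumes "0 \<le> r" "0 \<le> u" "\<omega> \<in> space M"
  shows "path_pair 0 u (future r \<omega>) = (\<xi> (r + u) \<omega> - \<xi> r \<omega>, W r u \<omega>)"
proof -
  have "exp_integral {0..0 + u} (future r \<omega>) = (LBINT s:{0..u}. exp (\<xi> (r + s) \<omega> - \<xi> r \<omega>))"
    unfolding future_def
    by (subst exp_integral_path) (simp_all add: cadlag_shift[OF L(4)[OF assms(3)] assms(1)])
  also have "\<dots> = exp (- \<xi> r \<omega>) * (LBINT s:{0..u}. exp (\<xi> (r + s) \<omega>))"
    unfolding set_integral_mult_right[symmetric] by (simp add: exp_diff exp_minus field_simps)
  also have "(LBINT s:{0..u}. exp (\<xi> (r + s) \<omega>)) = (LBINT s:{r..r + u}. exp (\<xi> s \<omega>))"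
    using set_integral_shift[of 0 u "\<lambda>s. exp (\<xi> s \<omega>)" r] by simp
  finally have e: "exp_integral {0..0 + u} (future r \<omega>) = exp (- \<xi> r \<omega>) * (LBINT s:{r..r + u}. exp (\<xi> s \<omega>))" .
  have v: "future r \<omega> (0 + u) = \<xi> (r + u) \<omega> - \<xi> r \<omega>" "future r \<omega> 0 = 0"
    using assms by (auto simp: future_def path_map_def)
  show ?thesis unfolding path_pair_def e v W_def by (simp add: exp_diff exp_minus field_simps)
qed

lemma Ih_independent_\<xi>: "independent_pair M borel Ih path_space (path_map \<xi>)"
proof -
  have m: "exp_integral {0..} \<in> borel_measurable path_space" by (rule measurable_exp_integral) simp
  have "independent_pair M path_space (path_map \<xi>h) path_space (path_map \<xi>)"
    by (rule independent_pair_sym[OF independent_pair_if_indep_var[OF dual_indep]])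
  from independent_pair_compose[OF this m measurable_ident_sets[OF refl]]
  have i: "independent_pair M borel (\<lambda>\<omega>. exp_integral {0..} (path_map \<xi>h \<omega>)) path_space (path_map \<xi>)" .
  have e2: "(\<lambda>\<omega>. (Ih \<omega>, path_map \<xi> \<omega>)) \<omega> = (\<lambda>\<omega>. (exp_integral {0..} (path_map \<xi>h \<omega>), path_map \<xi> \<omega>)) \<omega>" if "\<omega> \<in> space M" for \<omega>
    using Ih_path[OF that] by simp
  show ?thesis
    using i unfolding independent_pair_def
    by (simp only: distr_cong[OF refl refl e2] distr_cong[OF refl refl Ih_path[symmetric]] measurable_cong[OF Ih_path[symmetric]])
qed

lemma independent_pair_cong:
  assumes "\<And>\<omega>. \<omega> \<in> space M \<Longrightarrow> X \<omega> = X' \<omega>" "\<And>\<omega>. \<omega> \<in> space M \<Longrightarrow> Y \<omega> = Y' \<omega>"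
  shows "independent_pair M A X B Y \<longleftrightarrow> independent_pair M A X' B Y'"
proof -
  have p: "(\<lambda>\<omega>. (X \<omega>, Y \<omega>)) \<omega> = (\<lambda>\<omega>. (X' \<omega>, Y' \<omega>)) \<omega>" if "\<omega> \<in> space M" for \<omega> using assms[OF that] by simp
  show ?thesis unfolding independent_pair_def
    by (simp only: distr_cong[OF refl refl p] distr_cong[OF refl refl assms(1)] distr_cong[OF refl refl assms(2)]
        measurable_cong[OF assms(1)] measurable_cong[OF assms(2)])
qed

text \<open>By time reversal \<open>(\<xi> t, V t - exp (- \<xi> t) * Ih)\<close> has the law of the pair of \<open>\<xi>
  t\<close> and \<open>\<integral>\<^sub>0\<^sup>t exp (- \<xi> s) ds\<close>, so that \<open>V t\<close> is distributed
  as this integral plus \<open>exp (- \<xi> t)\<close> times an independent copy of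
  \<open>\<integral>\<^sub>0\<^sup>\<infinity> exp (- \<xi> s) ds\<close>. By the Markov property that sum is again
  distributed as \<open>\<integral>\<^sub>0\<^sup>\<infinity> exp (- \<xi> s) ds\<close>.\<close>
lemma V_law:
  assumes t: "0 \<le> t"
  shows "distr M borel (V t) = \<mu>"
proof -
  let ?h = "\<lambda>(i, x, w). exp (- x) * i + w :: real"
  have h: "?h \<in> borel_measurable (borel \<Otimes>\<^sub>M (borel \<Otimes>\<^sub>M borel))" by measurable
  let ?S = "\<lambda>\<omega>. (\<xi> t \<omega>, LBINT s:{0..t}. exp (- \<xi> s \<omega>))"
  let ?J = "\<lambda>\<omega>. exp_integral {0..} (neg_path (future t \<omega>))"
  have "independent_pair M (borel \<Otimes>\<^sub>M borel) ?S path_space (future t)"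
    using past_independent_future[OF t, of "-1"] by simp
  from independent_pair_compose[OF this measurable_ident_sets[OF refl] neg_exp_integral_measurable]
  have iJ: "independent_pair M borel ?J (borel \<Otimes>\<^sub>M borel) ?S" by (rule independent_pair_sym)
  have J_law: "distr M borel ?J = \<mu>"
    unfolding \<mu>_eq future_law[OF t, symmetric] by (subst distr_distr[OF neg_exp_integral_measurable future_measurable[OF t]]) (simp add: comp_def)
  have iV: "independent_pair M borel Ih (borel \<Otimes>\<^sub>M borel) (\<lambda>\<omega>. path_pair 0 t (path_map \<xi> \<omega>))"
    by (rule independent_pair_compose[OF Ih_independent_\<xi> measurable_ident_sets[OF refl] path_pair_measurable[OF _ t]]) simp
  have pp: "path_pair 0 t (path_map \<xi> \<omega>) = (\<xi> t \<omega>, LBINT s:{0..t}. exp (\<xi> s \<omega> - \<xi> t \<omega>))" if w: "\<omega> \<in> space M" for \<omega>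
  proof -
    have "W 0 t \<omega> = (LBINT s:{0..t}. exp (\<xi> s \<omega> - \<xi> t \<omega>))"
      unfolding W_def set_integral_mult_right[symmetric] by (simp add: exp_diff exp_minus field_simps)
    then show ?thesis by (simp add: path_pair_\<xi>[OF _ t w] L(3)[OF w])
  qed
  have law_eq: "distr M (borel \<Otimes>\<^sub>M borel) (\<lambda>\<omega>. path_pair 0 t (path_map \<xi> \<omega>)) = distr M (borel \<Otimes>\<^sub>M borel) ?S"
    unfolding levy_reversed_exp_integral[OF levy t] by (rule distr_cong[OF refl refl pp])
  have mV: "(\<lambda>\<omega>. (Ih \<omega>, path_pair 0 t (path_map \<xi> \<omega>))) \<in> measurable M (borel \<Otimes>\<^sub>M (borel \<Otimes>\<^sub>M borel))"
    using iV by (auto simp: independent_pair_def intro!: measurable_Pair)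
  have mJ: "(\<lambda>\<omega>. (?J \<omega>, ?S \<omega>)) \<in> measurable M (borel \<Otimes>\<^sub>M (borel \<Otimes>\<^sub>M borel))"
    using iJ by (auto simp: independent_pair_def intro!: measurable_Pair)
  have "distr M borel (V t) = distr M borel (\<lambda>\<omega>. ?h (Ih \<omega>, path_pair 0 t (path_map \<xi> \<omega>)))"
  proof (rule distr_cong[OF refl refl])
    fix \<omega> assume w: "\<omega> \<in> space M"
    show "V t \<omega> = ?h (Ih \<omega>, path_pair 0 t (path_map \<xi> \<omega>))"
      using V_add[OF _ t w, of 0] by (simp add: path_pair_\<xi>[OF _ t w] V_0[OF w])
  qed
  also have "\<dots> = distr (distr M (borel \<Otimes>\<^sub>M (borel \<Otimes>\<^sub>M borel)) (\<lambda>\<omega>. (Ih \<omega>, path_pair 0 t (path_map \<xi> \<omega>)))) borel ?h"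
    by (subst distr_distr[OF h mV]) (simp add: comp_def)
  also have "\<dots> = distr (\<mu> \<Otimes>\<^sub>M distr M (borel \<Otimes>\<^sub>M borel) ?S) borel ?h"
    using iV by (simp add: independent_pair_def law_eq \<mu>_def)
  also have "\<dots> = distr (distr M (borel \<Otimes>\<^sub>M (borel \<Otimes>\<^sub>M borel)) (\<lambda>\<omega>. (?J \<omega>, ?S \<omega>))) borel ?h"
    using iJ by (simp add: independent_pair_def J_law)
  also have "\<dots> = distr M borel (\<lambda>\<omega>. ?h (?J \<omega>, ?S \<omega>))"
    by (subst distr_distr[OF h mJ]) (simp add: comp_def)
  also have "\<dots> = distr M borel (\<lambda>\<omega>. exp_integral {0..} (neg_path (path_map \<xi> \<omega>)))"
  proof (rule distr_cong_AE[OF refl refl])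
    show "AE \<omega> in M. ?h (?J \<omega>, ?S \<omega>) = exp_integral {0..} (neg_path (path_map \<xi> \<omega>))"
      using AE_exp_neg_finite AE_space
    proof eventually_elim
      case (elim \<omega>)
      note c = L(4)[OF elim(2)]
      have i: "set_integrable lborel {0..} (\<lambda>s. exp (- \<xi> s \<omega>))"
        using elim(1) by (subst cadlag_nn_integral_exp(1)[OF cadlag_uminus[OF c]])
      have "exp_integral {0..} (neg_path (path_map \<xi> \<omega>)) = (LBINT s:{0..}. exp (- \<xi> s \<omega>))"
        unfolding neg_path_map by (rule exp_integral_path) (auto intro: cadlag_uminus c)
      also have "\<dots> = (LBINT s:{0..<t}. exp (- \<xi> s \<omega>)) + (LBINT s:{t..}. exp (- \<xi> s \<omega>))"
      proof -
        have "{0..} = {0..<t} \<union> {t..}" using t by auto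
        then show ?thesis using t
          by (simp only:) (intro set_integral_Un set_integrable_subset[OF i], auto)
      qed
      also have "(LBINT s:{t..}. exp (- \<xi> s \<omega>)) = (LBINT s:{0..}. exp (- \<xi> (t + s) \<omega>))"
        using set_integral_shift_atLeast[of 0 "\<lambda>s. exp (- \<xi> s \<omega>)" t] by simp
      also have "\<dots> = exp (- \<xi> t \<omega>) * (LBINT s:{0..}. exp (- (\<xi> (t + s) \<omega> - \<xi> t \<omega>)))"
        unfolding set_integral_mult_right[symmetric] by (simp add: exp_diff exp_minus field_simps)
      also have "(LBINT s:{0..}. exp (- (\<xi> (t + s) \<omega> - \<xi> t \<omega>))) = ?J \<omega>"
        unfolding future_def neg_path_map
        by (subst exp_integral_path[where X="\<lambda>s \<omega>. - (\<xi> (t + s) \<omega> - \<xi> t \<omega>)" and \<omega>=\<omega>, OF cadlag_uminus[OF cadlag_shift[OF c t]]]) simp_all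
      finally show ?case by (simp add: set_integral_Icc_eq_Ico)
    qed
    show "(\<lambda>\<omega>. ?h (?J \<omega>, ?S \<omega>)) \<in> borel_measurable M" by (rule measurable_compose[OF mJ h])
    show "(\<lambda>\<omega>. exp_integral {0..} (neg_path (path_map \<xi> \<omega>))) \<in> borel_measurable M"
      by (rule measurable_compose[OF path_\<xi> neg_exp_integral_measurable])
  qed
  also have "\<dots> = \<mu>"
    unfolding \<mu>_eq by (subst distr_distr[OF neg_exp_integral_measurable path_\<xi>]) (simp add: comp_def)
  finally show ?thesis .
qed

text \<open>\<open>V r\<close> is a function of \<open>Ih\<close> and of the path up to time \<open>r\<close>, the pair on
  the right is a function of the increments after \<open>r\<close>.\<close>
lemma V_independent_increment:
  assumes r: "0 \<le> r" and u: "0 \<le> u"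
  shows "independent_pair M borel (V r) (borel \<Otimes>\<^sub>M borel) (\<lambda>\<omega>. (\<xi> (r + u) \<omega> - \<xi> r \<omega>, W r u \<omega>))"
    and "distr M (borel \<Otimes>\<^sub>M borel) (\<lambda>\<omega>. (\<xi> (r + u) \<omega> - \<xi> r \<omega>, W r u \<omega>)) =
      distr M (borel \<Otimes>\<^sub>M borel) (\<lambda>\<omega>. (\<xi> u \<omega>, W 0 u \<omega>))"
proof -
  let ?Z = "\<lambda>\<omega>. (\<xi> (r + u) \<omega> - \<xi> r \<omega>, W r u \<omega>)"
  have Z: "?Z \<in> measurable M (borel \<Otimes>\<^sub>M borel)"
    using measurable_compose[OF path_\<xi> path_pair_measurable[OF r u]]
    by (rule measurable_cong[THEN iffD1, rotated]) (simp add: path_pair_\<xi>[OF r u])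
  have "independent_pair M (borel \<Otimes>\<^sub>M borel) (\<lambda>\<omega>. (\<xi> r \<omega>, E r \<omega>)) (borel \<Otimes>\<^sub>M borel) (\<lambda>\<omega>. path_pair 0 u (future r \<omega>))"
    using past_independent_future[OF r, of 1] unfolding E_def mult_1
    by (rule independent_pair_compose[OF _ measurable_ident_sets[OF refl] path_pair_measurable]) (use u in auto)
  then have YZ: "independent_pair M (borel \<Otimes>\<^sub>M borel) (\<lambda>\<omega>. (\<xi> r \<omega>, E r \<omega>)) (borel \<Otimes>\<^sub>M borel) ?Z"
    by (rule independent_pair_cong[THEN iffD1, rotated 2]) (simp_all add: path_pair_future[OF r u])
  have m: "(\<lambda>w. ((w r, exp_integral {0..r} w), path_pair r u w)) \<in> measurable path_space ((borel \<Otimes>\<^sub>M borel) \<Otimes>\<^sub>M (borel \<Otimes>\<^sub>M borel))"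
    using r u by (intro measurable_Pair measurable_exp_integral path_pair_measurable measurable_component_singleton) auto
  have "independent_pair M borel Ih ((borel \<Otimes>\<^sub>M borel) \<Otimes>\<^sub>M (borel \<Otimes>\<^sub>M borel))
      (\<lambda>\<omega>. ((path_map \<xi> \<omega> r, exp_integral {0..r} (path_map \<xi> \<omega>)), path_pair r u (path_map \<xi> \<omega>)))"
    by (rule independent_pair_compose[OF Ih_independent_\<xi> measurable_ident_sets[OF refl] m])
  then have XYZ: "independent_pair M borel Ih ((borel \<Otimes>\<^sub>M borel) \<Otimes>\<^sub>M (borel \<Otimes>\<^sub>M borel)) (\<lambda>\<omega>. ((\<xi> r \<omega>, E r \<omega>), ?Z \<omega>))"
  proof (rule independent_pair_cong[THEN iffD1, rotated 2])
    fix \<omega> assume w: "\<omega> \<in> space M"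
    have "exp_integral {0..r} (path_map \<xi> \<omega>) = E r \<omega>" unfolding E_def by (rule exp_integral_path[where X=\<xi>, OF L(4)[OF w]]) auto
    moreover have "path_map \<xi> \<omega> r = \<xi> r \<omega>" using r by (simp add: path_map_def)
    ultimately show "((path_map \<xi> \<omega> r, exp_integral {0..r} (path_map \<xi> \<omega>)), path_pair r u (path_map \<xi> \<omega>)) = ((\<xi> r \<omega>, E r \<omega>), ?Z \<omega>)"
      by (simp add: path_pair_\<xi>[OF r u w])
  qed simp
  have f: "(\<lambda>(i, x, e). exp (- x) * (i + e)) \<in> borel_measurable (borel \<Otimes>\<^sub>M (borel \<Otimes>\<^sub>M (borel :: real measure)))" by measurable
  from independent_pair_compose[OF independent_pair_assoc[OF XYZ YZ] f measurable_ident_sets[OF refl]]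
  show "independent_pair M borel (V r) (borel \<Otimes>\<^sub>M borel) ?Z" by (simp add: V_def[abs_def])
  have "distr M (borel \<Otimes>\<^sub>M borel) ?Z = distr (distr M path_space (future r)) (borel \<Otimes>\<^sub>M borel) (path_pair 0 u)"
    using u by (subst distr_distr[OF path_pair_measurable future_measurable[OF r]])
      (auto intro!: distr_cong simp: path_pair_future[OF r u])
  also have "\<dots> = distr M (borel \<Otimes>\<^sub>M borel) (\<lambda>\<omega>. (\<xi> u \<omega>, W 0 u \<omega>))"
    unfolding future_law[OF r] using u path_pair_\<xi>[of 0 u]
    by (subst distr_distr[OF path_pair_measurable path_\<xi>]) (auto intro!: distr_cong simp: L(3))
  finally show "distr M (borel \<Otimes>\<^sub>M borel) ?Z = distr M (borel \<Otimes>\<^sub>M borel) (\<lambda>\<omega>. (\<xi> u \<omega>, W 0 u \<omega>))" .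
qed

text \<open>Stationarity in the form needed for covariances: \<open>V (r + u)\<close> is a function of \<open>V r\<close>,
  which has the law of \<open>Ih = V 0\<close>, and of an independent pair whose law does not depend on
  \<open>r\<close>.\<close>
lemma V_pair_law:
  assumes r: "0 \<le> r" and u: "0 \<le> u"
  shows "distr M (borel \<Otimes>\<^sub>M borel) (\<lambda>\<omega>. (V r \<omega>, V (r + u) \<omega>)) = distr M (borel \<Otimes>\<^sub>M borel) (\<lambda>\<omega>. (Ih \<omega>, V u \<omega>))"
proof -
  let ?h = "\<lambda>(v, x, w). (v, exp (- x) * v + w) :: real \<times> real"
  have h: "?h \<in> measurable (borel \<Otimes>\<^sub>M (borel \<Otimes>\<^sub>M borel)) (borel \<Otimes>\<^sub>M borel)" by measurable
  have gen: "distr M (borel \<Otimes>\<^sub>M borel) (\<lambda>\<omega>. (V r \<omega>, V (r + u) \<omega>)) =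
      distr (\<mu> \<Otimes>\<^sub>M distr M (borel \<Otimes>\<^sub>M borel) (\<lambda>\<omega>. (\<xi> u \<omega>, W 0 u \<omega>))) (borel \<Otimes>\<^sub>M borel) ?h" if r: "0 \<le> r" for r
  proof -
    note i = V_independent_increment[OF r u]
    let ?Z = "\<lambda>\<omega>. (\<xi> (r + u) \<omega> - \<xi> r \<omega>, W r u \<omega>)"
    have m: "(\<lambda>\<omega>. (V r \<omega>, ?Z \<omega>)) \<in> measurable M (borel \<Otimes>\<^sub>M (borel \<Otimes>\<^sub>M borel))"
      using i(1) by (auto simp: independent_pair_def intro!: measurable_Pair)
    have "distr M (borel \<Otimes>\<^sub>M borel) (\<lambda>\<omega>. (V r \<omega>, V (r + u) \<omega>)) = distr M (borel \<Otimes>\<^sub>M borel) (\<lambda>\<omega>. ?h (V r \<omega>, ?Z \<omega>))"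
      by (rule distr_cong[OF refl refl]) (simp add: V_add[OF r u])
    also have "\<dots> = distr (distr M (borel \<Otimes>\<^sub>M (borel \<Otimes>\<^sub>M borel)) (\<lambda>\<omega>. (V r \<omega>, ?Z \<omega>))) (borel \<Otimes>\<^sub>M borel) ?h"
      by (subst distr_distr[OF h m]) (simp add: comp_def)
    also have "\<dots> = distr (\<mu> \<Otimes>\<^sub>M distr M (borel \<Otimes>\<^sub>M borel) (\<lambda>\<omega>. (\<xi> u \<omega>, W 0 u \<omega>))) (borel \<Otimes>\<^sub>M borel) ?h"
      using i by (simp add: independent_pair_def V_law[OF r])
    finally show ?thesis .
  qed
  have "distr M (borel \<Otimes>\<^sub>M borel) (\<lambda>\<omega>. (Ih \<omega>, V u \<omega>)) = distr M (borel \<Otimes>\<^sub>M borel) (\<lambda>\<omega>. (V 0 \<omega>, V (0 + u) \<omega>))"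
    by (rule distr_cong[OF refl refl]) (simp add: V_0)
  then show ?thesis using gen[OF r] gen[of 0] by simp
qed

end

section \<open>A law of large numbers for the stationary process\<close>

lemma uniform_Icc:
  assumes s: "0 < (s::real)"
  shows "prob_space (uniform_measure lborel {0..s})"
    and "f \<in> borel_measurable borel \<Longrightarrow> (\<integral>r. f r \<partial>uniform_measure lborel {0..s}) = 1 / s * (LBINT r:{0..s}. f r :: real)"
proof -
  show "prob_space (uniform_measure lborel {0..s})"
    using s by (intro prob_space_uniform_measure) (auto simp: emeasure_lborel_Icc_eq)
  assume f: "f \<in> borel_measurable borel"
  have "uniform_measure lborel {0..s} = density lborel (\<lambda>r. ennreal (indicator {0..s} r / s))"
    unfolding uniform_measure_def
  proof (intro density_cong AE_I2)
    fix r :: real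
    show "indicator {0..s} r / emeasure lborel {0..s} = ennreal (indicator {0..s} r / s)"
      using s by (cases "r \<in> {0..s}") (auto simp: emeasure_lborel_Icc_eq divide_ennreal[of 1 s, simplified])
  qed auto
  then have "(\<integral>r. f r \<partial>uniform_measure lborel {0..s}) = (\<integral>r. (indicator {0..s} r / s) *\<^sub>R f r \<partial>lborel)"
    using f s by (simp only:) (subst integral_density, auto)
  also have "\<dots> = 1 / s * (LBINT r:{0..s}. f r)"
    unfolding set_lebesgue_integral_def by (subst integral_mult_right_zero[symmetric]) (auto intro!: Bochner_Integration.integral_cong)
  finally show "(\<integral>r. f r \<partial>uniform_measure lborel {0..s}) = 1 / s * (LBINT r:{0..s}. f r)" .
qed

lemma tendsto_0_ennrealI:
  fixes f :: "'b \<Rightarrow> ennreal"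
  assumes "\<And>e. 0 < e \<Longrightarrow> eventually (\<lambda>x. f x < ennreal e) F"
  shows "(f \<longlongrightarrow> 0) F"
proof (rule order_tendstoI)
  fix a :: ennreal assume a: "0 < a"
  obtain e where e: "0 < e" "ennreal e \<le> a"
  proof (cases a)
    case (real r)
    then show ?thesis using a that[of r] by simp
  next
    case top
    then show ?thesis using that[of 1] by simp
  qed
  show "eventually (\<lambda>x. f x < a) F"
    using assms[OF e(1)] by (rule eventually_mono) (use e in auto)
qed auto

context levy_dual_pair
begin

abbreviation Q :: "real \<Rightarrow> real measure" where
  "Q s \<equiv> uniform_measure lborel {0..s}"

text \<open>The time average over \<open>{0..s}\<close>, written as an expectation so that Fubini and Jensen apply to it
  directly; \<open>max 0 r\<close> keeps the integrand measurable in \<open>r\<close> on the whole line.\<close>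
definition avg :: "(real \<Rightarrow> real) \<Rightarrow> real \<Rightarrow> 'a \<Rightarrow> real" where
  "avg g s \<omega> = (\<integral>r. g (V (max 0 r) \<omega>) \<partial>Q s)"

definition deviation :: "(real \<Rightarrow> real) \<Rightarrow> real \<Rightarrow> ennreal" where
  "deviation g s = (\<integral>\<^sup>+\<omega>. ennreal \<bar>avg g s \<omega> - (\<integral>v. g v \<partial>\<mu>)\<bar> \<partial>M)"

definition mean_ergodic :: "(real \<Rightarrow> real) \<Rightarrow> bool" where
  "mean_ergodic g \<longleftrightarrow> integrable \<mu> g \<and> (deviation g \<longlongrightarrow> 0) at_top"

lemma sets_\<mu> [simp, measurable_cong]: "sets \<mu> = sets borel" and space_\<mu> [simp]: "space \<mu> = UNIV"
  by (auto simp: \<mu>_def)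

lemma prob_space_\<mu>: "prob_space \<mu>"
  unfolding \<mu>_def by (rule prob_space_distr) simp

lemma V_Q_measurable:
  assumes g: "g \<in> borel_measurable borel"
  shows "(\<lambda>p. g (V (max 0 (fst p)) (snd p))) \<in> borel_measurable (Q s \<Otimes>\<^sub>M M)"
proof -
  have "(\<lambda>p. V (max 0 (fst p)) (snd p)) \<in> borel_measurable (Q s \<Otimes>\<^sub>M M)"
    using joint_measurable_V by (simp cong: measurable_cong_sets sets_pair_measure_cong)
  from measurable_compose[OF this g] show ?thesis .
qed

lemma V_section_measurable:
  assumes g: "g \<in> borel_measurable borel" and w: "\<omega> \<in> space M"
  shows "(\<lambda>r. g (V (max 0 r) \<omega>)) \<in> borel_measurable borel"
  using measurable_compose[OF measurable_compose[OF measurable_Pair2'[OF w] joint_measurable_V] g] by simp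

lemma V_max_measurable: "g \<in> borel_measurable borel \<Longrightarrow> (\<lambda>\<omega>. g (V (max 0 r) \<omega>)) \<in> borel_measurable M"
  by (rule measurable_compose[OF V_measurable]) auto

lemma avg_measurable:
  assumes s: "0 < s" and g: "g \<in> borel_measurable borel"
  shows "avg g s \<in> borel_measurable M"
proof -
  interpret Qs: prob_space "Q s" by (rule uniform_Icc[OF s])
  have "(\<lambda>q. (snd q, fst q)) \<in> measurable (M \<Otimes>\<^sub>M Q s) (Q s \<Otimes>\<^sub>M M)" by measurable
  from measurable_compose[OF this V_Q_measurable[OF g]]
  have "(\<lambda>q. g (V (max 0 (snd q)) (fst q))) \<in> borel_measurable (M \<Otimes>\<^sub>M Q s)" by simp
  then show ?thesis unfolding avg_def
    by (intro Qs.borel_measurable_lebesgue_integral) (simp only: case_prod_beta')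
qed

lemma nn_integral_V: "0 \<le> t \<Longrightarrow> k \<in> borel_measurable borel \<Longrightarrow> (\<integral>\<^sup>+\<omega>. k (V t \<omega>) \<partial>M) = (\<integral>\<^sup>+v. k v \<partial>\<mu>)"
  unfolding V_law[symmetric] by (subst nn_integral_distr) (auto intro: V_measurable)

lemma nn_integral_V_Q:
  assumes s: "0 < s" and g: "g \<in> borel_measurable borel"
  shows "(\<integral>\<^sup>+\<omega>. \<integral>\<^sup>+r. ennreal \<bar>g (V (max 0 r) \<omega>)\<bar> \<partial>Q s \<partial>M) = (\<integral>\<^sup>+v. ennreal \<bar>g v\<bar> \<partial>\<mu>)"
proof -
  interpret Qs: prob_space "Q s" by (rule uniform_Icc[OF s])
  interpret P: pair_sigma_finite "Q s" M ..
  have m: "(\<lambda>p. ennreal \<bar>g (V (max 0 (fst p)) (snd p))\<bar>) \<in> borel_measurable (Q s \<Otimes>\<^sub>M M)"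
    using V_Q_measurable[OF g] by measurable
  have "(\<integral>\<^sup>+\<omega>. \<integral>\<^sup>+r. ennreal \<bar>g (V (max 0 r) \<omega>)\<bar> \<partial>Q s \<partial>M) = (\<integral>\<^sup>+r. \<integral>\<^sup>+\<omega>. ennreal \<bar>g (V (max 0 r) \<omega>)\<bar> \<partial>M \<partial>Q s)"
    by (rule P.Fubini') (use m in \<open>simp only: case_prod_beta'\<close>)
  also have "\<dots> = (\<integral>\<^sup>+r. (\<integral>\<^sup>+v. ennreal \<bar>g v\<bar> \<partial>\<mu>) \<partial>Q s)"
    using g by (intro nn_integral_cong nn_integral_V) auto
  finally show ?thesis by (simp only: nn_integral_const Qs.emeasure_space_1 mult_1_right)
qed

lemma AE_integrable_Q:
  fixes g :: "real \<Rightarrow> real"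
  assumes s: "0 < s" and g: "integrable \<mu> g"
  shows "AE \<omega> in M. integrable (Q s) (\<lambda>r. g (V (max 0 r) \<omega>))"
proof -
  interpret Qs: prob_space "Q s" by (rule uniform_Icc[OF s])
  have gm: "g \<in> borel_measurable borel" using g by auto
  have "(\<lambda>q. (snd q, fst q)) \<in> measurable (M \<Otimes>\<^sub>M Q s) (Q s \<Otimes>\<^sub>M M)" by measurable
  from measurable_compose[OF this V_Q_measurable[OF gm]]
  have "(\<lambda>q. ennreal \<bar>g (V (max 0 (snd q)) (fst q))\<bar>) \<in> borel_measurable (M \<Otimes>\<^sub>M Q s)" by simp
  then have m: "(\<lambda>\<omega>. \<integral>\<^sup>+r. ennreal \<bar>g (V (max 0 r) \<omega>)\<bar> \<partial>Q s) \<in> borel_measurable M"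
    by (intro Qs.borel_measurable_nn_integral) (simp only: case_prod_beta')
  have "(\<integral>\<^sup>+\<omega>. \<integral>\<^sup>+r. ennreal \<bar>g (V (max 0 r) \<omega>)\<bar> \<partial>Q s \<partial>M) < \<infinity>"
    unfolding nn_integral_V_Q[OF s gm] using g by (simp add: integrable_iff_bounded)
  then have "AE \<omega> in M. (\<integral>\<^sup>+r. ennreal \<bar>g (V (max 0 r) \<omega>)\<bar> \<partial>Q s) \<noteq> \<infinity>"
    by (intro nn_integral_PInf_AE m) auto
  then show ?thesis using AE_space
  proof eventually_elim
    case (elim \<omega>)
    then show ?case using V_section_measurable[OF gm elim(2)]
      by (auto simp: integrable_iff_bounded less_top[symmetric])
  qed
qed

lemma deviation_triangle:
  assumes s: "0 < s" and f: "integrable \<mu> f" and g: "integrable \<mu> g"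
  shows "deviation g s \<le> deviation f s + 2 * (\<integral>\<^sup>+v. ennreal \<bar>g v - f v\<bar> \<partial>\<mu>)"
proof -
  interpret Qs: prob_space "Q s" by (rule uniform_Icc[OF s])
  have fm: "f \<in> borel_measurable borel" and gm: "g \<in> borel_measurable borel" using f g by auto
  note [measurable] = avg_measurable[OF s fm] avg_measurable[OF s gm]
  let ?D = "\<integral>\<^sup>+v. ennreal \<bar>g v - f v\<bar> \<partial>\<mu>"
  let ?B = "\<lambda>\<omega>. \<integral>\<^sup>+r. ennreal \<bar>g (V (max 0 r) \<omega>) - f (V (max 0 r) \<omega>)\<bar> \<partial>Q s"
  have Bm: "?B \<in> borel_measurable M"
  proof -
    have d: "(\<lambda>v. g v - f v) \<in> borel_measurable borel" using fm gm by measurable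
    have "(\<lambda>q. (snd q, fst q)) \<in> measurable (M \<Otimes>\<^sub>M Q s) (Q s \<Otimes>\<^sub>M M)" by measurable
    from measurable_compose[OF this V_Q_measurable[OF d]]
    have "(\<lambda>q. ennreal \<bar>g (V (max 0 (snd q)) (fst q)) - f (V (max 0 (snd q)) (fst q))\<bar>) \<in> borel_measurable (M \<Otimes>\<^sub>M Q s)" by simp
    then show ?thesis by (intro Qs.borel_measurable_nn_integral) (simp only: case_prod_beta')
  qed
  have D: "ennreal \<bar>(\<integral>v. f v \<partial>\<mu>) - (\<integral>v. g v \<partial>\<mu>)\<bar> \<le> ?D"
  proof -
    have "ennreal \<bar>(\<integral>v. f v \<partial>\<mu>) - (\<integral>v. g v \<partial>\<mu>)\<bar> = ennreal (norm (\<integral>v. g v - f v \<partial>\<mu>))"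
      using f g by (simp add: abs_minus_commute)
    also have "\<dots> \<le> (\<integral>\<^sup>+v. norm (g v - f v) \<partial>\<mu>)" using f g by (intro integral_norm_bound_ennreal) auto
    finally show ?thesis by simp
  qed
  have "deviation g s \<le> (\<integral>\<^sup>+\<omega>. ennreal \<bar>avg f s \<omega> - (\<integral>v. f v \<partial>\<mu>)\<bar> + (?B \<omega> + ?D) \<partial>M)"
    unfolding deviation_def
  proof (rule nn_integral_mono_AE)
    show "AE \<omega> in M. ennreal \<bar>avg g s \<omega> - (\<integral>v. g v \<partial>\<mu>)\<bar> \<le> ennreal \<bar>avg f s \<omega> - (\<integral>v. f v \<partial>\<mu>)\<bar> + (?B \<omega> + ?D)"
      using AE_integrable_Q[OF s f] AE_integrable_Q[OF s g]
    proof eventually_elim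
      case (elim \<omega>)
      have "ennreal \<bar>avg g s \<omega> - avg f s \<omega>\<bar> = ennreal (norm (\<integral>r. g (V (max 0 r) \<omega>) - f (V (max 0 r) \<omega>) \<partial>Q s))"
        using elim by (simp add: avg_def)
      also have "\<dots> \<le> (\<integral>\<^sup>+r. norm (g (V (max 0 r) \<omega>) - f (V (max 0 r) \<omega>)) \<partial>Q s)"
        using elim by (intro integral_norm_bound_ennreal) auto
      finally have 1: "ennreal \<bar>avg g s \<omega> - avg f s \<omega>\<bar> \<le> ?B \<omega>" by simp
      have "ennreal \<bar>avg g s \<omega> - (\<integral>v. g v \<partial>\<mu>)\<bar> \<le>
          ennreal (\<bar>avg f s \<omega> - (\<integral>v. f v \<partial>\<mu>)\<bar> + (\<bar>avg g s \<omega> - avg f s \<omega>\<bar> + \<bar>(\<integral>v. f v \<partial>\<mu>) - (\<integral>v. g v \<partial>\<mu>)\<bar>))"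
        by (intro ennreal_leI) linarith
      also have "\<dots> = ennreal \<bar>avg f s \<omega> - (\<integral>v. f v \<partial>\<mu>)\<bar> + (ennreal \<bar>avg g s \<omega> - avg f s \<omega>\<bar> + ennreal \<bar>(\<integral>v. f v \<partial>\<mu>) - (\<integral>v. g v \<partial>\<mu>)\<bar>)"
        by (simp add: ennreal_plus)
      also have "\<dots> \<le> ennreal \<bar>avg f s \<omega> - (\<integral>v. f v \<partial>\<mu>)\<bar> + (?B \<omega> + ?D)"
        by (intro add_mono order_refl 1 D)
      finally show ?case .
    qed
  qed
  also have "\<dots> = deviation f s + ((\<integral>\<^sup>+\<omega>. ?B \<omega> \<partial>M) + ?D)"
    unfolding deviation_def using Bm by (subst nn_integral_add) (auto simp: nn_integral_add emeasure_space_1)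
  also have "(\<integral>\<^sup>+\<omega>. ?B \<omega> \<partial>M) = ?D"
    using fm gm by (intro nn_integral_V_Q[OF s, of "\<lambda>v. g v - f v"]) measurable
  finally show ?thesis by (simp add: mult_2)
qed

text \<open>By stationarity the deviation is Lipschitz in \<open>g\<close> for the distance in
  \<open>L\<^sup>1(\<mu>)\<close>.\<close>
lemma mean_ergodic_approx:
  assumes g: "integrable \<mu> g" and f: "\<And>n. mean_ergodic (f n)"
    and lim: "(\<lambda>n::nat. \<integral>\<^sup>+v. ennreal \<bar>g v - f n v\<bar> \<partial>\<mu>) \<longlonglongrightarrow> 0"
  shows "mean_ergodic g"
  unfolding mean_ergodic_def
proof (intro conjI g)
  show "(deviation g \<longlongrightarrow> 0) at_top"
  proof (rule tendsto_0_ennrealI)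
    fix e :: real assume e: "0 < e"
    have "eventually (\<lambda>n. (\<integral>\<^sup>+v. ennreal \<bar>g v - f n v\<bar> \<partial>\<mu>) < ennreal (e / 8)) sequentially"
      using order_tendstoD(2)[OF lim, of "ennreal (e / 8)"] e by simp
    then obtain n where n: "(\<integral>\<^sup>+v. ennreal \<bar>g v - f n v\<bar> \<partial>\<mu>) < ennreal (e / 8)"
      unfolding eventually_sequentially by auto
    have "eventually (\<lambda>s. deviation (f n) s < ennreal (e / 2)) at_top"
      using f[of n] e by (intro order_tendstoD(2)) (auto simp: mean_ergodic_def)
    then show "eventually (\<lambda>s. deviation g s < ennreal e) at_top" using eventually_gt_at_top[of 0]
    proof eventually_elim
      case (elim s)
      have "deviation g s \<le> deviation (f n) s + 2 * (\<integral>\<^sup>+v. ennreal \<bar>g v - f n v\<bar> \<partial>\<mu>)"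
        using f[of n] by (intro deviation_triangle elim g) (simp add: mean_ergodic_def)
      also have "\<dots> \<le> ennreal (e / 2) + ennreal 2 * ennreal (e / 8)"
        using elim n by (intro add_mono mult_mono) auto
      also have "\<dots> = ennreal (e / 2 + 2 * (e / 8))" using e by (simp only: ennreal_plus ennreal_mult)
      also have "\<dots> < ennreal e" using e by (simp add: ennreal_less_iff)
      finally show ?case .
    qed
  qed
qed

lemma AE_V_minus_W_tendsto_0: "AE \<omega> in M. ((\<lambda>u. V u \<omega> - W 0 u \<omega>) \<longlongrightarrow> 0) at_top"
  using drift[unfolded drifts_to_infinity_def] AE_space
proof eventually_elim
  case (elim \<omega>)
  have "((\<lambda>u. exp (- \<xi> u \<omega>) * Ih \<omega>) \<longlongrightarrow> 0 * Ih \<omega>) at_top"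
    by (intro tendsto_intros filterlim_compose[OF exp_at_bot] filterlim_compose[OF filterlim_uminus_at_bot_at_top] elim(1))
  moreover have "eventually (\<lambda>u. exp (- \<xi> u \<omega>) * Ih \<omega> = V u \<omega> - W 0 u \<omega>) at_top"
    using eventually_ge_at_top[of 0]
  proof eventually_elim
    case u: (elim u)
    show ?case using V_add[OF _ u elim(2), of 0] by (simp add: V_0[OF elim(2)] L(3)[OF elim(2)])
  qed
  ultimately show ?case by (auto intro: Lim_transform_eventually)
qed

text \<open>As \<open>V u - W 0 u\<close> tends to \<open>0\<close> and \<open>W 0 u\<close> is independent of \<open>V 0
  = Ih\<close>, the process mixes: the covariance of \<open>g (V 0)\<close> and \<open>g (V u)\<close> vanishes in the
  limit.\<close>
lemma Lipschitz_covariance_tendsto_0: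
  assumes g: "g \<in> borel_measurable borel" and C: "\<And>v. \<bar>g v\<bar> \<le> C" and K: "\<And>v w. \<bar>g v - g w\<bar> \<le> K * \<bar>v - w\<bar>"
  defines "h \<equiv> \<lambda>v. g v - (\<integral>v. g v \<partial>\<mu>)"
  shows "((\<lambda>u. expectation (\<lambda>\<omega>. h (Ih \<omega>) * h (V u \<omega>))) \<longlongrightarrow> 0) at_top"
proof -
  interpret \<mu>: prob_space \<mu> by (rule prob_space_\<mu>)
  have hm [measurable]: "h \<in> borel_measurable borel" unfolding h_def using g by measurable
  note [measurable] = g
  have gi: "integrable \<mu> g" using C g by (intro \<mu>.integrable_const_bound[of _ C]) auto
  have m: "\<bar>\<integral>v. g v \<partial>\<mu>\<bar> \<le> C"
  proof -
    have "\<bar>\<integral>v. g v \<partial>\<mu>\<bar> \<le> (\<integral>v. \<bar>g v\<bar> \<partial>\<mu>)" using integral_norm_bound[of \<mu> g] by simp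
    also have "\<dots> \<le> (\<integral>v. C \<partial>\<mu>)" using gi C by (intro integral_mono) auto
    finally show ?thesis using \<mu>.prob_space by simp
  qed
  have hC: "\<bar>h v\<bar> \<le> 2 * C" for v using C[of v] m unfolding h_def by linarith
  have C0: "0 \<le> C" using C[of 0] by linarith
  have Wm: "W 0 u \<in> borel_measurable M" if u: "0 \<le> u" for u
  proof -
    have "(\<lambda>\<omega>. (\<xi> (0 + u) \<omega> - \<xi> 0 \<omega>, W 0 u \<omega>)) \<in> measurable M (borel \<Otimes>\<^sub>M borel)"
      using V_independent_increment(1)[of 0, OF _ u] by (simp add: independent_pair_def)
    from measurable_compose[OF this measurable_snd] show ?thesis by simp
  qed
  have zero: "expectation (\<lambda>\<omega>. h (Ih \<omega>) * h (W 0 u \<omega>)) = 0" if u: "0 \<le> u" for u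
  proof -
    have "independent_pair M borel (\<lambda>\<omega>. h (V 0 \<omega>)) borel (\<lambda>\<omega>. (\<lambda>p. h (snd p)) (\<xi> (0 + u) \<omega> - \<xi> 0 \<omega>, W 0 u \<omega>))"
      by (rule independent_pair_compose[OF V_independent_increment(1)[OF _ u]]) auto
    then have "indep_var borel (\<lambda>\<omega>. h (V 0 \<omega>)) borel (\<lambda>\<omega>. h (W 0 u \<omega>))"
      by (simp add: independent_pair_def indep_var_distribution_eq)
    then have "expectation (\<lambda>\<omega>. h (V 0 \<omega>) * h (W 0 u \<omega>)) = expectation (\<lambda>\<omega>. h (V 0 \<omega>)) * expectation (\<lambda>\<omega>. h (W 0 u \<omega>))"
      using hC by (intro indep_var_lebesgue_integral integrable_const_bound[of _ "2 * C"])
        (auto intro!: measurable_compose[OF V_measurable hm] measurable_compose[OF Wm[OF u] hm])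
    moreover have "expectation (\<lambda>\<omega>. h (V 0 \<omega>)) = (\<integral>v. h v \<partial>\<mu>)"
      using V_measurable[of 0] unfolding V_law[of 0, OF order_refl, symmetric] by (subst integral_distr) auto
    moreover have "(\<integral>v. h v \<partial>\<mu>) = 0" unfolding h_def using gi \<mu>.prob_space by simp
    moreover have "expectation (\<lambda>\<omega>. h (V 0 \<omega>) * h (W 0 u \<omega>)) = expectation (\<lambda>\<omega>. h (Ih \<omega>) * h (W 0 u \<omega>))"
      by (intro Bochner_Integration.integral_cong) (auto simp: V_0)
    ultimately show ?thesis by simp
  qed
  let ?s = "\<lambda>u \<omega>. h (Ih \<omega>) * (h (V (max 0 u) \<omega>) - h (W 0 (max 0 u) \<omega>))"
  have "((\<lambda>u. expectation (?s u)) \<longlongrightarrow> expectation (\<lambda>\<omega>. 0)) at_top"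
  proof (rule integral_dominated_convergence_at_top)
    have "(\<lambda>\<omega>. h (V (max 0 u) \<omega>)) \<in> borel_measurable M" "(\<lambda>\<omega>. h (W 0 (max 0 u) \<omega>)) \<in> borel_measurable M" for u
      by (auto intro!: measurable_compose[OF V_measurable hm] measurable_compose[OF Wm hm])
    then show "?s u \<in> borel_measurable M" for u by measurable
    show "AE \<omega> in M. ((\<lambda>u. ?s u \<omega>) \<longlongrightarrow> 0) at_top"
      using AE_V_minus_W_tendsto_0
    proof eventually_elim
      case (elim \<omega>)
      have "((\<lambda>u. 2 * C * (K * \<bar>V u \<omega> - W 0 u \<omega>\<bar>)) \<longlongrightarrow> 2 * C * (K * \<bar>0\<bar>)) at_top"
        by (intro tendsto_intros elim)
      then have lim: "((\<lambda>u. 2 * C * (K * \<bar>V u \<omega> - W 0 u \<omega>\<bar>)) \<longlongrightarrow> 0) at_top" by simp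
      show ?case
      proof (rule Lim_null_comparison[OF _ lim])
        show "eventually (\<lambda>u. norm (?s u \<omega>) \<le> 2 * C * (K * \<bar>V u \<omega> - W 0 u \<omega>\<bar>)) at_top"
          using eventually_ge_at_top[of 0]
        proof eventually_elim
          case (elim u)
          have "norm (?s u \<omega>) = \<bar>h (Ih \<omega>)\<bar> * \<bar>g (V u \<omega>) - g (W 0 u \<omega>)\<bar>"
            using elim by (simp add: abs_mult h_def max_absorb2)
          also have "\<dots> \<le> 2 * C * (K * \<bar>V u \<omega> - W 0 u \<omega>\<bar>)" using C0 by (intro mult_mono hC K) auto
          finally show ?case .
        qed
      qed
    qed
    show "eventually (\<lambda>u. AE \<omega> in M. norm (?s u \<omega>) \<le> 2 * C * (4 * C)) at_top"
    proof (intro always_eventually allI AE_I2)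
      fix u \<omega>
      have "\<bar>h (V (max 0 u) \<omega>) - h (W 0 (max 0 u) \<omega>)\<bar> \<le> 4 * C"
        using hC[of "V (max 0 u) \<omega>"] hC[of "W 0 (max 0 u) \<omega>"] by linarith
      then show "norm (?s u \<omega>) \<le> 2 * C * (4 * C)"
        unfolding real_norm_def abs_mult using C0 by (intro mult_mono hC) auto
    qed
  qed auto
  then have lim: "((\<lambda>u. expectation (?s u)) \<longlongrightarrow> 0) at_top" by simp
  have ev: "eventually (\<lambda>u. expectation (?s u) = expectation (\<lambda>\<omega>. h (Ih \<omega>) * h (V u \<omega>))) at_top"
    using eventually_ge_at_top[of 0]
  proof eventually_elim
    case (elim u)
    have i: "integrable M (\<lambda>\<omega>. h (Ih \<omega>) * h (Z \<omega>))" if "Z \<in> borel_measurable M" for Z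
    proof (rule integrable_const_bound[of _ "2 * C * (2 * C)"])
      show "AE \<omega> in M. norm (h (Ih \<omega>) * h (Z \<omega>)) \<le> 2 * C * (2 * C)"
        unfolding real_norm_def abs_mult using C0 by (intro AE_I2 mult_mono hC) auto
    qed (use that in measurable)
    show ?case
      using elim zero[OF elim] i[OF V_measurable[OF elim]] i[OF Wm[OF elim]]
      by (simp add: max_absorb2 right_diff_distrib)
  qed
  show ?thesis by (rule Lim_transform_eventually[OF lim ev])
qed

text \<open>The second moment of the time average of the centred function is the mean of the covariances \<open>c \<bar>r
  - r'\<bar>\<close> over the square \<open>{0..s}\<times>{0..s}\<close>. The covariances are small at distance at least
  \<open>N\<close>, and the remaining strip has a proportion of at most \<open>2 N / s\<close> of the square.\<close>
lemma Lipschitz_mean_ergodic: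
  assumes g: "g \<in> borel_measurable borel" and C: "\<And>v. \<bar>g v\<bar> \<le> C" and K: "\<And>v w. \<bar>g v - g w\<bar> \<le> K * \<bar>v - w\<bar>"
  shows "mean_ergodic g"
proof -
  interpret \<mu>: prob_space \<mu> by (rule prob_space_\<mu>)
  define h where "h v = g v - (\<integral>v. g v \<partial>\<mu>)" for v
  have hm [measurable]: "h \<in> borel_measurable borel" unfolding h_def using g by measurable
  have gi: "integrable \<mu> g" using C g by (intro \<mu>.integrable_const_bound[of _ C]) auto
  define D where "D = C + \<bar>\<integral>v. g v \<partial>\<mu>\<bar>"
  have hD: "\<bar>h v\<bar> \<le> D" for v using C[of v] unfolding h_def D_def by linarith
  have D0: "0 \<le> D" using hD[of 0] by linarith
  define c where "c u = expectation (\<lambda>\<omega>. h (Ih \<omega>) * h (V u \<omega>))" for u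
  have c: "(c \<longlongrightarrow> 0) at_top"
    using Lipschitz_covariance_tendsto_0[OF assms] unfolding c_def[abs_def] h_def .
  define H where "H r \<omega> = h (V (max 0 r) \<omega>)" for r \<omega>
  have Hm: "H r \<in> borel_measurable M" for r unfolding H_def by (rule V_max_measurable[OF hm])
  have cov: "expectation (\<lambda>\<omega>. H r \<omega> * H r' \<omega>) = c \<bar>r - r'\<bar>" if "0 \<le> r" "0 \<le> r'" for r r'
  proof -
    have le: "expectation (\<lambda>\<omega>. H r \<omega> * H r' \<omega>) = c (r' - r)" if rr: "0 \<le> r" "r \<le> r'" for r r'
    proof -
      have k: "(\<lambda>p. h (fst p) * h (snd p)) \<in> borel_measurable (borel \<Otimes>\<^sub>M borel)" by measurable
      have u: "0 \<le> r' - r" using rr by simp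
      have m1: "(\<lambda>\<omega>. (V r \<omega>, V (r + (r' - r)) \<omega>)) \<in> measurable M (borel \<Otimes>\<^sub>M borel)"
        using rr by (intro measurable_Pair V_measurable) auto
      have m2: "(\<lambda>\<omega>. (Ih \<omega>, V (r' - r) \<omega>)) \<in> measurable M (borel \<Otimes>\<^sub>M borel)"
        using rr by (intro measurable_Pair V_measurable Ih_measurable) auto
      have "expectation (\<lambda>\<omega>. H r \<omega> * H r' \<omega>) = (\<integral>p. h (fst p) * h (snd p) \<partial>distr M (borel \<Otimes>\<^sub>M borel) (\<lambda>\<omega>. (V r \<omega>, V (r + (r' - r)) \<omega>)))"
        unfolding integral_distr[OF m1 k] using rr by (simp add: H_def max_absorb2)
      also have "\<dots> = c (r' - r)"
        unfolding V_pair_law[OF rr(1) u] integral_distr[OF m2 k] by (simp add: c_def)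
      finally show ?thesis .
    qed
    show ?thesis
    proof (cases "r \<le> r'")
      case True
      with le[of r r'] that show ?thesis by (simp add: abs_minus_commute)
    next
      case False
      with le[of r' r] that show ?thesis by (simp add: mult.commute)
    qed
  qed
  have cD: "\<bar>expectation (\<lambda>\<omega>. H r \<omega> * H r' \<omega>)\<bar> \<le> D * D" for r r'
  proof -
    have "norm (H r \<omega> * H r' \<omega>) \<le> D * D" for \<omega>
      unfolding real_norm_def abs_mult H_def using D0 by (intro mult_mono hD) auto
    then have "integrable M (\<lambda>\<omega>. H r \<omega> * H r' \<omega>)" "(\<And>\<omega>. \<bar>H r \<omega> * H r' \<omega>\<bar> \<le> D * D)"
      using Hm[of r] Hm[of r'] by (auto intro!: integrable_const_bound[of _ "D * D"])
    then have le: "expectation (\<lambda>\<omega>. \<bar>H r \<omega> * H r' \<omega>\<bar>) \<le> expectation (\<lambda>_. D * D)"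
      by (intro integral_mono) auto
    have "\<bar>expectation (\<lambda>\<omega>. H r \<omega> * H r' \<omega>)\<bar> \<le> expectation (\<lambda>\<omega>. \<bar>H r \<omega> * H r' \<omega>\<bar>)"
      by (rule integral_abs_bound)
    also note le
    also have "expectation (\<lambda>_. D * D) = D * D" by (simp add: prob_space)
    finally show ?thesis .
  qed
  have second: "expectation (\<lambda>\<omega>. (avg h s \<omega>)\<^sup>2) \<le> e + D * D * (2 * N / s)"
    if s: "0 < s" and N: "0 \<le> N" "\<And>u. N \<le> u \<Longrightarrow> \<bar>c u\<bar> \<le> e" for s e N
  proof -
    interpret Qs: prob_space "Q s" by (rule uniform_Icc[OF s])
    interpret P: pair_prob_space "Q s" M ..
    note am [measurable] = avg_measurable[OF s hm]
    have Hs: "H r \<in> borel_measurable M" "(\<lambda>r. H r \<omega>) \<in> borel_measurable borel" if "\<omega> \<in> space M" for r \<omega>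
      using Hm V_section_measurable[OF hm that] by (auto simp: H_def)
    have Hj [measurable]: "(\<lambda>p. H (fst p) (snd p)) \<in> borel_measurable (Q s \<Otimes>\<^sub>M M)"
      unfolding H_def by (rule V_Q_measurable[OF hm])
    have aD: "\<bar>avg h s \<omega>\<bar> \<le> D" if "\<omega> \<in> space M" for \<omega>
    proof -
      have "\<bar>avg h s \<omega>\<bar> \<le> (\<integral>r. \<bar>H r \<omega>\<bar> \<partial>Q s)"
        unfolding avg_def H_def using integral_norm_bound[of "Q s" "\<lambda>r. h (V (max 0 r) \<omega>)"] by simp
      also have "\<dots> \<le> (\<integral>r. D \<partial>Q s)"
        using Hs(2)[OF that] hD D0 by (intro integral_mono Qs.integrable_const_bound[of _ D]) (auto simp: H_def)
      finally show ?thesis using Qs.prob_space by simp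
    qed
    have bound: "norm (H r \<omega> * avg h s \<omega>) \<le> D * D" if "\<omega> \<in> space M" for r \<omega>
      unfolding real_norm_def abs_mult H_def using D0 aD[OF that] by (intro mult_mono hD) auto
    have boundH: "norm (H r \<omega> * H r' \<omega>) \<le> D * D" for r r' \<omega>
      unfolding real_norm_def abs_mult H_def using D0 by (intro mult_mono hD) auto
    have i1: "integrable (Q s \<Otimes>\<^sub>M M) (\<lambda>p. H (fst p) (snd p) * avg h s (snd p))"
      using bound by (intro P.integrable_const_bound[of _ "D * D"] AE_I2) (auto simp: space_pair_measure)
    have i2: "integrable (Q s \<Otimes>\<^sub>M M) (\<lambda>p. H r (snd p) * H (fst p) (snd p))" for r
      using boundH by (intro P.integrable_const_bound[of _ "D * D"] AE_I2 borel_measurable_times Hj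
          measurable_compose[OF measurable_snd Hm]) auto
    have "expectation (\<lambda>\<omega>. (avg h s \<omega>)\<^sup>2) = expectation (\<lambda>\<omega>. \<integral>r. H r \<omega> * avg h s \<omega> \<partial>Q s)"
      by (intro Bochner_Integration.integral_cong refl) (simp add: avg_def H_def power2_eq_square)
    also have "\<dots> = (\<integral>r. expectation (\<lambda>\<omega>. H r \<omega> * avg h s \<omega>) \<partial>Q s)"
      by (rule P.Fubini_integral) (use i1 in \<open>simp only: case_prod_beta'\<close>)
    also have "\<dots> \<le> (\<integral>r. e + D * D * (2 * N / s) \<partial>Q s)"
    proof (rule integral_mono_AE)
      show "integrable (Q s) (\<lambda>r. expectation (\<lambda>\<omega>. H r \<omega> * avg h s \<omega>))"
        using P.integrable_fst'[OF i1] by simp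
      have "AE r in Q s. r \<in> {0..s}"
        using s by (intro AE_uniform_measureI) (auto simp: emeasure_lborel_Icc_eq)
      then show "AE r in Q s. expectation (\<lambda>\<omega>. H r \<omega> * avg h s \<omega>) \<le> e + D * D * (2 * N / s)"
      proof eventually_elim
        case (elim r)
        have ind: "integrable (Q s) (indicator {r - N..r + N} :: real \<Rightarrow> real)"
          by (rule Qs.integrable_const_bound[of _ 1]) auto
        have "expectation (\<lambda>\<omega>. H r \<omega> * avg h s \<omega>) = expectation (\<lambda>\<omega>. \<integral>r'. H r \<omega> * H r' \<omega> \<partial>Q s)"
          by (intro Bochner_Integration.integral_cong refl) (simp add: avg_def H_def)
        also have "\<dots> = (\<integral>r'. expectation (\<lambda>\<omega>. H r \<omega> * H r' \<omega>) \<partial>Q s)"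
          by (rule P.Fubini_integral) (use i2[of r] in \<open>simp only: case_prod_beta'\<close>)
        also have "\<dots> \<le> (\<integral>r'. e + D * D * indicator {r - N..r + N} r' \<partial>Q s)"
        proof (rule integral_mono_AE)
          show "integrable (Q s) (\<lambda>r'. expectation (\<lambda>\<omega>. H r \<omega> * H r' \<omega>))"
            using P.integrable_fst'[OF i2[of r]] by simp
          show "integrable (Q s) (\<lambda>r'. e + D * D * indicator {r - N..r + N} r')"
            by (intro Bochner_Integration.integrable_add integrable_mult_right Qs.integrable_const ind)
          have e0: "0 \<le> e" using N(2)[of N] by simp
          have "AE r' in Q s. r' \<in> {0..s}"
            using s by (intro AE_uniform_measureI) (auto simp: emeasure_lborel_Icc_eq)
          then show "AE r' in Q s. expectation (\<lambda>\<omega>. H r \<omega> * H r' \<omega>) \<le> e + D * D * indicator {r - N..r + N} r'"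
          proof eventually_elim
            case r': (elim r')
            show ?case
            proof (cases "r' \<in> {r - N..r + N}")
              case True
              then show ?thesis using cD[of r r'] e0 by simp
            next
              case False
              then have "N \<le> \<bar>r - r'\<bar>" by auto
              from N(2)[OF this] False show ?thesis using cov[of r r'] elim r' by simp
            qed
          qed
        qed
        also have "\<dots> = (\<integral>r'. e \<partial>Q s) + (\<integral>r'. D * D * indicator {r - N..r + N} r' \<partial>Q s)"
          by (intro Bochner_Integration.integral_add integrable_mult_right Qs.integrable_const ind)
        also have "(\<integral>r'. e \<partial>Q s) = e" using Qs.prob_space by simp
        also have "(\<integral>r'. D * D * indicator {r - N..r + N} r' \<partial>Q s) = D * D * Qs.prob {r - N..r + N}"
        proof -
          have "(\<integral>r'. indicator {r - N..r + N} r' \<partial>Q s) = Qs.prob ({r - N..r + N} \<inter> space (Q s))"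
            by (rule Bochner_Integration.integral_indicator)
          also have "{r - N..r + N} \<inter> space (Q s) = {r - N..r + N}" by simp
          finally show ?thesis by (simp only: integral_mult_right_zero)
        qed
        also have "e + D * D * Qs.prob {r - N..r + N} \<le> e + D * D * (2 * N / s)"
        proof (intro add_left_mono mult_left_mono)
          have "Qs.prob {r - N..r + N} = measure lborel ({0..s} \<inter> {r - N..r + N}) / measure lborel {0..s}"
            using s by (intro measure_uniform_measure) (auto simp: emeasure_lborel_Icc_eq)
          also have "\<dots> \<le> measure lborel {r - N..r + N} / measure lborel {0..s}"
            by (intro divide_right_mono measure_mono_fmeasurable) (auto intro: fmeasurable_cbox[of "r - N" "r + N", simplified])
          also have "\<dots> = 2 * N / s" using s N by simp
          finally show "Qs.prob {r - N..r + N} \<le> 2 * N / s" .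
        qed (use D0 in auto)
        finally show ?case .
      qed
    qed auto
    also have "\<dots> = e + D * D * (2 * N / s)" using Qs.prob_space by simp
    finally show ?thesis .
  qed
  have dev: "deviation g s = ennreal (expectation (\<lambda>\<omega>. \<bar>avg h s \<omega>\<bar>)) \<and> (expectation (\<lambda>\<omega>. \<bar>avg h s \<omega>\<bar>))\<^sup>2 \<le> expectation (\<lambda>\<omega>. (avg h s \<omega>)\<^sup>2)"
    if s: "0 < s" for s
  proof -
    interpret Qs: prob_space "Q s" by (rule uniform_Icc[OF s])
    note [measurable] = avg_measurable[OF s hm]
    have sec: "(\<lambda>r. g (V (max 0 r) \<omega>)) \<in> borel_measurable borel" "(\<lambda>r. h (V (max 0 r) \<omega>)) \<in> borel_measurable borel" if "\<omega> \<in> space M" for \<omega>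
      using V_section_measurable[OF g that] V_section_measurable[OF hm that] by auto
    have aD: "\<bar>avg h s \<omega>\<bar> \<le> D" if "\<omega> \<in> space M" for \<omega>
    proof -
      have "\<bar>avg h s \<omega>\<bar> \<le> (\<integral>r. \<bar>h (V (max 0 r) \<omega>)\<bar> \<partial>Q s)"
        unfolding avg_def using integral_norm_bound[of "Q s" "\<lambda>r. h (V (max 0 r) \<omega>)"] by simp
      also have "\<dots> \<le> (\<integral>r. D \<partial>Q s)"
        using sec(2)[OF that] hD D0 by (intro integral_mono Qs.integrable_const_bound[of _ D]) auto
      finally show ?thesis using Qs.prob_space by simp
    qed
    have ah: "avg h s \<omega> = avg g s \<omega> - (\<integral>v. g v \<partial>\<mu>)" if "\<omega> \<in> space M" for \<omega>
    proof -
      have "integrable (Q s) (\<lambda>r. g (V (max 0 r) \<omega>))"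
        using sec(1)[OF that] C by (intro Qs.integrable_const_bound[of _ C]) auto
      then show ?thesis unfolding avg_def h_def using Qs.prob_space by simp
    qed
    have i: "integrable M (\<lambda>\<omega>. \<bar>avg h s \<omega>\<bar>)" using aD by (intro integrable_const_bound[of _ D] AE_I2) auto
    have i2: "integrable M (\<lambda>\<omega>. \<bar>avg h s \<omega>\<bar>\<^sup>2)"
    proof (intro integrable_const_bound[of _ "D\<^sup>2"] AE_I2)
      show "norm (\<bar>avg h s \<omega>\<bar>\<^sup>2) \<le> D\<^sup>2" if "\<omega> \<in> space M" for \<omega>
        using power_mono[OF aD[OF that] abs_ge_zero, of 2] by simp
    qed simp
    have "deviation g s = (\<integral>\<^sup>+\<omega>. ennreal \<bar>avg h s \<omega>\<bar> \<partial>M)"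
      unfolding deviation_def by (intro nn_integral_cong) (simp add: ah)
    also have "\<dots> = ennreal (expectation (\<lambda>\<omega>. \<bar>avg h s \<omega>\<bar>))" by (rule nn_integral_eq_integral[OF i]) simp
    finally show ?thesis using variance_positive[of "\<lambda>\<omega>. \<bar>avg h s \<omega>\<bar>"] variance_eq[OF i i2] by simp
  qed
  show ?thesis
    unfolding mean_ergodic_def
  proof (intro conjI gi)
    have small: "eventually (\<lambda>s. deviation g s < ennreal e) at_top" if e: "0 < e" for e :: real
    proof -
      have "eventually (\<lambda>u. \<bar>c u\<bar> < e\<^sup>2 / 2) at_top"
        using tendstoD[OF c, of "e\<^sup>2 / 2"] e by (simp add: dist_real_def)
      then obtain N0 where N0: "\<And>u. N0 \<le> u \<Longrightarrow> \<bar>c u\<bar> < e\<^sup>2 / 2" unfolding eventually_at_top_linorder by blast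
      define N where "N = max 0 N0"
      have N: "0 \<le> N" "\<And>u. N \<le> u \<Longrightarrow> \<bar>c u\<bar> \<le> e\<^sup>2 / 2" using N0 unfolding N_def by (auto intro: less_imp_le)
      have "((\<lambda>s. D * D * (2 * N / s)) \<longlongrightarrow> D * D * 0) at_top"
        by (intro tendsto_intros tendsto_divide_0[OF tendsto_const] filterlim_at_top_imp_at_infinity filterlim_ident)
      then have "eventually (\<lambda>s. D * D * (2 * N / s) < e\<^sup>2 / 2) at_top"
        using e by (intro order_tendstoD(2)) auto
      then show ?thesis using eventually_gt_at_top[of 0]
      proof eventually_elim
        case (elim s)
        have "(expectation (\<lambda>\<omega>. \<bar>avg h s \<omega>\<bar>))\<^sup>2 \<le> expectation (\<lambda>\<omega>. (avg h s \<omega>)\<^sup>2)" using dev[OF elim(2)] by simp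
        also have "\<dots> \<le> e\<^sup>2 / 2 + D * D * (2 * N / s)" by (rule second[OF elim(2) N])
        also have "\<dots> < e\<^sup>2" using elim(1) by simp
        finally have "expectation (\<lambda>\<omega>. \<bar>avg h s \<omega>\<bar>) < e"
          by (rule power_less_imp_less_base) (rule less_imp_le[OF e])
        then show ?case using dev[OF elim(2)] by (simp add: ennreal_less_iff)
      qed
    qed
    show "(deviation g \<longlongrightarrow> 0) at_top" by (rule tendsto_0_ennrealI[OF small])
  qed
qed

lemma mean_ergodic_const: "mean_ergodic (\<lambda>_. c)"
  by (rule Lipschitz_mean_ergodic[of _ "\<bar>c\<bar>" 0]) auto

lemma mean_ergodic_cmult:
  assumes f: "mean_ergodic f"
  shows "mean_ergodic (\<lambda>v. c * f v)"
  unfolding mean_ergodic_def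
proof
  have fi: "integrable \<mu> f" and lim: "(deviation f \<longlongrightarrow> 0) at_top" using f by (auto simp: mean_ergodic_def)
  show "integrable \<mu> (\<lambda>v. c * f v)" using fi by simp
  have fm: "f \<in> borel_measurable borel" using fi by auto
  have ev: "eventually (\<lambda>s. ennreal \<bar>c\<bar> * deviation f s = deviation (\<lambda>v. c * f v) s) at_top"
    using eventually_gt_at_top[of 0]
  proof eventually_elim
    case (elim s)
    note [measurable] = avg_measurable[OF elim fm]
    have "deviation (\<lambda>v. c * f v) s = (\<integral>\<^sup>+\<omega>. ennreal \<bar>c\<bar> * ennreal \<bar>avg f s \<omega> - (\<integral>v. f v \<partial>\<mu>)\<bar> \<partial>M)"
      unfolding deviation_def
    proof (rule nn_integral_cong)
      fix \<omega>
      have e: "avg (\<lambda>v. c * f v) s \<omega> - (\<integral>v. c * f v \<partial>\<mu>) = c * (avg f s \<omega> - (\<integral>v. f v \<partial>\<mu>))"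
        unfolding avg_def by (simp only: integral_mult_right_zero right_diff_distrib)
      show "ennreal \<bar>avg (\<lambda>v. c * f v) s \<omega> - (\<integral>v. c * f v \<partial>\<mu>)\<bar> = ennreal \<bar>c\<bar> * ennreal \<bar>avg f s \<omega> - (\<integral>v. f v \<partial>\<mu>)\<bar>"
        unfolding e abs_mult by (rule ennreal_mult) auto
    qed
    also have "\<dots> = ennreal \<bar>c\<bar> * deviation f s"
      unfolding deviation_def by (intro nn_integral_cmult) measurable
    finally show ?case by simp
  qed
  have "((\<lambda>s. ennreal \<bar>c\<bar> * deviation f s) \<longlongrightarrow> ennreal \<bar>c\<bar> * 0) at_top"
    by (intro ennreal_tendsto_cmult lim) auto
  from Lim_transform_eventually[OF this ev] show "(deviation (\<lambda>v. c * f v) \<longlongrightarrow> 0) at_top" by simp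
qed

lemma mean_ergodic_add:
  assumes f: "mean_ergodic f" and g: "mean_ergodic g"
  shows "mean_ergodic (\<lambda>v. f v + g v)"
  unfolding mean_ergodic_def
proof
  have fi: "integrable \<mu> f" and fl: "(deviation f \<longlongrightarrow> 0) at_top" using f by (auto simp: mean_ergodic_def)
  have gi: "integrable \<mu> g" and gl: "(deviation g \<longlongrightarrow> 0) at_top" using g by (auto simp: mean_ergodic_def)
  show "integrable \<mu> (\<lambda>v. f v + g v)" using fi gi by simp
  have fm: "f \<in> borel_measurable borel" and gm: "g \<in> borel_measurable borel" using fi gi by auto
  have ev: "eventually (\<lambda>s. deviation (\<lambda>v. f v + g v) s \<le> deviation f s + deviation g s) at_top"
    using eventually_gt_at_top[of 0]
  proof eventually_elim
    case (elim s)
    note [measurable] = avg_measurable[OF elim fm] avg_measurable[OF elim gm]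
    have "deviation (\<lambda>v. f v + g v) s \<le> (\<integral>\<^sup>+\<omega>. ennreal \<bar>avg f s \<omega> - (\<integral>v. f v \<partial>\<mu>)\<bar> + ennreal \<bar>avg g s \<omega> - (\<integral>v. g v \<partial>\<mu>)\<bar> \<partial>M)"
      unfolding deviation_def
    proof (rule nn_integral_mono_AE)
      show "AE \<omega> in M. ennreal \<bar>avg (\<lambda>v. f v + g v) s \<omega> - (\<integral>v. f v + g v \<partial>\<mu>)\<bar> \<le>
          ennreal \<bar>avg f s \<omega> - (\<integral>v. f v \<partial>\<mu>)\<bar> + ennreal \<bar>avg g s \<omega> - (\<integral>v. g v \<partial>\<mu>)\<bar>"
        using AE_integrable_Q[OF elim fi] AE_integrable_Q[OF elim gi]
      proof eventually_elim
        case i: (elim \<omega>)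
        have "\<bar>avg (\<lambda>v. f v + g v) s \<omega> - (\<integral>v. f v + g v \<partial>\<mu>)\<bar> \<le> \<bar>avg f s \<omega> - (\<integral>v. f v \<partial>\<mu>)\<bar> + \<bar>avg g s \<omega> - (\<integral>v. g v \<partial>\<mu>)\<bar>"
          using i fi gi by (simp add: avg_def)
        then show ?case by (simp add: ennreal_plus[symmetric] ennreal_leI del: ennreal_plus)
      qed
    qed
    also have "\<dots> = deviation f s + deviation g s"
      unfolding deviation_def by (intro nn_integral_add) measurable
    finally show ?case .
  qed
  have lim: "((\<lambda>s. deviation f s + deviation g s) \<longlongrightarrow> 0 + 0) at_top" by (intro tendsto_add fl gl)
  show "(deviation (\<lambda>v. f v + g v) \<longlongrightarrow> 0) at_top"
    by (rule tendsto_sandwich[OF _ ev tendsto_const]) (use lim in auto)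
qed

lemma clamp_diff_le: "\<bar>max 0 (min 1 x) - max 0 (min 1 y)\<bar> \<le> \<bar>x - y\<bar>" for x y :: real
  by (auto simp: max_def min_def)

text \<open>The indicator is the decreasing limit of piecewise linear functions of slope \<open>- n\<close> on \<open>[x,
  x + 1 / n]\<close>.\<close>
lemma mean_ergodic_atMost: "mean_ergodic (indicator {..x})"
proof -
  interpret \<mu>: prob_space \<mu> by (rule prob_space_\<mu>)
  let ?r = "\<lambda>(n::nat) v. max 0 (min 1 (1 - real n * (v - x)))"
  show ?thesis
  proof (rule mean_ergodic_approx)
    show "integrable \<mu> (indicator {..x} :: real \<Rightarrow> real)" by (intro \<mu>.integrable_const_bound[of _ 1]) auto
    show "mean_ergodic (?r n)" for n
    proof (rule Lipschitz_mean_ergodic[of _ 1 "real n"])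
      show "\<bar>?r n v - ?r n w\<bar> \<le> real n * \<bar>v - w\<bar>" for v w
      proof -
        have "\<bar>?r n v - ?r n w\<bar> \<le> \<bar>(1 - real n * (v - x)) - (1 - real n * (w - x))\<bar>" by (rule clamp_diff_le)
        also have "\<dots> = \<bar>real n * (w - v)\<bar>" by (simp add: algebra_simps)
        also have "\<dots> = real n * \<bar>v - w\<bar>" by (simp add: abs_mult abs_minus_commute)
        finally show ?thesis .
      qed
    qed auto
    have "(\<lambda>n. \<integral>\<^sup>+v. ennreal \<bar>indicator {..x} v - ?r n v\<bar> \<partial>\<mu>) \<longlonglongrightarrow> (\<integral>\<^sup>+v. 0 \<partial>\<mu>)"
    proof (rule nn_integral_dominated_convergence[where w="\<lambda>_. 1"])
      show "AE v in \<mu>. (\<lambda>n. ennreal \<bar>indicator {..x} v - ?r n v\<bar>) \<longlonglongrightarrow> 0"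
      proof (rule AE_I2)
        fix v
        have "eventually (\<lambda>n. ennreal \<bar>indicator {..x} v - ?r n v\<bar> = 0) sequentially"
        proof (cases "v \<le> x")
          case True
          then have "1 \<le> 1 - real n * (v - x)" for n by (simp add: mult_nonneg_nonpos)
          then have "?r n v = 1" for n by simp
          then show ?thesis using True by simp
        next
          case False
          obtain N :: nat where N: "1 / (v - x) \<le> real N" using real_arch_simple by blast
          show ?thesis
            unfolding eventually_sequentially
          proof (intro exI[of _ N] allI impI)
            fix n assume "N \<le> n"
            with N have "1 / (v - x) \<le> real n" by linarith
            then have "1 \<le> real n * (v - x)" using False by (simp add: field_simps)
            then have "?r n v = 0" by simp
            then show "ennreal \<bar>indicator {..x} v - ?r n v\<bar> = 0" using False by simp
          qed
        qed
        then show "(\<lambda>n. ennreal \<bar>indicator {..x} v - ?r n v\<bar>) \<longlonglongrightarrow> 0" by (rule tendsto_eventually)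
      qed
      show "AE v in \<mu>. ennreal \<bar>indicator {..x} v - ?r n v\<bar> \<le> 1" for n
        by (intro AE_I2) (auto simp: indicator_def ennreal_le_1)
    qed (use \<mu>.emeasure_space_1 in auto)
    then show "(\<lambda>n. \<integral>\<^sup>+v. ennreal \<bar>indicator {..x} v - ?r n v\<bar> \<partial>\<mu>) \<longlonglongrightarrow> 0" by simp
  qed
qed

lemma mean_ergodic_indicator:
  assumes "A \<in> sets borel"
  shows "mean_ergodic (indicator A)"
proof -
  interpret \<mu>: prob_space \<mu> by (rule prob_space_\<mu>)
  have G: "Int_stable (range (\<lambda>x::real. {..x}))" "range (\<lambda>x::real. {..x}) \<subseteq> Pow UNIV"
    by (auto simp: Int_stable_def)
  have "A \<in> sigma_sets UNIV (range (\<lambda>x::real. {..x}))"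
    using assms unfolding borel_eq_atMost by simp
  then show ?thesis
  proof (induction rule: sigma_sets_induct_disjoint[OF G, consumes 1, case_names basic empty compl union])
    case (basic A)
    then show ?case using mean_ergodic_atMost by auto
  next
    case empty
    show ?case using mean_ergodic_const[of 0] by (simp add: indicator_def)
  next
    case (compl A)
    have "mean_ergodic (\<lambda>v. 1 + (-1) * indicator A v)" by (intro mean_ergodic_add mean_ergodic_const mean_ergodic_cmult compl)
    also have "(\<lambda>v. 1 + (-1) * indicator A v) = (indicator (UNIV - A) :: real \<Rightarrow> real)" by (auto simp: fun_eq_iff indicator_def)
    finally show ?case .
  next
    case (union A)
    have Ab: "A i \<in> sets borel" for i using union(2) unfolding borel_eq_atMost by auto
    have sum: "mean_ergodic (indicator (\<Union>i<n. A i))" for n :: nat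
    proof (induction n)
      case 0
      show ?case using mean_ergodic_const[of 0] by (simp add: indicator_def)
    next
      case (Suc n)
      have "A i \<inter> A n = {}" if "i < n" for i using disjoint_family_onD[OF union(1), of i n] that by simp
      then have "(\<Union>i<n. A i) \<inter> A n = {}" by blast
      then have "indicator (\<Union>i<Suc n. A i) = (\<lambda>v. indicator (\<Union>i<n. A i) v + indicator (A n) v :: real)"
        by (auto simp: fun_eq_iff indicator_def less_Suc_eq)
      then show ?case using mean_ergodic_add[OF Suc union(3)[of n]] by simp
    qed
    show ?case
    proof (rule mean_ergodic_approx[OF _ sum])
      show "integrable \<mu> (indicator (\<Union>i. A i) :: real \<Rightarrow> real)" using Ab by (intro \<mu>.integrable_const_bound[of _ 1]) auto
      have e: "(\<integral>\<^sup>+v. ennreal \<bar>indicator (\<Union>i. A i) v - indicator (\<Union>i<n. A i) v\<bar> \<partial>\<mu>) = emeasure \<mu> ((\<Union>i. A i) - (\<Union>i<n. A i))" for n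
      proof -
        have "(\<integral>\<^sup>+v. ennreal \<bar>indicator (\<Union>i. A i) v - indicator (\<Union>i<n. A i) v\<bar> \<partial>\<mu>) =
            (\<integral>\<^sup>+v. indicator ((\<Union>i. A i) - (\<Union>i<n. A i)) v \<partial>\<mu>)"
          by (intro nn_integral_cong) (auto simp: indicator_def)
        then show ?thesis using Ab by simp
      qed
      have "(\<lambda>n. emeasure \<mu> ((\<Union>i. A i) - (\<Union>i<n. A i))) \<longlonglongrightarrow> emeasure \<mu> (\<Inter>n. (\<Union>i. A i) - (\<Union>i<n. A i))"
      proof (rule Lim_emeasure_decseq)
        show "range (\<lambda>n. (\<Union>i. A i) - (\<Union>i<n. A i)) \<subseteq> sets \<mu>" using Ab by auto
        show "decseq (\<lambda>n. (\<Union>i. A i) - (\<Union>i<n. A i))"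
          unfolding decseq_def by (intro allI impI Diff_mono order_refl UN_mono) auto
      qed (simp add: \<mu>.emeasure_eq_measure)
      moreover have "(\<Inter>n. (\<Union>i. A i) - (\<Union>i<n. A i)) = {}" by auto
      ultimately have "(\<lambda>n. emeasure \<mu> ((\<Union>i. A i) - (\<Union>i<n. A i))) \<longlonglongrightarrow> emeasure \<mu> {}" by (simp only:)
      then show "(\<lambda>n. \<integral>\<^sup>+v. ennreal \<bar>indicator (\<Union>i. A i) v - indicator (\<Union>i<n. A i) v\<bar> \<partial>\<mu>) \<longlonglongrightarrow> 0"
        by (simp only: e emeasure_empty)
    qed
  qed
qed

text \<open>The class of functions with a mean ergodic theorem is a vector space closed in
  \<open>L\<^sup>1(\<mu>)\<close>, and it contains the indicators of all Borel sets.\<close>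
theorem law_of_large_numbers:
  fixes g :: "real \<Rightarrow> real"
  assumes "integrable \<mu> g"
  shows "mean_ergodic g"
  using assms
proof (induction rule: integrable_induct)
  case (base A c)
  have "mean_ergodic (\<lambda>v. c * indicator A v)" using base by (intro mean_ergodic_cmult mean_ergodic_indicator) auto
  then show ?case by (simp add: mult.commute)
next
  case (add f g)
  then show ?case by (intro mean_ergodic_add)
next
  case (lim f s)
  show ?case
  proof (rule mean_ergodic_approx[OF lim(4) lim(5)])
    have "(\<lambda>n. \<integral>\<^sup>+v. ennreal \<bar>f v - s n v\<bar> \<partial>\<mu>) \<longlonglongrightarrow> (\<integral>\<^sup>+v. 0 \<partial>\<mu>)"
    proof (rule nn_integral_dominated_convergence[where w="\<lambda>v. ennreal (3 * \<bar>f v\<bar>)"])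
      note [measurable] = borel_measurable_integrable[OF lim(1)] borel_measurable_integrable[OF lim(4)]
      show "(\<lambda>v. ennreal \<bar>f v - s n v\<bar>) \<in> borel_measurable \<mu>" for n by measurable
      show "(\<lambda>v. ennreal (3 * \<bar>f v\<bar>)) \<in> borel_measurable \<mu>" by measurable
      have "integrable \<mu> (\<lambda>v. 3 * \<bar>f v\<bar>)" using lim(4) by auto
      then have "(\<integral>\<^sup>+v. ennreal (norm (3 * \<bar>f v\<bar>)) \<partial>\<mu>) < \<infinity>" by (simp only: integrable_iff_bounded)
      moreover have "(\<integral>\<^sup>+v. ennreal (3 * \<bar>f v\<bar>) \<partial>\<mu>) = (\<integral>\<^sup>+v. ennreal (norm (3 * \<bar>f v\<bar>)) \<partial>\<mu>)"
        by (intro nn_integral_cong) simp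
      ultimately show "(\<integral>\<^sup>+v. ennreal (3 * \<bar>f v\<bar>) \<partial>\<mu>) < \<infinity>" by (simp only:)
      show "AE v in \<mu>. ennreal \<bar>f v - s n v\<bar> \<le> ennreal (3 * \<bar>f v\<bar>)" for n
      proof (rule AE_I2)
        fix v assume "v \<in> space \<mu>"
        with lim(3)[of v n] show "ennreal \<bar>f v - s n v\<bar> \<le> ennreal (3 * \<bar>f v\<bar>)" by (intro ennreal_leI) auto
      qed
      show "AE v in \<mu>. (\<lambda>n. ennreal \<bar>f v - s n v\<bar>) \<longlonglongrightarrow> 0"
      proof (rule AE_I2)
        fix v assume "v \<in> space \<mu>"
        then have "(\<lambda>n. ennreal \<bar>f v - s n v\<bar>) \<longlonglongrightarrow> ennreal \<bar>f v - f v\<bar>" by (intro tendsto_intros lim(2)) auto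
        then show "(\<lambda>n. ennreal \<bar>f v - s n v\<bar>) \<longlonglongrightarrow> 0" by simp
      qed
    qed auto
    then show "(\<lambda>n. \<integral>\<^sup>+v. ennreal \<bar>f v - s n v\<bar> \<partial>\<mu>) \<longlonglongrightarrow> 0" by simp
  qed
qed

end

section \<open>Regular variation\<close>

text \<open>This is the uniform convergence theorem for slowly varying functions in additive form. If it failed along
  \<open>x n\<close>, \<open>u n\<close>, then for large \<open>n\<close> the sets of \<open>v \<in> {0..2}\<close> with
  \<open>k (x n + v)\<close> near \<open>k (x n)\<close>, and with \<open>k (x n + u n + v)\<close> near \<open>k (x n + u
  n)\<close>, both have measure above \<open>3/2\<close>. Shifting the second one by \<open>u n\<close> puts both into
  \<open>{0..3}\<close>, so that they meet, and \<open>k (x n + u n)\<close> is near \<open>k (x n)\<close> after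
  all.\<close>
lemma additive_slow_variation_locally_uniform:
  fixes k :: "real \<Rightarrow> real"
  assumes [measurable]: "k \<in> borel_measurable borel"
    and lim: "\<And>u. ((\<lambda>x. k (x + u) - k x) \<longlongrightarrow> 0) at_top" and e: "0 < e"
  shows "\<exists>X. \<forall>x\<ge>X. \<forall>u\<in>{0..1}. \<bar>k (x + u) - k x\<bar> < 2 * e"
proof (rule ccontr)
  assume "\<not> ?thesis"
  then have "\<forall>n::nat. \<exists>x u. real n \<le> x \<and> u \<in> {0..1} \<and> 2 * e \<le> \<bar>k (x + u) - k x\<bar>"
    by (metis linorder_not_less)
  then obtain x u where xu: "\<And>n::nat. real n \<le> x n" "\<And>n. u n \<in> {0..1}" "\<And>n. 2 * e \<le> \<bar>k (x n + u n) - k (x n)\<bar>"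
    by metis
  have large: "\<exists>n. \<forall>m\<ge>n. 3/2 < measure lborel {v\<in>{0..2}. \<forall>j\<ge>m. \<bar>k (y j + v) - k (y j)\<bar> < e}"
    if y: "filterlim y at_top sequentially" for y :: "nat \<Rightarrow> real"
  proof -
    let ?U = "\<lambda>n. {v\<in>{0..2}. \<forall>j\<ge>n. \<bar>k (y j + v) - k (y j)\<bar> < e}"
    have U: "?U n \<in> sets lborel" for n by measurable
    have "(\<Union>n. ?U n) = {0..2}"
    proof (intro subset_antisym subsetI)
      fix v :: real assume v: "v \<in> {0..2}"
      have "(\<lambda>j. k (y j + v) - k (y j)) \<longlonglongrightarrow> 0" using filterlim_compose[OF lim y] .
      from tendstoD[OF this e] obtain n where "\<forall>j\<ge>n. \<bar>k (y j + v) - k (y j)\<bar> < e"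
        unfolding eventually_sequentially by (auto simp: dist_real_def)
      with v show "v \<in> (\<Union>n. ?U n)" by auto
    qed auto
    moreover have "(\<lambda>n. measure lborel (?U n)) \<longlonglongrightarrow> measure lborel (\<Union>n. ?U n)"
    proof (rule Lim_measure_incseq)
      show "range ?U \<subseteq> sets lborel" using U by auto
      show "incseq ?U" by (auto simp: incseq_def)
      show "emeasure lborel (\<Union>n. ?U n) \<noteq> \<infinity>" unfolding calculation by simp
    qed
    ultimately have "(\<lambda>n. measure lborel (?U n)) \<longlonglongrightarrow> 2" by simp
    from order_tendstoD(1)[OF this, of "3/2"] show ?thesis unfolding eventually_sequentially by auto
  qed
  have x: "filterlim x at_top sequentially"
    by (rule filterlim_at_top_mono[OF filterlim_real_sequentially]) (use xu in auto)
  have xu': "filterlim (\<lambda>n. x n + u n) at_top sequentially"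
    by (rule filterlim_at_top_mono[OF x]) (use xu(2) in auto)
  let ?U = "\<lambda>n. {v\<in>{0..2}. \<forall>j\<ge>n. \<bar>k (x j + v) - k (x j)\<bar> < e}"
  let ?V = "\<lambda>n. {v\<in>{0..2}. \<forall>j\<ge>n. \<bar>k (x j + u j + v) - k (x j + u j)\<bar> < e}"
  obtain n where n: "3/2 < measure lborel (?U n)" "3/2 < measure lborel (?V n)"
    using large[OF x] large[OF xu'] by (meson max.cobounded1 max.cobounded2)
  let ?W = "{w. w - u n \<in> ?V n}"
  have [measurable]: "?U n \<in> sets borel" "?W \<in> sets borel" by measurable
  have "emeasure lborel ?W = emeasure (distr lborel borel ((+) (u n))) ?W"
    by (simp add: lborel_distr_plus)
  also have "\<dots> = emeasure lborel (?V n)"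
    by (subst emeasure_distr) (auto intro!: arg_cong[where f="emeasure lborel"])
  finally have W: "measure lborel ?W = measure lborel (?V n)" by (simp add: measure_def)
  have disj: "?U n \<inter> ?W = {}"
  proof (rule ccontr)
    assume "?U n \<inter> ?W \<noteq> {}"
    then obtain w where w: "\<bar>k (x n + w) - k (x n)\<bar> < e" "\<bar>k (x n + u n + (w - u n)) - k (x n + u n)\<bar> < e"
      by blast
    then have "\<bar>k (x n + u n) - k (x n)\<bar> < 2 * e" by (simp add: algebra_simps)
    with xu(3)[of n] show False by simp
  qed
  have sub: "?U n \<subseteq> {0..3}" "?W \<subseteq> {0..3}" using xu(2)[of n] by auto
  have fm: "?U n \<in> fmeasurable lborel" "?W \<in> fmeasurable lborel"
    by (rule fmeasurableI2[OF fmeasurable_cbox[of 0 "3::real", simplified] ], use sub in auto)+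
  have "measure lborel (?U n) + measure lborel ?W = measure lborel (?U n \<union> ?W)"
    using fm by (intro measure_Union[symmetric] disj) (auto simp: fmeasurable_def)
  also have "\<dots> \<le> measure lborel {0..3::real}"
    by (rule measure_mono_fmeasurable) (use sub in \<open>auto intro: fmeasurable_cbox[of 0 "3::real", simplified]\<close>)
  finally show False using n W by simp
qed

text \<open>With \<open>k x = ln (g (exp x)) - \<rho> x\<close>, uniformity gives \<open>\<bar>k (x + u) - k x\<bar> <
  \<rho> / 2\<close> for \<open>u \<in> {0..1}\<close> and all large \<open>x\<close>, so that \<open>k x\<close>
  decreases by at most \<open>\<rho> / 2\<close> per unit and \<open>k x + \<rho> x\<close> grows linearly.\<close>
lemma regularly_varying_at_top:
  assumes g: "regularly_varying g \<rho>" and \<rho>: "0 < \<rho>" and pos: "\<forall>t>0. 0 < g t"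
  shows "filterlim g at_top at_top"
proof -
  have "exp \<in> measurable borel (restrict_space borel {0::real<..})"
    by (rule measurable_restrict_space2) auto
  from measurable_compose[OF this] g
  have [measurable]: "(\<lambda>x. g (exp x)) \<in> borel_measurable borel" by (auto simp: regularly_varying_def)
  define k where "k x = ln (g (exp x)) - \<rho> * x" for x
  have k: "k \<in> borel_measurable borel" unfolding k_def by measurable
  have lim: "((\<lambda>x. k (x + u) - k x) \<longlongrightarrow> 0) at_top" for u
  proof -
    have "((\<lambda>t. g (exp u * t) / g t) \<longlongrightarrow> exp u powr \<rho>) at_top"
      using g by (auto simp: regularly_varying_def)
    from filterlim_compose[OF this exp_at_top]
    have "((\<lambda>x. ln (g (exp u * exp x) / g (exp x)) - \<rho> * u) \<longlongrightarrow> ln (exp u powr \<rho>) - \<rho> * u) at_top"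
      by (intro tendsto_intros) auto
    moreover have "ln (g (exp u * exp x) / g (exp x)) - \<rho> * u = k (x + u) - k x" for x
    proof -
      have "0 < g (exp u * exp x)" "0 < g (exp x)" using pos by auto
      then show ?thesis by (simp add: k_def ln_div exp_add algebra_simps)
    qed
    ultimately show ?thesis by simp
  qed
  obtain X where X: "\<And>x u. X \<le> x \<Longrightarrow> u \<in> {0..1} \<Longrightarrow> \<bar>k (x + u) - k x\<bar> < \<rho> / 2"
  proof -
    have "\<exists>X. \<forall>x\<ge>X. \<forall>u\<in>{0..1}. \<bar>k (x + u) - k x\<bar> < 2 * (\<rho> / 4)"
      by (rule additive_slow_variation_locally_uniform[OF k lim]) (use \<rho> in simp)
    then show ?thesis using that by force
  qed
  define h where "h x = ln (g (exp x))" for x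
  have step: "h x + \<rho> * u - \<rho> / 2 \<le> h (x + u)" if "X \<le> x" "u \<in> {0..1}" for x u
    using X[OF that] unfolding k_def h_def distrib_left by linarith
  have lower: "h X + real n * (\<rho> / 2) \<le> h (X + real n)" for n
  proof (induction n)
    case (Suc n)
    have "h (X + real n) + \<rho> * 1 - \<rho> / 2 \<le> h (X + real n + 1)" by (rule step) auto
    moreover have "real (Suc n) * (\<rho> / 2) = real n * (\<rho> / 2) + \<rho> / 2" by (simp add: field_simps)
    moreover have "h (X + real (Suc n)) = h (X + real n + 1)" by (simp add: algebra_simps)
    ultimately show ?case using Suc by linarith
  qed simp
  have "h X + (x - X - 1) * (\<rho> / 2) - \<rho> / 2 \<le> h x" if x: "X \<le> x" for x
  proof -
    define n where "n = nat \<lfloor>x - X\<rfloor>"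
    have n: "real n \<le> x - X" "x - X < real n + 1" using x unfolding n_def by linarith+
    have "h (X + real n) + \<rho> * (x - X - real n) - \<rho> / 2 \<le> h (X + real n + (x - X - real n))"
      by (rule step) (use n in auto)
    moreover have "0 \<le> \<rho> * (x - X - real n)" using n \<rho> by simp
    moreover have "(x - X - 1) * (\<rho> / 2) \<le> real n * (\<rho> / 2)" using n \<rho> by (intro mult_right_mono) auto
    ultimately show ?thesis using lower[of n] by simp
  qed
  then have "eventually (\<lambda>x. h X + (x - X - 1) * (\<rho> / 2) - \<rho> / 2 \<le> h x) at_top"
    by (rule eventually_mono[OF eventually_ge_at_top[of X]])
  moreover have "filterlim (\<lambda>x. h X + (x - X - 1) * (\<rho> / 2) - \<rho> / 2) at_top at_top"
  proof -
    have "filterlim (\<lambda>x. (h X - (X + 1) * (\<rho> / 2) - \<rho> / 2) + (\<rho> / 2) * x) at_top at_top"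
      using \<rho> by (intro filterlim_tendsto_add_at_top[OF tendsto_const] filterlim_tendsto_pos_mult_at_top[OF tendsto_const] filterlim_ident) auto
    moreover have "h X + (x - X - 1) * (\<rho> / 2) - \<rho> / 2 = (h X - (X + 1) * (\<rho> / 2) - \<rho> / 2) + (\<rho> / 2) * x" for x
      by (simp add: field_simps)
    ultimately show ?thesis by (simp only:)
  qed
  ultimately have "filterlim h at_top at_top" by (rule filterlim_at_top_mono[rotated])
  from filterlim_compose[OF exp_at_top filterlim_compose[OF this ln_at_top]]
  have lim_exp: "filterlim (\<lambda>t. exp (h (ln t))) at_top at_top" .
  have ev: "eventually (\<lambda>t. exp (h (ln t)) = g t) at_top"
    using eventually_gt_at_top[of 0] by eventually_elim (use pos in \<open>auto simp: h_def\<close>)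
  show ?thesis by (rule iffD1[OF filterlim_cong[OF refl refl ev] lim_exp])
qed

section \<open>Change of variables by an integral\<close>

text \<open>The density \<open>1 / V\<close> of \<open>A\<close> is only cadlag, so that \<open>A\<close> is not differentiable everywhere and
  the change of variables is done by comparing measures instead of derivatives.\<close>
locale positive_density =
  fixes h H :: "real \<Rightarrow> real"
  assumes pos: "\<And>s. 0 \<le> s \<Longrightarrow> 0 < h s"
    and int: "\<And>t. set_integrable lborel {0..t} h"
    and H: "\<And>t. 0 \<le> t \<Longrightarrow> H t = (LBINT s:{0..t}. h s)"
begin

lemma H_0: "H 0 = 0"
  unfolding H[OF order_refl] set_lebesgue_integral_def
proof (rule integral_eq_zero_AE)
  show "AE s in lborel. indicator {0..0} s *\<^sub>R h s = 0"
    using AE_lborel_singleton[of 0] by eventually_elim (auto simp: indicator_def)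
qed

lemma H_add:
  assumes "0 \<le> s" "s \<le> t"
  shows "H t = H s + (LBINT r:{s<..t}. h r)"
proof -
  have "{0..t} = {0..s} \<union> {s<..t}" using assms by auto
  then show ?thesis
    using assms unfolding H[OF order_trans[OF assms]] H[OF assms(1)]
    by (simp only:) (intro set_integral_Un set_integrable_subset[OF int[of t]], auto)
qed

lemma H_strict_mono:
  assumes "0 \<le> s" "s < t"
  shows "H s < H t"
proof -
  have i: "integrable lborel (\<lambda>r. indicator {s<..t} r *\<^sub>R h r)"
  proof -
    have "{s<..t} \<subseteq> {0..t}" using assms by auto
    from set_integrable_subset[OF int _ this] show ?thesis by (simp add: set_integrable_def)
  qed
  have nn: "0 \<le> indicator {s<..t} r *\<^sub>R h r" for r
    using pos[of r] assms by (auto simp: indicator_def intro: less_imp_le)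
  have "0 \<le> (\<integral>r. indicator {s<..t} r *\<^sub>R h r \<partial>lborel)" by (rule Bochner_Integration.integral_nonneg) (rule nn)
  moreover have "(\<integral>r. indicator {s<..t} r *\<^sub>R h r \<partial>lborel) \<noteq> 0"
  proof
    assume "(\<integral>r. indicator {s<..t} r *\<^sub>R h r \<partial>lborel) = 0"
    then have "AE r in lborel. indicator {s<..t} r *\<^sub>R h r = 0"
      using integral_nonneg_eq_0_iff_AE[OF i] nn by auto
    then have "AE r in lborel. r \<notin> {s<..t}"
    proof eventually_elim
      case (elim r)
      show ?case
      proof
        assume r: "r \<in> {s<..t}"
        then have "0 < h r" using assms by (intro pos) auto
        with elim r show False by simp
      qed
    qed
    then have "{s<..t} \<in> null_sets lborel" by (subst (asm) AE_iff_null_sets[symmetric]) auto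
    then show False using assms by (simp add: null_sets_def)
  qed
  ultimately show ?thesis using H_add[of s t] assms unfolding set_lebesgue_integral_def by simp
qed

lemma H_mono: "0 \<le> s \<Longrightarrow> s \<le> t \<Longrightarrow> H s \<le> H t"
  using H_strict_mono[of s t] by (cases "s = t") auto

lemma H_nonneg: "0 \<le> t \<Longrightarrow> 0 \<le> H t"
  using H_mono[of 0 t] H_0 by simp

lemma H_continuous: "continuous_on {0..t} H"
proof -
  have "continuous_on {0..t} (\<lambda>s. integral {0..s} h)"
    by (rule indefinite_integral_continuous_1) (rule set_borel_integral_eq_integral(1)[OF int])
  then show ?thesis
    by (rule continuous_on_cong[THEN iffD1, rotated 2]) (auto simp: H set_borel_integral_eq_integral(2)[OF int])
qed

lemma H_surj:
  assumes "0 \<le> t" "0 \<le> u" "u \<le> H t"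
  obtains s where "0 \<le> s" "s \<le> t" "H s = u"
  using IVT'[OF _ assms(3,1) H_continuous] assms H_0 by auto

lemma H_borel: "(\<lambda>s. H (max 0 s)) \<in> borel_measurable borel"
proof (rule borel_measurable_mono)
  show "mono (\<lambda>s. H (max 0 s))" by (intro monoI H_mono) auto
qed

text \<open>\<open>H\<close> maps \<open>{0..t}\<close> increasingly onto \<open>{0..H t}\<close>, and the preimage of an
  interval is an interval over which \<open>h\<close> integrates to the length of the original one.\<close>
lemma distr_density_eq:
  assumes t: "0 \<le> t"
  shows "distr (density lborel (\<lambda>s. ennreal (indicator {0..t} s *\<^sub>R h s))) borel (\<lambda>s. H (max 0 s)) =
    density lborel (indicator {0..H t})" (is "?D = ?E")
proof -
  have i: "integrable lborel (\<lambda>s. indicator {0..t} s *\<^sub>R h s)" using int by (simp add: set_integrable_def)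
  have nn: "0 \<le> indicator A r *\<^sub>R h r" if "A \<subseteq> {0..t}" for A r
    using pos[of r] that by (auto simp: indicator_def subset_eq intro: less_imp_le)
  have m: "(\<lambda>s. H (max 0 s)) \<in> measurable (density lborel (\<lambda>s. ennreal (indicator {0..t} s *\<^sub>R h s))) borel"
    using H_borel by simp
  have val: "emeasure (density lborel (\<lambda>s. ennreal (indicator {0..t} s *\<^sub>R h s))) {s<..} = ennreal (H t - H s)"
    if s: "0 \<le> s" "s \<le> t" for s
  proof -
    have "emeasure (density lborel (\<lambda>s. ennreal (indicator {0..t} s *\<^sub>R h s))) {s<..} =
        (\<integral>\<^sup>+r. ennreal (indicator {0..t} r *\<^sub>R h r) * indicator {s<..} r \<partial>lborel)"
      using i by (subst emeasure_density) auto
    also have "\<dots> = (\<integral>\<^sup>+r. ennreal (indicator {s<..t} r *\<^sub>R h r) \<partial>lborel)"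
      using s by (intro nn_integral_cong) (auto simp: indicator_def)
    also have "\<dots> = ennreal (LBINT r:{s<..t}. h r)"
      unfolding set_lebesgue_integral_def
      using set_integrable_subset[OF int[of t], of "{s<..t}"] s nn[of "{s<..t}"]
      by (intro nn_integral_eq_integral AE_I2) (auto simp: set_integrable_def subset_eq)
    also have "\<dots> = ennreal (H t - H s)" using H_add[OF s] by simp
    finally show ?thesis .
  qed
  have total: "emeasure (density lborel (\<lambda>s. ennreal (indicator {0..t} s *\<^sub>R h s))) UNIV = ennreal (H t)"
  proof -
    have "emeasure (density lborel (\<lambda>s. ennreal (indicator {0..t} s *\<^sub>R h s))) UNIV =
        (\<integral>\<^sup>+r. ennreal (indicator {0..t} r *\<^sub>R h r) \<partial>lborel)"
      using i by (subst emeasure_density) auto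
    also have "\<dots> = ennreal (H t)"
      unfolding H[OF t] set_lebesgue_integral_def using i nn[of "{0..t}"]
      by (intro nn_integral_eq_integral AE_I2) auto
    finally show ?thesis .
  qed
  have E: "emeasure ?E {x<..} = emeasure lborel ({0..H t} \<inter> {x<..})" for x
    by (subst emeasure_density) (auto simp: indicator_inter_arith[symmetric] intro!: nn_integral_cong[THEN trans[OF _ nn_integral_indicator]])
  have D: "emeasure ?D {x<..} = emeasure (density lborel (\<lambda>s. ennreal (indicator {0..t} s *\<^sub>R h s))) {s. x < H (max 0 s)}" for x
    by (subst emeasure_distr[OF m]) (auto simp: vimage_def)
  have zero: "emeasure (density lborel (\<lambda>s. ennreal (indicator {0..t} s *\<^sub>R h s))) {s. x < H (max 0 s)} =
      emeasure (density lborel (\<lambda>s. ennreal (indicator {0..t} s *\<^sub>R h s))) B"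
    if "\<And>s. s \<in> {0..t} \<Longrightarrow> x < H s \<longleftrightarrow> s \<in> B" "B \<in> sets borel" for x B
  proof -
    have "{s. x < H (max 0 s)} \<in> sets borel"
      using measurable_sets[OF H_borel, of "{x<..}"] by (simp add: vimage_def)
    with that show ?thesis using i
      by (subst (1 2) emeasure_density) (auto intro!: nn_integral_cong simp: indicator_def max_absorb2)
  qed
  have eq: "emeasure ?D {x<..} = emeasure ?E {x<..}" for x
  proof -
    consider "x < 0" | "0 \<le> x" "x \<le> H t" | "H t < x" by linarith
    then show ?thesis
    proof cases
      case 1
      have "{0..H t} \<inter> {x<..} = {0..H t}" using 1 by auto
      moreover have "x < H s" if "s \<in> {0..t}" for s using H_nonneg[of s] 1 that by auto
      ultimately show ?thesis unfolding D E
        by (subst zero[of x UNIV]) (auto simp: total[unfolded real_scaleR_def] H_nonneg[OF t])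
    next
      case 2
      obtain s0 where s0: "0 \<le> s0" "s0 \<le> t" "H s0 = x" using H_surj[OF t 2] .
      have iff: "x < H s \<longleftrightarrow> s \<in> {s0<..}" if "s \<in> {0..t}" for s
        using H_strict_mono[of s0 s] H_mono[of s s0] s0 that by (cases "s \<le> s0") auto
      have "{0..H t} \<inter> {x<..} = {x<..H t}" using 2 by auto
      then show ?thesis unfolding D E
        using 2 s0 by (subst zero[OF iff]) (auto simp: val[unfolded real_scaleR_def])
    next
      case 3
      have "{0..H t} \<inter> {x<..} = {}" using 3 by auto
      moreover have "\<not> x < H s" if "s \<in> {0..t}" for s using H_mono[of s t] 3 that by auto
      ultimately show ?thesis unfolding D E
        by (subst zero[of x "{}"]) auto
    qed
  qed
  show ?thesis
  proof (rule measure_eqI_lessThan)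
    show "emeasure ?D {x<..} < \<infinity>" for x
    proof -
      have "emeasure ?D {x<..} = emeasure lborel ({0..H t} \<inter> {x<..})" unfolding eq E ..
      also have "\<dots> \<le> emeasure lborel {0..H t}" by (intro emeasure_mono) auto
      also have "\<dots> < \<infinity>" by (simp add: emeasure_lborel_Icc_eq)
      finally show ?thesis .
    qed
    show "emeasure ?D {x<..} = emeasure ?E {x<..}" for x by (rule eq)
  qed auto
qed

lemma change_of_variables:
  fixes k :: "real \<Rightarrow> real"
  assumes t: "0 \<le> t" and k: "k \<in> borel_measurable borel"
  shows "(LBINT u:{0..H t}. k u) = (LBINT s:{0..t}. h s * k (H s))"
proof -
  have i: "integrable lborel (\<lambda>s. indicator {0..t} s *\<^sub>R h s)" using int by (simp add: set_integrable_def)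
  have nn: "0 \<le> indicator {0..t} r *\<^sub>R h r" for r
    using pos[of r] by (auto simp: indicator_def intro: less_imp_le)
  have "(LBINT u:{0..H t}. k u) = (\<integral>u. k u \<partial>density lborel (\<lambda>u. ennreal (indicator {0..H t} u)))"
    unfolding set_lebesgue_integral_def using k by (subst integral_density) auto
  also have "density lborel (\<lambda>u. ennreal (indicator {0..H t} u)) = density lborel (indicator {0..H t})"
    by (intro density_cong) (auto simp: indicator_def)
  also have "(\<integral>u. k u \<partial>density lborel (indicator {0..H t})) =
      (\<integral>s. k (H (max 0 s)) \<partial>density lborel (\<lambda>s. ennreal (indicator {0..t} s *\<^sub>R h s)))"
    unfolding distr_density_eq[OF t, symmetric] using H_borel k by (subst integral_distr) auto
  also have "\<dots> = (\<integral>s. (indicator {0..t} s *\<^sub>R h s) *\<^sub>R k (H (max 0 s)) \<partial>lborel)"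
    using i nn measurable_compose[OF H_borel k] by (intro integral_density) auto
  also have "\<dots> = (LBINT s:{0..t}. h s * k (H s))"
    unfolding set_lebesgue_integral_def by (intro Bochner_Integration.integral_cong) (auto simp: indicator_def max_absorb2)
  finally show ?thesis .
qed

end

section \<open>The time change\<close>

lemma xi_tilde_nonneg: "0 \<le> t \<Longrightarrow> xi_tilde x y t = x t"
  by (simp add: xi_tilde_def)

lemma I_tilde_nonneg: "0 \<le> I_tilde x y t"
  unfolding I_tilde_def set_lebesgue_integral_def
  by (intro Bochner_Integration.integral_nonneg) (simp add: indicator_def)

lemma V_tilde_nonneg: "0 \<le> V_tilde x y t"
  unfolding V_tilde_def by (simp add: I_tilde_nonneg)

lemma U_tilde_nonneg: "0 \<le> U_tilde x y t"
  unfolding U_tilde_def by (simp add: V_tilde_nonneg)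

lemma A_fun_nonneg_time: "0 \<le> t \<Longrightarrow> A_fun x y t = (LBINT s:{0..t}. 1 / V_tilde x y s)"
  unfolding A_fun_def by (rule interval_integral_Icc)

lemma A_fun_neg_time:
  assumes "t < 0"
  shows "A_fun x y t \<le> 0"
proof -
  have "A_fun x y t = - (LBINT s:{t..0}. 1 / V_tilde x y s)"
    unfolding A_fun_def using assms
    by (subst interval_integral_endpoints_reverse) (simp add: interval_integral_Icc)
  also have "\<dots> \<le> 0"
    unfolding set_lebesgue_integral_def
    using V_tilde_nonneg by (auto intro!: Bochner_Integration.integral_nonneg)
  finally show ?thesis .
qed

text \<open>Splitting the half line at \<open>0\<close> and reflecting its negative part. The left limits in
  \<open>xi_tilde\<close> agree with the values of \<open>y\<close> off a countable set.\<close>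
lemma negative_half_exp_integral:
  assumes y: "cadlag y"
  shows "set_integrable lborel {..<0} (\<lambda>s. exp (xi_tilde x y s)) \<longleftrightarrow> set_integrable lborel {0..} (\<lambda>s. exp (y s))" (is ?iff)
    and "(LBINT s:{..<0}. exp (xi_tilde x y s)) = I_hat y" (is ?eq)
proof -
  let ?l = "\<lambda>s. if 0 < s then Lim (at_left s) y else 0"
  have [measurable]: "?l \<in> borel_measurable borel"
  proof -
    have "(\<lambda>(s, \<omega>::unit). if 0 < s then Lim (at_left s) (\<lambda>t. y t) else 0) \<in> borel_measurable (borel \<Otimes>\<^sub>M count_space UNIV)"
      using y by (intro cadlag_left_process_measurable[where X="\<lambda>t _. y t"]) auto
    from measurable_compose[OF measurable_Pair2'[of "()" "count_space UNIV" borel] this]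
    show ?thesis by simp
  qed
  have ym [measurable]: "(\<lambda>s. if 0 \<le> s then y s else 0) \<in> borel_measurable borel"
    by (rule cadlag_measurable_if[OF y])
  let ?G = "\<lambda>r. indicator {0<..} r *\<^sub>R exp (?l r) :: real"
  let ?Y = "\<lambda>r. indicator {0..} r *\<^sub>R exp (if 0 \<le> r then y r else 0) :: real"
  have Y: "?Y = (\<lambda>r. indicator {0..} r *\<^sub>R exp (y r))" by (auto simp: fun_eq_iff indicator_def)
  have F: "(\<lambda>s. indicator {..<0} s *\<^sub>R exp (xi_tilde x y s)) = (\<lambda>s. ?G (0 + (-1) * s))"
    by (auto simp: fun_eq_iff indicator_def xi_tilde_def)
  have AE: "AE r in lborel. ?G r = ?Y r"
    using cadlag_AE_continuous[OF y] AE_lborel_singleton[of 0]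
    by eventually_elim (auto simp: indicator_def)
  have "integrable lborel (\<lambda>s. ?G (0 + (-1) * s)) \<longleftrightarrow> integrable lborel ?G"
    by (rule lborel_integrable_real_affine_iff) simp
  also have "\<dots> \<longleftrightarrow> integrable lborel ?Y"
    by (rule integrable_cong_AE) (use AE in auto)
  finally show ?iff unfolding set_integrable_def F Y .
  have "(\<integral>r. ?G r \<partial>lborel) = \<bar>-1\<bar> *\<^sub>R (\<integral>s. ?G (0 + (-1) * s) \<partial>lborel)"
    by (rule lborel_integral_real_affine) simp
  moreover have "(\<integral>r. ?G r \<partial>lborel) = (\<integral>r. ?Y r \<partial>lborel)"
    by (rule integral_cong_AE) (use AE in auto)
  ultimately show ?eq unfolding set_lebesgue_integral_def F I_hat_def Y by simp
qed

text \<open>The past contributes \<open>I_hat y\<close>. If its integral diverges, then so does the whole one, which is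
  then \<open>0\<close> by convention.\<close>
lemma I_tilde_eq:
  assumes x: "cadlag x" and y: "cadlag y" and t: "0 \<le> t"
  shows "set_integrable lborel {0..} (\<lambda>s. exp (y s)) \<Longrightarrow> I_tilde x y t = I_hat y + (LBINT s:{0..t}. exp (x s))"
    and "\<not> set_integrable lborel {0..} (\<lambda>s. exp (y s)) \<Longrightarrow> I_tilde x y t = 0"
proof -
  have un: "{..t} = {..<0} \<union> {0..t}" using t by auto
  have e: "(\<lambda>s. indicator {0..t} s *\<^sub>R exp (xi_tilde x y s)) = (\<lambda>s. indicator {0..t} s *\<^sub>R exp (x s))"
    by (auto simp: fun_eq_iff indicator_def xi_tilde_def)
  have ex: "(LBINT s:{0..t}. exp (xi_tilde x y s)) = (LBINT s:{0..t}. exp (x s))"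
    unfolding set_lebesgue_integral_def e ..
  have ix: "set_integrable lborel {0..t} (\<lambda>s. exp (xi_tilde x y s))"
    using cadlag_exp_integrable[OF x, of t] unfolding set_integrable_def e .
  show "I_tilde x y t = I_hat y + (LBINT s:{0..t}. exp (x s))" if i: "set_integrable lborel {0..} (\<lambda>s. exp (y s))"
  proof -
    have "I_tilde x y t = (LBINT s:{..<0}. exp (xi_tilde x y s)) + (LBINT s:{0..t}. exp (xi_tilde x y s))"
      unfolding I_tilde_def un using ix i
      by (intro set_integral_Un) (auto simp: negative_half_exp_integral(1)[OF y])
    then show ?thesis by (simp only: negative_half_exp_integral(2)[OF y] ex)
  qed
  show "I_tilde x y t = 0" if i: "\<not> set_integrable lborel {0..} (\<lambda>s. exp (y s))"
  proof -
    have "\<not> set_integrable lborel {..t} (\<lambda>s. exp (xi_tilde x y s))"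
    proof
      assume "set_integrable lborel {..t} (\<lambda>s. exp (xi_tilde x y s))"
      then have "set_integrable lborel {..<0} (\<lambda>s. exp (xi_tilde x y s))"
        by (rule set_integrable_subset) (use t in auto)
      with i show False by (simp add: negative_half_exp_integral(1)[OF y])
    qed
    then show ?thesis unfolding I_tilde_def set_integrable_def set_lebesgue_integral_def by (rule not_integrable_integral_eq)
  qed
qed

lemma I_hat_pos:
  assumes y: "cadlag y" and i: "set_integrable lborel {0..} (\<lambda>s. exp (y s))"
  shows "0 < I_hat y"
proof -
  obtain K where K: "\<And>s. 0 \<le> s \<Longrightarrow> s \<le> 1 \<Longrightarrow> \<bar>y s\<bar> \<le> K" using cadlag_bounded[OF y, of 1] by metis
  have "exp (- K) = (\<integral>s. indicator {0..1::real} s *\<^sub>R exp (- K) \<partial>lborel)" by simp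
  also have "\<dots> \<le> (\<integral>s. indicator {0..} s *\<^sub>R exp (y s) \<partial>lborel)"
  proof (rule integral_mono)
    show "integrable lborel (\<lambda>s. indicator {0..1::real} s *\<^sub>R exp (- K))" by (auto intro!: integrable_mult_left integrable_real_indicator)
    show "integrable lborel (\<lambda>s. indicator {0..} s *\<^sub>R exp (y s))" using i by (simp add: set_integrable_def)
    fix s :: real
    show "indicator {0..1::real} s *\<^sub>R exp (- K) \<le> indicator {0..} s *\<^sub>R exp (y s)"
      using K[of s] by (auto simp: indicator_def abs_le_iff)
  qed
  also have "\<dots> = I_hat y" by (simp add: I_hat_def set_lebesgue_integral_def)
  finally show ?thesis by (rule less_le_trans[OF exp_gt_zero])
qed

context levy_dual_pair
begin

abbreviation xi_path :: "'a \<Rightarrow> real \<Rightarrow> real" where "xi_path \<omega> \<equiv> \<lambda>r. \<xi> r \<omega>"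
abbreviation dual_path :: "'a \<Rightarrow> real \<Rightarrow> real" where "dual_path \<omega> \<equiv> \<lambda>r. \<xi>h r \<omega>"

definition A :: "real \<Rightarrow> 'a \<Rightarrow> real" where "A t \<omega> = A_fun (xi_path \<omega>) (dual_path \<omega>) t"
definition U :: "real \<Rightarrow> 'a \<Rightarrow> real" where "U t \<omega> = U_tilde (xi_path \<omega>) (dual_path \<omega>) t"
definition T :: "real \<Rightarrow> 'a \<Rightarrow> real" where "T t \<omega> = T_fun (xi_path \<omega>) (dual_path \<omega>) t"

text \<open>The almost sure event on which the exponential functional of the past is finite, so that the pathwise
  functionals have their intended values.\<close>
definition good :: "'a \<Rightarrow> bool" where
  "good \<omega> \<longleftrightarrow> \<omega> \<in> space M \<and> set_integrable lborel {0..} (\<lambda>s. exp (\<xi>h s \<omega>))"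

lemma V_tilde_good: "good \<omega> \<Longrightarrow> 0 \<le> t \<Longrightarrow> V_tilde (xi_path \<omega>) (dual_path \<omega>) t = V t \<omega>"
  unfolding V_tilde_def V_def Ih_def E_def good_def
  by (simp add: I_tilde_eq(1) L(4) \<xi>h_cadlag xi_tilde_nonneg)

lemma E_density:
  assumes "\<omega> \<in> space M"
  shows "positive_density (\<lambda>s. exp (\<xi> s \<omega>)) (\<lambda>t. E t \<omega>)"
proof
  show "set_integrable lborel {0..t} (\<lambda>s. exp (\<xi> s \<omega>))" for t
    by (rule cadlag_exp_integrable[OF L(4)[OF assms]])
qed (auto simp: E_def)

lemma Ih_pos: "good \<omega> \<Longrightarrow> 0 < Ih \<omega>"
  unfolding Ih_def good_def by (auto intro: I_hat_pos \<xi>h_cadlag)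

lemma E_nonneg: "\<omega> \<in> space M \<Longrightarrow> 0 \<le> t \<Longrightarrow> 0 \<le> E t \<omega>"
  by (rule positive_density.H_nonneg[OF E_density])

lemma V_pos: "good \<omega> \<Longrightarrow> 0 \<le> t \<Longrightarrow> 0 < V t \<omega>"
  unfolding V_def using Ih_pos[of \<omega>] E_nonneg[of \<omega> t] by (auto simp: good_def intro!: mult_pos_pos)

lemma inverse_V_eq: "1 / V t \<omega> = exp (\<xi> t \<omega>) * (1 / (Ih \<omega> + E t \<omega>))"
  by (simp add: V_def exp_minus field_simps)

lemma A_eq_integral: "good \<omega> \<Longrightarrow> 0 \<le> t \<Longrightarrow> A t \<omega> = (LBINT s:{0..t}. 1 / V s \<omega>)"
  unfolding A_def A_fun_nonneg_time set_lebesgue_integral_def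
  by (intro Bochner_Integration.integral_cong refl) (auto simp: indicator_def V_tilde_good)

lemma A_density:
  assumes g: "good \<omega>"
  shows "positive_density (\<lambda>s. 1 / V s \<omega>) (\<lambda>t. A t \<omega>)"
proof
  have w: "\<omega> \<in> space M" using g by (simp add: good_def)
  show "0 < 1 / V s \<omega>" if "0 \<le> s" for s using V_pos[OF g that] by simp
  show "A t \<omega> = (LBINT s:{0..t}. 1 / V s \<omega>)" if "0 \<le> t" for t by (rule A_eq_integral[OF g that])
  show "set_integrable lborel {0..t} (\<lambda>s. 1 / V s \<omega>)" for t
  proof -
    have i: "set_integrable lborel {0..t} (\<lambda>s. exp (\<xi> s \<omega>) * (1 / Ih \<omega>))"
      using cadlag_exp_integrable[OF L(4)[OF w]] by (rule set_integrable_mult_left)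
    have m: "(\<lambda>s. indicator {0..t} s *\<^sub>R (1 / V s \<omega>)) \<in> borel_measurable lborel"
    proof -
      have [measurable]: "(\<lambda>s. V (max 0 s) \<omega>) \<in> borel_measurable borel"
        using V_section_measurable[OF _ w, of "\<lambda>v. v"] by simp
      have "(\<lambda>s. indicator {0..t} s *\<^sub>R (1 / V s \<omega>)) = (\<lambda>s. indicator {0..t} s *\<^sub>R (1 / V (max 0 s) \<omega>))"
        by (auto simp: fun_eq_iff indicator_def max_absorb2)
      then show ?thesis by simp
    qed
    show ?thesis
      unfolding set_integrable_def
    proof (rule Bochner_Integration.integrable_bound[OF i[unfolded set_integrable_def] m], rule AE_I2)
      fix s
      show "norm (indicator {0..t} s *\<^sub>R (1 / V s \<omega>)) \<le> norm (indicator {0..t} s *\<^sub>R (exp (\<xi> s \<omega>) * (1 / Ih \<omega>)))"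
      proof (cases "s \<in> {0..t}")
        case True
        then have "1 / V s \<omega> \<le> exp (\<xi> s \<omega>) * (1 / Ih \<omega>)"
          unfolding inverse_V_eq using Ih_pos[OF g] E_nonneg[OF w, of s]
          by (intro mult_left_mono divide_left_mono) auto
        with True V_pos[OF g, of s] Ih_pos[OF g] show ?thesis by simp
      qed simp
    qed
  qed
qed

text \<open>\<open>A\<close> and the right-hand side are both obtained from the density \<open>exp (\<xi> s)\<close> of
  \<open>E\<close>: substituting \<open>e = E s\<close> in the integral of \<open>1 / V\<close> leaves the integral of
  \<open>1 / (Ih + e)\<close>.\<close>
lemma A_eq_ln:
  assumes g: "good \<omega>" and t: "0 \<le> t"
  shows "A t \<omega> = ln (Ih \<omega> + E t \<omega>) - ln (Ih \<omega>)"
proof -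
  have w: "\<omega> \<in> space M" using g by (simp add: good_def)
  have I: "0 < Ih \<omega>" and Et: "0 \<le> E t \<omega>" by (rule Ih_pos[OF g], rule E_nonneg[OF w t])
  interpret E: positive_density "\<lambda>s. exp (\<xi> s \<omega>)" "\<lambda>t. E t \<omega>" by (rule E_density[OF w])
  let ?k = "\<lambda>u. 1 / (Ih \<omega> + max 0 u)"
  have km: "?k \<in> borel_measurable borel" by measurable
  have "A t \<omega> = (LBINT s:{0..t}. exp (\<xi> s \<omega>) * ?k (E s \<omega>))"
    unfolding A_eq_integral[OF g t] set_lebesgue_integral_def inverse_V_eq
    by (intro Bochner_Integration.integral_cong refl) (auto simp: indicator_def max_absorb2 E_nonneg[OF w])
  also have "\<dots> = (LBINT u:{0..E t \<omega>}. ?k u)"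
    by (rule E.change_of_variables[OF t km, symmetric])
  also have "\<dots> = (\<integral>u. ?k u * indicator {0..E t \<omega>} u \<partial>lborel)"
    unfolding set_lebesgue_integral_def by (simp add: mult.commute)
  also have "\<dots> = ln (Ih \<omega> + E t \<omega>) - ln (Ih \<omega> + 0)"
  proof (rule integral_FTC_Icc_nonneg)
    show "DERIV (\<lambda>u. ln (Ih \<omega> + u)) u :> ?k u" if "u \<in> {0..E t \<omega>}" for u
      using I that by (auto intro!: derivative_eq_intros simp: max_absorb2)
    show "0 \<le> ?k u" if "u \<in> {0..E t \<omega>}" for u using I that by simp
  qed (use km Et in auto)
  finally show ?thesis by simp
qed

text \<open>The identity that makes everything work: \<open>Ih + E t = exp (\<xi> t) * V t\<close>.\<close>
lemma A_eq_\<xi>_plus: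
  assumes g: "good \<omega>" and t: "0 \<le> t"
  shows "A t \<omega> - \<xi> t \<omega> = ln (V t \<omega>) - ln (V 0 \<omega>)"
proof -
  have w: "\<omega> \<in> space M" using g by (simp add: good_def)
  have "ln (V t \<omega>) = - \<xi> t \<omega> + ln (Ih \<omega> + E t \<omega>)"
    unfolding V_def using Ih_pos[OF g] E_nonneg[OF w t] by (subst ln_mult) auto
  then show ?thesis by (simp add: A_eq_ln[OF g t] V_0[OF w])
qed

lemma A_bad:
  assumes "\<omega> \<in> space M" "\<not> good \<omega>" "0 \<le> t"
  shows "A t \<omega> = 0"
proof -
  have "V_tilde (xi_path \<omega>) (dual_path \<omega>) s = 0" if "0 \<le> s" for s
    unfolding V_tilde_def using assms that by (simp add: I_tilde_eq(2) L(4) \<xi>h_cadlag good_def)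
  then have "A t \<omega> = (LBINT s:{0..t}. 0)"
    unfolding A_def A_fun_nonneg_time[OF assms(3)] set_lebesgue_integral_def
    by (intro Bochner_Integration.integral_cong refl) (auto simp: indicator_def)
  then show ?thesis by simp
qed

lemma A_mono: "\<omega> \<in> space M \<Longrightarrow> 0 \<le> s \<Longrightarrow> s \<le> t \<Longrightarrow> A s \<omega> \<le> A t \<omega>"
  using positive_density.H_mono[OF A_density, of \<omega> s t] A_bad[of \<omega> s] A_bad[of \<omega> t]
  by (cases "good \<omega>") auto

lemma T_unique:
  assumes g: "good \<omega>" and S: "0 \<le> S" "A S \<omega> = s" and s: "0 < s"
  shows "T s \<omega> = S"
proof -
  interpret A: positive_density "\<lambda>s. 1 / V s \<omega>" "\<lambda>t. A t \<omega>" by (rule A_density[OF g])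
  have uniq: "z = S" if "A z \<omega> = s" for z
  proof -
    have "0 \<le> z" using A_fun_neg_time[of z "xi_path \<omega>" "dual_path \<omega>"] that s unfolding A_def by linarith
    then show ?thesis using A.H_strict_mono[of z S] A.H_strict_mono[of S z] S that by (cases z S rule: linorder_cases) auto
  qed
  have "(SOME z. A z \<omega> = s) = S" by (rule some_equality[where P="\<lambda>z. A z \<omega> = s", OF S(2) uniq])
  then show ?thesis unfolding T_def T_fun_def inv_def A_def .
qed

lemma T_default:
  assumes "\<And>z. A z \<omega> \<noteq> s"
  shows "T s \<omega> = (SOME z. False)"
  unfolding T_def T_fun_def inv_def using assms by (simp add: A_def)

text \<open>Measurability holds on the whole space, not only almost surely: outside the range of \<open>A\<close> the
  inverse takes one fixed default value, whatever the path. Inside the range, \<open>T s\<close> is the length of the set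
  of times \<open>r \<ge> 0\<close> with \<open>A r \<le> s\<close>.\<close>
definition T_explicit :: "real \<times> 'a \<Rightarrow> real" where
  "T_explicit p = (if \<exists>n::nat. fst p \<le> A (real n) (snd p)
     then \<integral>r. (if 0 \<le> r \<and> A (max 0 r) (snd p) \<le> fst p then 1 else 0) \<partial>lborel else (SOME z. False))"

lemma T_eq_explicit:
  assumes w: "\<omega> \<in> space M" and s: "0 < s"
  shows "T s \<omega> = T_explicit (s, \<omega>)"
proof (cases "\<exists>n::nat. s \<le> A (real n) \<omega>")
  case True
  then obtain n :: nat where n: "s \<le> A (real n) \<omega>" by blast
  have g: "good \<omega>" using A_bad[OF w, of "real n"] n s by (cases "good \<omega>") auto
  interpret A: positive_density "\<lambda>s. 1 / V s \<omega>" "\<lambda>t. A t \<omega>" by (rule A_density[OF g])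
  obtain S where S: "0 \<le> S" "S \<le> real n" "A S \<omega> = s" using A.H_surj[of "real n" s] n s by auto
  have iff: "A r \<omega> \<le> s \<longleftrightarrow> r \<le> S" if "0 \<le> r" for r
    using A.H_strict_mono[of S r] A.H_mono[of r S] S that by (cases "r \<le> S") auto
  have "(\<lambda>r. if 0 \<le> r \<and> A (max 0 r) \<omega> \<le> s then 1 else 0 :: real) = indicator {0..S}"
    using iff by (auto simp: fun_eq_iff indicator_def max_absorb2)
  then have "T_explicit (s, \<omega>) = S" using True S by (simp add: T_explicit_def)
  then show ?thesis using T_unique[OF g S(1,3) s] by simp
next
  case False
  have "A z \<omega> \<noteq> s" for z
  proof (cases "0 \<le> z")
    case True
    obtain n :: nat where "z \<le> real n" using real_arch_simple by blast
    from A_mono[OF w True this] False[simplified, rule_format, of n] show ?thesis by linarith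
  next
    case nz: False
    then show ?thesis using A_fun_neg_time[of z "xi_path \<omega>" "dual_path \<omega>"] s unfolding A_def by linarith
  qed
  then show ?thesis using False by (simp add: T_default T_explicit_def)
qed

lemma joint_measurable_xi_tilde:
  "(\<lambda>p. xi_tilde (xi_path (snd p)) (dual_path (snd p)) (fst p)) \<in> borel_measurable (borel \<Otimes>\<^sub>M M)"
proof -
  have "(\<lambda>p :: real \<times> 'a. (- fst p, snd p)) \<in> measurable (borel \<Otimes>\<^sub>M M) (borel \<Otimes>\<^sub>M M)" by measurable
  from measurable_compose[OF this cadlag_left_process_measurable[of \<xi>h M, OF \<xi>h_measurable \<xi>h_cadlag]]
  have [measurable]: "(\<lambda>p. if 0 < - fst p then Lim (at_left (- fst p)) (dual_path (snd p)) else 0) \<in> borel_measurable (borel \<Otimes>\<^sub>M M)"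
    by (simp only: case_prod_conv)
  note [measurable] = joint_measurable_\<xi>
  have "(\<lambda>p. if 0 \<le> fst p then \<xi> (max 0 (fst p)) (snd p)
      else (if 0 < - fst p then Lim (at_left (- fst p)) (dual_path (snd p)) else 0)) \<in> borel_measurable (borel \<Otimes>\<^sub>M M)"
    by measurable
  also have "(\<lambda>p. if 0 \<le> fst p then \<xi> (max 0 (fst p)) (snd p)
      else (if 0 < - fst p then Lim (at_left (- fst p)) (dual_path (snd p)) else 0)) =
    (\<lambda>p. xi_tilde (xi_path (snd p)) (dual_path (snd p)) (fst p))"
    by (auto simp: fun_eq_iff xi_tilde_def max_absorb2)
  finally show ?thesis .
qed

lemma joint_measurable_V_tilde:
  "(\<lambda>p. V_tilde (xi_path (snd p)) (dual_path (snd p)) (fst p)) \<in> borel_measurable (borel \<Otimes>\<^sub>M M)"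
proof -
  have "(\<lambda>q. (snd q, snd (fst q))) \<in> measurable ((borel \<Otimes>\<^sub>M M) \<Otimes>\<^sub>M lborel) (borel \<Otimes>\<^sub>M M)" by measurable
  from measurable_compose[OF this joint_measurable_xi_tilde]
  have [measurable]: "(\<lambda>q. xi_tilde (xi_path (snd (fst q))) (dual_path (snd (fst q))) (snd q)) \<in> borel_measurable ((borel \<Otimes>\<^sub>M M) \<Otimes>\<^sub>M lborel)"
    by simp
  have "(\<lambda>q. (if snd q \<le> fst (fst q) then 1 else 0) *\<^sub>R exp (xi_tilde (xi_path (snd (fst q))) (dual_path (snd (fst q))) (snd q))) \<in> borel_measurable ((borel \<Otimes>\<^sub>M M) \<Otimes>\<^sub>M lborel)"
    by measurable
  then have "(\<lambda>p. \<integral>s. (if s \<le> fst p then 1 else 0) *\<^sub>R exp (xi_tilde (xi_path (snd p)) (dual_path (snd p)) s) \<partial>lborel) \<in> borel_measurable (borel \<Otimes>\<^sub>M M)"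
    by (intro lborel.borel_measurable_lebesgue_integral) (simp only: case_prod_beta')
  also have "(\<lambda>p. \<integral>s. (if s \<le> fst p then 1 else 0) *\<^sub>R exp (xi_tilde (xi_path (snd p)) (dual_path (snd p)) s) \<partial>lborel) =
      (\<lambda>p. I_tilde (xi_path (snd p)) (dual_path (snd p)) (fst p))"
    unfolding I_tilde_def set_lebesgue_integral_def
    by (intro ext Bochner_Integration.integral_cong) (auto simp: indicator_def)
  finally have [measurable]: "(\<lambda>p. I_tilde (xi_path (snd p)) (dual_path (snd p)) (fst p)) \<in> borel_measurable (borel \<Otimes>\<^sub>M M)" .
  note [measurable] = joint_measurable_xi_tilde
  show ?thesis unfolding V_tilde_def by measurable
qed

lemma joint_measurable_A: "(\<lambda>p. A (max 0 (fst p)) (snd p)) \<in> borel_measurable (borel \<Otimes>\<^sub>M M)"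
proof -
  have "(\<lambda>q. (snd q, snd (fst q))) \<in> measurable ((borel \<Otimes>\<^sub>M M) \<Otimes>\<^sub>M lborel) (borel \<Otimes>\<^sub>M M)" by measurable
  from measurable_compose[OF this joint_measurable_V_tilde]
  have [measurable]: "(\<lambda>q. V_tilde (xi_path (snd (fst q))) (dual_path (snd (fst q))) (snd q)) \<in> borel_measurable ((borel \<Otimes>\<^sub>M M) \<Otimes>\<^sub>M lborel)"
    by simp
  have "(\<lambda>q. (if 0 \<le> snd q \<and> snd q \<le> max 0 (fst (fst q)) then 1 else 0) *\<^sub>R (1 / V_tilde (xi_path (snd (fst q))) (dual_path (snd (fst q))) (snd q))) \<in> borel_measurable ((borel \<Otimes>\<^sub>M M) \<Otimes>\<^sub>M lborel)"
    by measurable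
  then have "(\<lambda>p. \<integral>s. (if 0 \<le> s \<and> s \<le> max 0 (fst p) then 1 else 0) *\<^sub>R (1 / V_tilde (xi_path (snd p)) (dual_path (snd p)) s) \<partial>lborel) \<in> borel_measurable (borel \<Otimes>\<^sub>M M)"
    by (intro lborel.borel_measurable_lebesgue_integral) (simp only: case_prod_beta')
  also have "(\<lambda>p. \<integral>s. (if 0 \<le> s \<and> s \<le> max 0 (fst p) then 1 else 0) *\<^sub>R (1 / V_tilde (xi_path (snd p)) (dual_path (snd p)) s) \<partial>lborel) =
      (\<lambda>p. A (max 0 (fst p)) (snd p))"
    unfolding A_def A_fun_nonneg_time[OF max.cobounded1] set_lebesgue_integral_def
    by (intro ext Bochner_Integration.integral_cong) (auto simp: indicator_def)
  finally show ?thesis .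
qed

lemma A_measurable: "0 \<le> t \<Longrightarrow> A t \<in> borel_measurable M"
  using measurable_compose[OF measurable_Pair1'[of t borel M] joint_measurable_A] by (simp add: max_absorb2)

lemma T_explicit_measurable: "T_explicit \<in> borel_measurable (borel \<Otimes>\<^sub>M M)"
proof -
  have [measurable]: "(\<lambda>p. A (real n) (snd p)) \<in> borel_measurable (borel \<Otimes>\<^sub>M M)" for n :: nat
    by (rule measurable_compose[OF measurable_snd A_measurable]) simp
  have "(\<lambda>q. (snd q, snd (fst q))) \<in> measurable ((borel \<Otimes>\<^sub>M M) \<Otimes>\<^sub>M lborel) (borel \<Otimes>\<^sub>M M)" by measurable
  from measurable_compose[OF this joint_measurable_A]
  have [measurable]: "(\<lambda>q. A (max 0 (snd q)) (snd (fst q))) \<in> borel_measurable ((borel \<Otimes>\<^sub>M M) \<Otimes>\<^sub>M lborel)"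
    by simp
  have "(\<lambda>q. if 0 \<le> snd q \<and> A (max 0 (snd q)) (snd (fst q)) \<le> fst (fst q) then 1 else 0 :: real) \<in> borel_measurable ((borel \<Otimes>\<^sub>M M) \<Otimes>\<^sub>M lborel)"
    by measurable
  then have [measurable]: "(\<lambda>p. \<integral>r. (if 0 \<le> r \<and> A (max 0 r) (snd p) \<le> fst p then 1 else 0 :: real) \<partial>lborel) \<in> borel_measurable (borel \<Otimes>\<^sub>M M)"
    by (intro lborel.borel_measurable_lebesgue_integral) (simp only: case_prod_beta')
  show ?thesis unfolding T_explicit_def[abs_def] by measurable
qed

lemma T_measurable:
  assumes s: "0 < s"
  shows "T s \<in> borel_measurable M"
proof -
  have "(\<lambda>\<omega>. T_explicit (s, \<omega>)) \<in> borel_measurable M"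
    by (rule measurable_compose[OF measurable_Pair1' T_explicit_measurable]) simp
  then show ?thesis by (rule measurable_cong[THEN iffD1, rotated]) (simp add: T_eq_explicit s)
qed

definition U_explicit :: "real \<times> 'a \<Rightarrow> real" where
  "U_explicit p = 1 / V_tilde (xi_path (snd p)) (dual_path (snd p)) (T_explicit p)"

lemma U_explicit_measurable: "U_explicit \<in> borel_measurable (borel \<Otimes>\<^sub>M M)"
proof -
  have "(\<lambda>p. (T_explicit p, snd p)) \<in> measurable (borel \<Otimes>\<^sub>M M) (borel \<Otimes>\<^sub>M M)"
    using T_explicit_measurable by measurable
  from measurable_compose[OF this joint_measurable_V_tilde]
  have [measurable]: "(\<lambda>p. V_tilde (xi_path (snd p)) (dual_path (snd p)) (T_explicit p)) \<in> borel_measurable (borel \<Otimes>\<^sub>M M)"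
    by simp
  show ?thesis unfolding U_explicit_def[abs_def] by measurable
qed

lemma U_eq_explicit: "\<omega> \<in> space M \<Longrightarrow> 0 < s \<Longrightarrow> U s \<omega> = U_explicit (s, \<omega>)"
  using T_eq_explicit[of \<omega> s] by (simp add: U_def U_tilde_def U_explicit_def T_def)

lemma set_integral_U_eq:
  fixes f :: "real \<Rightarrow> real"
  assumes "\<omega> \<in> space M"
  shows "(LBINT s:{0..t}. f (U s \<omega>)) = (LBINT s:{0..t}. f (U_explicit (s, \<omega>)))"
  unfolding set_lebesgue_integral_def
  by (rule integral_discrete_difference[of "{0}"]) (auto simp: indicator_def U_eq_explicit[OF assms])

lemma integral_U_measurable:
  fixes f :: "real \<Rightarrow> real"
  assumes f: "f \<in> borel_measurable borel"
  shows "(\<lambda>\<omega>. LBINT s:{0..t}. f (U s \<omega>)) \<in> borel_measurable M"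
proof -
  have "(\<lambda>q. (snd q, fst q)) \<in> measurable (M \<Otimes>\<^sub>M lborel) (borel \<Otimes>\<^sub>M M)" by measurable
  from measurable_compose[OF measurable_compose[OF this U_explicit_measurable] f]
  have [measurable]: "(\<lambda>q. f (U_explicit (snd q, fst q))) \<in> borel_measurable (M \<Otimes>\<^sub>M lborel)" .
  have "(\<lambda>q. indicator {0..t} (snd q) *\<^sub>R f (U_explicit (snd q, fst q))) \<in> borel_measurable (M \<Otimes>\<^sub>M lborel)"
    by measurable
  then have "(\<lambda>\<omega>. \<integral>s. indicator {0..t} s *\<^sub>R f (U_explicit (s, \<omega>)) \<partial>lborel) \<in> borel_measurable M"
    by (intro lborel.borel_measurable_lebesgue_integral) (simp only: case_prod_beta')
  then show ?thesis
    by (rule measurable_cong[THEN iffD1, rotated]) (simp only: set_integral_U_eq, simp only: set_lebesgue_integral_def)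
qed

text \<open>The substitution \<open>u = A r\<close>, with \<open>U (A r) = 1 / V r\<close>.\<close>
lemma time_change:
  fixes f :: "real \<Rightarrow> real"
  assumes f: "f \<in> borel_measurable borel" and g: "good \<omega>" and S: "0 \<le> S"
  shows "(LBINT u:{0..A S \<omega>}. f (U u \<omega>)) = (LBINT r:{0..S}. 1 / V r \<omega> * f (1 / V r \<omega>))"
proof -
  have w: "\<omega> \<in> space M" using g by (simp add: good_def)
  interpret A: positive_density "\<lambda>s. 1 / V s \<omega>" "\<lambda>t. A t \<omega>" by (rule A_density[OF g])
  have k: "(\<lambda>u. f (U_explicit (u, \<omega>))) \<in> borel_measurable borel"
    by (rule measurable_compose[OF measurable_compose[OF measurable_Pair2'[OF w] U_explicit_measurable] f])
  have U: "U_explicit (A r \<omega>, \<omega>) = 1 / V r \<omega>" if "0 < r" for r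
  proof -
    have pos: "0 < A r \<omega>" using A.H_strict_mono[of 0 r] A.H_0 that by simp
    have "T (A r \<omega>) \<omega> = r" by (rule T_unique[OF g _ refl pos]) (use that in simp)
    then show ?thesis using that unfolding U_explicit_def T_eq_explicit[OF w pos, symmetric]
      by (simp add: V_tilde_good[OF g])
  qed
  have "(LBINT u:{0..A S \<omega>}. f (U u \<omega>)) = (LBINT r:{0..S}. 1 / V r \<omega> * f (U_explicit (A r \<omega>, \<omega>)))"
    unfolding set_integral_U_eq[OF w] by (rule A.change_of_variables[OF S k])
  also have "\<dots> = (LBINT r:{0..S}. 1 / V r \<omega> * f (1 / V r \<omega>))"
    unfolding set_lebesgue_integral_def
    by (rule integral_discrete_difference[of "{0}"]) (auto simp: indicator_def U)
  finally show ?thesis .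
qed

lemma AE_good: "AE \<omega> in M. good \<omega>"
  using AE_dual_exp_finite AE_space
  by eventually_elim (simp add: good_def cadlag_nn_integral_exp(1) \<xi>h_cadlag)

lemma E_unbounded:
  assumes w: "\<omega> \<in> space M" and d: "filterlim (\<lambda>t. \<xi> t \<omega>) at_top at_top"
  shows "\<exists>t\<ge>0. c \<le> E t \<omega>"
proof -
  interpret E: positive_density "\<lambda>s. exp (\<xi> s \<omega>)" "\<lambda>t. E t \<omega>" by (rule E_density[OF w])
  obtain N where N: "\<And>s. N \<le> s \<Longrightarrow> 0 \<le> \<xi> s \<omega>"
    using d unfolding filterlim_at_top eventually_at_top_linorder by blast
  define a where "a = max 0 N"
  define t where "t = a + max 0 c"
  have at: "0 \<le> a" "a \<le> t" by (auto simp: a_def t_def)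
  have "c \<le> (\<integral>s. indicator {a<..t} s *\<^sub>R 1 \<partial>lborel)" using at by (simp add: t_def)
  also have "\<dots> \<le> (\<integral>s. indicator {a<..t} s *\<^sub>R exp (\<xi> s \<omega>) \<partial>lborel)"
  proof (rule integral_mono)
    show "integrable lborel (\<lambda>s. indicator {a<..t} s *\<^sub>R 1 :: real)" using at by (auto intro!: integrable_real_indicator)
    have "{a<..t} \<subseteq> {0..t}" using at by auto
    from set_integrable_subset[OF E.int _ this] show "integrable lborel (\<lambda>s. indicator {a<..t} s *\<^sub>R exp (\<xi> s \<omega>))"
      by (simp add: set_integrable_def)
    show "indicator {a<..t} s *\<^sub>R 1 \<le> indicator {a<..t} s *\<^sub>R exp (\<xi> s \<omega>)" for s
      using N[of s] by (auto simp: indicator_def a_def)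
  qed
  also have "\<dots> \<le> E t \<omega>" using E.H_add[OF at] E.H_nonneg[OF at(1)] by (simp add: set_lebesgue_integral_def)
  finally show ?thesis using at by (intro exI[of _ t]) auto
qed

text \<open>The almost sure event on which moreover \<open>T\<close> is a right inverse of \<open>A\<close> on the
  positive half-line.\<close>
definition regular :: "'a \<Rightarrow> bool" where
  "regular \<omega> \<longleftrightarrow> good \<omega> \<and> (\<forall>t>0. 0 \<le> T t \<omega> \<and> A (T t \<omega>) \<omega> = t)"

lemma AE_regular: "AE \<omega> in M. regular \<omega>"
  using AE_good drift[unfolded drifts_to_infinity_def]
proof eventually_elim
  case (elim \<omega>)
  then have w: "\<omega> \<in> space M" by (simp add: good_def)
  interpret A: positive_density "\<lambda>s. 1 / V s \<omega>" "\<lambda>t. A t \<omega>" by (rule A_density[OF elim(1)])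
  have "0 \<le> T t \<omega> \<and> A (T t \<omega>) \<omega> = t" if t: "0 < t" for t
  proof -
    obtain s where s: "0 \<le> s" "Ih \<omega> * exp t \<le> E s \<omega>" using E_unbounded[OF w elim(2)] by blast
    have I: "0 < Ih \<omega>" by (rule Ih_pos[OF elim(1)])
    have "t + ln (Ih \<omega>) = ln (Ih \<omega> * exp t)" using I by (simp add: ln_mult)
    also have "\<dots> \<le> ln (Ih \<omega> + E s \<omega>)" using I s by (subst ln_le_cancel_iff) (auto intro: add_pos_nonneg E_nonneg[OF w])
    finally have "t \<le> A s \<omega>" unfolding A_eq_ln[OF elim(1) s(1)] by simp
    then obtain S where S: "0 \<le> S" "A S \<omega> = t" using A.H_surj[OF s(1)] t by (metis less_imp_le)
    then show ?thesis using T_unique[OF elim(1) S t] by simp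
  qed
  with elim(1) show ?case by (simp add: regular_def)
qed

lemma regular_le_T_iff:
  assumes r: "regular \<omega>" and t: "0 < t" and s: "0 \<le> s"
  shows "s \<le> T t \<omega> \<longleftrightarrow> A s \<omega> \<le> t"
proof -
  interpret A: positive_density "\<lambda>s. 1 / V s \<omega>" "\<lambda>t. A t \<omega>" using r by (intro A_density) (simp add: regular_def)
  have T: "0 \<le> T t \<omega>" "A (T t \<omega>) \<omega> = t" using r t by (auto simp: regular_def)
  show ?thesis using A.H_mono[OF s, of "T t \<omega>"] A.H_strict_mono[OF T(1), of s] T by (cases "s \<le> T t \<omega>") auto
qed

lemma regular_time_change:
  fixes f :: "real \<Rightarrow> real"
  assumes f: "f \<in> borel_measurable borel" and r: "regular \<omega>" and t: "0 < t"
  shows "(LBINT u:{0..t}. f (U u \<omega>)) = (LBINT r:{0..T t \<omega>}. 1 / V r \<omega> * f (1 / V r \<omega>))"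
  using time_change[OF f, of \<omega> "T t \<omega>"] r t by (simp add: regular_def)

end

section \<open>Convergence in law\<close>

lemma cdf_distr_eq:
  assumes "prob_space M" "X \<in> borel_measurable M"
  shows "cdf (distr M borel X) x = measure M {\<omega>\<in>space M. X \<omega> \<le> x}"
  unfolding cdf_def2 using assms(2) by (subst measure_distr) (auto intro!: arg_cong[where f="measure M"])

definition tends_to_0_in_prob :: "'a measure \<Rightarrow> (real \<Rightarrow> 'a \<Rightarrow> real) \<Rightarrow> bool" where
  "tends_to_0_in_prob M D \<longleftrightarrow> (\<forall>e>0. ((\<lambda>t. measure M {\<omega>\<in>space M. e < \<bar>D t \<omega>\<bar>}) \<longlongrightarrow> 0) at_top)"

lemma (in real_distribution) ex_continuity_point:
  assumes "a < b"
  obtains y where "a < y" "y < b" "isCont (cdf M) y"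
proof -
  have "uncountable {a<..<b}" using assms by (simp add: uncountable_open_interval)
  moreover have "countable {y. \<not> isCont (cdf M) y}"
    using countable_atoms by (simp add: isCont_cdf zero_less_measure_iff[symmetric])
  ultimately have "\<not> {a<..<b} \<subseteq> {y. \<not> isCont (cdf M) y}" using countable_subset by blast
  then show ?thesis using that by auto
qed

lemma tendsto_realI:
  fixes f :: "'b \<Rightarrow> real"
  assumes "\<And>e. 0 < e \<Longrightarrow> eventually (\<lambda>t. f t < L + e) F" "\<And>e. 0 < e \<Longrightarrow> eventually (\<lambda>t. L - e < f t) F"
  shows "(f \<longlongrightarrow> L) F"
proof (rule order_tendstoI)
  show "eventually (\<lambda>t. a < f t) F" if "a < L" for a using assms(2)[of "L - a"] that by simp
  show "eventually (\<lambda>t. f t < a) F" if "L < a" for a using assms(1)[of "a - L"] that by simp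
qed

lemma isCont_ex_le:
  assumes "real_distribution L" "isCont (cdf L) x" "0 < e"
  obtains y where "x < y" "isCont (cdf L) y" "cdf L y < cdf L x + e"
proof -
  interpret real_distribution L by fact
  have "eventually (\<lambda>y. cdf L y < cdf L x + e) (at x)"
    using assms(2,3) by (intro order_tendstoD(2)[OF _ less_add_same_cancel1[THEN iffD2]]) (auto simp: isCont_def)
  then obtain d where d: "0 < d" "\<And>y. y \<noteq> x \<Longrightarrow> dist y x < d \<Longrightarrow> cdf L y < cdf L x + e"
    unfolding eventually_at by auto
  obtain y where "x < y" "y < x + d" "isCont (cdf L) y" using ex_continuity_point[of x "x + d"] d(1) by auto
  then show ?thesis using d(2)[of y] that by (auto simp: dist_real_def)
qed

lemma isCont_ex_ge:
  assumes "real_distribution L" "isCont (cdf L) x" "0 < e"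
  obtains y where "y < x" "isCont (cdf L) y" "cdf L x - e < cdf L y"
proof -
  interpret real_distribution L by fact
  have "eventually (\<lambda>y. cdf L x - e < cdf L y) (at x)"
    using assms(2,3) by (intro order_tendstoD(1)) (auto simp: isCont_def)
  then obtain d where d: "0 < d" "\<And>y. y \<noteq> x \<Longrightarrow> dist y x < d \<Longrightarrow> cdf L x - e < cdf L y"
    unfolding eventually_at by auto
  obtain y where "x - d < y" "y < x" "isCont (cdf L) y" using ex_continuity_point[of "x - d" x] d(1) by auto
  then show ?thesis using d(2)[of y] that by (auto simp: dist_real_def)
qed

context prob_space
begin

lemma converges_in_lawD:
  assumes "converges_in_law M X L" "\<And>t. 0 < t \<Longrightarrow> X t \<in> borel_measurable M" "isCont (cdf L) x"
  shows "((\<lambda>t. prob {\<omega>\<in>space M. X t \<omega> \<le> x}) \<longlongrightarrow> cdf L x) at_top"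
proof -
  have "((\<lambda>t. cdf (distr M borel (X t)) x) \<longlongrightarrow> cdf L x) at_top"
    using assms(1,3) by (auto simp: converges_in_law_def)
  moreover have "eventually (\<lambda>t. cdf (distr M borel (X t)) x = prob {\<omega>\<in>space M. X t \<omega> \<le> x}) at_top"
    using eventually_gt_at_top[of 0]
    by eventually_elim (rule cdf_distr_eq[OF prob_space_axioms assms(2)])
  ultimately show ?thesis by (rule Lim_transform_eventually)
qed

lemma converges_in_lawI:
  assumes "real_distribution L" "\<And>t. 0 < t \<Longrightarrow> X t \<in> borel_measurable M"
    and "\<And>x. isCont (cdf L) x \<Longrightarrow> ((\<lambda>t. prob {\<omega>\<in>space M. X t \<omega> \<le> x}) \<longlongrightarrow> cdf L x) at_top"
  shows "converges_in_law M X L"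
  unfolding converges_in_law_def
proof (intro conjI allI impI assms(1))
  fix x assume x: "isCont (cdf L) x"
  have "eventually (\<lambda>t. prob {\<omega>\<in>space M. X t \<omega> \<le> x} = cdf (distr M borel (X t)) x) at_top"
    using eventually_gt_at_top[of 0]
    by eventually_elim (rule cdf_distr_eq[OF prob_space_axioms assms(2), symmetric])
  with assms(3)[OF x] show "((\<lambda>t. cdf (distr M borel (X t)) x) \<longlongrightarrow> cdf L x) at_top"
    by (rule Lim_transform_eventually)
qed

lemma prob_le_add:
  assumes "A \<in> events" "B \<in> events" "C \<in> events" "AE \<omega> in M. \<omega> \<in> A \<longrightarrow> \<omega> \<in> B \<or> \<omega> \<in> C"
  shows "prob A \<le> prob B + prob C"
proof -
  have "prob A \<le> prob (B \<union> C)" using assms by (intro finite_measure_mono_AE) auto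
  also have "\<dots> \<le> prob B + prob C" using assms by (intro measure_Un_le) auto
  finally show ?thesis .
qed

lemma prob_shift_le:
  fixes X Y :: "'a \<Rightarrow> real"
  assumes [measurable]: "X \<in> borel_measurable M" "Y \<in> borel_measurable M"
  shows "prob {\<omega>\<in>space M. X \<omega> \<le> x} \<le> prob {\<omega>\<in>space M. Y \<omega> \<le> x + e} + prob {\<omega>\<in>space M. e < \<bar>X \<omega> - Y \<omega>\<bar>}"
proof (rule prob_le_add)
  have "Y \<omega> \<le> x + e \<or> e < \<bar>X \<omega> - Y \<omega>\<bar>" if "X \<omega> \<le> x" for \<omega>
    using that by (intro disjCI) linarith
  then show "AE \<omega> in M. \<omega> \<in> {\<omega>\<in>space M. X \<omega> \<le> x} \<longrightarrow> \<omega> \<in> {\<omega>\<in>space M. Y \<omega> \<le> x + e} \<or> \<omega> \<in> {\<omega>\<in>space M. e < \<bar>X \<omega> - Y \<omega>\<bar>}"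
    by (intro AE_I2) blast
qed measurable

lemma tends_to_0_in_prob_uminus:
  "tends_to_0_in_prob M (\<lambda>t \<omega>. X t \<omega> - Y t \<omega>) \<Longrightarrow> tends_to_0_in_prob M (\<lambda>t \<omega>. Y t \<omega> - X t \<omega>)"
  by (simp add: tends_to_0_in_prob_def abs_minus_commute)

lemma slutsky:
  assumes L: "converges_in_law M X L" and D: "tends_to_0_in_prob M (\<lambda>t \<omega>. X t \<omega> - Y t \<omega>)"
    and X: "\<And>t. 0 < t \<Longrightarrow> X t \<in> borel_measurable M" and Y: "\<And>t. 0 < t \<Longrightarrow> Y t \<in> borel_measurable M"
  shows "converges_in_law M Y L"
proof (rule converges_in_lawI[OF _ Y])
  show rd: "real_distribution L" using L by (simp add: converges_in_law_def)
  fix x assume x: "isCont (cdf L) x"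
  show "((\<lambda>t. prob {\<omega>\<in>space M. Y t \<omega> \<le> x}) \<longlongrightarrow> cdf L x) at_top"
  proof (rule tendsto_realI)
    fix e :: real assume e: "0 < e"
    obtain y where y: "x < y" "isCont (cdf L) y" "cdf L y < cdf L x + e / 2" using isCont_ex_le[OF rd x, of "e / 2"] e by auto
    have "((\<lambda>t. prob {\<omega>\<in>space M. X t \<omega> \<le> y} + prob {\<omega>\<in>space M. y - x < \<bar>X t \<omega> - Y t \<omega>\<bar>}) \<longlongrightarrow> cdf L y + 0) at_top"
      using D y by (intro tendsto_add converges_in_lawD[OF L X]) (auto simp: tends_to_0_in_prob_def)
    then have "eventually (\<lambda>t. prob {\<omega>\<in>space M. X t \<omega> \<le> y} + prob {\<omega>\<in>space M. y - x < \<bar>X t \<omega> - Y t \<omega>\<bar>} < cdf L x + e) at_top"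
      using y e by (intro order_tendstoD(2)) auto
    then show "eventually (\<lambda>t. prob {\<omega>\<in>space M. Y t \<omega> \<le> x} < cdf L x + e) at_top"
      using eventually_gt_at_top[of 0]
    proof eventually_elim
      case (elim t)
      then show ?case using prob_shift_le[OF Y[OF elim(2)] X[OF elim(2)], of x "y - x"] by (simp add: abs_minus_commute)
    qed
  next
    fix e :: real assume e: "0 < e"
    obtain y where y: "y < x" "isCont (cdf L) y" "cdf L x - e / 2 < cdf L y" using isCont_ex_ge[OF rd x, of "e / 2"] e by auto
    have "((\<lambda>t. prob {\<omega>\<in>space M. X t \<omega> \<le> y} - prob {\<omega>\<in>space M. x - y < \<bar>X t \<omega> - Y t \<omega>\<bar>}) \<longlongrightarrow> cdf L y - 0) at_top"
      using D y by (intro tendsto_diff converges_in_lawD[OF L X]) (auto simp: tends_to_0_in_prob_def)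
    then have "eventually (\<lambda>t. cdf L x - e < prob {\<omega>\<in>space M. X t \<omega> \<le> y} - prob {\<omega>\<in>space M. x - y < \<bar>X t \<omega> - Y t \<omega>\<bar>}) at_top"
      using y e by (intro order_tendstoD(1)) auto
    then show "eventually (\<lambda>t. cdf L x - e < prob {\<omega>\<in>space M. Y t \<omega> \<le> x}) at_top"
      using eventually_gt_at_top[of 0]
    proof eventually_elim
      case (elim t)
      then show ?case using prob_shift_le[OF X[OF elim(2)] Y[OF elim(2)], of y "x - y"] by simp
    qed
  qed
qed

text \<open>Evaluating the distribution functions at moving points \<open>c t\<close> is harmless, as the limit is
  squeezed between its values at nearby continuity points.\<close>
lemma converges_in_law_moving:
  assumes L: "converges_in_law M X L" and X: "\<And>t. 0 < t \<Longrightarrow> X t \<in> borel_measurable M"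
    and s: "filterlim s at_top at_top" and c: "(c \<longlongrightarrow> x) at_top" and x: "isCont (cdf L) x"
  shows "((\<lambda>t. prob {\<omega>\<in>space M. X (s t) \<omega> \<le> c t}) \<longlongrightarrow> cdf L x) at_top"
    and "((\<lambda>t. prob {\<omega>\<in>space M. X (s t) \<omega> < c t}) \<longlongrightarrow> cdf L x) at_top"
proof -
  have rd: "real_distribution L" using L by (simp add: converges_in_law_def)
  have spos: "eventually (\<lambda>t. 0 < s t) at_top" using s by (simp add: filterlim_at_top_dense)
  have up: "eventually (\<lambda>t. prob {\<omega>\<in>space M. X (s t) \<omega> \<le> c t} < cdf L x + e) at_top" if e: "0 < e" for e
  proof -
    obtain y where y: "x < y" "isCont (cdf L) y" "cdf L y < cdf L x + e" using isCont_ex_le[OF rd x e] .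
    have "((\<lambda>t. prob {\<omega>\<in>space M. X (s t) \<omega> \<le> y}) \<longlongrightarrow> cdf L y) at_top"
      by (rule filterlim_compose[OF converges_in_lawD[OF L X y(2)] s])
    from order_tendstoD(2)[OF this y(3)] order_tendstoD(2)[OF c y(1)] spos
    show ?thesis
    proof eventually_elim
      case (elim t)
      note [measurable] = X[OF elim(3)]
      have "prob {\<omega>\<in>space M. X (s t) \<omega> \<le> c t} \<le> prob {\<omega>\<in>space M. X (s t) \<omega> \<le> y}"
        using elim(2) by (intro finite_measure_mono) auto
      with elim(1) show ?case by simp
    qed
  qed
  have low: "eventually (\<lambda>t. cdf L x - e < prob {\<omega>\<in>space M. X (s t) \<omega> < c t}) at_top" if e: "0 < e" for e
  proof -
    obtain y where y: "y < x" "isCont (cdf L) y" "cdf L x - e < cdf L y" using isCont_ex_ge[OF rd x e] .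
    have "((\<lambda>t. prob {\<omega>\<in>space M. X (s t) \<omega> \<le> y}) \<longlongrightarrow> cdf L y) at_top"
      by (rule filterlim_compose[OF converges_in_lawD[OF L X y(2)] s])
    from order_tendstoD(1)[OF this y(3)] order_tendstoD(1)[OF c y(1)] spos
    show ?thesis
    proof eventually_elim
      case (elim t)
      note [measurable] = X[OF elim(3)]
      have "prob {\<omega>\<in>space M. X (s t) \<omega> \<le> y} \<le> prob {\<omega>\<in>space M. X (s t) \<omega> < c t}"
        using elim(2) by (intro finite_measure_mono) auto
      with elim(1) show ?case by simp
    qed
  qed
  have le: "eventually (\<lambda>t. prob {\<omega>\<in>space M. X (s t) \<omega> < c t} \<le> prob {\<omega>\<in>space M. X (s t) \<omega> \<le> c t}) at_top"
    using spos
  proof eventually_elim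
    case (elim t)
    note [measurable] = X[OF elim]
    show ?case by (intro finite_measure_mono) auto
  qed
  show "((\<lambda>t. prob {\<omega>\<in>space M. X (s t) \<omega> \<le> c t}) \<longlongrightarrow> cdf L x) at_top"
  proof (rule tendsto_realI[OF up])
    fix e :: real assume "0 < e"
    from low[OF this] le show "eventually (\<lambda>t. cdf L x - e < prob {\<omega>\<in>space M. X (s t) \<omega> \<le> c t}) at_top"
      by eventually_elim simp
  qed
  show "((\<lambda>t. prob {\<omega>\<in>space M. X (s t) \<omega> < c t}) \<longlongrightarrow> cdf L x) at_top"
  proof (rule tendsto_realI[OF _ low])
    fix e :: real assume "0 < e"
    from up[OF this] le show "eventually (\<lambda>t. prob {\<omega>\<in>space M. X (s t) \<omega> < c t} < cdf L x + e) at_top"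
      by eventually_elim simp
  qed
qed

lemma converges_in_law_scale:
  assumes L: "converges_in_law M X L" and X: "\<And>t. 0 < t \<Longrightarrow> X t \<in> borel_measurable M"
    and s: "filterlim s at_top at_top" "\<And>t. 0 < t \<Longrightarrow> 0 < s t" and c: "(c \<longlongrightarrow> k) at_top" "0 < k" "\<And>t. 0 < t \<Longrightarrow> 0 < c t"
  shows "converges_in_law M (\<lambda>t \<omega>. c t * X (s t) \<omega>) (distr L borel (\<lambda>x. k * x))"
proof -
  interpret L: real_distribution L using L by (simp add: converges_in_law_def)
  interpret kL: real_distribution "distr L borel (\<lambda>x. k * x)"
    by (rule L.real_distribution_distr) simp
  show ?thesis
  proof (rule converges_in_lawI[OF kL.real_distribution_axioms])
    show "(\<lambda>\<omega>. c t * X (s t) \<omega>) \<in> borel_measurable M" if "0 < t" for t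
      by (intro borel_measurable_times borel_measurable_const X s that)
    fix x assume x: "isCont (cdf (distr L borel (\<lambda>x. k * x))) x"
    have cdf: "cdf (distr L borel (\<lambda>x. k * x)) x = cdf L (x / k)"
    proof -
      have "(\<lambda>x. k * x) -` {..x} \<inter> space L = {..x / k}" using c(2) by (auto simp: field_simps)
      then show ?thesis unfolding cdf_def2 by (subst measure_distr) auto
    qed
    have "measure (distr L borel (\<lambda>x. k * x)) {x} = measure L {x / k}"
    proof -
      have "(\<lambda>x. k * x) -` {x} \<inter> space L = {x / k}" using c(2) by (auto simp: field_simps)
      then show ?thesis by (subst measure_distr) auto
    qed
    then have xk: "isCont (cdf L) (x / k)" using x kL.isCont_cdf L.isCont_cdf by simp
    have "((\<lambda>t. x / c t) \<longlongrightarrow> x / k) at_top" using c by (intro tendsto_intros) auto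
    from converges_in_law_moving(1)[OF L X s(1) this xk]
    have "((\<lambda>t. prob {\<omega>\<in>space M. X (s t) \<omega> \<le> x / c t}) \<longlongrightarrow> cdf L (x / k)) at_top" .
    moreover have "eventually (\<lambda>t. prob {\<omega>\<in>space M. X (s t) \<omega> \<le> x / c t} = prob {\<omega>\<in>space M. c t * X (s t) \<omega> \<le> x}) at_top"
      using eventually_gt_at_top[of 0]
    proof eventually_elim
      case (elim t)
      show ?case using c(3)[OF elim] by (intro arg_cong[where f=prob]) (auto simp: field_simps)
    qed
    ultimately show "((\<lambda>t. prob {\<omega>\<in>space M. c t * X (s t) \<omega> \<le> x}) \<longlongrightarrow> cdf (distr L borel (\<lambda>x. k * x)) x) at_top"
      unfolding cdf by (rule Lim_transform_eventually)
  qed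
qed

lemma converges_in_law_tight:
  assumes L: "converges_in_law M X L" and X: "\<And>t. 0 < t \<Longrightarrow> X t \<in> borel_measurable M" and e: "0 < e"
  obtains K where "0 < K" "eventually (\<lambda>t. prob {\<omega>\<in>space M. K < X t \<omega>} < e) at_top"
proof -
  interpret L: real_distribution L using L by (simp add: converges_in_law_def)
  have "eventually (\<lambda>K. 1 - e / 2 < cdf L K) at_top"
    using e by (intro order_tendstoD(1)[OF L.cdf_lim_at_top_prob]) simp
  then obtain K0 where K0: "\<And>K. K0 \<le> K \<Longrightarrow> 1 - e / 2 < cdf L K" unfolding eventually_at_top_linorder by blast
  obtain K where K: "max 0 K0 < K" "isCont (cdf L) K" using L.ex_continuity_point[of "max 0 K0" "max 0 K0 + 1"] by auto
  have "eventually (\<lambda>t. 1 - e < prob {\<omega>\<in>space M. X t \<omega> \<le> K}) at_top"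
    using K0[of K] K e by (intro order_tendstoD(1)[OF converges_in_lawD[OF L X K(2)]]) auto
  then have "eventually (\<lambda>t. prob {\<omega>\<in>space M. K < X t \<omega>} < e) at_top"
    using eventually_gt_at_top[of 0]
  proof eventually_elim
    case (elim t)
    note [measurable] = X[OF elim(2)]
    have "{\<omega>\<in>space M. K < X t \<omega>} = space M - {\<omega>\<in>space M. X t \<omega> \<le> K}" by auto
    then have "prob {\<omega>\<in>space M. K < X t \<omega>} = 1 - prob {\<omega>\<in>space M. X t \<omega> \<le> K}" by (simp add: prob_compl)
    with elim show ?case by simp
  qed
  then show ?thesis using K that by auto
qed

end

text \<open>The effect on limit laws of inverting a monotone process under regularly varying scalings. For positive
  \<open>x\<close> and \<open>y\<close> the condition \<open>x powr (- \<alpha>) \<le> y\<close> means \<open>y powr (- (1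
  / \<alpha>)) \<le> x\<close>, and the latter threshold is the limit of \<open>c y\<close>. The lemma serves the passage
  from \<open>A\<close> to \<open>T\<close> and, with \<open>1 / \<alpha>\<close> for \<open>\<alpha>\<close>, the way
  back.\<close>
lemma (in prob_space) reciprocal_power_limit:
  assumes S: "converges_in_law M X S" and pos: "AE x in S. 0 < x" and alpha: "0 < \<alpha>"
    and X: "\<And>t. 0 < t \<Longrightarrow> X t \<in> borel_measurable M" and Z: "\<And>t. 0 < t \<Longrightarrow> Z t \<in> borel_measurable M"
    and Z_pos: "\<And>t. 0 < t \<Longrightarrow> prob {\<omega>\<in>space M. Z t \<omega> \<le> 0} = 0"
    and s: "\<And>y. 0 < y \<Longrightarrow> filterlim (s y) at_top at_top"
    and c: "\<And>y. 0 < y \<Longrightarrow> (c y \<longlongrightarrow> y powr (- (1 / \<alpha>))) at_top"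
    and Z_X: "\<And>y t. 0 < y \<Longrightarrow> 0 < t \<Longrightarrow> prob {\<omega>\<in>space M. Z t \<omega> \<le> y} = 1 - prob {\<omega>\<in>space M. X (s y t) \<omega> < c y t}"
  shows "converges_in_law M Z (distr S borel (\<lambda>x. x powr (- \<alpha>)))"
proof -
  interpret S: real_distribution S using S by (simp add: converges_in_law_def)
  let ?P = "\<lambda>x. x powr (- \<alpha>) :: real"
  have Pm: "?P \<in> borel_measurable S" by (simp cong: measurable_cong_sets)
  interpret D: real_distribution "distr S borel ?P" by (rule S.real_distribution_distr[OF Pm])
  have inv: "x powr (- \<alpha>) \<le> y \<longleftrightarrow> y powr (- (1 / \<alpha>)) \<le> x" "x powr (- \<alpha>) = y \<longleftrightarrow> y powr (- (1 / \<alpha>)) = x"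
    if "0 < x" "0 < y" for x y :: real
  proof -
    have x: "(x powr (- \<alpha>)) powr (- (1 / \<alpha>)) = x" using that alpha by (simp add: powr_powr)
    have y: "(y powr (- (1 / \<alpha>))) powr (- \<alpha>) = y" using that alpha by (simp add: powr_powr)
    show "x powr (- \<alpha>) \<le> y \<longleftrightarrow> y powr (- (1 / \<alpha>)) \<le> x"
    proof
      assume "x powr (- \<alpha>) \<le> y"
      then have "y powr (- (1 / \<alpha>)) \<le> (x powr (- \<alpha>)) powr (- (1 / \<alpha>))"
        using that alpha by (intro powr_mono2') auto
      then show "y powr (- (1 / \<alpha>)) \<le> x" unfolding x .
    next
      assume "y powr (- (1 / \<alpha>)) \<le> x"
      then have "x powr (- \<alpha>) \<le> (y powr (- (1 / \<alpha>))) powr (- \<alpha>)"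
        using that alpha by (intro powr_mono2') auto
      then show "x powr (- \<alpha>) \<le> y" unfolding y .
    qed
    show "x powr (- \<alpha>) = y \<longleftrightarrow> y powr (- (1 / \<alpha>)) = x"
    proof
      assume h: "x powr (- \<alpha>) = y"
      show "y powr (- (1 / \<alpha>)) = x" using x unfolding h .
    next
      assume h: "y powr (- (1 / \<alpha>)) = x"
      show "x powr (- \<alpha>) = y" using y unfolding h .
    qed
  qed
  show ?thesis
  proof (rule converges_in_lawI[OF D.real_distribution_axioms Z])
    fix y assume y: "isCont (cdf (distr S borel ?P)) y"
    show "((\<lambda>t. prob {\<omega>\<in>space M. Z t \<omega> \<le> y}) \<longlongrightarrow> cdf (distr S borel ?P) y) at_top"
    proof (cases "0 < y")
      case False
      have "measure S (?P -` {..y} \<inter> space S) = measure S {}"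
      proof (rule S.finite_measure_eq_AE)
        show "AE x in S. x \<in> ?P -` {..y} \<inter> space S \<longleftrightarrow> x \<in> {}"
          using pos
        proof eventually_elim
          case (elim x)
          then have "0 < x powr (- \<alpha>)" by simp
          with False have "\<not> x powr (- \<alpha>) \<le> y" by linarith
          then show ?case by blast
        qed
      qed (auto intro: measurable_sets[OF Pm, simplified])
      then have cdf0: "cdf (distr S borel ?P) y = 0" unfolding cdf_def2 using Pm by (simp add: measure_distr)
      have "eventually (\<lambda>t. 0 = prob {\<omega>\<in>space M. Z t \<omega> \<le> y}) at_top"
        using eventually_gt_at_top[of 0]
      proof eventually_elim
        case (elim t)
        note [measurable] = Z[OF elim]
        have "prob {\<omega>\<in>space M. Z t \<omega> \<le> y} \<le> prob {\<omega>\<in>space M. Z t \<omega> \<le> 0}"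
          using False by (intro finite_measure_mono) auto
        then show ?case using Z_pos[OF elim] measure_nonneg[of M "{\<omega>\<in>space M. Z t \<omega> \<le> y}"] by simp
      qed
      then show ?thesis unfolding cdf0 by (rule Lim_transform_eventually[OF tendsto_const])
    next
      case True
      let ?c = "y powr (- (1 / \<alpha>))"
      have c0: "0 < ?c" using True by simp
      have "measure (distr S borel ?P) {y} = measure S {?c}"
      proof (subst measure_distr[OF Pm])
        show "measure S (?P -` {y} \<inter> space S) = measure S {?c}"
        proof (rule S.finite_measure_eq_AE)
          show "AE x in S. x \<in> ?P -` {y} \<inter> space S \<longleftrightarrow> x \<in> {?c}"
            using pos by eventually_elim (use inv(2)[OF _ True] in auto)
        qed (auto intro: measurable_sets[OF Pm, simplified])
      qed simp
      then have atom: "measure S {?c} = 0" using y D.isCont_cdf by simp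
      then have cont: "isCont (cdf S) ?c" using S.isCont_cdf by simp
      have cdf: "cdf (distr S borel ?P) y = 1 - cdf S ?c"
      proof -
        have "cdf (distr S borel ?P) y = measure S (?P -` {..y} \<inter> space S)" unfolding cdf_def2 using Pm by (simp add: measure_distr)
        also have "\<dots> = measure S {?c..}"
        proof (rule S.finite_measure_eq_AE)
          show "AE x in S. x \<in> ?P -` {..y} \<inter> space S \<longleftrightarrow> x \<in> {?c..}"
            using pos by eventually_elim (use inv(1)[OF _ True] in auto)
        qed (auto intro: measurable_sets[OF Pm, simplified])
        also have "\<dots> = measure S ({?c} \<union> {?c<..})" by (intro arg_cong[where f="measure S"]) auto
        also have "\<dots> = measure S {?c} + measure S {?c<..}" by (intro S.finite_measure_Union) auto
        also have "{?c<..} = space S - {..?c}" by (auto simp: S.space_eq_univ)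
        also have "measure S (space S - {..?c}) = 1 - cdf S ?c" unfolding cdf_def2 by (intro S.prob_compl) auto
        finally show ?thesis using atom by simp
      qed
      from converges_in_law_moving(2)[OF S X s[OF True] c[OF True] cont]
      have "((\<lambda>t. 1 - prob {\<omega>\<in>space M. X (s y t) \<omega> < c y t}) \<longlongrightarrow> 1 - cdf S ?c) at_top"
        by (intro tendsto_diff tendsto_const)
      moreover have "eventually (\<lambda>t. 1 - prob {\<omega>\<in>space M. X (s y t) \<omega> < c y t} = prob {\<omega>\<in>space M. Z t \<omega> \<le> y}) at_top"
        using eventually_gt_at_top[of 0] by eventually_elim (rule Z_X[OF True, symmetric])
      ultimately show ?thesis unfolding cdf by (rule Lim_transform_eventually)
    qed
  qed
qed

section \<open>From the process to the inverse of its additive functional\<close>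

locale scaled_levy_dual_pair = levy_dual_pair +
  fixes \<alpha> :: real and a b :: "real \<Rightarrow> real"
  assumes alpha: "0 < \<alpha>"
    and a_pos: "\<And>t. 0 < t \<Longrightarrow> 0 < a t" and a_rv: "regularly_varying a \<alpha>"
    and b_pos: "\<And>t. 0 < t \<Longrightarrow> 0 < b t" and b_rv: "regularly_varying b (1 / \<alpha>)"
    and ab: "(\<lambda>t. a (b t)) \<sim>[at_top] (\<lambda>t. t)" and ba: "(\<lambda>t. b (a t)) \<sim>[at_top] (\<lambda>t. t)"
begin

lemma a_at_top: "filterlim a at_top at_top"
  using a_pos by (intro regularly_varying_at_top[OF a_rv alpha]) auto

lemma b_at_top: "filterlim b at_top at_top"
  using b_pos alpha by (intro regularly_varying_at_top[OF b_rv]) auto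

lemma a_scale: "0 < c \<Longrightarrow> ((\<lambda>t. a (c * t) / a t) \<longlongrightarrow> c powr \<alpha>) at_top"
  and b_scale: "0 < c \<Longrightarrow> ((\<lambda>t. b (c * t) / b t) \<longlongrightarrow> c powr (1 / \<alpha>)) at_top"
  using a_rv b_rv by (auto simp: regularly_varying_def)

lemma b_inverse: "((\<lambda>t. b (a t) / t) \<longlongrightarrow> 1) at_top" and a_inverse: "((\<lambda>t. a (b t) / t) \<longlongrightarrow> 1) at_top"
proof -
  have r: "((\<lambda>t. f t / t) \<longlongrightarrow> 1) at_top" if "f \<sim>[at_top] (\<lambda>t. t)" for f :: "real \<Rightarrow> real"
  proof -
    have "eventually (\<lambda>t. (if f t = 0 \<and> t = 0 then 1 else f t / t) = f t / t) at_top"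
      using eventually_gt_at_top[of 0] by eventually_elim auto
    with that[unfolded asymp_equiv_def] show ?thesis by (rule Lim_transform_eventually)
  qed
  show "((\<lambda>t. b (a t) / t) \<longlongrightarrow> 1) at_top" "((\<lambda>t. a (b t) / t) \<longlongrightarrow> 1) at_top" by (rule r[OF ba], rule r[OF ab])
qed

lemma b_scaled_inverse: "0 < y \<Longrightarrow> ((\<lambda>t. t / b (y * a t)) \<longlongrightarrow> y powr (- (1 / \<alpha>))) at_top"
proof -
  assume y: "0 < y"
  have "((\<lambda>t. (b (y * a t) / b (a t)) * (b (a t) / t)) \<longlongrightarrow> y powr (1 / \<alpha>) * 1) at_top"
    by (intro tendsto_mult filterlim_compose[OF b_scale[OF y] a_at_top] b_inverse)
  from tendsto_inverse[OF this] y
  have "((\<lambda>t. inverse ((b (y * a t) / b (a t)) * (b (a t) / t))) \<longlongrightarrow> y powr (- (1 / \<alpha>))) at_top"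
    by (simp add: powr_minus)
  moreover have "eventually (\<lambda>t. inverse ((b (y * a t) / b (a t)) * (b (a t) / t)) = t / b (y * a t)) at_top"
    using eventually_gt_at_top[of 0]
  proof eventually_elim
    case (elim t)
    have "0 < b (a t)" "0 < b (y * a t)" using a_pos[OF elim] y by (auto intro!: b_pos)
    then show ?case by simp
  qed
  ultimately show ?thesis by (rule Lim_transform_eventually)
qed

lemma a_scaled_inverse: "0 < y \<Longrightarrow> ((\<lambda>s. s / a (y * b s)) \<longlongrightarrow> y powr (- \<alpha>)) at_top"
proof -
  assume y: "0 < y"
  have "((\<lambda>t. (a (y * b t) / a (b t)) * (a (b t) / t)) \<longlongrightarrow> y powr \<alpha> * 1) at_top"
    by (intro tendsto_mult filterlim_compose[OF a_scale[OF y] b_at_top] a_inverse)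
  from tendsto_inverse[OF this] y
  have "((\<lambda>t. inverse ((a (y * b t) / a (b t)) * (a (b t) / t))) \<longlongrightarrow> y powr (- \<alpha>)) at_top"
    by (simp add: powr_minus)
  moreover have "eventually (\<lambda>t. inverse ((a (y * b t) / a (b t)) * (a (b t) / t)) = t / a (y * b t)) at_top"
    using eventually_gt_at_top[of 0]
  proof eventually_elim
    case (elim t)
    have "0 < a (b t)" "0 < a (y * b t)" using b_pos[OF elim] y by (auto intro!: a_pos)
    then show ?case by simp
  qed
  ultimately show ?thesis by (rule Lim_transform_eventually)
qed

text \<open>The three processes on the scales on which they are expected to converge.\<close>
definition X\<xi> :: "real \<Rightarrow> 'a \<Rightarrow> real" where "X\<xi> t \<omega> = inverse (b t) * \<xi> t \<omega>"
definition XA :: "real \<Rightarrow> 'a \<Rightarrow> real" where "XA t \<omega> = inverse (b t) * A t \<omega>"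
definition XT :: "real \<Rightarrow> 'a \<Rightarrow> real" where "XT t \<omega> = 1 / a t * T t \<omega>"

lemma X\<xi>_measurable: "0 < t \<Longrightarrow> X\<xi> t \<in> borel_measurable M"
  and XA_measurable: "0 < t \<Longrightarrow> XA t \<in> borel_measurable M"
  and XT_measurable: "0 < t \<Longrightarrow> XT t \<in> borel_measurable M"
  unfolding X\<xi>_def[abs_def] XA_def[abs_def] XT_def[abs_def]
  by (intro borel_measurable_times borel_measurable_const L(2) A_measurable T_measurable; simp)+

text \<open>The difference of \<open>A t\<close> and \<open>\<xi> t\<close> is \<open>ln (V t) - ln (V 0)\<close>, which
  is tight by stationarity.\<close>
lemma XA_minus_X\<xi>: "tends_to_0_in_prob M (\<lambda>t \<omega>. XA t \<omega> - X\<xi> t \<omega>)"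
  unfolding tends_to_0_in_prob_def
proof (intro allI impI)
  fix e :: real assume e: "0 < e"
  interpret \<mu>: prob_space \<mu> by (rule prob_space_\<mu>)
  let ?S = "\<lambda>c. {v::real. c < \<bar>ln v\<bar>}"
  have Sm: "?S c \<in> sets borel" for c by measurable
  have tail: "((\<lambda>c. measure \<mu> (?S c)) \<longlongrightarrow> 0) at_top"
  proof (rule tendstoI)
    fix r :: real assume r: "0 < r"
    have "(\<lambda>n. measure \<mu> (?S (real n))) \<longlonglongrightarrow> measure \<mu> (\<Inter>n. ?S (real n))"
      using Sm by (intro \<mu>.finite_Lim_measure_decseq) (auto simp: decseq_def)
    moreover have "(\<Inter>n. ?S (real n)) = {}"
    proof -
      have "\<exists>n. \<not> real n < \<bar>ln v\<bar>" for v :: real using reals_Archimedean2[of "\<bar>ln v\<bar>"] by (meson less_asym)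
      then show ?thesis by blast
    qed
    ultimately have "(\<lambda>n. measure \<mu> (?S (real n))) \<longlonglongrightarrow> 0" by simp
    from order_tendstoD(2)[OF this r] obtain n where n: "measure \<mu> (?S (real n)) < r"
      unfolding eventually_sequentially by auto
    show "eventually (\<lambda>c. dist (measure \<mu> (?S c)) 0 < r) at_top"
      using eventually_ge_at_top[of "real n"]
    proof eventually_elim
      case (elim c)
      have "measure \<mu> (?S c) \<le> measure \<mu> (?S (real n))" using Sm elim by (intro \<mu>.finite_measure_mono) auto
      with n show ?case by (simp add: dist_real_def)
    qed
  qed
  have "filterlim (\<lambda>t. e / 2 * b t) at_top at_top"
    using e by (intro filterlim_tendsto_pos_mult_at_top[OF tendsto_const] b_at_top) simp
  from filterlim_compose[OF tail this]
  have lim: "((\<lambda>t. 2 * measure \<mu> (?S (e / 2 * b t))) \<longlongrightarrow> 2 * 0) at_top" by (intro tendsto_mult tendsto_const)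
  have "eventually (\<lambda>t. prob {\<omega>\<in>space M. e < \<bar>XA t \<omega> - X\<xi> t \<omega>\<bar>} \<le> 2 * measure \<mu> (?S (e / 2 * b t))) at_top"
    using eventually_gt_at_top[of 0]
  proof eventually_elim
    case (elim t)
    note [measurable] = XA_measurable[OF elim] X\<xi>_measurable[OF elim] V_measurable[OF less_imp_le[OF elim]] V_measurable[OF order_refl]
    let ?c = "e / 2 * b t"
    have law: "prob {\<omega>\<in>space M. ?c < \<bar>ln (V s \<omega>)\<bar>} = measure \<mu> (?S ?c)" if "0 \<le> s" for s
      unfolding V_law[OF that, symmetric] measure_distr[OF V_measurable[OF that] Sm]
      by (rule arg_cong[where f=prob]) blast
    have "prob {\<omega>\<in>space M. e < \<bar>XA t \<omega> - X\<xi> t \<omega>\<bar>} \<le>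
        prob {\<omega>\<in>space M. ?c < \<bar>ln (V t \<omega>)\<bar>} + prob {\<omega>\<in>space M. ?c < \<bar>ln (V 0 \<omega>)\<bar>}"
    proof (rule prob_le_add)
      show "AE \<omega> in M. \<omega> \<in> {\<omega>\<in>space M. e < \<bar>XA t \<omega> - X\<xi> t \<omega>\<bar>} \<longrightarrow>
        \<omega> \<in> {\<omega>\<in>space M. ?c < \<bar>ln (V t \<omega>)\<bar>} \<or> \<omega> \<in> {\<omega>\<in>space M. ?c < \<bar>ln (V 0 \<omega>)\<bar>}"
        using AE_good
      proof eventually_elim
        case g: (elim \<omega>)
        have bt: "0 < b t" by (rule b_pos[OF elim])
        have "XA t \<omega> - X\<xi> t \<omega> = (A t \<omega> - \<xi> t \<omega>) / b t" by (simp add: XA_def X\<xi>_def divide_inverse algebra_simps)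
        also have "\<dots> = (ln (V t \<omega>) - ln (V 0 \<omega>)) / b t" using A_eq_\<xi>_plus[OF g less_imp_le[OF elim]] by simp
        finally have d: "\<bar>XA t \<omega> - X\<xi> t \<omega>\<bar> * b t = \<bar>ln (V t \<omega>) - ln (V 0 \<omega>)\<bar>" using bt by (simp only: abs_divide abs_of_pos) simp
        show ?case
        proof (intro impI)
          assume "\<omega> \<in> {\<omega>\<in>space M. e < \<bar>XA t \<omega> - X\<xi> t \<omega>\<bar>}"
          then have w: "\<omega> \<in> space M" and "e * b t < \<bar>XA t \<omega> - X\<xi> t \<omega>\<bar> * b t" using bt by (simp, simp only: mem_Collect_eq mult_less_cancel_right_pos)
          then have "?c + ?c < \<bar>ln (V t \<omega>)\<bar> + \<bar>ln (V 0 \<omega>)\<bar>" unfolding d using abs_triangle_ineq4[of "ln (V t \<omega>)" "ln (V 0 \<omega>)"] by linarith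
          then show "\<omega> \<in> {\<omega>\<in>space M. ?c < \<bar>ln (V t \<omega>)\<bar>} \<or> \<omega> \<in> {\<omega>\<in>space M. ?c < \<bar>ln (V 0 \<omega>)\<bar>}" using w by (simp del: mult_less_cancel_left_pos) linarith
        qed
      qed
    qed measurable
    also have "\<dots> = 2 * measure \<mu> (?S ?c)" using law[of t] law[of 0] elim by simp
    finally show ?case .
  qed
  from Lim_null_comparison[OF _ lim[unfolded mult_zero_right], where f="\<lambda>t. prob {\<omega>\<in>space M. e < \<bar>XA t \<omega> - X\<xi> t \<omega>\<bar>}"] this
  show "((\<lambda>t. prob {\<omega>\<in>space M. e < \<bar>XA t \<omega> - X\<xi> t \<omega>\<bar>}) \<longlongrightarrow> 0) at_top"
    unfolding real_norm_def abs_of_nonneg[OF measure_nonneg] by blast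
qed

lemma X\<xi>_iff_XA: "converges_in_law M X\<xi> S \<longleftrightarrow> converges_in_law M XA S"
  using slutsky[OF _ XA_minus_X\<xi> XA_measurable X\<xi>_measurable]
    slutsky[OF _ tends_to_0_in_prob_uminus[OF XA_minus_X\<xi>] X\<xi>_measurable XA_measurable] by blast

lemma prob_T_le:
  assumes t: "0 < t" and s: "0 \<le> s"
  shows "prob {\<omega>\<in>space M. T t \<omega> \<le> s} = 1 - prob {\<omega>\<in>space M. A s \<omega> < t}"
    and "prob {\<omega>\<in>space M. A s \<omega> \<le> t} = 1 - prob {\<omega>\<in>space M. T t \<omega> < s}"
proof -
  note [measurable] = T_measurable[OF t] A_measurable[OF s]
  have "prob {\<omega>\<in>space M. T t \<omega> \<le> s} = prob {\<omega>\<in>space M. \<not> A s \<omega> < t}"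
  proof (intro finite_measure_eq_AE)
    show "AE \<omega> in M. \<omega> \<in> {\<omega>\<in>space M. T t \<omega> \<le> s} \<longleftrightarrow> \<omega> \<in> {\<omega>\<in>space M. \<not> A s \<omega> < t}"
      using AE_regular
    proof eventually_elim
      case (elim \<omega>)
      interpret A: positive_density "\<lambda>s. 1 / V s \<omega>" "\<lambda>t. A t \<omega>" using elim by (intro A_density) (simp add: regular_def)
      have T: "0 \<le> T t \<omega>" "A (T t \<omega>) \<omega> = t" using elim t by (auto simp: regular_def)
      have "T t \<omega> \<le> s \<longleftrightarrow> \<not> A s \<omega> < t"
        using A.H_mono[OF T(1), of s] A.H_strict_mono[OF s, of "T t \<omega>"] T(2) by (cases "T t \<omega> \<le> s") auto
      then show ?case by auto
    qed
  qed measurable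
  also have "\<dots> = 1 - prob {\<omega>\<in>space M. A s \<omega> < t}" by (rule prob_neg) measurable
  finally show "prob {\<omega>\<in>space M. T t \<omega> \<le> s} = 1 - prob {\<omega>\<in>space M. A s \<omega> < t}" .
  have "prob {\<omega>\<in>space M. A s \<omega> \<le> t} = prob {\<omega>\<in>space M. \<not> T t \<omega> < s}"
  proof (intro finite_measure_eq_AE)
    show "AE \<omega> in M. \<omega> \<in> {\<omega>\<in>space M. A s \<omega> \<le> t} \<longleftrightarrow> \<omega> \<in> {\<omega>\<in>space M. \<not> T t \<omega> < s}"
      using AE_regular by eventually_elim (auto simp: regular_le_T_iff[OF _ t s, symmetric])
  qed measurable
  also have "\<dots> = 1 - prob {\<omega>\<in>space M. T t \<omega> < s}" by (rule prob_neg) measurable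
  finally show "prob {\<omega>\<in>space M. A s \<omega> \<le> t} = 1 - prob {\<omega>\<in>space M. T t \<omega> < s}" .
qed

lemma prob_T_nonpos:
  assumes t: "0 < t"
  shows "prob {\<omega>\<in>space M. T t \<omega> \<le> 0} = 0"
proof -
  note [measurable] = A_measurable[OF order_refl]
  have "prob {\<omega>\<in>space M. A 0 \<omega> < t} = 1"
  proof (subst prob_eq_1)
    show "AE \<omega> in M. \<omega> \<in> {\<omega>\<in>space M. A 0 \<omega> < t}"
      using AE_good AE_space
      by eventually_elim (use t positive_density.H_0[OF A_density] in auto)
  qed measurable
  then show ?thesis using prob_T_le(1)[OF t order_refl] by simp
qed

lemma prob_A_nonpos:
  assumes s: "0 < s"
  shows "prob {\<omega>\<in>space M. A s \<omega> \<le> 0} = 0"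
proof -
  note [measurable] = A_measurable[OF less_imp_le[OF s]]
  show ?thesis
  proof (subst prob_eq_0)
    show "AE \<omega> in M. \<omega> \<notin> {\<omega>\<in>space M. A s \<omega> \<le> 0}"
      using AE_good
    proof eventually_elim
      case (elim \<omega>)
      show ?case using positive_density.H_strict_mono[OF A_density[OF elim] order_refl s]
          positive_density.H_0[OF A_density[OF elim]] by auto
    qed
  qed measurable
qed

lemma XT_nonpos: "0 < t \<Longrightarrow> prob {\<omega>\<in>space M. XT t \<omega> \<le> 0} = 0"
proof -
  assume t: "0 < t"
  have "{\<omega>\<in>space M. XT t \<omega> \<le> 0} = {\<omega>\<in>space M. T t \<omega> \<le> 0}"
    using a_pos[OF t] by (auto simp: XT_def divide_le_0_iff)
  then show ?thesis using prob_T_nonpos[OF t] by simp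
qed

lemma XA_nonpos: "0 < t \<Longrightarrow> prob {\<omega>\<in>space M. XA t \<omega> \<le> 0} = 0"
proof -
  assume t: "0 < t"
  have "{\<omega>\<in>space M. XA t \<omega> \<le> 0} = {\<omega>\<in>space M. A t \<omega> \<le> 0}"
    using b_pos[OF t] by (auto simp: XA_def mult_le_0_iff)
  then show ?thesis using prob_A_nonpos[OF t] by simp
qed

lemma prob_XT_le:
  assumes y: "0 < y" and t: "0 < t"
  shows "prob {\<omega>\<in>space M. XT t \<omega> \<le> y} = 1 - prob {\<omega>\<in>space M. XA (y * a t) \<omega> < t / b (y * a t)}"
proof -
  have s: "0 < y * a t" using y a_pos[OF t] by simp
  have "{\<omega>\<in>space M. XA (y * a t) \<omega> < t / b (y * a t)} = {\<omega>\<in>space M. A (y * a t) \<omega> < t}"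
    using b_pos[OF s] by (auto simp: XA_def field_simps)
  moreover have "{\<omega>\<in>space M. XT t \<omega> \<le> y} = {\<omega>\<in>space M. T t \<omega> \<le> y * a t}"
    using a_pos[OF t] by (auto simp: XT_def field_simps)
  ultimately show ?thesis using prob_T_le(1)[OF t less_imp_le[OF s]] by simp
qed

lemma prob_XA_le:
  assumes y: "0 < y" and t: "0 < t"
  shows "prob {\<omega>\<in>space M. XA t \<omega> \<le> y} = 1 - prob {\<omega>\<in>space M. XT (y * b t) \<omega> < t / a (y * b t)}"
proof -
  have s: "0 < y * b t" using y b_pos[OF t] by simp
  have "{\<omega>\<in>space M. XT (y * b t) \<omega> < t / a (y * b t)} = {\<omega>\<in>space M. T (y * b t) \<omega> < t}"
    using a_pos[OF s] by (auto simp: XT_def field_simps)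
  moreover have "{\<omega>\<in>space M. XA t \<omega> \<le> y} = {\<omega>\<in>space M. A t \<omega> \<le> y * b t}"
    using b_pos[OF t] by (auto simp: XA_def field_simps)
  ultimately show ?thesis using prob_T_le(2)[OF s less_imp_le[OF t]] by simp
qed

lemma XT_limit_if_XA_limit:
  assumes S: "converges_in_law M XA S" and pos: "AE x in S. 0 < x"
  shows "converges_in_law M XT (distr S borel (\<lambda>x. x powr (- \<alpha>)))"
proof (rule reciprocal_power_limit[OF S pos alpha XA_measurable XT_measurable XT_nonpos,
    where s="\<lambda>y t. y * a t" and c="\<lambda>y t. t / b (y * a t)"])
  show "filterlim (\<lambda>t. y * a t) at_top at_top" if "0 < y" for y
    using that by (intro filterlim_tendsto_pos_mult_at_top[OF tendsto_const] a_at_top)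
qed (auto intro: b_scaled_inverse prob_XT_le)

lemma XA_limit_if_XT_limit:
  assumes S: "converges_in_law M XT S" and pos: "AE x in S. 0 < x"
  shows "converges_in_law M XA (distr S borel (\<lambda>x. x powr (- (1 / \<alpha>))))"
proof (rule reciprocal_power_limit[OF S pos _ XT_measurable XA_measurable XA_nonpos,
    where s="\<lambda>y t. y * b t" and c="\<lambda>y t. t / a (y * b t)"])
  show "filterlim (\<lambda>t. y * b t) at_top at_top" if "0 < y" for y
    using that by (intro filterlim_tendsto_pos_mult_at_top[OF tendsto_const] b_at_top)
  show "((\<lambda>t. t / a (y * b t)) \<longlongrightarrow> y powr (- (1 / (1 / \<alpha>)))) at_top" if "0 < y" for y
    using a_scaled_inverse[OF that] by simp
qed (use alpha in \<open>auto intro: prob_XA_le\<close>)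

end

section \<open>The ergodic time change\<close>

text \<open>Between neighbouring grid points a nondecreasing function is squeezed between its values there, which differ
  from the linear function by the slope times the mesh at most, up to the error on the grid.\<close>
lemma near_linear_if_near_linear_on_grid:
  fixes J :: "real \<Rightarrow> real"
  assumes J_0: "J 0 = 0" and J_mono: "\<And>x y. 0 \<le> x \<Longrightarrow> x \<le> y \<Longrightarrow> J x \<le> J y"
    and d: "0 < d" and x: "0 \<le> x" "x < real N * d" and s: "0 < s" and m: "0 \<le> m" and c: "0 \<le> c"
    and grid: "\<And>i. i \<in> {1..N} \<Longrightarrow> \<bar>1 / (real i * d * s) * J (real i * d * s) - m\<bar> < c"
  shows "\<bar>1 / s * J (x * s) - m * x\<bar> \<le> m * d + real N * d * c"
proof -
  define i where "i = nat \<lfloor>x / d\<rfloor>"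
  have "0 \<le> x / d" using x d by simp
  then have i: "real i \<le> x / d" "x / d < real i + 1" unfolding i_def by linarith+
  have ix: "real i * d \<le> x" "x < real (Suc i) * d" using i d by (simp_all add: field_simps)
  have "real i * d < real N * d" using ix x by linarith
  then have iN: "Suc i \<le> N" using d by simp
  have near: "\<bar>1 / s * J (real k * d * s) - m * (real k * d)\<bar> \<le> real N * d * c" if k: "k \<le> N" for k
  proof (cases "k = 0")
    case True
    then show ?thesis using J_0 d c by simp
  next
    case False
    let ?z = "real k * d"
    have z: "0 < ?z" "?z \<le> real N * d" using False d k by auto
    have "\<bar>1 / s * J (z * s) - m * z\<bar> = z * \<bar>1 / (z * s) * J (z * s) - m\<bar>" if "0 < z" for z
    proof -
      have "1 / s * J (z * s) - m * z = z * (1 / (z * s) * J (z * s) - m)" using that s by (simp add: field_simps)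
      then show ?thesis using that by (simp only: abs_mult abs_of_pos)
    qed
    from this[OF z(1)] have "\<bar>1 / s * J (?z * s) - m * ?z\<bar> = ?z * \<bar>1 / (?z * s) * J (?z * s) - m\<bar>" .
    also have "\<dots> \<le> ?z * c" using grid[of k] False k z by (intro mult_left_mono) auto
    also have "\<dots> \<le> real N * d * c" by (rule mult_right_mono[OF z(2) c])
    finally show ?thesis .
  qed
  have "1 / s * J (real i * d * s) \<le> 1 / s * J (x * s)"
    using ix d s by (intro mult_left_mono J_mono mult_right_mono) auto
  moreover have "1 / s * J (x * s) \<le> 1 / s * J (real (Suc i) * d * s)"
    using ix x d s by (intro mult_left_mono J_mono mult_right_mono) auto
  moreover have "m * (real i * d) \<ge> m * x - m * d"
  proof -
    have "m * (x - d) \<le> m * (real i * d)" using ix m by (intro mult_left_mono) (auto simp: algebra_simps)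
    then show ?thesis by (simp add: algebra_simps)
  qed
  moreover have "m * (real (Suc i) * d) \<le> m * x + m * d"
  proof -
    have "m * (real (Suc i) * d) \<le> m * (x + d)" using ix m by (intro mult_left_mono) (auto simp: algebra_simps)
    then show ?thesis by (simp add: algebra_simps)
  qed
  ultimately show ?thesis using near[of i] near[of "Suc i"] iN by linarith
qed

lemma set_integrable_if_integrable_uniform_Icc:
  fixes f :: "real \<Rightarrow> real"
  assumes s: "0 < s" and f: "f \<in> borel_measurable borel" and i: "integrable (uniform_measure lborel {0..s}) f"
  shows "set_integrable lborel {0..s} f"
proof -
  have "(\<integral>\<^sup>+x. ennreal \<bar>f x\<bar> \<partial>uniform_measure lborel {0..s}) < \<infinity>"
    using i by (simp add: integrable_iff_bounded)
  moreover have "(\<integral>\<^sup>+x. ennreal \<bar>f x\<bar> \<partial>uniform_measure lborel {0..s}) = (\<integral>\<^sup>+x. ennreal \<bar>f x\<bar> * indicator {0..s} x \<partial>lborel) / ennreal s"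
    using s f by (subst nn_integral_uniform_measure) (auto simp: emeasure_lborel_Icc_eq)
  ultimately have "(\<integral>\<^sup>+x. ennreal \<bar>f x\<bar> * indicator {0..s} x \<partial>lborel) < \<infinity>"
    by (auto simp: less_top[symmetric] ennreal_top_divide)
  moreover have "(\<integral>\<^sup>+x. ennreal \<bar>f x\<bar> * indicator {0..s} x \<partial>lborel) = (\<integral>\<^sup>+x. ennreal (norm (indicator {0..s} x *\<^sub>R f x)) \<partial>lborel)"
    by (intro nn_integral_cong) (auto simp: indicator_def)
  ultimately show ?thesis using f unfolding set_integrable_def integrable_iff_bounded by auto
qed

context levy_dual_pair
begin

lemma avg_tail:
  fixes g :: "real \<Rightarrow> real"
  assumes g: "integrable \<mu> g" and c: "0 < c"
  shows "((\<lambda>s. prob {\<omega>\<in>space M. c \<le> \<bar>avg g s \<omega> - (\<integral>v. g v \<partial>\<mu>)\<bar>}) \<longlongrightarrow> 0) at_top"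
proof (rule tendsto_realI)
  fix r :: real assume r: "0 < r"
  have dev: "(deviation g \<longlongrightarrow> 0) at_top" using law_of_large_numbers[OF g] by (simp add: mean_ergodic_def)
  have "0 < ennreal (c * r)" using c r by simp
  from order_tendstoD(2)[OF dev this]
  show "eventually (\<lambda>s. prob {\<omega>\<in>space M. c \<le> \<bar>avg g s \<omega> - (\<integral>v. g v \<partial>\<mu>)\<bar>} < 0 + r) at_top"
    using eventually_gt_at_top[of 0]
  proof eventually_elim
    case (elim s)
    have gm: "g \<in> borel_measurable borel" using borel_measurable_integrable[OF g] by simp
    note [measurable] = avg_measurable[OF elim(2) gm]
    let ?S = "{\<omega>\<in>space M. c \<le> \<bar>avg g s \<omega> - (\<integral>v. g v \<partial>\<mu>)\<bar>}"
    have "ennreal (c * prob ?S) = ennreal c * emeasure M ?S"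
      using c by (simp add: emeasure_eq_measure ennreal_mult)
    also have "\<dots> = (\<integral>\<^sup>+\<omega>. ennreal c * indicator ?S \<omega> \<partial>M)" by (subst nn_integral_cmult_indicator) auto
    also have "\<dots> \<le> deviation g s" unfolding deviation_def
      by (intro nn_integral_mono) (auto simp: indicator_def intro!: ennreal_leI)
    also have "\<dots> < ennreal (c * r)" by (rule elim(1))
    finally have "c * prob ?S < c * r" using c r by (subst (asm) ennreal_less_iff) auto
    then show ?case using c by simp
  qed
next
  fix r :: real assume "0 < r"
  then show "eventually (\<lambda>s. 0 - r < prob {\<omega>\<in>space M. c \<le> \<bar>avg g s \<omega> - (\<integral>v. g v \<partial>\<mu>)\<bar>}) at_top"
    by (intro always_eventually allI) (rule less_le_trans[OF _ measure_nonneg], simp)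
qed

lemma avg_eq:
  fixes g :: "real \<Rightarrow> real"
  assumes g: "g \<in> borel_measurable borel" and s: "0 < s" and w: "\<omega> \<in> space M"
  shows "avg g s \<omega> = 1 / s * (LBINT r:{0..s}. g (V r \<omega>))"
proof -
  have "(LBINT r:{0..s}. g (V (max 0 r) \<omega>)) = (LBINT r:{0..s}. g (V r \<omega>))"
    by (rule set_lebesgue_integral_cong) auto
  then show ?thesis unfolding avg_def using uniform_Icc(2)[OF s V_section_measurable[OF g w]] by simp
qed

lemma AE_locally_integrable:
  fixes g :: "real \<Rightarrow> real"
  assumes g: "integrable \<mu> g"
  shows "AE \<omega> in M. \<forall>s\<ge>0. set_integrable lborel {0..s} (\<lambda>r. g (V r \<omega>))"
proof -
  have gm: "g \<in> borel_measurable borel" using borel_measurable_integrable[OF g] by simp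
  have "AE \<omega> in M. \<forall>n::nat. integrable (Q (real (Suc n))) (\<lambda>r. g (V (max 0 r) \<omega>))"
    unfolding AE_all_countable by (intro allI AE_integrable_Q[OF _ g]) simp
  then show ?thesis using AE_space
  proof eventually_elim
    case (elim \<omega>)
    show ?case
    proof (intro allI impI)
      fix s :: real assume s: "0 \<le> s"
      obtain n :: nat where n: "s < real n" using reals_Archimedean2 by blast
      have "set_integrable lborel {0..real (Suc n)} (\<lambda>r. g (V (max 0 r) \<omega>))"
        using elim(1) by (intro set_integrable_if_integrable_uniform_Icc V_section_measurable[OF gm elim(2)]) auto
      then have "set_integrable lborel {0..s} (\<lambda>r. g (V (max 0 r) \<omega>))"
        by (rule set_integrable_subset) (use n in auto)
      moreover have "set_integrable lborel {0..s} (\<lambda>r. g (V (max 0 r) \<omega>)) \<longleftrightarrow> set_integrable lborel {0..s} (\<lambda>r. g (V r \<omega>))"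
        by (rule set_integrable_cong) auto
      ultimately show "set_integrable lborel {0..s} (\<lambda>r. g (V r \<omega>))" by simp
    qed
  qed
qed

text \<open>The function whose \<open>\<mu>\<close>-integral is the \<open>\<nu>\<close>-integral of \<open>f\<close>; see
  \<open>integral_\<nu>\<close>.\<close>
definition recip :: "(real \<Rightarrow> real) \<Rightarrow> real \<Rightarrow> real" where
  "recip f v = 1 / v * f (1 / v)"

lemma AE_\<mu>_pos: "AE v in \<mu>. 0 < v"
  unfolding \<mu>_def by (subst AE_distr_iff) (use AE_good Ih_pos in \<open>auto elim: eventually_mono\<close>)

end

context scaled_levy_dual_pair
begin

definition YU :: "(real \<Rightarrow> real) \<Rightarrow> real \<Rightarrow> 'a \<Rightarrow> real" where
  "YU f t \<omega> = 1 / a t * (LBINT s:{0..t}. f (U s \<omega>))"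

lemma YU_measurable: "f \<in> borel_measurable borel \<Longrightarrow> YU f t \<in> borel_measurable M"
  unfolding YU_def[abs_def] by (intro borel_measurable_times borel_measurable_const integral_U_measurable)

lemma YU_time_change:
  assumes f: "f \<in> borel_measurable borel" and r: "regular \<omega>" and t: "0 < t"
  shows "YU f t \<omega> = 1 / a t * (LBINT r:{0..XT t \<omega> * a t}. recip f (V r \<omega>))"
proof -
  have "XT t \<omega> * a t = T t \<omega>" using a_pos[OF t] by (simp add: XT_def)
  then show ?thesis unfolding YU_def recip_def using regular_time_change[OF f r t] by simp
qed

text \<open>The additive functional of \<open>U\<close> with density \<open>f\<close> is, after the time change, a
  Birkhoff integral of \<open>V\<close> up to time \<open>T t\<close>. As it is nondecreasing, the law of large numbers at
  finitely many deterministic multiples of \<open>a t\<close> controls it at the random time \<open>T t\<close>, which is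
  tight on the scale \<open>a t\<close>.\<close>
lemma YU_nonneg_asymptotic:
  fixes f :: "real \<Rightarrow> real"
  assumes fm: "f \<in> borel_measurable borel" and f: "\<And>x. 0 \<le> f x" and g: "integrable \<mu> (recip f)"
    and \<Lambda>: "converges_in_law M XT \<Lambda>"
  shows "tends_to_0_in_prob M (\<lambda>t \<omega>. YU f t \<omega> - (\<integral>v. recip f v \<partial>\<mu>) * XT t \<omega>)"
  unfolding tends_to_0_in_prob_def
proof (intro allI impI)
  fix e :: real assume e: "0 < e"
  let ?g = "recip f"
  define m where "m = (\<integral>v. ?g v \<partial>\<mu>)"
  have gm: "?g \<in> borel_measurable borel" using borel_measurable_integrable[OF g] by simp
  have m: "0 \<le> m" unfolding m_def
    by (rule integral_nonneg_AE) (use AE_\<mu>_pos f in \<open>auto simp: recip_def elim!: eventually_mono\<close>)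
  \<comment> \<open>The mesh \<open>d\<close> of the grid makes the error \<open>m * d\<close> between neighbouring
    points at most \<open>e / 2\<close>; \<open>m + 1\<close> avoids a division by \<open>0\<close>.\<close>
  define d where "d = e / (2 * (m + 1))"
  have d: "0 < d" and md: "m * d \<le> e / 2" using m e by (auto simp: d_def field_simps)
  show "((\<lambda>t. prob {\<omega>\<in>space M. e < \<bar>YU f t \<omega> - (\<integral>v. recip f v \<partial>\<mu>) * XT t \<omega>\<bar>}) \<longlongrightarrow> 0) at_top"
    unfolding m_def[symmetric]
  proof (rule tendsto_realI)
    fix r :: real assume r: "0 < r"
    obtain K where K: "0 < K" "eventually (\<lambda>t. prob {\<omega>\<in>space M. K < XT t \<omega>} < r / 2) at_top"
      using converges_in_law_tight[OF \<Lambda> XT_measurable, of "r / 2"] r by auto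
    obtain N :: nat where N: "K / d < real N" using reals_Archimedean2 by blast
    then have Nd: "K < real N * d" using d by (simp add: field_simps)
    then have N0: "0 < real N * d" using K by linarith
    \<comment> \<open>The admissible error of the averages, chosen so that it contributes at most \<open>e / 4\<close>
      up to time \<open>K * a t\<close>.\<close>
    define c where "c = e / (4 * (real N * d))"
    have c: "0 < c" using N0 e by (simp add: c_def)
    have "k * (e / (4 * k)) = e / 4" if "0 < k" for k using that by simp
    from this[OF N0] have Nc: "real N * d * c = e / 4" unfolding c_def .
    define F where "F = (\<lambda>t i. {\<omega>\<in>space M. c \<le> \<bar>avg ?g (real i * d * a t) \<omega> - m\<bar>})"
    have "((\<lambda>t. \<Sum>i\<in>{1..N}. prob (F t i)) \<longlongrightarrow> (\<Sum>i\<in>{1..N}. 0)) at_top"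
    proof (intro tendsto_sum)
      fix i assume "i \<in> {1..N}"
      then have "filterlim (\<lambda>t. real i * d * a t) at_top at_top"
        using d by (intro filterlim_tendsto_pos_mult_at_top[OF tendsto_const] a_at_top) auto
      from filterlim_compose[OF avg_tail[OF g c] this] show "((\<lambda>t. prob (F t i)) \<longlongrightarrow> 0) at_top"
        unfolding F_def m_def .
    qed
    then have "((\<lambda>t. \<Sum>i\<in>{1..N}. prob (F t i)) \<longlongrightarrow> 0) at_top" by simp
    then have "eventually (\<lambda>t. (\<Sum>i\<in>{1..N}. prob (F t i)) < r / 2) at_top" using r by (intro order_tendstoD(2)) auto
    with K(2) show "eventually (\<lambda>t. prob {\<omega>\<in>space M. e < \<bar>YU f t \<omega> - m * XT t \<omega>\<bar>} < 0 + r) at_top"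
      using eventually_gt_at_top[of 0]
    proof eventually_elim
      case (elim t)
      note [measurable] = YU_measurable[OF fm] XT_measurable[OF elim(3)]
      have at: "0 < a t" by (rule a_pos[OF elim(3)])
      have Fm: "F t i \<in> events" if "i \<in> {1..N}" for i
      proof -
        have "0 < real i * d * a t" using that d at by simp
        note [measurable] = avg_measurable[OF this gm]
        show ?thesis unfolding F_def by measurable
      qed
      have "prob {\<omega>\<in>space M. e < \<bar>YU f t \<omega> - m * XT t \<omega>\<bar>} \<le> prob {\<omega>\<in>space M. K < XT t \<omega>} + prob (\<Union>i\<in>{1..N}. F t i)"
      proof (rule prob_le_add)
        show "AE \<omega> in M. \<omega> \<in> {\<omega>\<in>space M. e < \<bar>YU f t \<omega> - m * XT t \<omega>\<bar>} \<longrightarrow>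
            \<omega> \<in> {\<omega>\<in>space M. K < XT t \<omega>} \<or> \<omega> \<in> (\<Union>i\<in>{1..N}. F t i)"
          using AE_regular AE_locally_integrable[OF g] AE_space
        proof eventually_elim
          case reg: (elim \<omega>)
          let ?J = "\<lambda>x. LBINT r:{0..x}. ?g (V r \<omega>)"
          have V: "0 < V r \<omega>" if "0 \<le> r" for r using reg(1) that by (intro V_pos) (auto simp: regular_def)
          have T: "0 \<le> XT t \<omega>" using reg(1) elim(3) at by (auto simp: XT_def regular_def)
          show ?case
          proof (intro impI, rule ccontr)
            assume big: "\<omega> \<in> {\<omega>\<in>space M. e < \<bar>YU f t \<omega> - m * XT t \<omega>\<bar>}"
              and "\<not> (\<omega> \<in> {\<omega>\<in>space M. K < XT t \<omega>} \<or> \<omega> \<in> (\<Union>i\<in>{1..N}. F t i))"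
            then have le: "XT t \<omega> \<le> K" and nF: "\<And>i. i \<in> {1..N} \<Longrightarrow> \<omega> \<notin> F t i" using reg(3) by (auto simp: not_less)
            have "\<bar>1 / a t * ?J (XT t \<omega> * a t) - m * XT t \<omega>\<bar> \<le> m * d + real N * d * c"
            proof (rule near_linear_if_near_linear_on_grid[OF _ _ d T _ at m less_imp_le[OF c]])
              show "?J 0 = 0" unfolding set_integral_Icc_eq_Ioc by (simp add: set_lebesgue_integral_def)
              show "?J x \<le> ?J y" if "0 \<le> x" "x \<le> y" for x y
                unfolding set_lebesgue_integral_def
              proof (rule integral_mono)
                show "integrable lborel (\<lambda>r. indicator {0..x} r *\<^sub>R ?g (V r \<omega>))" "integrable lborel (\<lambda>r. indicator {0..y} r *\<^sub>R ?g (V r \<omega>))"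
                  using reg(2) that by (auto simp: set_integrable_def)
                fix r :: real
                have "0 \<le> ?g (V r \<omega>)" if "0 \<le> r" using V[OF that] f[of "1 / V r \<omega>"] by (simp add: recip_def)
                then show "indicator {0..x} r *\<^sub>R ?g (V r \<omega>) \<le> indicator {0..y} r *\<^sub>R ?g (V r \<omega>)"
                  using that by (auto simp: indicator_def)
              qed
              show "XT t \<omega> < real N * d" using le Nd by linarith
              fix i assume i: "i \<in> {1..N}"
              then have "0 < real i * d * a t" using d at by simp
              from avg_eq[OF gm this reg(3)] nF[OF i] reg(3)
              show "\<bar>1 / (real i * d * a t) * ?J (real i * d * a t) - m\<bar> < c" by (simp add: F_def not_le)
            qed
            then have "\<bar>YU f t \<omega> - m * XT t \<omega>\<bar> \<le> m * d + real N * d * c"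
              unfolding YU_time_change[OF fm reg(1) elim(3)] .
            then have "\<bar>YU f t \<omega> - m * XT t \<omega>\<bar> \<le> e / 2 + e / 4" using md unfolding Nc by linarith
            then show False using big e by simp
          qed
        qed
      qed (use Fm in \<open>measurable\<close>)
      also have "prob (\<Union>i\<in>{1..N}. F t i) \<le> (\<Sum>i\<in>{1..N}. prob (F t i))"
        using Fm by (intro finite_measure_subadditive_finite) auto
      finally show ?case using elim by linarith
    qed
  next
    fix r :: real assume "0 < r"
    then show "eventually (\<lambda>t. 0 - r < prob {\<omega>\<in>space M. e < \<bar>YU f t \<omega> - m * XT t \<omega>\<bar>}) at_top"
      by (intro always_eventually allI) (rule less_le_trans[OF _ measure_nonneg], simp)
  qed
qed

text \<open>The positive and the negative part of \<open>f\<close> are treated separately. The functional itself is then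
  handled on the event where both parts are locally integrable along the path.\<close>
lemma YU_asymptotic:
  fixes f :: "real \<Rightarrow> real"
  assumes fm: "f \<in> borel_measurable borel" and g: "integrable \<mu> (recip f)" and \<Lambda>: "converges_in_law M XT \<Lambda>"
  shows "tends_to_0_in_prob M (\<lambda>t \<omega>. (\<integral>v. recip f v \<partial>\<mu>) * XT t \<omega> - YU f t \<omega>)"
  unfolding tends_to_0_in_prob_def
proof (intro allI impI)
  fix e :: real assume e: "0 < e"
  let ?p = "\<lambda>x. max 0 (f x)" and ?n = "\<lambda>x. max 0 (- f x)"
  have m: "?p \<in> borel_measurable borel" "?n \<in> borel_measurable borel" using fm by measurable
  have gm: "recip f \<in> borel_measurable borel" using borel_measurable_integrable[OF g] by simp
  have rm: "recip h \<in> borel_measurable borel" if [measurable]: "h \<in> borel_measurable borel" for h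
    unfolding recip_def[abs_def] by measurable
  have le: "norm (recip ?p v) \<le> norm (recip f v)" "norm (recip ?n v) \<le> norm (recip f v)" for v
    by (auto simp: recip_def abs_mult divide_right_mono max_def)
  have ip: "integrable \<mu> (recip ?p)" and "in": "integrable \<mu> (recip ?n)"
    by (rule Bochner_Integration.integrable_bound[OF g], use rm m le in \<open>simp_all\<close>)+
  have split: "recip f v = recip ?p v - recip ?n v" for v by (auto simp: recip_def max_def)
  let ?mp = "\<integral>v. recip ?p v \<partial>\<mu>" and ?mn = "\<integral>v. recip ?n v \<partial>\<mu>" and ?m = "\<integral>v. recip f v \<partial>\<mu>"
  have m_split: "?m = ?mp - ?mn" unfolding split by (rule Bochner_Integration.integral_diff[OF ip "in"])
  have "((\<lambda>t. prob {\<omega>\<in>space M. e / 2 < \<bar>YU ?p t \<omega> - ?mp * XT t \<omega>\<bar>} + prob {\<omega>\<in>space M. e / 2 < \<bar>YU ?n t \<omega> - ?mn * XT t \<omega>\<bar>})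
      \<longlongrightarrow> 0 + 0) at_top"
  proof (rule tendsto_add)
    have h: "0 < e / 2" using e by simp
    show "((\<lambda>t. prob {\<omega>\<in>space M. e / 2 < \<bar>YU ?p t \<omega> - ?mp * XT t \<omega>\<bar>}) \<longlongrightarrow> 0) at_top"
      using YU_nonneg_asymptotic[OF m(1) _ ip \<Lambda>] h unfolding tends_to_0_in_prob_def by (simp del: less_divide_eq_numeral1 divide_less_eq_numeral1)
    show "((\<lambda>t. prob {\<omega>\<in>space M. e / 2 < \<bar>YU ?n t \<omega> - ?mn * XT t \<omega>\<bar>}) \<longlongrightarrow> 0) at_top"
      using YU_nonneg_asymptotic[OF m(2) _ "in" \<Lambda>] h unfolding tends_to_0_in_prob_def by (simp del: less_divide_eq_numeral1 divide_less_eq_numeral1)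
  qed
  then have lim: "((\<lambda>t. prob {\<omega>\<in>space M. e / 2 < \<bar>YU ?p t \<omega> - ?mp * XT t \<omega>\<bar>} + prob {\<omega>\<in>space M. e / 2 < \<bar>YU ?n t \<omega> - ?mn * XT t \<omega>\<bar>})
      \<longlongrightarrow> 0) at_top" by simp
  show "((\<lambda>t. prob {\<omega>\<in>space M. e < \<bar>?m * XT t \<omega> - YU f t \<omega>\<bar>}) \<longlongrightarrow> 0) at_top"
  proof (rule tendsto_sandwich[OF _ _ tendsto_const lim])
    show "eventually (\<lambda>t. 0 \<le> prob {\<omega>\<in>space M. e < \<bar>?m * XT t \<omega> - YU f t \<omega>\<bar>}) at_top" by simp
    show "eventually (\<lambda>t. prob {\<omega>\<in>space M. e < \<bar>?m * XT t \<omega> - YU f t \<omega>\<bar>} \<le>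
        prob {\<omega>\<in>space M. e / 2 < \<bar>YU ?p t \<omega> - ?mp * XT t \<omega>\<bar>} + prob {\<omega>\<in>space M. e / 2 < \<bar>YU ?n t \<omega> - ?mn * XT t \<omega>\<bar>}) at_top"
      using eventually_gt_at_top[of 0]
    proof eventually_elim
      case (elim t)
      note [measurable] = YU_measurable[OF fm] YU_measurable[OF m(1)] YU_measurable[OF m(2)] XT_measurable[OF elim]
      have at: "0 < a t" by (rule a_pos[OF elim])
      show ?case
      proof (rule prob_le_add)
        show "AE \<omega> in M. \<omega> \<in> {\<omega>\<in>space M. e < \<bar>?m * XT t \<omega> - YU f t \<omega>\<bar>} \<longrightarrow>
          \<omega> \<in> {\<omega>\<in>space M. e / 2 < \<bar>YU ?p t \<omega> - ?mp * XT t \<omega>\<bar>} \<or> \<omega> \<in> {\<omega>\<in>space M. e / 2 < \<bar>YU ?n t \<omega> - ?mn * XT t \<omega>\<bar>}"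
          using AE_regular AE_locally_integrable[OF ip] AE_locally_integrable[OF "in"]
        proof eventually_elim
          case reg: (elim \<omega>)
          have T: "0 \<le> XT t \<omega> * a t" using reg(1) elim at by (auto simp: XT_def regular_def)
          have "YU f t \<omega> = YU ?p t \<omega> - YU ?n t \<omega>"
            unfolding YU_time_change[OF fm reg(1) elim] YU_time_change[OF m(1) reg(1) elim] YU_time_change[OF m(2) reg(1) elim] split
            using reg(2,3) T by (subst set_integral_diff) (auto simp: right_diff_distrib)
          then have "YU f t \<omega> - ?m * XT t \<omega> = (YU ?p t \<omega> - ?mp * XT t \<omega>) - (YU ?n t \<omega> - ?mn * XT t \<omega>)"
            unfolding m_split by (simp add: algebra_simps)
          then have "e < \<bar>?m * XT t \<omega> - YU f t \<omega>\<bar> \<Longrightarrow>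
              e / 2 < \<bar>YU ?p t \<omega> - ?mp * XT t \<omega>\<bar> \<or> e / 2 < \<bar>YU ?n t \<omega> - ?mn * XT t \<omega>\<bar>" by linarith
          then show ?case by blast
        qed
      qed measurable
    qed
  qed
qed

end

section \<open>Transfer of the limit laws\<close>

lemma nondegenerate_distr:
  assumes "nondegenerate L" "h \<in> borel_measurable L" "AE x in L. g (h x) = x"
  shows "nondegenerate (distr L borel h)"
  unfolding nondegenerate_def
proof
  assume "\<exists>c. AE x in distr L borel h. x = c"
  then obtain c where "AE x in L. h x = c" using assms(2) by (auto simp: AE_distr_iff)
  with assms(3) have "AE x in L. x = g c" by eventually_elim auto
  with assms(1) show False by (auto simp: nondegenerate_def)
qed

context prob_space
begin

text \<open>The limiting distribution function vanishes at its negative continuity points, which accumulate at \<open>0\<close>.\<close>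
lemma limit_nonneg:
  assumes L: "converges_in_law M X L" and X: "\<And>t. 0 < t \<Longrightarrow> X t \<in> borel_measurable M"
    and n: "((\<lambda>t. prob {\<omega>\<in>space M. X t \<omega> < 0}) \<longlongrightarrow> 0) at_top"
  shows "AE x in L. 0 \<le> x"
proof -
  interpret L: real_distribution L using L by (simp add: converges_in_law_def)
  have c0: "cdf L y = 0" if y: "y < 0" "isCont (cdf L) y" for y
  proof (rule tendsto_unique[OF _ converges_in_lawD[OF L X y(2)]])
    show "((\<lambda>t. prob {\<omega>\<in>space M. X t \<omega> \<le> y}) \<longlongrightarrow> 0) at_top"
    proof (rule tendsto_sandwich[OF _ _ tendsto_const n])
      show "eventually (\<lambda>t. prob {\<omega>\<in>space M. X t \<omega> \<le> y} \<le> prob {\<omega>\<in>space M. X t \<omega> < 0}) at_top"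
        using eventually_gt_at_top[of 0]
      proof eventually_elim
        case (elim t)
        note [measurable] = X[OF elim]
        show ?case using y(1) by (intro finite_measure_mono) auto
      qed
    qed simp
  qed simp
  have "AE x in L. \<not> x \<le> - inverse (real (Suc n))" for n
  proof -
    obtain y where y: "- inverse (real (Suc n)) < y" "y < 0" "isCont (cdf L) y"
      using L.ex_continuity_point[of "- inverse (real (Suc n))" 0] by auto
    have "cdf L (- inverse (real (Suc n))) \<le> cdf L y" using y by (intro L.cdf_nondecreasing) simp
    then have "measure L {.. - inverse (real (Suc n))} = 0" using c0[OF y(2,3)] by (simp add: cdf_def2 measure_le_0_iff)
    then show ?thesis by (subst (asm) L.prob_eq_0) auto
  qed
  then have "AE x in L. \<forall>n. \<not> x \<le> - inverse (real (Suc n))" by (subst AE_all_countable) blast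
  then show ?thesis
  proof eventually_elim
    case (elim x)
    show ?case
    proof (rule ccontr)
      assume "\<not> 0 \<le> x"
      then obtain n where "inverse (real (Suc n)) < - x" using reals_Archimedean[of "- x"] by auto
      with elim[rule_format, of n] show False by linarith
    qed
  qed
qed

lemma converges_in_law_cmult:
  assumes L: "converges_in_law M X L" and X: "\<And>t. 0 < t \<Longrightarrow> X t \<in> borel_measurable M" and m: "m \<noteq> 0"
  shows "converges_in_law M (\<lambda>t \<omega>. m * X t \<omega>) (distr L borel (\<lambda>x. m * x))"
proof (cases "0 < m")
  case True
  then show ?thesis
    using converges_in_law_scale[OF L X filterlim_ident _ tendsto_const, of m] by simp
next
  case False
  then have m: "m < 0" using m by simp
  interpret L: real_distribution L using L by (simp add: converges_in_law_def)
  interpret D: real_distribution "distr L borel (\<lambda>x. m * x)" by (rule L.real_distribution_distr) simp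
  show ?thesis
  proof (rule converges_in_lawI[OF D.real_distribution_axioms])
    show "(\<lambda>\<omega>. m * X t \<omega>) \<in> borel_measurable M" if "0 < t" for t using X[OF that] by measurable
    fix x assume x: "isCont (cdf (distr L borel (\<lambda>x. m * x))) x"
    have iff: "m * y \<le> x \<longleftrightarrow> x / m \<le> y" "m * y = x \<longleftrightarrow> y = x / m" for y using m by (auto simp: field_simps)
    have "measure (distr L borel (\<lambda>x. m * x)) {x} = measure L {x / m}"
    proof -
      have "(\<lambda>x. m * x) -` {x} \<inter> space L = {x / m}" using iff(2) by auto
      then show ?thesis by (subst measure_distr) auto
    qed
    then have atom: "measure L {x / m} = 0" and xm: "isCont (cdf L) (x / m)" using x D.isCont_cdf L.isCont_cdf by simp_all
    have "cdf (distr L borel (\<lambda>x. m * x)) x = 1 - cdf L (x / m)"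
    proof -
      have "(\<lambda>x. m * x) -` {..x} \<inter> space L = {x / m} \<union> (space L - {..x / m})" using iff(1) by auto
      then have "cdf (distr L borel (\<lambda>x. m * x)) x = measure L ({x / m} \<union> (space L - {..x / m}))"
        unfolding cdf_def2 by (subst measure_distr) auto
      also have "\<dots> = measure L {x / m} + measure L (space L - {..x / m})"
        by (intro L.finite_measure_Union) auto
      also have "measure L (space L - {..x / m}) = 1 - cdf L (x / m)" unfolding cdf_def2 by (intro L.prob_compl) simp
      finally show ?thesis using atom by simp
    qed
    moreover have "((\<lambda>t. 1 - prob {\<omega>\<in>space M. X t \<omega> < x / m}) \<longlongrightarrow> 1 - cdf L (x / m)) at_top"
      by (intro tendsto_diff tendsto_const converges_in_law_moving(2)[OF L X filterlim_ident tendsto_const xm])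
    moreover have "eventually (\<lambda>t. 1 - prob {\<omega>\<in>space M. X t \<omega> < x / m} = prob {\<omega>\<in>space M. m * X t \<omega> \<le> x}) at_top"
      using eventually_gt_at_top[of 0]
    proof eventually_elim
      case (elim t)
      note [measurable] = X[OF elim]
      have "{\<omega>\<in>space M. m * X t \<omega> \<le> x} = space M - {\<omega>\<in>space M. X t \<omega> < x / m}" by (auto simp: iff(1) not_less)
      then show ?case by (simp only:) (rule prob_compl[symmetric], measurable)
    qed
    ultimately show "((\<lambda>t. prob {\<omega>\<in>space M. m * X t \<omega> \<le> x}) \<longlongrightarrow> cdf (distr L borel (\<lambda>x. m * x)) x) at_top"
      by (simp only:) (rule Lim_transform_eventually)
  qed
qed

end

context levy_dual_pair
begin

lemma increments_indep:
  assumes "0 \<le> p" "0 \<le> q"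
  shows "indep_var borel (\<lambda>\<omega>. \<xi> p \<omega> - \<xi> 0 \<omega>) borel (\<lambda>\<omega>. \<xi> (p + q) \<omega> - \<xi> p \<omega>)"
proof -
  let ?\<tau> = "\<lambda>i::nat. if i = 0 then 0 else if i = 1 then p else p + q"
  let ?f = "\<lambda>b. if b then 0 else 1 :: nat"
  have "indep_vars (\<lambda>_. borel) (\<lambda>i \<omega>. \<xi> (?\<tau> (Suc i)) \<omega> - \<xi> (?\<tau> i) \<omega>) {..<2}"
    using assms by (intro L(6)) auto
  moreover have "range ?f = {..<2}" by (auto simp: image_def)
  ultimately have "indep_vars ((\<lambda>_. borel) \<circ> ?f) (\<lambda>b \<omega>. \<xi> (?\<tau> (Suc (?f b))) \<omega> - \<xi> (?\<tau> (?f b)) \<omega>) UNIV"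
    by (intro indep_vars_reindex) (auto simp: inj_on_def split: if_splits)
  also have "?this \<longleftrightarrow> indep_vars (case_bool borel borel) (case_bool (\<lambda>\<omega>. \<xi> p \<omega> - \<xi> 0 \<omega>) (\<lambda>\<omega>. \<xi> (p + q) \<omega> - \<xi> p \<omega>)) UNIV"
    by (intro indep_vars_cong) (auto split: bool.splits)
  finally show ?thesis by (simp only: indep_var_def)
qed

lemma prob_\<xi>_neg: "((\<lambda>t. prob {\<omega>\<in>space M. \<xi> t \<omega> < 0}) \<longlongrightarrow> 0) at_top"
proof -
  let ?s = "\<lambda>t \<omega>. indicator {\<omega>\<in>space M. \<xi> (max 0 t) \<omega> < 0} \<omega> :: real"
  have m: "{\<omega>\<in>space M. \<xi> (max 0 t) \<omega> < 0} \<in> events" for t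
  proof -
    have [measurable]: "\<xi> (max 0 t) \<in> borel_measurable M" by (intro L(2)) simp
    show ?thesis by measurable
  qed
  have "((\<lambda>t. \<integral>\<omega>. ?s t \<omega> \<partial>M) \<longlongrightarrow> (\<integral>\<omega>. 0 \<partial>M)) at_top"
  proof (rule integral_dominated_convergence_at_top[where w="\<lambda>_. 1"])
    show "?s t \<in> borel_measurable M" for t using m by measurable
    show "AE \<omega> in M. ((\<lambda>t. ?s t \<omega>) \<longlongrightarrow> 0) at_top"
      using drift[unfolded drifts_to_infinity_def]
    proof eventually_elim
      case (elim \<omega>)
      then have "eventually (\<lambda>t. 0 \<le> \<xi> t \<omega>) at_top" by (simp add: filterlim_at_top)
      then have "eventually (\<lambda>t. ?s t \<omega> = 0) at_top"
        using eventually_ge_at_top[of 0] by eventually_elim (auto simp: indicator_def)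
      then show ?case by (rule tendsto_eventually)
    qed
  qed (auto simp: indicator_def)
  then have "((\<lambda>t. prob {\<omega>\<in>space M. \<xi> (max 0 t) \<omega> < 0}) \<longlongrightarrow> 0) at_top"
    using m by simp
  moreover have "eventually (\<lambda>t. prob {\<omega>\<in>space M. \<xi> (max 0 t) \<omega> < 0} = prob {\<omega>\<in>space M. \<xi> t \<omega> < 0}) at_top"
    using eventually_ge_at_top[of 0] by eventually_elim simp
  ultimately show ?thesis by (rule Lim_transform_eventually)
qed

lemma prob_both_increments_le:
  assumes s: "0 \<le> s"
  shows "prob {\<omega>\<in>space M. \<xi> s \<omega> \<le> x \<and> \<xi> (s + s) \<omega> - \<xi> s \<omega> \<le> x} = prob {\<omega>\<in>space M. \<xi> s \<omega> \<le> x} * prob {\<omega>\<in>space M. \<xi> s \<omega> \<le> x}"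
    and "prob {\<omega>\<in>space M. \<xi> (s + s) \<omega> - \<xi> s \<omega> < y} = prob {\<omega>\<in>space M. \<xi> s \<omega> < y}"
proof -
  have m[measurable]: "\<xi> s \<in> borel_measurable M" "\<xi> (s + s) \<in> borel_measurable M" using s by (auto intro: L(2))
  have d: "distr M borel (\<lambda>\<omega>. \<xi> (s + s) \<omega> - \<xi> s \<omega>) = distr M borel (\<xi> s)" using L(5)[of s "s + s"] s by simp
  have e: "prob {\<omega>\<in>space M. \<xi> (s + s) \<omega> - \<xi> s \<omega> \<in> A} = prob {\<omega>\<in>space M. \<xi> s \<omega> \<in> A}" if [measurable]: "A \<in> sets borel" for A
  proof -
    have "prob {\<omega>\<in>space M. \<xi> (s + s) \<omega> - \<xi> s \<omega> \<in> A} = measure (distr M borel (\<lambda>\<omega>. \<xi> (s + s) \<omega> - \<xi> s \<omega>)) A"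
      using m that by (subst measure_distr) (auto intro!: arg_cong[where f=prob])
    also have "\<dots> = prob {\<omega>\<in>space M. \<xi> s \<omega> \<in> A}"
      unfolding d using m that by (subst measure_distr) (auto intro!: arg_cong[where f=prob])
    finally show ?thesis .
  qed
  show "prob {\<omega>\<in>space M. \<xi> (s + s) \<omega> - \<xi> s \<omega> < y} = prob {\<omega>\<in>space M. \<xi> s \<omega> < y}" using e[of "{..<y}"] by simp
  have "prob {\<omega>\<in>space M. \<xi> s \<omega> \<le> x \<and> \<xi> (s + s) \<omega> - \<xi> s \<omega> \<le> x} =
    prob ((\<lambda>\<omega>. (\<xi> s \<omega> - \<xi> 0 \<omega>, \<xi> (s + s) \<omega> - \<xi> s \<omega>)) -` ({..x} \<times> {..x}) \<inter> space M)"
    by (intro arg_cong[where f=prob]) (auto simp: L(3))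
  also have "\<dots> = prob ((\<lambda>\<omega>. \<xi> s \<omega> - \<xi> 0 \<omega>) -` {..x} \<inter> space M) * prob ((\<lambda>\<omega>. \<xi> (s + s) \<omega> - \<xi> s \<omega>) -` {..x} \<inter> space M)"
    by (rule indep_varD[OF increments_indep[OF s s]]) auto
  also have "(\<lambda>\<omega>. \<xi> s \<omega> - \<xi> 0 \<omega>) -` {..x} \<inter> space M = {\<omega>\<in>space M. \<xi> s \<omega> \<le> x}" by (auto simp: L(3))
  also have "(\<lambda>\<omega>. \<xi> (s + s) \<omega> - \<xi> s \<omega>) -` {..x} \<inter> space M = {\<omega>\<in>space M. \<xi> (s + s) \<omega> - \<xi> s \<omega> \<in> {..x}}" by auto
  finally show "prob {\<omega>\<in>space M. \<xi> s \<omega> \<le> x \<and> \<xi> (s + s) \<omega> - \<xi> s \<omega> \<le> x} = prob {\<omega>\<in>space M. \<xi> s \<omega> \<le> x} * prob {\<omega>\<in>space M. \<xi> s \<omega> \<le> x}"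
    using e[of "{..x}"] by simp
qed

end

context scaled_levy_dual_pair
begin

lemma X\<xi>_limit_nonneg:
  assumes S: "converges_in_law M X\<xi> S"
  shows "AE x in S. 0 \<le> x"
proof (rule limit_nonneg[OF S X\<xi>_measurable])
  have "eventually (\<lambda>t. prob {\<omega>\<in>space M. \<xi> t \<omega> < 0} = prob {\<omega>\<in>space M. X\<xi> t \<omega> < 0}) at_top"
    using eventually_gt_at_top[of 0]
  proof eventually_elim
    case (elim t)
    show ?case using b_pos[OF elim] by (intro arg_cong[where f=prob]) (auto simp: X\<xi>_def mult_less_0_iff)
  qed
  with prob_\<xi>_neg show "((\<lambda>t. prob {\<omega>\<in>space M. X\<xi> t \<omega> < 0}) \<longlongrightarrow> 0) at_top" by (rule Lim_transform_eventually)
qed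

lemma XA_limit_at_reciprocal:
  assumes \<Lambda>: "converges_in_law M XT \<Lambda>" and z: "0 < z" "isCont (cdf \<Lambda>) z"
  shows "((\<lambda>t. prob {\<omega>\<in>space M. XA t \<omega> \<le> z powr (- (1 / \<alpha>))}) \<longlongrightarrow> 1 - cdf \<Lambda> z) at_top"
proof -
  let ?y = "z powr (- (1 / \<alpha>))"
  have y: "0 < ?y" "?y powr (- \<alpha>) = z" using z alpha by (auto simp: powr_powr)
  have c: "((\<lambda>t. t / a (?y * b t)) \<longlongrightarrow> z) at_top" using a_scaled_inverse[OF y(1)] unfolding y(2) .
  have s: "filterlim (\<lambda>t. ?y * b t) at_top at_top"
    by (rule filterlim_tendsto_pos_mult_at_top[OF tendsto_const y(1) b_at_top])
  have "((\<lambda>t. 1 - prob {\<omega>\<in>space M. XT (?y * b t) \<omega> < t / a (?y * b t)}) \<longlongrightarrow> 1 - cdf \<Lambda> z) at_top"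
    by (intro tendsto_diff tendsto_const converges_in_law_moving(2)[OF \<Lambda> XT_measurable s c z(2)])
  moreover have "eventually (\<lambda>t. 1 - prob {\<omega>\<in>space M. XT (?y * b t) \<omega> < t / a (?y * b t)} = prob {\<omega>\<in>space M. XA t \<omega> \<le> ?y}) at_top"
    using eventually_gt_at_top[of 0] by eventually_elim (rule prob_XA_le[OF y(1), symmetric])
  ultimately show ?thesis by (rule Lim_transform_eventually)
qed

text \<open>If \<open>\<xi> (2 s) \<le> y b (2 s)\<close> and both increments of \<open>\<xi>\<close> on
  \<open>[0,s]\<close> and \<open>[s,2s]\<close> are nonnegative, then both are at most a multiple of \<open>b s\<close>.
  As the increments are independent with the same law, the probability of being at most of the order of \<open>b\<close>
  at time \<open>2 s\<close> is in the limit at most the square of the corresponding probability at time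
  \<open>s\<close>.\<close>
lemma XA_doubling:
  assumes y: "0 < y" and s: "0 < s" and b2: "b (s + s) \<le> B * b s"
  shows "prob {\<omega>\<in>space M. XA (s + s) \<omega> \<le> y} \<le> prob {\<omega>\<in>space M. 1 < \<bar>XA (s + s) \<omega> - X\<xi> (s + s) \<omega>\<bar>} + 2 * prob {\<omega>\<in>space M. \<xi> s \<omega> < 0}
    + (prob {\<omega>\<in>space M. XA s \<omega> \<le> (y + 1) * B + 1} + prob {\<omega>\<in>space M. 1 < \<bar>XA s \<omega> - X\<xi> s \<omega>\<bar>})\<^sup>2"
proof -
  have s2: "0 < s + s" using s by simp
  note [measurable] = XA_measurable[OF s] XA_measurable[OF s2] X\<xi>_measurable[OF s] X\<xi>_measurable[OF s2]
    L(2)[OF less_imp_le[OF s]] L(2)[OF less_imp_le[OF s2]]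
  let ?K = "(y + 1) * B"
  let ?\<eta> = "\<lambda>\<omega>. \<xi> (s + s) \<omega> - \<xi> s \<omega>"
  let ?both = "{\<omega>\<in>space M. \<xi> s \<omega> \<le> ?K * b s \<and> ?\<eta> \<omega> \<le> ?K * b s}"
  have "prob {\<omega>\<in>space M. XA (s + s) \<omega> \<le> y} \<le> prob {\<omega>\<in>space M. X\<xi> (s + s) \<omega> \<le> y + 1} + prob {\<omega>\<in>space M. 1 < \<bar>XA (s + s) \<omega> - X\<xi> (s + s) \<omega>\<bar>}"
    by (rule prob_shift_le) measurable
  moreover have "prob {\<omega>\<in>space M. X\<xi> (s + s) \<omega> \<le> y + 1} \<le> prob {\<omega>\<in>space M. \<xi> s \<omega> < 0} + prob ({\<omega>\<in>space M. ?\<eta> \<omega> < 0} \<union> ?both)"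
  proof (rule prob_le_add)
    show "AE \<omega> in M. \<omega> \<in> {\<omega>\<in>space M. X\<xi> (s + s) \<omega> \<le> y + 1} \<longrightarrow> \<omega> \<in> {\<omega>\<in>space M. \<xi> s \<omega> < 0} \<or> \<omega> \<in> {\<omega>\<in>space M. ?\<eta> \<omega> < 0} \<union> ?both"
    proof (intro AE_I2 impI)
      fix \<omega> assume w: "\<omega> \<in> {\<omega>\<in>space M. X\<xi> (s + s) \<omega> \<le> y + 1}"
      then have "\<xi> (s + s) \<omega> \<le> (y + 1) * b (s + s)" using b_pos[OF s2] by (simp add: X\<xi>_def field_simps)
      also have "\<dots> \<le> (y + 1) * (B * b s)" using b2 y by (intro mult_left_mono) auto
      finally have "\<xi> s \<omega> + ?\<eta> \<omega> \<le> ?K * b s" by (simp add: mult.assoc)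
      then have "\<xi> s \<omega> < 0 \<or> ?\<eta> \<omega> < 0 \<or> (\<xi> s \<omega> \<le> ?K * b s \<and> ?\<eta> \<omega> \<le> ?K * b s)" by linarith
      with w show "\<omega> \<in> {\<omega>\<in>space M. \<xi> s \<omega> < 0} \<or> \<omega> \<in> {\<omega>\<in>space M. ?\<eta> \<omega> < 0} \<union> ?both" by blast
    qed
  qed measurable
  moreover have "prob ({\<omega>\<in>space M. ?\<eta> \<omega> < 0} \<union> ?both) \<le> prob {\<omega>\<in>space M. ?\<eta> \<omega> < 0} + prob ?both"
    by (rule measure_Un_le) measurable
  moreover have "prob {\<omega>\<in>space M. ?\<eta> \<omega> < 0} = prob {\<omega>\<in>space M. \<xi> s \<omega> < 0}"
    by (rule prob_both_increments_le(2)[OF less_imp_le[OF s]])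
  moreover have "prob ?both = (prob {\<omega>\<in>space M. \<xi> s \<omega> \<le> ?K * b s})\<^sup>2"
    unfolding power2_eq_square by (rule prob_both_increments_le(1)[OF less_imp_le[OF s]])
  moreover have "(prob {\<omega>\<in>space M. \<xi> s \<omega> \<le> ?K * b s})\<^sup>2 \<le> (prob {\<omega>\<in>space M. XA s \<omega> \<le> ?K + 1} + prob {\<omega>\<in>space M. 1 < \<bar>XA s \<omega> - X\<xi> s \<omega>\<bar>})\<^sup>2"
  proof (intro power_mono)
    have "{\<omega>\<in>space M. \<xi> s \<omega> \<le> ?K * b s} = {\<omega>\<in>space M. X\<xi> s \<omega> \<le> ?K}" using b_pos[OF s] by (auto simp: X\<xi>_def field_simps)
    then show "prob {\<omega>\<in>space M. \<xi> s \<omega> \<le> ?K * b s} \<le> prob {\<omega>\<in>space M. XA s \<omega> \<le> ?K + 1} + prob {\<omega>\<in>space M. 1 < \<bar>XA s \<omega> - X\<xi> s \<omega>\<bar>}"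
      using prob_shift_le[of "X\<xi> s" "XA s" ?K 1] by (simp add: abs_minus_commute)
  qed simp
  ultimately show ?thesis by linarith
qed

text \<open>Let \<open>p\<close> be the mass of \<open>(0,\<infinity>)\<close> under \<open>\<Lambda>\<close>. For small
  continuity points \<open>z\<close> of \<open>\<Lambda>\<close>, the probability of \<open>A t / b t \<le> z powr (- (1 /
  \<alpha>))\<close> tends to \<open>1 - cdf \<Lambda> z\<close>, which is at most \<open>p\<close> and close to
  \<open>p\<close>. The doubling estimate thus gives \<open>p \<le> p\<^sup>2\<close>, and \<open>p = 0\<close> would make
  \<open>\<Lambda>\<close> degenerate at \<open>0\<close>.\<close>
lemma XT_limit_pos:
  assumes \<Lambda>: "converges_in_law M XT \<Lambda>" and nd: "nondegenerate \<Lambda>"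
  shows "AE x in \<Lambda>. 0 < x"
proof -
  interpret \<Lambda>: real_distribution \<Lambda> using \<Lambda> by (simp add: converges_in_law_def)
  have nonneg: "AE x in \<Lambda>. 0 \<le> x"
  proof (rule limit_nonneg[OF \<Lambda> XT_measurable])
    have "eventually (\<lambda>t. 0 = prob {\<omega>\<in>space M. XT t \<omega> < 0}) at_top"
      using eventually_gt_at_top[of 0]
    proof eventually_elim
      case (elim t)
      note [measurable] = XT_measurable[OF elim]
      have "prob {\<omega>\<in>space M. XT t \<omega> < 0} \<le> prob {\<omega>\<in>space M. XT t \<omega> \<le> 0}" by (intro finite_measure_mono) auto
      then show ?case using XT_nonpos[OF elim] measure_nonneg[of M "{\<omega>\<in>space M. XT t \<omega> < 0}"] by linarith
    qed
    with tendsto_const show "((\<lambda>t. prob {\<omega>\<in>space M. XT t \<omega> < 0}) \<longlongrightarrow> 0) at_top" by (rule Lim_transform_eventually)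
  qed
  define p where "p = measure \<Lambda> {0<..}"
  have p0: "cdf \<Lambda> 0 = 1 - p"
  proof -
    have "{..0} = space \<Lambda> - {0::real<..}" by auto
    then show ?thesis unfolding cdf_def2 p_def by (simp only:) (rule \<Lambda>.prob_compl, simp)
  qed
  have "p \<le> p * p"
  proof (rule field_le_epsilon)
    fix e :: real assume e: "0 < e"
    have "(cdf \<Lambda> \<longlongrightarrow> cdf \<Lambda> 0) (at_right 0)" using \<Lambda>.cdf_is_right_cont by (simp add: continuous_within)
    from order_tendstoD(2)[OF this, of "1 - p + e"] e p0 have "eventually (\<lambda>z. cdf \<Lambda> z < 1 - p + e) (at_right 0)" by simp
    then obtain z0 where z0: "0 < z0" "\<And>z. 0 < z \<Longrightarrow> z < z0 \<Longrightarrow> cdf \<Lambda> z < 1 - p + e"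
      unfolding eventually_at_right_field by auto
    obtain z1 where z1: "0 < z1" "z1 < z0" "isCont (cdf \<Lambda>) z1" using \<Lambda>.ex_continuity_point[OF z0(1)] .
    define y where "y = z1 powr (- (1 / \<alpha>))"
    define B where "B = 2 powr (1 / \<alpha>) + 1"
    have y: "0 < y" and B: "0 < B" using z1 by (auto simp: y_def B_def add_pos_pos)
    \<comment> \<open>\<open>B\<close> exceeds the limit of \<open>b (2 s) / b s\<close>, and \<open>?K\<close> is the
      level that the doubling estimate produces from \<open>y\<close>.\<close>
    let ?K = "(y + 1) * B + 1"
    have K: "0 < ?K" using y B by (simp add: add_pos_pos)
    obtain z2 where z2: "0 < z2" "z2 < ?K powr (- \<alpha>)" "isCont (cdf \<Lambda>) z2"
      using \<Lambda>.ex_continuity_point[of 0 "?K powr (- \<alpha>)"] K by auto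
    let ?y2 = "z2 powr (- (1 / \<alpha>))"
    have "(?K powr (- \<alpha>)) powr (- (1 / \<alpha>)) < ?y2"
      using z2 alpha by (intro powr_less_mono2_neg) auto
    then have Ky2: "?K \<le> ?y2" using alpha K by (simp add: powr_powr)
    have lim1: "((\<lambda>s. prob {\<omega>\<in>space M. XA (s + s) \<omega> \<le> y}) \<longlongrightarrow> 1 - cdf \<Lambda> z1) at_top"
      using filterlim_compose[OF XA_limit_at_reciprocal[OF \<Lambda> z1(1,3)] filterlim_at_top_add_at_top[OF filterlim_ident filterlim_ident]]
      unfolding y_def .
    have D: "((\<lambda>s. prob {\<omega>\<in>space M. 1 < \<bar>XA s \<omega> - X\<xi> s \<omega>\<bar>}) \<longlongrightarrow> 0) at_top"
      using XA_minus_X\<xi> by (simp add: tends_to_0_in_prob_def)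
    have lim2: "((\<lambda>s. prob {\<omega>\<in>space M. 1 < \<bar>XA (s + s) \<omega> - X\<xi> (s + s) \<omega>\<bar>} + 2 * prob {\<omega>\<in>space M. \<xi> s \<omega> < 0}
      + (prob {\<omega>\<in>space M. XA s \<omega> \<le> ?y2} + prob {\<omega>\<in>space M. 1 < \<bar>XA s \<omega> - X\<xi> s \<omega>\<bar>})\<^sup>2)
      \<longlongrightarrow> 0 + 2 * 0 + ((1 - cdf \<Lambda> z2) + 0)\<^sup>2) at_top"
      by (intro tendsto_add tendsto_mult tendsto_const tendsto_power prob_\<xi>_neg D XA_limit_at_reciprocal[OF \<Lambda> z2(1,3)]
          filterlim_compose[OF D filterlim_at_top_add_at_top[OF filterlim_ident filterlim_ident]])
    have "((\<lambda>s. b (2 * s) / b s) \<longlongrightarrow> 2 powr (1 / \<alpha>)) at_top" by (rule b_scale) simp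
    then have "eventually (\<lambda>s. b (2 * s) / b s < B) at_top" by (rule order_tendstoD(2)) (simp add: B_def)
    then have "eventually (\<lambda>s. prob {\<omega>\<in>space M. XA (s + s) \<omega> \<le> y} \<le>
        prob {\<omega>\<in>space M. 1 < \<bar>XA (s + s) \<omega> - X\<xi> (s + s) \<omega>\<bar>} + 2 * prob {\<omega>\<in>space M. \<xi> s \<omega> < 0}
      + (prob {\<omega>\<in>space M. XA s \<omega> \<le> ?y2} + prob {\<omega>\<in>space M. 1 < \<bar>XA s \<omega> - X\<xi> s \<omega>\<bar>})\<^sup>2) at_top"
      using eventually_gt_at_top[of 0]
    proof eventually_elim
      case (elim s)
      note [measurable] = XA_measurable[OF elim(2)]
      have "b (s + s) \<le> B * b s" using elim(1) b_pos[OF elim(2)] by (simp add: divide_less_eq mult_2[symmetric])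
      from XA_doubling[OF y elim(2) this]
      have 1: "prob {\<omega>\<in>space M. XA (s + s) \<omega> \<le> y} \<le> prob {\<omega>\<in>space M. 1 < \<bar>XA (s + s) \<omega> - X\<xi> (s + s) \<omega>\<bar>} + 2 * prob {\<omega>\<in>space M. \<xi> s \<omega> < 0}
        + (prob {\<omega>\<in>space M. XA s \<omega> \<le> ?K} + prob {\<omega>\<in>space M. 1 < \<bar>XA s \<omega> - X\<xi> s \<omega>\<bar>})\<^sup>2" .
      have "prob {\<omega>\<in>space M. XA s \<omega> \<le> ?K} \<le> prob {\<omega>\<in>space M. XA s \<omega> \<le> ?y2}" using Ky2 by (intro finite_measure_mono) auto
      then have "(prob {\<omega>\<in>space M. XA s \<omega> \<le> ?K} + prob {\<omega>\<in>space M. 1 < \<bar>XA s \<omega> - X\<xi> s \<omega>\<bar>})\<^sup>2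
        \<le> (prob {\<omega>\<in>space M. XA s \<omega> \<le> ?y2} + prob {\<omega>\<in>space M. 1 < \<bar>XA s \<omega> - X\<xi> s \<omega>\<bar>})\<^sup>2" by (intro power_mono) auto
      with 1 show ?case by linarith
    qed
    from tendsto_le[OF _ lim2 lim1 this] have "1 - cdf \<Lambda> z1 \<le> (1 - cdf \<Lambda> z2)\<^sup>2" by simp
    also have "\<dots> \<le> p\<^sup>2"
    proof (intro power_mono)
      have "cdf \<Lambda> 0 \<le> cdf \<Lambda> z2" using z2 by (intro \<Lambda>.cdf_nondecreasing) simp
      then show "1 - cdf \<Lambda> z2 \<le> p" using p0 by simp
      show "0 \<le> 1 - cdf \<Lambda> z2" using \<Lambda>.cdf_bounded_prob[of z2] by simp
    qed
    finally show "p \<le> p * p + e" using z0(2)[OF z1(1,2)] by (simp add: power2_eq_square)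
  qed
  then have "p * 1 \<le> p * p" by simp
  then have "p = 0 \<or> 1 \<le> p" using measure_nonneg[of \<Lambda> "{0<..}"] unfolding p_def[symmetric]
    by (cases "p = 0") (auto simp: mult_le_cancel_left_pos)
  moreover have "p \<noteq> 0"
  proof
    assume "p = 0"
    then have "AE x in \<Lambda>. x \<notin> {0<..}" unfolding p_def by (subst (asm) \<Lambda>.prob_eq_0) auto
    with nonneg have "AE x in \<Lambda>. x = 0" by eventually_elim auto
    with nd show False by (auto simp: nondegenerate_def)
  qed
  ultimately have "p = 1" using \<Lambda>.prob_le_1[of "{0<..}"] by (simp add: p_def)
  then show ?thesis unfolding p_def by (subst (asm) \<Lambda>.prob_eq_1) auto
qed

text \<open>The map \<open>x powr (- (1 / \<alpha>))\<close> is injective on \<open>(0,\<infinity>)\<close>, which carries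
  \<open>\<Lambda>\<close>, so its image of \<open>\<Lambda>\<close> is nondegenerate as well.\<close>
lemma X\<xi>_limit_if_XT_limit:
  assumes \<Lambda>: "converges_in_law M XT \<Lambda>" and nd: "nondegenerate \<Lambda>"
  shows "has_nondegenerate_limit_in_law M X\<xi>"
  unfolding has_nondegenerate_limit_in_law_def
proof (intro exI conjI)
  have pos: "AE x in \<Lambda>. 0 < x" by (rule XT_limit_pos[OF \<Lambda> nd])
  show "converges_in_law M X\<xi> (distr \<Lambda> borel (\<lambda>x. x powr (- (1 / \<alpha>))))"
    unfolding X\<xi>_iff_XA by (rule XA_limit_if_XT_limit[OF \<Lambda> pos])
  have "sets \<Lambda> = sets borel" using \<Lambda> by (simp add: converges_in_law_def real_distribution_def real_distribution_axioms_def)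
  then show "nondegenerate (distr \<Lambda> borel (\<lambda>x. x powr (- (1 / \<alpha>))))"
    by (intro nondegenerate_distr[OF nd, where g="\<lambda>x. x powr (- \<alpha>)"])
      (use pos alpha in \<open>auto simp: powr_powr cong: measurable_cong_sets elim!: eventually_mono\<close>)
qed

lemma YU_limit:
  assumes fm: "f \<in> borel_measurable borel" and g: "integrable \<mu> (recip f)" and m: "(\<integral>v. recip f v \<partial>\<mu>) \<noteq> 0"
    and \<Lambda>: "converges_in_law M XT \<Lambda>"
  shows "converges_in_law M (YU f) (distr \<Lambda> borel (\<lambda>x. (\<integral>v. recip f v \<partial>\<mu>) * x))"
  using XT_measurable YU_measurable[OF fm]
  by (intro slutsky[OF converges_in_law_cmult[OF \<Lambda> XT_measurable m] YU_asymptotic[OF fm g \<Lambda>]] borel_measurable_times borel_measurable_const) auto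

end

section \<open>One-sided stable laws and Mittag-Leffler laws\<close>

lemma filterlim_powr_at_top: "0 < p \<Longrightarrow> filterlim (\<lambda>x::real. x powr p) at_top at_top"
  by real_asymp

lemma char_distr_cmult:
  assumes "real_distribution L"
  shows "char (distr L borel (\<lambda>x. k * x)) u = char L (k * u)"
proof -
  interpret real_distribution L by fact
  show ?thesis unfolding char_def by (subst integral_distr) (auto simp: mult_ac)
qed

lemma char_convolution:
  assumes "real_distribution L" "real_distribution L'"
  shows "char (L \<star> L') u = char L u * char L' u"
proof -
  interpret L: real_distribution L by fact
  interpret L': real_distribution L' by fact
  interpret P: pair_prob_space L L' ..
  let ?f = "\<lambda>p. iexp (u * (fst p + snd p))"
  have m: "?f \<in> borel_measurable (L \<Otimes>\<^sub>M L')" by measurable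
  have i: "integrable (L \<Otimes>\<^sub>M L') ?f" by (rule P.integrable_const_bound[where B=1]) (use m in auto)
  have "char (L \<star> L') u = (\<integral>p. ?f p \<partial>(L \<Otimes>\<^sub>M L'))"
    unfolding char_def convolution_def by (subst integral_distr) (auto simp: case_prod_beta')
  also have "\<dots> = (\<integral>x. (\<integral>y. ?f (x, y) \<partial>L') \<partial>L)" by (rule P.integral_fst'[OF i, symmetric])
  also have "\<dots> = (\<integral>x. iexp (u * x) * char L' u \<partial>L)"
    unfolding char_def by (simp add: distrib_left exp_add)
  also have "\<dots> = char L u * char L' u" unfolding char_def by simp
  finally show ?thesis .
qed

lemma real_distribution_convolution:
  assumes "real_distribution L" "real_distribution L'"
  shows "real_distribution (L \<star> L')"
proof -
  interpret L: real_distribution L by fact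
  interpret L': real_distribution L' by fact
  interpret P: pair_prob_space L L' ..
  show ?thesis unfolding convolution_def by (rule P.real_distribution_distr) (simp add: case_prod_beta')
qed

text \<open>Cauchy's functional equation on the half-line: nonnegativity makes \<open>f\<close> monotone, so that \<open>f
  (n u) = n f u\<close> lies between the values at the integers next to \<open>n u\<close>.\<close>
lemma additive_mono_linear:
  fixes f :: "real \<Rightarrow> real"
  assumes add: "\<And>u v. 0 < u \<Longrightarrow> 0 < v \<Longrightarrow> f (u + v) = f u + f v" and nonneg: "\<And>u. 0 < u \<Longrightarrow> 0 \<le> f u"
    and u: "0 < u"
  shows "f u = u * f 1"
proof -
  have mono: "f x \<le> f y" if "0 < x" "x \<le> y" for x y
    using add[of x "y - x"] nonneg[of "y - x"] that by (cases "x = y") auto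
  have mult: "f (real (Suc n) * x) = real (Suc n) * f x" if x: "0 < x" for n x
  proof (induction n)
    case (Suc n)
    have "f (real (Suc (Suc n)) * x) = f (real (Suc n) * x + x)" by (simp add: algebra_simps)
    also have "\<dots> = f (real (Suc n) * x) + f x" using x by (intro add) auto
    finally show ?case unfolding Suc by (simp add: algebra_simps)
  qed simp
  have "real (Suc n) * \<bar>f u - u * f 1\<bar> \<le> f 1" for n
  proof -
    let ?x = "real (Suc n) * u"
    define k where "k = nat \<lfloor>?x\<rfloor>"
    have x: "0 < ?x" using u by simp
    then have k: "real k \<le> ?x" "?x < real k + 1" unfolding k_def by linarith+
    have "f ?x \<le> f (real (Suc k) * 1)" using k x by (intro mono) auto
    then have up: "f ?x \<le> (real k + 1) * f 1" unfolding mult[OF zero_less_one] by (simp add: add.commute)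
    have low: "real k * f 1 \<le> f ?x"
    proof (cases k)
      case 0
      then show ?thesis using nonneg[OF x] by simp
    next
      case (Suc j)
      have "f (real (Suc j) * 1) \<le> f ?x" using k Suc by (intro mono) auto
      then show ?thesis unfolding mult[OF zero_less_one] Suc .
    qed
    have "real k * f 1 \<le> ?x * f 1" "?x * f 1 \<le> (real k + 1) * f 1"
      using k nonneg[OF zero_less_one] by (auto intro!: mult_right_mono)
    with up low have "\<bar>f ?x - ?x * f 1\<bar> \<le> f 1" by (simp add: algebra_simps abs_le_iff)
    also have "f ?x - ?x * f 1 = real (Suc n) * (f u - u * f 1)" unfolding mult[OF u] by (simp add: algebra_simps)
    finally show ?thesis by (simp only: abs_mult abs_of_nat)
  qed
  then have small: "real (Suc n) * \<bar>f u - u * f 1\<bar> \<le> f 1" for n .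
  show ?thesis
  proof (rule ccontr)
    assume "f u \<noteq> u * f 1"
    then have p: "0 < \<bar>f u - u * f 1\<bar>" by simp
    obtain n :: nat where "f 1 / \<bar>f u - u * f 1\<bar> < real n" using reals_Archimedean2 by blast
    then have "f 1 < real n * \<bar>f u - u * f 1\<bar>" using p by (simp add: divide_less_eq)
    moreover have "real n * \<bar>f u - u * f 1\<bar> \<le> real (Suc n) * \<bar>f u - u * f 1\<bar>" by (intro mult_right_mono) auto
    ultimately show False using small[of n] by linarith
  qed
qed

text \<open>On a nonnegative strictly stable law, the Laplace transform at \<open>u powr (1 / \<alpha>)\<close> is
  multiplicative in \<open>u\<close>, hence exponential.\<close>
lemma stable_nonneg_laplace:
  assumes S: "stable_law \<alpha> S" and nonneg: "AE x in S. 0 \<le> x" and alpha: "0 < \<alpha>"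
  obtains c where "0 < c" "\<And>l. 0 \<le> l \<Longrightarrow> (\<integral>x. exp (- l * x) \<partial>S) = exp (- c * l powr \<alpha>)"
proof -
  interpret S: real_distribution S using S by (simp add: stable_law_def)
  have nd: "nondegenerate S" using S by (simp add: stable_law_def)
  have i: "integrable S (\<lambda>x. exp (- l * x))" if "0 \<le> l" for l
    using nonneg that by (intro S.integrable_const_bound[where B=1]) (auto elim!: eventually_mono)
  define \<phi> where "\<phi> = (\<lambda>l. \<integral>x. exp (- l * x) \<partial>S)"
  have nn: "(\<integral>\<^sup>+x. ennreal (exp (- l * x)) \<partial>S) = ennreal (\<phi> l)" if "0 \<le> l" for l
    unfolding \<phi>_def by (rule nn_integral_eq_integral[OF i[OF that]]) auto
  have \<phi>0: "0 \<le> \<phi> l" for l unfolding \<phi>_def by (intro integral_nonneg_AE) auto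
  have \<phi>_pos: "0 < \<phi> l" if "0 \<le> l" for l
  proof (rule ccontr)
    assume "\<not> 0 < \<phi> l"
    then have "\<phi> l = 0" using \<phi>0[of l] by linarith
    then have "AE x in S. exp (- l * x) = 0"
      unfolding \<phi>_def by (subst (asm) integral_nonneg_eq_0_iff_AE[OF i[OF that]]) auto
    then have "AE x in S. False" by eventually_elim simp
    then show False by simp
  qed
  have \<phi>_le: "\<phi> l \<le> 1" if "0 \<le> l" for l
  proof -
    have "\<phi> l \<le> (\<integral>x. 1 \<partial>S)" unfolding \<phi>_def using nonneg that
      by (intro integral_mono_AE[OF i[OF that]]) (auto elim!: eventually_mono)
    then show ?thesis using S.prob_space by simp
  qed
  let ?r = "\<lambda>u. u powr (1 / \<alpha>)"
  have mult: "\<phi> (?r (u + v)) = \<phi> (?r u) * \<phi> (?r v)" if u: "0 < u" and v: "0 < v" for u v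
  proof -
    let ?D = "\<lambda>k. distr S borel (\<lambda>x. k * x)"
    have D: "(\<integral>\<^sup>+x. ennreal (exp (- x)) \<partial>?D k) = ennreal (\<phi> k)" if "0 \<le> k" for k
      unfolding nn[OF that, symmetric] by (subst nn_integral_distr) auto
    have fin: "finite_measure (?D k)" for k by (intro prob_space.finite_measure S.prob_space_distr) simp
    have e: "?r (?r u powr \<alpha> + ?r v powr \<alpha>) = ?r (u + v)" using u v alpha by (simp add: powr_powr)
    have "?D (?r u) \<star> ?D (?r v) = ?D (?r (?r u powr \<alpha> + ?r v powr \<alpha>))"
      using S u v by (simp add: stable_law_def)
    then have "ennreal (\<phi> (?r (u + v))) = (\<integral>\<^sup>+x. ennreal (exp (- x)) \<partial>(?D (?r u) \<star> ?D (?r v)))"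
      unfolding e by (simp only:) (rule D[symmetric], simp)
    also have "\<dots> = (\<integral>\<^sup>+x. \<integral>\<^sup>+y. ennreal (exp (- (x + y))) \<partial>?D (?r v) \<partial>?D (?r u))"
      by (rule nn_integral_convolution[OF fin fin]) auto
    also have "\<dots> = (\<integral>\<^sup>+x. ennreal (exp (- x)) * (\<integral>\<^sup>+y. ennreal (exp (- y)) \<partial>?D (?r v)) \<partial>?D (?r u))"
      by (intro nn_integral_cong, subst nn_integral_cmult[symmetric]) (auto simp: exp_add exp_diff exp_minus ennreal_mult'[symmetric] divide_inverse mult.commute)
    also have "\<dots> = ennreal (\<phi> (?r u)) * ennreal (\<phi> (?r v))"
      by (subst nn_integral_multc) (auto simp: D)
    finally show ?thesis using \<phi>0 by (simp add: ennreal_mult'[symmetric])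
  qed
  define f where "f = (\<lambda>u. - ln (\<phi> (?r u)))"
  have lin: "f u = u * f 1" if "0 < u" for u
  proof (rule additive_mono_linear[OF _ _ that])
    show "f (u + v) = f u + f v" if "0 < u" "0 < v" for u v
      unfolding f_def mult[OF that] using \<phi>_pos[of "?r u"] \<phi>_pos[of "?r v"] by (simp add: ln_mult)
    show "0 \<le> f u" if "0 < u" for u unfolding f_def using \<phi>_pos[of "?r u"] \<phi>_le[of "?r u"] by simp
  qed
  have \<phi>_eq: "\<phi> l = exp (- f 1 * l powr \<alpha>)" if "0 \<le> l" for l
  proof (cases "l = 0")
    case True
    then show ?thesis using S.prob_space by (simp add: \<phi>_def)
  next
    case False
    then have l: "0 < l" using that by simp
    then have "?r (l powr \<alpha>) = l" using alpha by (simp add: powr_powr)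
    with lin[of "l powr \<alpha>"] l have "ln (\<phi> l) = - f 1 * l powr \<alpha>" by (simp add: f_def)
    then show ?thesis using \<phi>_pos[OF that] by (metis exp_ln)
  qed
  have "f 1 \<noteq> 0"
  proof
    assume "f 1 = 0"
    then have "\<phi> 1 = 1" using \<phi>_eq[of 1] by simp
    then have "(\<integral>x. 1 - exp (- 1 * x) \<partial>S) = 0"
      unfolding \<phi>_def using i[of 1] S.prob_space by (subst Bochner_Integration.integral_diff) auto
    then have "AE x in S. 1 - exp (- 1 * x) = 0"
      using i[of 1] nonneg by (subst (asm) integral_nonneg_eq_0_iff_AE) (auto elim!: eventually_mono)
    then have "AE x in S. x = 0" by eventually_elim simp
    with nd show False by (auto simp: nondegenerate_def)
  qed
  moreover have "0 \<le> f 1" unfolding f_def using \<phi>_pos[of 1] \<phi>_le[of 1] by simp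
  ultimately show ?thesis using that[of "f 1"] \<phi>_eq unfolding \<phi>_def by auto
qed

text \<open>The mass at \<open>0\<close> is a lower bound of the Laplace transform, which vanishes at infinity.\<close>
lemma pos_if_laplace_tends_to_0:
  assumes "real_distribution S" and nonneg: "AE x in S. 0 \<le> x" and alpha: "0 < \<alpha>" and c: "0 < c"
    and laplace: "\<And>l. 0 \<le> l \<Longrightarrow> (\<integral>x. exp (- l * x) \<partial>S) = exp (- c * l powr \<alpha>)"
  shows "AE x in S. 0 < x"
proof -
  interpret S: real_distribution S by fact
  have le: "measure S {0} \<le> exp (- c * l powr \<alpha>)" if l: "0 \<le> l" for l
  proof -
    have i: "integrable S (\<lambda>x. exp (- l * x))"
      using nonneg l by (intro S.integrable_const_bound[where B=1]) (auto elim!: eventually_mono)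
    have "measure S {0} = (\<integral>x. indicator {0} x \<partial>S)" by simp
    also have "\<dots> \<le> (\<integral>x. exp (- l * x) \<partial>S)" by (rule integral_mono[OF _ i]) (auto simp: indicator_def S.integrable_const_bound[where B=1])
    finally show ?thesis unfolding laplace[OF l] .
  qed
  have "((\<lambda>l. exp (- c * l powr \<alpha>)) \<longlongrightarrow> 0) at_top"
  proof -
    have "filterlim (\<lambda>l. c * l powr \<alpha>) at_top at_top"
      using c alpha by (intro filterlim_tendsto_pos_mult_at_top[OF tendsto_const] filterlim_powr_at_top) auto
    then have "filterlim (\<lambda>l. - c * l powr \<alpha>) at_bot at_top" by (simp add: filterlim_uminus_at_top)
    then show ?thesis by (rule filterlim_compose[OF exp_at_bot])
  qed
  moreover have "eventually (\<lambda>l. measure S {0} \<le> exp (- c * l powr \<alpha>)) at_top"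
    using eventually_ge_at_top[of 0] by eventually_elim (rule le)
  ultimately have "measure S {0} \<le> 0" by (rule tendsto_lowerbound) simp
  then have "measure S {0} = 0" by (simp add: measure_le_0_iff)
  then have "AE x in S. x \<notin> {0}" by (subst (asm) S.prob_eq_0) auto
  with nonneg show ?thesis by eventually_elim auto
qed

text \<open>This crude bound makes the Mittag-Leffler series converge, as \<open>K\<close> is arbitrary.\<close>
lemma Gamma_lower_bound:
  assumes K: "0 < K" and x: "0 \<le> x"
  shows "K powr x * exp (- K) \<le> Gamma (1 + x :: real)"
proof -
  have lim: "((\<lambda>t::real. - exp (- t)) \<longlongrightarrow> - 0) at_top"
    by (intro tendsto_minus filterlim_compose[OF exp_at_bot] filterlim_uminus_at_bot_at_top)
  have "(\<integral>\<^sup>+t. ennreal (exp (- t)) * indicator {K..} t \<partial>lborel) = ennreal (- 0 - - exp (- K))"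
    by (rule nn_integral_FTC_atLeast[where F="\<lambda>t. - exp (- t)"]) (use lim in \<open>auto intro!: derivative_eq_intros\<close>)
  then have E: "(\<integral>\<^sup>+t. ennreal (exp (- t)) * indicator {K..} t \<partial>lborel) = ennreal (exp (- K))" by simp
  have "ennreal (K powr x * exp (- K)) = ennreal (K powr x) * (\<integral>\<^sup>+t. ennreal (exp (- t)) * indicator {K..} t \<partial>lborel)"
    unfolding E by (rule ennreal_mult) auto
  also have "\<dots> = (\<integral>\<^sup>+t. ennreal (K powr x) * (ennreal (exp (- t)) * indicator {K..} t) \<partial>lborel)"
    by (rule nn_integral_cmult[symmetric]) measurable
  also have "\<dots> \<le> (\<integral>\<^sup>+t. ennreal (indicator {0..} t * t powr (1 + x - 1) / exp t) \<partial>lborel)"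
  proof (intro nn_integral_mono)
    fix t :: real
    show "ennreal (K powr x) * (ennreal (exp (- t)) * indicator {K..} t) \<le> ennreal (indicator {0..} t * t powr (1 + x - 1) / exp t)"
    proof (cases "K \<le> t")
      case True
      have "ennreal (K powr x) * ennreal (exp (- t)) = ennreal (K powr x * exp (- t))" by (rule ennreal_mult[symmetric]) auto
      also have "\<dots> \<le> ennreal (t powr x * exp (- t))"
        using True K x by (intro ennreal_leI mult_right_mono powr_mono2) auto
      finally show ?thesis using True K by (simp add: exp_minus divide_inverse)
    qed simp
  qed
  also have "\<dots> = ennreal (Gamma (1 + x))" using x by (intro Gamma_conv_nn_integral_real[symmetric]) auto
  finally show ?thesis using x Gamma_real_pos[of "1 + x"] by (subst (asm) ennreal_le_iff) auto
qed

lemma gamma_integral_scaled: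
  fixes s x :: real
  assumes s: "0 < s" and x: "0 < x"
  shows "(\<integral>\<^sup>+l. ennreal (indicator {0<..} l * l powr (s - 1) * exp (- l * x)) \<partial>lborel) = ennreal (Gamma s * x powr (- s))"
proof -
  let ?I = "\<integral>\<^sup>+l. ennreal (indicator {0<..} l * l powr (s - 1) * exp (- l * x)) \<partial>lborel"
  have "ennreal (Gamma s) = (\<integral>\<^sup>+t. ennreal (indicator {0..} t * t powr (s - 1) / exp t) \<partial>lborel)"
    by (rule Gamma_conv_nn_integral_real[OF s])
  also have "\<dots> = ennreal \<bar>x\<bar> * (\<integral>\<^sup>+l. ennreal (indicator {0..} (0 + x * l) * (0 + x * l) powr (s - 1) / exp (0 + x * l)) \<partial>lborel)"
    using x by (intro nn_integral_real_affine) auto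
  also have "(\<integral>\<^sup>+l. ennreal (indicator {0..} (0 + x * l) * (0 + x * l) powr (s - 1) / exp (0 + x * l)) \<partial>lborel) =
      (\<integral>\<^sup>+l. ennreal (x powr (s - 1)) * ennreal (indicator {0<..} l * l powr (s - 1) * exp (- l * x)) \<partial>lborel)"
  proof (rule nn_integral_cong)
    fix l :: real
    show "ennreal (indicator {0..} (0 + x * l) * (0 + x * l) powr (s - 1) / exp (0 + x * l)) =
      ennreal (x powr (s - 1)) * ennreal (indicator {0<..} l * l powr (s - 1) * exp (- l * x))"
    proof (cases "0 < l")
      case True
      then have "ennreal (x powr (s - 1)) * ennreal (indicator {0<..} l * l powr (s - 1) * exp (- l * x))
        = ennreal (x powr (s - 1) * (l powr (s - 1) * exp (- l * x)))" by (simp add: ennreal_mult)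
      then show ?thesis using True x by (simp add: powr_mult exp_minus divide_inverse mult_ac)
    next
      case False
      then have "l = 0 \<or> x * l < 0" using x by (auto simp: mult_less_0_iff)
      then show ?thesis using False by auto
    qed
  qed
  also have "\<dots> = ennreal (x powr (s - 1)) * ?I" by (rule nn_integral_cmult) measurable
  finally have "ennreal (Gamma s) = ennreal (x * x powr (s - 1)) * ?I" using x by (simp add: ennreal_mult mult.assoc)
  also have "x * x powr (s - 1) = x powr s" using x by (simp add: powr_diff)
  finally have "ennreal (x powr (- s)) * ennreal (Gamma s) = ennreal (x powr (- s)) * ennreal (x powr s) * ?I" by (simp only: mult.assoc)
  also have "ennreal (x powr (- s)) * ennreal (x powr s) = 1" using x by (simp add: ennreal_mult[symmetric] powr_add[symmetric])
  finally show ?thesis using s Gamma_real_pos[OF s] by (simp add: ennreal_mult mult.commute)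
qed

text \<open>The substitution \<open>w = c * l powr \<alpha>\<close> reduces the integrand to \<open>exp (- w) * w ^ (n -
  1)\<close>, which has an elementary primitive.\<close>
lemma exp_power_integral:
  fixes \<alpha> c :: real
  assumes alpha: "0 < \<alpha>" and c: "0 < c" and n: "0 < n"
  shows "(\<integral>\<^sup>+l. ennreal (indicator {0<..} l * l powr (\<alpha> * real n - 1) * exp (- c * l powr \<alpha>)) \<partial>lborel) =
    ennreal (fact (n - 1) / (\<alpha> * c ^ n))"
proof -
  define A :: real where "A = fact (n - 1) / (\<alpha> * c ^ n)"
  let ?w = "\<lambda>l. c * l powr \<alpha>"
  let ?S = "\<lambda>w. \<Sum>k<n. w ^ k / fact k :: real"
  define F where "F = (\<lambda>l. - A * (exp (- ?w l) * ?S (?w l)))"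
  let ?f = "\<lambda>l. l powr (\<alpha> * real n - 1) * exp (- c * l powr \<alpha>)"
  have dS: "((\<lambda>w. exp (- w) * ?S w) has_real_derivative - (exp (- w) * (w ^ (n - 1) / fact (n - 1)))) (at w)" for w :: real
  proof -
    have "((\<lambda>w. \<Sum>k<m. w ^ k / fact k) has_real_derivative (\<Sum>k<m. w ^ k / fact k) - (if m = 0 then 0 else w ^ (m - 1) / fact (m - 1))) (at w)" for m
    proof (induction m)
      case (Suc m)
      note IH = Suc.IH
      show ?case
      proof (cases m)
        case (Suc j)
        have "((\<lambda>w. w ^ Suc j / fact (Suc j)) has_real_derivative real (Suc j) * w ^ (Suc j - Suc 0) / fact (Suc j)) (at w)"
          by (intro DERIV_cdivide DERIV_pow)
        also have "real (Suc j) * w ^ (Suc j - Suc 0) / fact (Suc j) = w ^ j / fact j"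
          unfolding fact_Suc by (simp del: of_nat_Suc)
        finally have d: "((\<lambda>w. w ^ m / fact m) has_real_derivative w ^ j / fact j) (at w)" unfolding Suc .
        from DERIV_add[OF IH d] show ?thesis using Suc by simp
      qed auto
    qed simp
    from this[of n] n have "((\<lambda>w. ?S w) has_real_derivative ?S w - w ^ (n - 1) / fact (n - 1)) (at w)" by simp
    moreover have "((\<lambda>w. exp (- w)) has_real_derivative - exp (- w)) (at w)" by (auto intro!: derivative_eq_intros)
    ultimately show ?thesis by (intro DERIV_cong[OF DERIV_mult]) (auto simp: algebra_simps)
  qed
  have dF: "(F has_real_derivative ?f l) (at l)" if l: "0 < l" for l
  proof -
    have "(?w has_real_derivative c * (\<alpha> * l powr (\<alpha> - 1))) (at l)"
      by (intro DERIV_cmult has_real_derivative_powr l)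
    from DERIV_cmult[OF DERIV_chain2[OF dS this], of "- A"]
    have "(F has_real_derivative - A * (- (exp (- ?w l) * (?w l ^ (n - 1) / fact (n - 1))) * (c * (\<alpha> * l powr (\<alpha> - 1))))) (at l)"
      unfolding F_def .
    also have "- A * (- (exp (- ?w l) * (?w l ^ (n - 1) / fact (n - 1))) * (c * (\<alpha> * l powr (\<alpha> - 1)))) = ?f l"
    proof -
      obtain j where j: "n = Suc j" using n by (cases n) auto
      have "(l powr \<alpha>) ^ j = l powr (\<alpha> * real j)" using l by (simp add: powr_realpow[symmetric] powr_powr)
      then have "(l powr \<alpha>) ^ j * l powr (\<alpha> - 1) = l powr (\<alpha> * real n - 1)"
        using l by (simp add: powr_add[symmetric] j algebra_simps)
      moreover have "- A * (- (exp (- ?w l) * (?w l ^ (n - 1) / fact (n - 1))) * (c * (\<alpha> * l powr (\<alpha> - 1))))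
        = exp (- ?w l) * ((l powr \<alpha>) ^ j * l powr (\<alpha> - 1))"
        using alpha c by (simp add: A_def j power_mult_distrib field_simps)
      ultimately show ?thesis by (simp add: mult.commute)
    qed
    finally show ?thesis .
  qed
  have w_top: "filterlim ?w at_top at_top"
    using c alpha by (intro filterlim_tendsto_pos_mult_at_top[OF tendsto_const] filterlim_powr_at_top) auto
  have "((\<lambda>w::real. \<Sum>k<n. (w ^ k / exp w) / fact k) \<longlongrightarrow> (\<Sum>k<n. 0 / fact k)) at_top"
    by (intro tendsto_sum tendsto_divide tendsto_power_div_exp_0 tendsto_const) auto
  then have "((\<lambda>w::real. exp (- w) * ?S w) \<longlongrightarrow> 0) at_top"
    by (simp add: sum_distrib_left exp_minus divide_inverse mult_ac)
  from tendsto_mult[OF tendsto_const[of "- A"] filterlim_compose[OF this w_top]]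
  have Ftop: "(F \<longlongrightarrow> 0) at_top" unfolding F_def by simp
  have "((\<lambda>l. l powr \<alpha>) \<longlongrightarrow> 0) (at_right 0)"
  proof -
    have "((\<lambda>l. l powr \<alpha>) \<longlongrightarrow> 0 powr \<alpha>) (at_right 0)"
      by (intro tendsto_powr2[OF tendsto_ident_at tendsto_const]) (use alpha in \<open>auto simp: eventually_at_right_field intro: exI[of _ 1]\<close>)
    then show ?thesis by simp
  qed
  from tendsto_mult[OF tendsto_const[of c] this] have w0: "(?w \<longlongrightarrow> 0) (at_right 0)" by simp
  have "((\<lambda>l. - A * (exp (- ?w l) * ?S (?w l))) \<longlongrightarrow> - A * (exp (- 0) * ?S 0)) (at_right 0)"
    by (intro tendsto_intros w0) auto
  moreover have "?S 0 = 1"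
  proof -
    obtain j where "n = Suc j" using n by (cases n) auto
    then show ?thesis by (simp only: sum.lessThan_Suc_shift) simp
  qed
  ultimately have F0: "(F \<longlongrightarrow> - A) (at_right 0)" unfolding F_def by simp
  have x_pos: "0 < x" if "0 < ereal x" for x using that by (simp add: zero_ereal_def)
  have dF': "DERIV F x :> ?f x" if "0 < ereal x" "ereal x < \<infinity>" for x by (rule dF[OF x_pos[OF that(1)]])
  have cf: "isCont ?f x" if "0 < ereal x" "ereal x < \<infinity>" for x using x_pos[OF that(1)] by (auto intro!: continuous_intros)
  have f0: "AE x in lborel. 0 < ereal x \<longrightarrow> ereal x < \<infinity> \<longrightarrow> 0 \<le> ?f x" by simp
  have lim0: "((F \<circ> real_of_ereal) \<longlongrightarrow> - A) (at_right 0)" using F0 by (simp add: zero_ereal_def ereal_tendsto_simps)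
  have limtop: "((F \<circ> real_of_ereal) \<longlongrightarrow> 0) (at_left \<infinity>)" using Ftop by (simp add: ereal_tendsto_simps)
  note FTC = interval_integral_FTC_nonneg[OF _ dF' cf f0 lim0 limtop, simplified]
  have ein: "einterval 0 \<infinity> = {0<..}" by (auto simp: einterval_def zero_ereal_def)
  have "(LBINT x=0..\<infinity>. ?f x) = (\<integral>l. indicator {0<..} l * ?f l \<partial>lborel)"
    by (simp add: interval_lebesgue_integral_def set_lebesgue_integral_def ein)
  moreover have "(LBINT x=0..\<infinity>. ?f x) = A" using FTC(2) by simp
  ultimately have "(\<integral>l. indicator {0<..} l * ?f l \<partial>lborel) = A" by simp
  moreover have "integrable lborel (\<lambda>l. indicator {0<..} l * ?f l)"
    using FTC(1) by (simp add: set_integrable_def ein)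
  ultimately have "(\<integral>\<^sup>+l. ennreal (indicator {0<..} l * ?f l) \<partial>lborel) = ennreal A"
    by (subst nn_integral_eq_integral) auto
  then show ?thesis by (simp add: A_def mult.assoc)
qed

text \<open>By Tonelli, \<open>Gamma s\<close> times the negative moment of order \<open>s\<close> is the integral of
  \<open>l powr (s - 1)\<close> against the Laplace transform, which is elementary for \<open>s = \<alpha>
  n\<close>.\<close>
lemma negative_moments:
  assumes "real_distribution S" and pos: "AE x in S. 0 < x" and alpha: "0 < \<alpha>" and c: "0 < c"
    and laplace: "\<And>l. 0 \<le> l \<Longrightarrow> (\<integral>x. exp (- l * x) \<partial>S) = exp (- c * l powr \<alpha>)"
  shows "(\<integral>\<^sup>+x. ennreal ((c * x powr (- \<alpha>)) ^ n) \<partial>S) = ennreal (fact n / Gamma (1 + real n * \<alpha>))"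
proof (cases "n = 0")
  case True
  interpret S: real_distribution S by fact
  show ?thesis using True S.emeasure_space_1 by simp
next
  case False
  interpret S: real_distribution S by fact
  interpret P: pair_sigma_finite S lborel ..
  let ?s = "\<alpha> * real n"
  have s: "0 < ?s" using False alpha by simp
  have G: "0 < Gamma ?s" using s by (rule Gamma_real_pos)
  let ?h = "\<lambda>x l. ennreal (indicator {0<..} l * l powr (?s - 1) * exp (- l * x))"
  have m: "(\<lambda>p. ?h (fst p) (snd p)) \<in> borel_measurable (S \<Otimes>\<^sub>M lborel)" by measurable
  have "(\<integral>\<^sup>+x. ennreal (Gamma ?s * x powr (- ?s)) \<partial>S) = (\<integral>\<^sup>+x. \<integral>\<^sup>+l. ?h x l \<partial>lborel \<partial>S)"
  proof (rule nn_integral_cong_AE)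
    show "AE x in S. ennreal (Gamma ?s * x powr (- ?s)) = (\<integral>\<^sup>+l. ?h x l \<partial>lborel)"
      using pos by eventually_elim (rule gamma_integral_scaled[OF s, symmetric])
  qed
  also have "\<dots> = (\<integral>\<^sup>+l. \<integral>\<^sup>+x. ?h x l \<partial>S \<partial>lborel)"
    by (rule P.Fubini'[symmetric]) (use m in \<open>simp only: case_prod_beta'\<close>)
  also have "\<dots> = (\<integral>\<^sup>+l. ennreal (indicator {0<..} l * l powr (?s - 1) * exp (- c * l powr \<alpha>)) \<partial>lborel)"
  proof (rule nn_integral_cong)
    fix l :: real
    show "(\<integral>\<^sup>+x. ?h x l \<partial>S) = ennreal (indicator {0<..} l * l powr (?s - 1) * exp (- c * l powr \<alpha>))"
    proof (cases "0 < l")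
      case True
      have i: "integrable S (\<lambda>x. exp (- l * x))"
        using pos True by (intro S.integrable_const_bound[where B=1]) (auto elim!: eventually_mono)
      have "(\<integral>\<^sup>+x. ?h x l \<partial>S) = (\<integral>\<^sup>+x. ennreal (l powr (?s - 1)) * ennreal (exp (- l * x)) \<partial>S)"
        using True by (intro nn_integral_cong) (simp add: ennreal_mult)
      also have "\<dots> = ennreal (l powr (?s - 1)) * (\<integral>\<^sup>+x. ennreal (exp (- l * x)) \<partial>S)"
        by (rule nn_integral_cmult) measurable
      also have "(\<integral>\<^sup>+x. ennreal (exp (- l * x)) \<partial>S) = ennreal (exp (- c * l powr \<alpha>))"
        unfolding laplace[OF less_imp_le[OF True], symmetric] by (rule nn_integral_eq_integral[OF i]) auto
      finally show ?thesis using True by (simp add: ennreal_mult)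
    qed simp
  qed
  also have "\<dots> = ennreal (fact (n - 1) / (\<alpha> * c ^ n))" using False by (intro exp_power_integral alpha c) simp
  finally have E: "(\<integral>\<^sup>+x. ennreal (Gamma ?s * x powr (- ?s)) \<partial>S) = ennreal (fact (n - 1) / (\<alpha> * c ^ n))" .
  have "(\<integral>\<^sup>+x. ennreal ((c * x powr (- \<alpha>)) ^ n) \<partial>S) = (\<integral>\<^sup>+x. ennreal (c ^ n / Gamma ?s) * ennreal (Gamma ?s * x powr (- ?s)) \<partial>S)"
  proof (rule nn_integral_cong_AE)
    show "AE x in S. ennreal ((c * x powr (- \<alpha>)) ^ n) = ennreal (c ^ n / Gamma ?s) * ennreal (Gamma ?s * x powr (- ?s))"
      using pos
    proof eventually_elim
      case (elim x)
      have "ennreal (c ^ n / Gamma ?s) * ennreal (Gamma ?s * x powr (- ?s)) = ennreal (c ^ n / Gamma ?s * (Gamma ?s * x powr (- ?s)))"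
        using G c by (intro ennreal_mult[symmetric]) auto
      moreover have "(x powr (- \<alpha>)) ^ n = x powr (- ?s)" using elim by (simp add: powr_realpow[symmetric] powr_powr)
      ultimately show ?case using G by (simp add: power_mult_distrib)
    qed
  qed
  also have "\<dots> = ennreal (c ^ n / Gamma ?s) * ennreal (fact (n - 1) / (\<alpha> * c ^ n))"
    unfolding E[symmetric] by (rule nn_integral_cmult) (simp cong: measurable_cong_sets)
  also have "\<dots> = ennreal (c ^ n / Gamma ?s * (fact (n - 1) / (\<alpha> * c ^ n)))"
    using G c alpha by (intro ennreal_mult[symmetric]) auto
  also have "c ^ n / Gamma ?s * (fact (n - 1) / (\<alpha> * c ^ n)) = fact n / Gamma (1 + real n * \<alpha>)"
  proof -
    have g: "Gamma (1 + real n * \<alpha>) = ?s * Gamma ?s"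
    proof -
      have "?s \<notin> \<int>\<^sub>\<le>\<^sub>0" using s by (auto dest: nonpos_Ints_nonpos)
      from Gamma_plus1[OF this] show ?thesis by (simp add: add.commute mult.commute)
    qed
    have "fact n = real n * (fact (n - 1) :: real)" using False by (simp add: fact_reduce)
    then show ?thesis unfolding g using c alpha False G by (simp add: field_simps)
  qed
  finally show ?thesis .
qed

text \<open>The moments \<open>fact n / Gamma (1 + n \<alpha>)\<close> are those of the Mittag-Leffler law. The
  exponential series may be integrated term by term, as \<open>Gamma (1 + n \<alpha>)\<close> grows faster than any
  geometric sequence.\<close>
theorem mittag_leffler_reciprocal_stable:
  assumes S: "real_distribution S" and pos: "AE x in S. 0 < x" and alpha: "0 < \<alpha>" and c: "0 < c"
    and laplace: "\<And>l. 0 \<le> l \<Longrightarrow> (\<integral>x. exp (- l * x) \<partial>S) = exp (- c * l powr \<alpha>)"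
  shows "mittag_leffler_law \<alpha> (distr S borel (\<lambda>x. c * x powr (- \<alpha>)))"
proof -
  interpret S: real_distribution S by fact
  let ?Z = "\<lambda>x. c * x powr (- \<alpha>) :: real"
  have Zm: "?Z \<in> borel_measurable S" by (simp cong: measurable_cong_sets)
  have Z0: "0 \<le> ?Z x" for x using c by simp
  have mom: "(\<integral>\<^sup>+x. ennreal (?Z x ^ n) \<partial>S) = ennreal (fact n / Gamma (1 + real n * \<alpha>))" for n
    by (rule negative_moments[OF S pos alpha c laplace])
  have G: "0 < Gamma (1 + real n * \<alpha>)" for n using alpha by (intro Gamma_real_pos) (simp add: add_pos_nonneg)
  have iZ: "integrable S (\<lambda>x. ?Z x ^ n)" and eZ: "(\<integral>x. ?Z x ^ n \<partial>S) = fact n / Gamma (1 + real n * \<alpha>)" for n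
  proof -
    have m: "(\<lambda>x. ?Z x ^ n) \<in> borel_measurable S" using Zm by measurable
    have "0 \<le> fact n / Gamma (1 + real n * \<alpha>)" using G[of n] by simp
    from integral_eq_nn_integral[OF m] mom[of n] this Z0 show "(\<integral>x. ?Z x ^ n \<partial>S) = fact n / Gamma (1 + real n * \<alpha>)"
      by (simp del: power_mult_distrib)
    show "integrable S (\<lambda>x. ?Z x ^ n)"
      by (rule integrableI_nonneg[OF m]) (use Z0 mom[of n] in \<open>simp_all del: power_mult_distrib\<close>)
  qed
  have main: "integrable S (\<lambda>x. exp (q * ?Z x)) \<and> (\<lambda>n. q ^ n / Gamma (1 + real n * \<alpha>)) sums (\<integral>x. exp (q * ?Z x) \<partial>S)" for q
  proof -
    let ?f = "\<lambda>n x. q ^ n / fact n * ?Z x ^ n"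
    have sum: "summable (\<lambda>n. \<bar>q\<bar> ^ n / Gamma (1 + real n * \<alpha>))"
    proof (rule summable_comparison_test')
      define K where "K = (2 * (\<bar>q\<bar> + 1)) powr (1 / \<alpha>)"
      have K: "0 < K" and Ka: "K powr \<alpha> = 2 * (\<bar>q\<bar> + 1)" using alpha by (auto simp: K_def powr_powr)
      show "summable (\<lambda>n. exp K * (1 / 2) ^ n)" by (intro summable_mult summable_geometric) simp
      show "norm (\<bar>q\<bar> ^ n / Gamma (1 + real n * \<alpha>)) \<le> exp K * (1 / 2) ^ n" for n
      proof -
        have "K powr (real n * \<alpha>) = (K powr \<alpha>) ^ n" using K by (simp add: powr_realpow[symmetric] powr_powr mult.commute)
        then have Kn: "K powr (real n * \<alpha>) = 2 ^ n * (\<bar>q\<bar> + 1) ^ n" unfolding Ka by (simp only: power_mult_distrib)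
        have "\<bar>q\<bar> ^ n \<le> (\<bar>q\<bar> + 1) ^ n" by (intro power_mono) auto
        also have "\<dots> = exp K * (1 / 2) ^ n * (K powr (real n * \<alpha>) * exp (- K))"
          unfolding Kn by (simp add: exp_minus power_divide)
        also have "\<dots> \<le> exp K * (1 / 2) ^ n * Gamma (1 + real n * \<alpha>)"
          using alpha by (intro mult_left_mono Gamma_lower_bound K) auto
        finally show ?thesis using G[of n] by (simp add: divide_le_eq)
      qed
    qed
    have i: "integrable S (?f n)" for n by (intro integrable_mult_right iZ)
    have exp_sums: "(\<lambda>n. ?f n x) sums exp (q * ?Z x)" for x
      using exp_converges[of "q * ?Z x"] by (simp add: power_mult_distrib divide_inverse mult_ac)
    have n_eq: "norm (?f n x) = \<bar>q\<bar> ^ n / fact n * ?Z x ^ n" for n x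
    proof -
      have "0 \<le> ?Z x ^ n" using Z0[of x] by (rule zero_le_power)
      then show ?thesis unfolding real_norm_def abs_mult[of "q ^ n / fact n"] by (simp only: abs_of_nonneg) (simp add: power_abs)
    qed
    have "summable (\<lambda>n. norm (?f n x))" for x
      unfolding n_eq using exp_converges[of "\<bar>q\<bar> * ?Z x"]
      by (intro sums_summable) (simp add: power_mult_distrib divide_inverse mult_ac)
    moreover have "(\<integral>x. norm (?f n x) \<partial>S) = \<bar>q\<bar> ^ n / Gamma (1 + real n * \<alpha>)" for n
      unfolding n_eq by (subst integral_mult_right_zero) (simp only: eZ, simp)
    ultimately have *: "AE x in S. summable (\<lambda>n. norm (?f n x))" "summable (\<lambda>n. \<integral>x. norm (?f n x) \<partial>S)"
      using sum by auto
    have ss: "(\<lambda>x. \<Sum>n. ?f n x) = (\<lambda>x. exp (q * ?Z x))" using exp_sums by (auto simp: sums_iff)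
    have "(\<integral>x. ?f n x \<partial>S) = q ^ n / Gamma (1 + real n * \<alpha>)" for n
      by (subst integral_mult_right_zero) (simp only: eZ, simp)
    then show ?thesis
      using integrable_suminf[of S ?f, OF i *] sums_integral[of S ?f, OF i *] unfolding ss by simp
  qed
  show ?thesis
    unfolding mittag_leffler_law_def
    using main Zm by (auto intro!: S.real_distribution_distr simp: integrable_distr_eq integral_distr)
qed

section \<open>The limit law of the Levy process\<close>

lemma (in prob_space) char_tendsto:
  assumes L: "converges_in_law M X L" and X: "\<And>t. 0 < t \<Longrightarrow> X t \<in> borel_measurable M"
  shows "(\<lambda>n. char (distr M borel (X (real (Suc n)))) u) \<longlonglongrightarrow> char L u"
proof (rule levy_continuity1)
  show "real_distribution (distr M borel (X (real (Suc n))))" for n by (intro real_distribution_distr X) simp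
  show "real_distribution L" using L by (simp add: converges_in_law_def)
  have "filterlim (\<lambda>n. real (Suc n)) at_top sequentially"
    by (rule filterlim_compose[OF filterlim_real_sequentially filterlim_Suc])
  from filterlim_compose[OF _ this, where g="\<lambda>t. cdf (distr M borel (X t)) x" for x]
  show "weak_conv_m (\<lambda>n. distr M borel (X (real (Suc n)))) L"
    using L unfolding weak_conv_m_def weak_conv_def converges_in_law_def by blast
qed

context scaled_levy_dual_pair
begin

lemma char_increment_product:
  assumes p: "0 \<le> p" and q: "0 \<le> q"
  shows "char (distr M borel (\<lambda>\<omega>. k * \<xi> (p + q) \<omega>)) u =
    char (distr M borel (\<lambda>\<omega>. k * \<xi> p \<omega>)) u * char (distr M borel (\<lambda>\<omega>. k * \<xi> q \<omega>)) u"
proof -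
  have m[measurable]: "\<xi> p \<in> borel_measurable M" "\<xi> q \<in> borel_measurable M" "\<xi> (p + q) \<in> borel_measurable M"
    using p q by (auto intro!: L(2))
  let ?X1 = "\<lambda>\<omega>. k * (\<xi> p \<omega> - \<xi> 0 \<omega>)" and ?X2 = "\<lambda>\<omega>. k * (\<xi> (p + q) \<omega> - \<xi> p \<omega>)"
  have "indep_var borel ((\<lambda>x. k * x) \<circ> (\<lambda>\<omega>. \<xi> p \<omega> - \<xi> 0 \<omega>)) borel ((\<lambda>x. k * x) \<circ> (\<lambda>\<omega>. \<xi> (p + q) \<omega> - \<xi> p \<omega>))"
    by (rule indep_var_compose[OF increments_indep[OF p q]]) auto
  then have ind: "indep_var borel ?X1 borel ?X2" by (simp add: comp_def)
  have "distr M borel (\<lambda>\<omega>. k * \<xi> (p + q) \<omega>) = distr M borel (\<lambda>\<omega>. ?X1 \<omega> + ?X2 \<omega>)"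
    by (rule distr_cong) (auto simp: L(3) algebra_simps)
  moreover have "distr M borel ?X1 = distr M borel (\<lambda>\<omega>. k * \<xi> p \<omega>)" by (rule distr_cong) (auto simp: L(3))
  moreover have "distr M borel ?X2 = distr M borel (\<lambda>\<omega>. k * \<xi> q \<omega>)"
  proof -
    have "distr M borel ?X2 = distr (distr M borel (\<lambda>\<omega>. \<xi> (p + q) \<omega> - \<xi> p \<omega>)) borel (\<lambda>x. k * x)"
      by (subst distr_distr) (auto simp: comp_def)
    also have "distr M borel (\<lambda>\<omega>. \<xi> (p + q) \<omega> - \<xi> p \<omega>) = distr M borel (\<xi> q)" using L(5)[of p "p + q"] p q by simp
    also have "distr (distr M borel (\<xi> q)) borel (\<lambda>x. k * x) = distr M borel (\<lambda>\<omega>. k * \<xi> q \<omega>)"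
      by (subst distr_distr) (auto simp: comp_def)
    finally show ?thesis .
  qed
  ultimately show ?thesis using char_distr_add[OF ind, of u] by simp
qed

text \<open>\<open>\<xi> (p t) / b t\<close> is \<open>X\<xi> (p t)\<close> times \<open>b (p t) / b t\<close>, and the
  factor converges by regular variation.\<close>
lemma char_limit_scaled:
  assumes S: "converges_in_law M X\<xi> S" and p: "0 < p"
  shows "(\<lambda>n. char (distr M borel (\<lambda>\<omega>. inverse (b (real (Suc n))) * \<xi> (p * real (Suc n)) \<omega>)) u) \<longlonglongrightarrow> char S (p powr (1 / \<alpha>) * u)"
proof -
  let ?Z = "\<lambda>t \<omega>. b (p * t) / b t * X\<xi> (p * t) \<omega>"
  have Z: "?Z t = (\<lambda>\<omega>. inverse (b t) * \<xi> (p * t) \<omega>)" if "0 < t" for t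
  proof -
    have "0 < b (p * t)" using p that by (intro b_pos) simp
    then show ?thesis by (simp add: fun_eq_iff X\<xi>_def divide_inverse)
  qed
  have "converges_in_law M ?Z (distr S borel (\<lambda>x. p powr (1 / \<alpha>) * x))"
    using p by (intro converges_in_law_scale[OF S X\<xi>_measurable] b_scale)
      (auto intro!: b_pos divide_pos_pos filterlim_tendsto_pos_mult_at_top[OF tendsto_const _ filterlim_ident])
  moreover have "?Z t \<in> borel_measurable M" if "0 < t" for t
    using that p by (intro borel_measurable_times borel_measurable_const X\<xi>_measurable) simp
  ultimately have "(\<lambda>n. char (distr M borel (?Z (real (Suc n)))) u) \<longlonglongrightarrow> char (distr S borel (\<lambda>x. p powr (1 / \<alpha>) * x)) u"
    by (rule char_tendsto)
  moreover have "real_distribution S" using S by (simp add: converges_in_law_def)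
  ultimately show ?thesis by (simp only: Z of_nat_0_less_iff zero_less_Suc char_distr_cmult)
qed

text \<open>Passing to the limit in \<open>char_increment_product\<close> with \<open>k = 1 / b t\<close> at the times
  \<open>p t\<close> and \<open>q t\<close> gives a functional equation for the characteristic function of
  \<open>S\<close>. With \<open>p powr \<alpha>\<close> and \<open>q powr \<alpha>\<close> in place of \<open>p\<close>
  and \<open>q\<close> it is strict stability.\<close>
lemma X\<xi>_limit_stable:
  assumes S: "converges_in_law M X\<xi> S" and nd: "nondegenerate S"
  shows "stable_law \<alpha> S"
proof -
  have rd: "real_distribution S" using S by (simp add: converges_in_law_def)
  interpret S: real_distribution S by fact
  have add: "char S ((p + q) powr (1 / \<alpha>) * u) = char S (p powr (1 / \<alpha>) * u) * char S (q powr (1 / \<alpha>) * u)"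
    if p: "0 < p" and q: "0 < q" for p q u
  proof (rule LIMSEQ_unique)
    show "(\<lambda>n. char (distr M borel (\<lambda>\<omega>. inverse (b (real (Suc n))) * \<xi> ((p + q) * real (Suc n)) \<omega>)) u)
        \<longlonglongrightarrow> char S ((p + q) powr (1 / \<alpha>) * u)" using p q by (intro char_limit_scaled[OF S]) simp
    have "(\<lambda>n. char (distr M borel (\<lambda>\<omega>. inverse (b (real (Suc n))) * \<xi> ((p + q) * real (Suc n)) \<omega>)) u) =
      (\<lambda>n. char (distr M borel (\<lambda>\<omega>. inverse (b (real (Suc n))) * \<xi> (p * real (Suc n)) \<omega>)) u *
        char (distr M borel (\<lambda>\<omega>. inverse (b (real (Suc n))) * \<xi> (q * real (Suc n)) \<omega>)) u)"
      unfolding distrib_right using p q by (intro ext char_increment_product) auto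
    then show "(\<lambda>n. char (distr M borel (\<lambda>\<omega>. inverse (b (real (Suc n))) * \<xi> ((p + q) * real (Suc n)) \<omega>)) u)
        \<longlonglongrightarrow> char S (p powr (1 / \<alpha>) * u) * char S (q powr (1 / \<alpha>) * u)"
      by (simp only:) (intro tendsto_mult char_limit_scaled[OF S] p q)
  qed
  have "distr S borel (\<lambda>x. p * x) \<star> distr S borel (\<lambda>x. q * x) = distr S borel (\<lambda>x. (p powr \<alpha> + q powr \<alpha>) powr (1 / \<alpha>) * x)"
    if p: "0 < p" and q: "0 < q" for p q
  proof (rule Levy_uniqueness)
    have rdD: "real_distribution (distr S borel (\<lambda>x. k * x))" for k by (rule S.real_distribution_distr) simp
    show "real_distribution (distr S borel (\<lambda>x. p * x) \<star> distr S borel (\<lambda>x. q * x))"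
      by (intro real_distribution_convolution rdD)
    show "real_distribution (distr S borel (\<lambda>x. (p powr \<alpha> + q powr \<alpha>) powr (1 / \<alpha>) * x))" by (rule rdD)
    have e: "(p powr \<alpha>) powr (1 / \<alpha>) = p" "(q powr \<alpha>) powr (1 / \<alpha>) = q" using p q alpha by (auto simp: powr_powr)
    show "char (distr S borel (\<lambda>x. p * x) \<star> distr S borel (\<lambda>x. q * x)) = char (distr S borel (\<lambda>x. (p powr \<alpha> + q powr \<alpha>) powr (1 / \<alpha>) * x))"
    proof
      fix u
      show "char (distr S borel (\<lambda>x. p * x) \<star> distr S borel (\<lambda>x. q * x)) u = char (distr S borel (\<lambda>x. (p powr \<alpha> + q powr \<alpha>) powr (1 / \<alpha>) * x)) u"
        unfolding char_convolution[OF rdD rdD] char_distr_cmult[OF rd]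
        using add[of "p powr \<alpha>" "q powr \<alpha>" u] p q unfolding e by simp
    qed
  qed
  with rd nd show ?thesis by (auto simp: stable_law_def)
qed

end

section \<open>Integrals with respect to \<open>\<nu>\<close>\<close>

text \<open>The function \<open>f\<close> is Borel on \<open>(0,\<infinity>)\<close> only. Since \<open>U\<close> is
  nonnegative on every path, \<open>f\<close> may be changed to this Borel function on the line.\<close>
definition extend_pos :: "(real \<Rightarrow> real) \<Rightarrow> real \<Rightarrow> real" where
  "extend_pos f x = (if 0 < x then f x else f 0)"

context levy_dual_pair
begin

lemma mu_law_eq: "mu_law M \<xi>h = \<mu>"
  by (simp add: mu_law_def \<mu>_def Ih_def[abs_def])

lemma extend_pos_measurable:
  assumes "integrable (nu_measure M \<xi>h) f"
  shows "f \<in> borel_measurable (restrict_space borel {0<..})" "extend_pos f \<in> borel_measurable borel"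
proof -
  have "sets (nu_measure M \<xi>h) = sets (restrict_space borel {0<..})" by (simp add: nu_measure_def)
  with borel_measurable_integrable[OF assms] show f: "f \<in> borel_measurable (restrict_space borel {0<..})"
    by (simp cong: measurable_cong_sets)
  have "restrict_space borel {x::real. 0 < x} = restrict_space borel {0<..}" by (simp add: greaterThan_def)
  with f show "extend_pos f \<in> borel_measurable borel"
    unfolding extend_pos_def[abs_def] by (subst measurable_If_restrict_space_iff) auto
qed

lemma integral_\<nu>:
  fixes f :: "real \<Rightarrow> real"
  assumes f: "integrable (nu_measure M \<xi>h) f"
  shows "integrable \<mu> (recip (extend_pos f))" "(\<integral>v. recip (extend_pos f) v \<partial>\<mu>) = integral\<^sup>L (nu_measure M \<xi>h) f"
proof -
  note m = extend_pos_measurable[OF f]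
  have i: "integrable \<mu> (\<lambda>x. indicator {0<..} x *\<^sub>R (1 / x * f (1 / x)))"
    using f unfolding integrable_nu_measure_iff[OF m(1)] mu_law_eq set_integrable_def .
  have rm: "recip (extend_pos f) \<in> borel_measurable \<mu>"
    using m(2) unfolding recip_def[abs_def] by (simp cong: measurable_cong_sets) measurable
  have eq: "AE v in \<mu>. recip (extend_pos f) v = indicator {0<..} v *\<^sub>R (1 / v * f (1 / v))"
    using AE_\<mu>_pos by eventually_elim (simp add: recip_def extend_pos_def)
  show "integrable \<mu> (recip (extend_pos f))"
    using i integrable_cong_AE[OF rm borel_measurable_integrable[OF i] eq] by simp
  show "(\<integral>v. recip (extend_pos f) v \<partial>\<mu>) = integral\<^sup>L (nu_measure M \<xi>h) f"
    unfolding integral_nu_measure[OF m(1)] mu_law_eq set_lebesgue_integral_def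
    by (rule integral_cong_AE[OF rm borel_measurable_integrable[OF i] eq])
qed

lemma integral_\<nu>_reciprocal:
  shows "integrable (nu_measure M \<xi>h) (\<lambda>x. 1 / x)" "(\<integral>x. 1 / x \<partial>nu_measure M \<xi>h) = 1"
proof -
  interpret \<mu>: prob_space \<mu> by (rule prob_space_\<mu>)
  have m: "(\<lambda>x. 1 / x :: real) \<in> borel_measurable (restrict_space borel {0<..})"
    by (rule measurable_restrict_space1) measurable
  have eq: "indicator {0<..} x *\<^sub>R (1 / x * (1 / (1 / x))) = (indicator {0<..} x :: real)" for x :: real
    by (simp add: indicator_def)
  have i: "integrable \<mu> (\<lambda>x. indicator {0<..} x :: real)" by (rule \<mu>.integrable_const_bound[where B=1]) auto
  show "integrable (nu_measure M \<xi>h) (\<lambda>x. 1 / x)"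
    unfolding integrable_nu_measure_iff[OF m] mu_law_eq set_integrable_def eq by (rule i)
  have "(\<integral>x. 1 / x \<partial>nu_measure M \<xi>h) = (\<integral>x. indicator {0<..} x \<partial>\<mu>)"
    unfolding integral_nu_measure[OF m] mu_law_eq set_lebesgue_integral_def eq ..
  also have "\<dots> = (\<integral>x. 1 \<partial>\<mu>)"
    using AE_\<mu>_pos by (intro integral_cong_AE) (auto elim!: eventually_mono)
  finally show "(\<integral>x. 1 / x \<partial>nu_measure M \<xi>h) = 1" using \<mu>.prob_space by simp
qed

end

context scaled_levy_dual_pair
begin

lemma YU_extend_pos:
  "1 / a t * (LBINT s:{0..t}. f (U_tilde (\<lambda>r. \<xi> r \<omega>) (\<lambda>r. \<xi>h r \<omega>) s)) = YU (extend_pos f) t \<omega>"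
proof -
  have "f (U s \<omega>) = extend_pos f (U s \<omega>)" for s
    using U_tilde_nonneg[of "\<lambda>r. \<xi> r \<omega>" "\<lambda>r. \<xi>h r \<omega>" s] by (auto simp: extend_pos_def U_def)
  then show ?thesis by (simp add: YU_def U_def)
qed

text \<open>For \<open>f x = 1 / x\<close> the time change turns the additive functional of \<open>U\<close> into the time
  \<open>T t\<close> itself.\<close>
lemma XT_limit_if_YU_limit:
  assumes "converges_in_law M (YU (extend_pos (\<lambda>x. 1 / x))) \<Lambda>"
  shows "converges_in_law M XT \<Lambda>"
proof (rule slutsky[OF assms])
  let ?f = "extend_pos (\<lambda>x. 1 / x)"
  have fm: "?f \<in> borel_measurable borel" by (rule extend_pos_measurable(2)[OF integral_\<nu>_reciprocal(1)])
  show "YU ?f t \<in> borel_measurable M" for t by (rule YU_measurable[OF fm])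
  show "XT t \<in> borel_measurable M" if "0 < t" for t by (rule XT_measurable[OF that])
  show "tends_to_0_in_prob M (\<lambda>t \<omega>. YU ?f t \<omega> - XT t \<omega>)"
    unfolding tends_to_0_in_prob_def
  proof (intro allI impI tendsto_eventually)
    fix e :: real assume e: "0 < e"
    show "eventually (\<lambda>t. prob {\<omega>\<in>space M. e < \<bar>YU ?f t \<omega> - XT t \<omega>\<bar>} = 0) at_top"
      using eventually_gt_at_top[of 0]
    proof eventually_elim
      case (elim t)
      note [measurable] = YU_measurable[OF fm] XT_measurable[OF elim]
      have at: "0 < a t" by (rule a_pos[OF elim])
      have "AE \<omega> in M. YU ?f t \<omega> = XT t \<omega>"
        using AE_regular
      proof eventually_elim
        case reg: (elim \<omega>)
        have T: "0 \<le> XT t \<omega> * a t" using reg elim at by (auto simp: XT_def regular_def)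
        have "recip ?f (V r \<omega>) = 1" if "0 \<le> r" for r
          using V_pos[of \<omega> r] reg that by (simp add: regular_def recip_def extend_pos_def)
        then have "(LBINT r:{0..XT t \<omega> * a t}. recip ?f (V r \<omega>)) = (LBINT r:{0..XT t \<omega> * a t}. 1)"
          by (intro set_lebesgue_integral_cong) auto
        also have "\<dots> = XT t \<omega> * a t" using T by (simp add: set_lebesgue_integral_def)
        finally show ?case unfolding YU_time_change[OF fm reg elim] using at by simp
      qed
      then have "AE \<omega> in M. \<omega> \<notin> {\<omega>\<in>space M. e < \<bar>YU ?f t \<omega> - XT t \<omega>\<bar>}"
        by eventually_elim (use e in auto)
      then show ?case by (subst prob_eq_0) auto
    qed
  qed
qed

end

section \<open>The equivalence of the two limit theorems\<close>

theorem theorem4p1: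
  fixes M :: "'a measure"
    and \<xi> \<xi>h :: "real \<Rightarrow> 'a \<Rightarrow> real"
    and \<alpha> :: real
    and a b :: "real \<Rightarrow> real"
  defines "\<nu> \<equiv> nu_measure M \<xi>h"
    and "X \<equiv> (\<lambda>t \<omega>. inverse (b t) * \<xi> t \<omega>)"
    and "Y \<equiv> (\<lambda>f t \<omega>. 1 / a t *
                (LBINT s:{0..t}. f (U_tilde (\<lambda>r. \<xi> r \<omega>) (\<lambda>r. \<xi>h r \<omega>) s)))"
  assumes levy: "levy_process M \<xi>"
    and drift: "drifts_to_infinity M \<xi>"
    and dual: "independent_copy_of_minus M \<xi> \<xi>h"
    and not_L1: "\<not> integrable M (\<xi> 1)"
    and alpha: "0 < \<alpha>" "\<alpha> < 1"
    and a_pos: "\<forall>t>0. 0 < a t"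
    and a_rv: "regularly_varying a \<alpha>"
    and b_pos: "\<forall>t>0. 0 < b t"
    and b_rv: "regularly_varying b (1 / \<alpha>)"
    and ab: "(\<lambda>t. a (b t)) \<sim>[at_top] (\<lambda>t. t)"
    and ba: "(\<lambda>t. b (a t)) \<sim>[at_top] (\<lambda>t. t)"
  shows "(has_nondegenerate_limit_in_law M X \<longleftrightarrow>
           (\<forall>f::real \<Rightarrow> real. integrable \<nu> f \<and> integral\<^sup>L \<nu> f \<noteq> 0 \<longrightarrow>
              has_nondegenerate_limit_in_law M (Y f))) \<and>
         (\<forall>S. converges_in_law M X S \<and> nondegenerate S \<longrightarrow>
           (AE x in S. 0 < x) \<and> stable_law \<alpha> S \<and>
           (\<exists>c>0. \<forall>l\<ge>0. (\<integral>x. exp (- l * x) \<partial>S) = exp (- c * l powr \<alpha>)) \<and>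
           (\<forall>f::real \<Rightarrow> real. integrable \<nu> f \<and> integral\<^sup>L \<nu> f \<noteq> 0 \<longrightarrow>
              converges_in_law M (Y f) (distr S borel (\<lambda>x. integral\<^sup>L \<nu> f * x powr (- \<alpha>))) \<and>
              (\<exists>k L. k \<noteq> 0 \<and> mittag_leffler_law \<alpha> L \<and>
                 distr S borel (\<lambda>x. integral\<^sup>L \<nu> f * x powr (- \<alpha>)) = distr L borel (\<lambda>x. k * x))))"
proof -
  interpret P: scaled_levy_dual_pair M \<xi> \<xi>h \<alpha> a b
    using levy drift dual alpha(1) a_pos a_rv b_pos b_rv ab ba by unfold_locales auto
  have X: "X = P.X\<xi>" by (simp add: X_def P.X\<xi>_def fun_eq_iff)
  have Y: "Y f = P.YU (extend_pos f)" for f unfolding Y_def P.YU_extend_pos ..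
  have limits: "(AE x in S. 0 < x) \<and> stable_law \<alpha> S \<and>
      (\<exists>c>0. \<forall>l\<ge>0. (\<integral>x. exp (- l * x) \<partial>S) = exp (- c * l powr \<alpha>)) \<and>
      (\<forall>f::real \<Rightarrow> real. integrable \<nu> f \<and> integral\<^sup>L \<nu> f \<noteq> 0 \<longrightarrow>
        converges_in_law M (Y f) (distr S borel (\<lambda>x. integral\<^sup>L \<nu> f * x powr (- \<alpha>))) \<and>
        nondegenerate (distr S borel (\<lambda>x. integral\<^sup>L \<nu> f * x powr (- \<alpha>))) \<and>
        (\<exists>k L. k \<noteq> 0 \<and> mittag_leffler_law \<alpha> L \<and>
          distr S borel (\<lambda>x. integral\<^sup>L \<nu> f * x powr (- \<alpha>)) = distr L borel (\<lambda>x. k * x)))"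
    if S: "converges_in_law M X S" and nd: "nondegenerate S" for S
  proof -
    have S': "converges_in_law M P.X\<xi> S" using S by (simp add: X)
    have rd: "real_distribution S" using S by (simp add: converges_in_law_def)
    interpret S: real_distribution S by fact
    have st: "stable_law \<alpha> S" by (rule P.X\<xi>_limit_stable[OF S' nd])
    have nonneg: "AE x in S. 0 \<le> x" by (rule P.X\<xi>_limit_nonneg[OF S'])
    obtain c where c: "0 < c" "\<And>l. 0 \<le> l \<Longrightarrow> (\<integral>x. exp (- l * x) \<partial>S) = exp (- c * l powr \<alpha>)"
      using stable_nonneg_laplace[OF st nonneg alpha(1)] by metis
    have pos: "AE x in S. 0 < x" by (rule pos_if_laplace_tends_to_0[OF rd nonneg alpha(1) c])
    have XT: "converges_in_law M P.XT (distr S borel (\<lambda>x. x powr (- \<alpha>)))"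
      using S' pos unfolding P.X\<xi>_iff_XA by (rule P.XT_limit_if_XA_limit)
    have mittag_leffler: "mittag_leffler_law \<alpha> (distr S borel (\<lambda>x. c * x powr (- \<alpha>)))"
      by (rule mittag_leffler_reciprocal_stable[OF rd pos alpha(1) c])
    have pm: "(\<lambda>x. x powr (- \<alpha>)) \<in> borel_measurable S" by (simp cong: measurable_cong_sets)
    have "converges_in_law M (Y f) (distr S borel (\<lambda>x. integral\<^sup>L \<nu> f * x powr (- \<alpha>))) \<and>
        nondegenerate (distr S borel (\<lambda>x. integral\<^sup>L \<nu> f * x powr (- \<alpha>))) \<and>
        (\<exists>k L. k \<noteq> 0 \<and> mittag_leffler_law \<alpha> L \<and>
          distr S borel (\<lambda>x. integral\<^sup>L \<nu> f * x powr (- \<alpha>)) = distr L borel (\<lambda>x. k * x))"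
      if f: "integrable \<nu> f" and m: "integral\<^sup>L \<nu> f \<noteq> 0" for f :: "real \<Rightarrow> real"
    proof (intro conjI exI)
      let ?m = "integral\<^sup>L \<nu> f"
      note f' = f[unfolded \<nu>_def]
      have "converges_in_law M (P.YU (extend_pos f)) (distr (distr S borel (\<lambda>x. x powr (- \<alpha>))) borel (\<lambda>x. ?m * x))"
        using P.YU_limit[OF P.extend_pos_measurable(2)[OF f'] P.integral_\<nu>(1)[OF f'] _ XT] m
        unfolding P.integral_\<nu>(2)[OF f'] \<nu>_def by blast
      then show "converges_in_law M (Y f) (distr S borel (\<lambda>x. ?m * x powr (- \<alpha>)))"
        unfolding Y using pm by (simp add: distr_distr comp_def)
      show "nondegenerate (distr S borel (\<lambda>x. ?m * x powr (- \<alpha>)))"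
      proof (rule nondegenerate_distr[OF nd, where g="\<lambda>y. (y / ?m) powr (- (1 / \<alpha>))"])
        show "(\<lambda>x. ?m * x powr (- \<alpha>)) \<in> borel_measurable S" using pm by measurable
        show "AE x in S. (?m * x powr (- \<alpha>) / ?m) powr (- (1 / \<alpha>)) = x"
          using pos by eventually_elim (use m alpha in \<open>simp add: powr_powr\<close>)
      qed
      show "?m / c \<noteq> 0" using m c(1) by simp
      show "mittag_leffler_law \<alpha> (distr S borel (\<lambda>x. c * x powr (- \<alpha>)))" by (rule mittag_leffler)
      show "distr S borel (\<lambda>x. ?m * x powr (- \<alpha>)) = distr (distr S borel (\<lambda>x. c * x powr (- \<alpha>))) borel (\<lambda>x. ?m / c * x)"
        using pm c(1) by (subst distr_distr) (auto simp: comp_def)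
    qed
    with pos st c show ?thesis by blast
  qed
  have "has_nondegenerate_limit_in_law M X"
    if all: "\<forall>f::real \<Rightarrow> real. integrable \<nu> f \<and> integral\<^sup>L \<nu> f \<noteq> 0 \<longrightarrow> has_nondegenerate_limit_in_law M (Y f)"
  proof -
    have "has_nondegenerate_limit_in_law M (Y (\<lambda>x. 1 / x))"
      using all P.integral_\<nu>_reciprocal unfolding \<nu>_def by auto
    then obtain \<Lambda> where \<Lambda>: "converges_in_law M (P.YU (extend_pos (\<lambda>x. 1 / x))) \<Lambda>" "nondegenerate \<Lambda>"
      by (auto simp: has_nondegenerate_limit_in_law_def Y)
    show ?thesis unfolding X by (rule P.X\<xi>_limit_if_XT_limit[OF P.XT_limit_if_YU_limit[OF \<Lambda>(1)] \<Lambda>(2)])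
  qed
  moreover have "has_nondegenerate_limit_in_law M (Y f)"
    if lim: "has_nondegenerate_limit_in_law M X" and f: "integrable \<nu> f \<and> integral\<^sup>L \<nu> f \<noteq> 0" for f :: "real \<Rightarrow> real"
  proof -
    obtain S where "converges_in_law M X S" "nondegenerate S" using lim by (auto simp: has_nondegenerate_limit_in_law_def)
    from limits[OF this] f show ?thesis unfolding has_nondegenerate_limit_in_law_def by blast
  qed
  ultimately show ?thesis using limits by blast
qed

end
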